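(* Let $\alpha\in(0,2)$ and let $(Z_i)_{i\in\mathbb{Z}}$ be an i.i.d. sequence of real random variables that are regularly varying with index $\alpha$. When $\alpha=1$, suppose further that $Z_1$ is symmetric (i.e. $Z_1$ and $-Z_1$ have the same distribution). Let $(a_n)_{n\ge 1}$ be a sequence of positive real numbers such that $n\operatorname{P}(|Z_1|>a_n)\to 1$ as $n\to\infty$. Let $q\in\mathbb{N}$ and let $\varphi_0,\varphi_1,\ldots,\varphi_q$ be real numbers; put $\Phi=\sum_{i=0}^{q}\varphi_i$ and suppose that $\Phi\neq 0$ and $$0\le \frac{\sum_{i=0}^{s}\varphi_i}{\sum_{i=0}^{q}\varphi_i}\le 1\qquad\text{for every } s=0,1,\ldots,q.$$ Let $X_t=\sum_{i=0}^{q}\varphi_i Z_{t-i}$ for $t\in\mathbb{Z}$, and define $$V_n(t)=\frac{1}{a_n}\Bigg(\sum_{i=1}^{\lfloor nt\rfloor}X_i-\lfloor nt\rfloor b_n\Bigg),\quad t\in[0,1],\qquad b_n=\begin{cases}0,&\alpha\in(0,1],\\ \Phi\,\mathrm{E}(Z_1),&\alpha\in(1,2).\end{cases}$$ Then there is an $\alpha$-stable L\'evy process $V$ such that, as $n\to\infty$, $$V_n(\,\cdot\,)\xrightarrow{d}\Phi\,V(\,\cdot\,)$$ in $D[0,1]$ endowed with the Skorohod $M_2$ topology.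
   Context: A real random variable $Z$ is regularly varying with index $\alpha>0$ if $\operatorname{P}(|Z|>x)=x^{-\alpha}L(x)$ for $x>0$, with $L$ slowly varying at $\infty$, and the limits $p=\lim_{x\to\infty}\operatorname{P}(Z>x)/\operatorname{P}(|Z|>x)$ and $r=\lim_{x\to\infty}\operatorname{P}(Z<-x)/\operatorname{P}(|Z|>x)$ exist. $D[0,1]$ is the space of right-continuous functions $x:[0,1]\to\mathbb{R}$ with left limits. For $x\in D[0,1]$ the completed graph is $$\Gamma_x=\{(t,z)\in[0,1]\times\mathbb{R}: z=\lambda x(t-)+(1-\lambda)x(t)\text{ for some }\lambda\in[0,1]\},$$ where $x(t-)$ is the left limit of $x$ at $t$ (with the convention $x(0-)=x(0)$). The Skorohod $M_2$ topology on $D[0,1]$ is the topology induced by the metric $$d_{M_2}(x_1,x_2)=\Big(\sup_{a\in\Gamma_{x_1}}\inf_{b\in\Gamma_{x_2}}d(a,b)\Big)\vee\Big(\sup_{a\in\Gamma_{x_2}}\inf_{b\in\Gamma_{x_1}}d(a,b)\Big),$$ where $d((s_1,y_1),(s_2,y_2))=|s_1-s_2|\vee|y_1-y_2|$ on $\mathbb{R}^2$ and $u\vee v=\max\{u,v\}$. The symbol $\xrightarrow{d}$ denotes convergence in distribution (weak convergence of laws) of random elements of $D[0,1]$ with respect to this topology. An $\alpha$-stable L\'evy process is a L\'evy process (stationary independent increments, started at $0$, c\`adl\`ag paths) whose value at time $1$ has a non-degenerate $\alpha$-stable distribution, not necessarily strictly stable; it is considered on $[0,1]$. *)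

theory Defs
  imports "HOL-Probability.Probability"
begin

section \<open>Regular variation\<close>

definition slowly_varying :: "(real \<Rightarrow> real) \<Rightarrow> bool" where
  "slowly_varying L \<longleftrightarrow>
     L \<in> borel_measurable (restrict_space borel {0<..}) \<and> (\<forall>x>0. L x > 0) \<and>
     (\<forall>c>0. ((\<lambda>x. L (c * x) / L x) \<longlongrightarrow> 1) at_top)"

definition (in prob_space) regularly_varying :: "real \<Rightarrow> ('a \<Rightarrow> real) \<Rightarrow> bool" where
  "regularly_varying \<alpha> Z \<longleftrightarrow>
     random_variable borel Z \<and>
     (\<exists>L. slowly_varying L \<and>
        (\<forall>x>0. prob {\<omega> \<in> space M. \<bar>Z \<omega>\<bar> > x} = x powr (- \<alpha>) * L x)) \<and>
     (\<exists>p. ((\<lambda>x. prob {\<omega> \<in> space M. Z \<omega> > x} / prob {\<omega> \<in> space M. \<bar>Z \<omega>\<bar> > x}) \<longlongrightarrow> p) at_top) \<and>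
     (\<exists>r. ((\<lambda>x. prob {\<omega> \<in> space M. Z \<omega> < - x} / prob {\<omega> \<in> space M. \<bar>Z \<omega>\<bar> > x}) \<longlongrightarrow> r) at_top)"

section \<open>The space D[0,1] and the M2 metric\<close>

text \<open>At an endpoint of \<open>I\<close> the corresponding one-sided filter is trivial and imposes no condition.\<close>

definition cadlag_on :: "real set \<Rightarrow> (real \<Rightarrow> real) \<Rightarrow> bool" where
  "cadlag_on I x \<longleftrightarrow>
     (\<forall>t\<in>I. (x \<longlongrightarrow> x t) (at t within I \<inter> {t<..}) \<and>
            (\<exists>l. (x \<longlongrightarrow> l) (at t within I \<inter> {..<t})))"

text \<open>Functions on the unit interval are represented by functions on \<open>real\<close> that are
  \<open>undefined\<close> outside \<open>{0..1}\<close>, so that equality is equality on the unit interval.\<close>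

definition D01 :: "(real \<Rightarrow> real) set" where
  "D01 = {x \<in> extensional {0..1}. cadlag_on {0..1} x}"

definition left_lim :: "(real \<Rightarrow> real) \<Rightarrow> real \<Rightarrow> real" where
  "left_lim x t = (if t = 0 then x 0 else Lim (at_left t) x)"

definition completed_graph :: "(real \<Rightarrow> real) \<Rightarrow> (real \<times> real) set" where
  "completed_graph x =
     {(t, z). t \<in> {0..1} \<and> (\<exists>c\<in>{0..1}. z = c * left_lim x t + (1 - c) * x t)}"

definition dist_max :: "real \<times> real \<Rightarrow> real \<times> real \<Rightarrow> real" where
  "dist_max a b = max \<bar>fst a - fst b\<bar> \<bar>snd a - snd b\<bar>"

text \<open>The value outside \<open>D01\<close> is immaterial; it is chosen because the locale \<open>Metric_space\<close>
  requires non-negativity everywhere.\<close>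

definition dist_M2 :: "(real \<Rightarrow> real) \<Rightarrow> (real \<Rightarrow> real) \<Rightarrow> real" where
  "dist_M2 x y =
     (if x \<in> D01 \<and> y \<in> D01
      then max (SUP a\<in>completed_graph x. INF b\<in>completed_graph y. dist_max a b)
               (SUP a\<in>completed_graph y. INF b\<in>completed_graph x. dist_max a b)
      else 0)"

lemma cadlag_on_D01_cases:
  assumes "cadlag_on {0..1} x" "0 \<le> t" "t \<le> 1"
  shows "t < 1 \<Longrightarrow> (x \<longlongrightarrow> x t) (at_right t)"
    and "0 < t \<Longrightarrow> (x \<longlongrightarrow> left_lim x t) (at_left t)"
proof -
  assume "t < 1"
  have "at t within {0..1} \<inter> {t<..} = at_right t"
    by (rule at_within_nhd[of _ "{..<1}"]) (use assms \<open>t < 1\<close> in auto)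
  then show "(x \<longlongrightarrow> x t) (at_right t)"
    using assms by (auto simp: cadlag_on_def dest!: bspec[of _ _ t])
next
  assume "0 < t"
  have "at t within {0..1} \<inter> {..<t} = at_left t"
    by (rule at_within_nhd[of _ "{0<..}"]) (use assms \<open>0 < t\<close> in auto)
  then obtain l where l: "(x \<longlongrightarrow> l) (at_left t)"
    using assms by (auto simp: cadlag_on_def dest!: bspec[of _ _ t])
  then have "Lim (at_left t) x = l"
    by (intro tendsto_Lim) auto
  with l \<open>0 < t\<close> show "(x \<longlongrightarrow> left_lim x t) (at_left t)"
    by (simp add: left_lim_def)
qed

lemma bounded_D01:
  assumes "x \<in> D01"
  obtains K where "\<And>t. 0 \<le> t \<Longrightarrow> t \<le> 1 \<Longrightarrow> \<bar>x t\<bar> \<le> K"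
proof -
  have c: "cadlag_on {0..1} x" using assms by (simp add: D01_def)
  have "bounded (x ` ({0..1} \<inter> {0..1}))"
  proof (rule Bolzano[of 0 1 "\<lambda>a b. bounded (x ` ({a..b} \<inter> {0..1}))"])
    fix a b c :: real
    assume "bounded (x ` ({a..b} \<inter> {0..1}))" "bounded (x ` ({b..c} \<inter> {0..1}))"
    then have "bounded (x ` ({a..b} \<inter> {0..1}) \<union> x ` ({b..c} \<inter> {0..1}))" by simp
    then show "bounded (x ` ({a..c} \<inter> {0..1}))"
      by (rule bounded_subset) (unfold image_Un[symmetric], rule image_mono, auto)
  next
    fix t :: real assume t: "0 \<le> t" "t \<le> 1"
    have "\<exists>d>0. \<forall>s\<in>{t<..<t+d} \<inter> {0..1}. \<bar>x s\<bar> \<le> \<bar>x t\<bar> + 1"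
    proof (cases "t < 1")
      case True
      have "eventually (\<lambda>s. dist (x s) (x t) < 1) (at_right t)"
        using cadlag_on_D01_cases(1)[OF c t True] by (rule tendstoD) simp
      then obtain u where "u > t" "\<And>s. t < s \<Longrightarrow> s < u \<Longrightarrow> dist (x s) (x t) < 1"
        by (auto simp: eventually_at_right_field)
      then show ?thesis
        by (intro exI[of _ "u - t"]) (force simp: dist_real_def)
    qed (use t in \<open>auto intro!: exI[of _ 1]\<close>)
    then obtain d1 where d1: "d1 > 0" "\<And>s. s \<in> {t<..<t+d1} \<inter> {0..1} \<Longrightarrow> \<bar>x s\<bar> \<le> \<bar>x t\<bar> + 1"
      by blast
    have "\<exists>d>0. \<forall>s\<in>{t-d<..<t} \<inter> {0..1}. \<bar>x s\<bar> \<le> \<bar>left_lim x t\<bar> + 1"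
    proof (cases "0 < t")
      case True
      have "eventually (\<lambda>s. dist (x s) (left_lim x t) < 1) (at_left t)"
        using cadlag_on_D01_cases(2)[OF c t True] by (rule tendstoD) simp
      then obtain u where "u < t" "\<And>s. u < s \<Longrightarrow> s < t \<Longrightarrow> dist (x s) (left_lim x t) < 1"
        by (auto simp: eventually_at_left_field)
      then show ?thesis
        by (intro exI[of _ "t - u"]) (force simp: dist_real_def)
    qed (use t in \<open>auto intro!: exI[of _ 1]\<close>)
    then obtain d2 where d2: "d2 > 0"
        "\<And>s. s \<in> {t-d2<..<t} \<inter> {0..1} \<Longrightarrow> \<bar>x s\<bar> \<le> \<bar>left_lim x t\<bar> + 1"
      by blast
    show "\<exists>d>0. \<forall>a b. a \<le> t \<and> t \<le> b \<and> b - a < d \<longrightarrow> bounded (x ` ({a..b} \<inter> {0..1}))"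
    proof (intro exI[of _ "min d1 d2"] conjI allI impI)
      fix a b assume ab: "a \<le> t \<and> t \<le> b \<and> b - a < min d1 d2"
      have "\<bar>x s\<bar> \<le> \<bar>x t\<bar> + \<bar>left_lim x t\<bar> + 1" if "s \<in> {a..b} \<inter> {0..1}" for s
      proof -
        consider "s = t" | "s < t" | "t < s" by linarith
        then show ?thesis
          using d1(2)[of s] d2(2)[of s] that ab by cases auto
      qed
      then show "bounded (x ` ({a..b} \<inter> {0..1}))"
        unfolding bounded_iff by (intro exI[of _ "\<bar>x t\<bar> + \<bar>left_lim x t\<bar> + 1"]) auto
    qed (use d1 d2 in auto)
  qed simp
  then obtain K where "\<forall>t\<in>{0..1}. \<bar>x t\<bar> \<le> K"
    by (auto simp: bounded_iff)
  then show ?thesis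
    by (intro that[of K]) auto
qed

lemma left_lim_bounded:
  assumes "cadlag_on {0..1} x" "0 < t" "t \<le> 1" and "\<And>s. t - d < s \<Longrightarrow> s < t \<Longrightarrow> \<bar>x s - c\<bar> \<le> K" "0 < d"
  shows "\<bar>left_lim x t - c\<bar> \<le> K"
proof (rule tendsto_upperbound)
  show "((\<lambda>s. \<bar>x s - c\<bar>) \<longlongrightarrow> \<bar>left_lim x t - c\<bar>) (at_left t)"
    using cadlag_on_D01_cases(2)[OF assms(1)] assms by (intro tendsto_intros) auto
  show "eventually (\<lambda>s. \<bar>x s - c\<bar> \<le> K) (at_left t)"
    unfolding eventually_at_left_field using assms by (intro exI[of _ "t - d"]) auto
qed simp

lemma segment_abs_le:
  fixes u v w c :: real
  assumes "0 \<le> c" "c \<le> 1" "\<bar>u - w\<bar> \<le> K" "\<bar>v - w\<bar> \<le> K"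
  shows "\<bar>c * u + (1 - c) * v - w\<bar> \<le> K"
proof -
  have "c * u + (1 - c) * v - w = c * (u - w) + (1 - c) * (v - w)"
    by (simp add: algebra_simps)
  also have "\<bar>\<dots>\<bar> \<le> c * \<bar>u - w\<bar> + (1 - c) * \<bar>v - w\<bar>"
    using assms abs_triangle_ineq[of "c * (u - w)" "(1 - c) * (v - w)"] by (simp add: abs_mult)
  also have "\<dots> \<le> c * K + (1 - c) * K"
    using assms by (intro add_mono mult_left_mono) auto
  finally show ?thesis by (simp add: algebra_simps)
qed

lemma completed_graph_bounded:
  assumes "x \<in> D01"
  obtains K where "\<And>t z. (t, z) \<in> completed_graph x \<Longrightarrow> 0 \<le> t \<and> t \<le> 1 \<and> \<bar>z\<bar> \<le> K"
proof -
  obtain K where K: "\<And>t. 0 \<le> t \<Longrightarrow> t \<le> 1 \<Longrightarrow> \<bar>x t\<bar> \<le> K"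
    using bounded_D01[OF assms] by blast
  have "\<bar>left_lim x t\<bar> \<le> K" if "0 \<le> t" "t \<le> 1" for t
  proof (cases "t = 0")
    case False
    then show ?thesis
      using left_lim_bounded[of x t t 0 K] K that assms by (auto simp: D01_def)
  qed (use K in \<open>auto simp: left_lim_def\<close>)
  then show ?thesis
    using K segment_abs_le[of _ _ 0 K] by (intro that[of K]) (auto simp: completed_graph_def)
qed

lemma graph_in_completed_graph: "0 \<le> t \<Longrightarrow> t \<le> 1 \<Longrightarrow> (t, x t) \<in> completed_graph x"
  by (auto simp: completed_graph_def intro!: bexI[of _ 0])

lemma dist_max_nonneg [simp]: "0 \<le> dist_max a b"
  by (simp add: dist_max_def)

lemma dist_max_triangle: "dist_max a c \<le> dist_max a b + dist_max b c"
  by (auto simp: dist_max_def)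

lemma bdd_below_dist_max [simp]: "bdd_below (dist_max a ` B)"
  by (auto intro: bdd_belowI[of _ 0])

lemma bdd_above_completed_graph:
  assumes "x \<in> D01" "y \<in> D01"
  shows "bdd_above ((\<lambda>a. INF b\<in>completed_graph y. dist_max a b) ` completed_graph x)"
proof -
  obtain K where K: "\<And>t z. (t, z) \<in> completed_graph x \<Longrightarrow> 0 \<le> t \<and> t \<le> 1 \<and> \<bar>z\<bar> \<le> K"
    using completed_graph_bounded[OF assms(1)] by blast
  show ?thesis
  proof (rule bdd_aboveI2)
    fix a assume "a \<in> completed_graph x"
    then have "dist_max a (0, y 0) \<le> 1 + K + \<bar>y 0\<bar>"
      using K[of "fst a" "snd a"] by (auto simp: dist_max_def)
    moreover have "(INF b\<in>completed_graph y. dist_max a b) \<le> dist_max a (0, y 0)"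
      by (intro cINF_lower) (auto simp: graph_in_completed_graph)
    ultimately show "(INF b\<in>completed_graph y. dist_max a b) \<le> 1 + K + \<bar>y 0\<bar>" by simp
  qed
qed

lemma dist_M2_commute: "dist_M2 x y = dist_M2 y x"
  by (auto simp: dist_M2_def max.commute)

lemma dist_M2_approx:
  assumes "x \<in> D01" "y \<in> D01" "a \<in> completed_graph x" "e > 0"
  obtains b where "b \<in> completed_graph y" "dist_max a b < dist_M2 x y + e"
proof -
  have "(INF b\<in>completed_graph y. dist_max a b) \<le> dist_M2 x y"
    using assms cSUP_upper[OF assms(3) bdd_above_completed_graph[OF assms(1,2)]]
    by (simp add: dist_M2_def)
  then have "(INF b\<in>completed_graph y. dist_max a b) < dist_M2 x y + e"
    using assms by simp
  then show ?thesis
    using that graph_in_completed_graph[of 0 y] by (subst (asm) cINF_less_iff) auto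
qed

lemma dist_M2_le:
  assumes xy: "x \<in> D01" "y \<in> D01"
    and "\<And>a e. a \<in> completed_graph x \<Longrightarrow> e > 0 \<Longrightarrow> \<exists>b\<in>completed_graph y. dist_max a b < r + e"
    and "\<And>a e. a \<in> completed_graph y \<Longrightarrow> e > 0 \<Longrightarrow> \<exists>b\<in>completed_graph x. dist_max a b < r + e"
  shows "dist_M2 x y \<le> r"
proof -
  have *: "(SUP a\<in>completed_graph u. INF b\<in>completed_graph v. dist_max a b) \<le> r"
    if "\<And>a e. a \<in> completed_graph u \<Longrightarrow> e > 0 \<Longrightarrow> \<exists>b\<in>completed_graph v. dist_max a b < r + e" for u v
  proof (rule cSUP_least)
    show "completed_graph u \<noteq> {}" using graph_in_completed_graph[of 0 u] by auto
    fix a assume a: "a \<in> completed_graph u"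
    show "(INF b\<in>completed_graph v. dist_max a b) \<le> r"
    proof (rule field_le_epsilon)
      fix e :: real assume "e > 0"
      with that[OF a] obtain b where "b \<in> completed_graph v" "dist_max a b < r + e" by blast
      moreover from this have "(INF b\<in>completed_graph v. dist_max a b) \<le> dist_max a b"
        by (intro cINF_lower) auto
      ultimately show "(INF b\<in>completed_graph v. dist_max a b) \<le> r + e" by simp
    qed
  qed
  show ?thesis
    using xy *[OF assms(3)] *[OF assms(4)] by (simp add: dist_M2_def)
qed

lemma dist_M2_nonneg: "0 \<le> dist_M2 x y"
proof (cases "x \<in> D01 \<and> y \<in> D01")
  case True
  show ?thesis
  proof (rule field_le_epsilon)
    fix e :: real assume "e > 0"
    then obtain b where "b \<in> completed_graph y" "dist_max (0, x 0) b < dist_M2 x y + e"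
      using dist_M2_approx[of x y "(0, x 0)" e] True graph_in_completed_graph[of 0 x] by auto
    then show "0 \<le> dist_M2 x y + e" using dist_max_nonneg[of "(0, x 0)" b] by linarith
  qed
qed (auto simp: dist_M2_def)

lemma dist_M2_triangle:
  assumes "x \<in> D01" "y \<in> D01" "z \<in> D01"
  shows "dist_M2 x z \<le> dist_M2 x y + dist_M2 y z"
proof -
  have *: "\<exists>b\<in>completed_graph w. dist_max a b < dist_M2 u v + dist_M2 v w + e"
    if uvw: "u \<in> D01" "v \<in> D01" "w \<in> D01" "a \<in> completed_graph u" "e > 0" for u v w a e
  proof -
    obtain c where c: "c \<in> completed_graph v" "dist_max a c < dist_M2 u v + e / 2"
      using dist_M2_approx[OF uvw(1,2,4) half_gt_zero[OF uvw(5)]] by blast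
    obtain b where b: "b \<in> completed_graph w" "dist_max c b < dist_M2 v w + e / 2"
      using dist_M2_approx[OF uvw(2,3) c(1) half_gt_zero[OF uvw(5)]] by blast
    have "dist_max a b < dist_M2 u v + dist_M2 v w + e"
      using dist_max_triangle[of a b c] b c by linarith
    with b show ?thesis by blast
  qed
  show ?thesis
    using *[of x y z] *[of z y x] assms dist_M2_commute[of x y] dist_M2_commute[of y z]
    by (intro dist_M2_le) (auto simp: add.commute)
qed

lemma dist_M2_eq_0_interior:
  assumes xy: "x \<in> D01" "y \<in> D01" "dist_M2 x y = 0" and t: "0 \<le> t" "t < 1"
  shows "x t = y t"
proof (rule ccontr)
  assume "x t \<noteq> y t"
  define e where "e = \<bar>x t - y t\<bar> / 4"
  have e: "e > 0" using \<open>x t \<noteq> y t\<close> by (simp add: e_def)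
  have c: "cadlag_on {0..1} x" "cadlag_on {0..1} y" using xy by (auto simp: D01_def)
  have "eventually (\<lambda>s. dist (x s) (x t) < e) (at_right t)"
    "eventually (\<lambda>s. dist (y s) (y t) < e) (at_right t)"
    using cadlag_on_D01_cases(1)[OF c(1), of t] cadlag_on_D01_cases(1)[OF c(2), of t] t e
    by (auto intro: tendstoD)
  then have "eventually (\<lambda>s. dist (x s) (x t) < e \<and> dist (y s) (y t) < e) (at_right t)"
    by eventually_elim auto
  then obtain u0 where u0: "u0 > t"
      "\<And>s. t < s \<Longrightarrow> s < u0 \<Longrightarrow> \<bar>x s - x t\<bar> < e \<and> \<bar>y s - y t\<bar> < e"
    by (auto simp: eventually_at_right_field dist_real_def)
  define u where "u = min u0 1"
  define s where "s = (t + u) / 2"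
  have s: "t < s" "s < u" "u \<le> 1" using u0 t by (auto simp: s_def u_def)
  have u: "\<And>s. t < s \<Longrightarrow> s < u \<Longrightarrow> \<bar>x s - x t\<bar> < e \<and> \<bar>y s - y t\<bar> < e"
    using u0 by (auto simp: u_def)
  obtain b where b: "b \<in> completed_graph y" "dist_max (s, x s) b < min e (s - t)"
    using dist_M2_approx[of x y "(s, x s)" "min e (s - t)"] xy e s t graph_in_completed_graph[of s x]
    by auto
  obtain r k where r: "b = (r, k * left_lim y r + (1 - k) * y r)" "0 \<le> k" "k \<le> 1"
    using b(1) by (auto simp: completed_graph_def)
  have r': "\<bar>s - r\<bar> < s - t" "\<bar>x s - (k * left_lim y r + (1 - k) * y r)\<bar> < e"
    using b(2) r(1) by (auto simp: dist_max_def)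
  have "2 * s = t + u" by (simp add: s_def)
  with r'(1) have "t < r" "r < u" by linarith+
  note r' = this r'(2)
  have "\<bar>left_lim y r - y t\<bar> \<le> e"
    using left_lim_bounded[OF c(2), of r "r - t" "y t" e] r' s t u by force
  moreover have "\<bar>y r - y t\<bar> \<le> e" using u r' by force
  ultimately have "\<bar>k * left_lim y r + (1 - k) * y r - y t\<bar> \<le> e"
    using r by (intro segment_abs_le) auto
  moreover have "\<bar>x s - x t\<bar> < e" using u s by auto
  ultimately have "\<bar>x t - y t\<bar> < 3 * e" using r'(3) by linarith
  then show False using e by (simp add: e_def)
qed

lemma dist_M2_eq_0_endpoint:
  assumes xy: "x \<in> D01" "y \<in> D01" "dist_M2 x y = 0" and "e > 0"
  obtains k where "0 \<le> k" "k \<le> 1" "\<bar>x 1 - (k * left_lim y 1 + (1 - k) * y 1)\<bar> < e"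
proof -
  have c: "cadlag_on {0..1} y" using xy by (auto simp: D01_def)
  have "eventually (\<lambda>s. dist (y s) (left_lim y 1) < e / 2) (at_left 1)"
    using tendstoD[OF cadlag_on_D01_cases(2)[OF c, of 1], of "e / 2"] \<open>e > 0\<close> by simp
  then obtain u where u: "u < 1" "\<And>s. u < s \<Longrightarrow> s < 1 \<Longrightarrow> \<bar>y s - left_lim y 1\<bar> < e / 2"
    by (auto simp: eventually_at_left_field dist_real_def)
  obtain b where b: "b \<in> completed_graph y" "dist_max (1, x 1) b < min (e / 2) (min 1 (1 - u))"
    using dist_M2_approx[of x y "(1, x 1)" "min (e / 2) (min 1 (1 - u))"] xy \<open>e > 0\<close> u
      graph_in_completed_graph[of 1 x]
    by auto
  obtain r k where r: "b = (r, k * left_lim y r + (1 - k) * y r)" "0 \<le> k" "k \<le> 1" "r \<le> 1"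
    using b(1) by (auto simp: completed_graph_def)
  have r': "u < r" "0 < r" "\<bar>x 1 - (k * left_lim y r + (1 - k) * y r)\<bar> < e / 2"
    using b(2) r(1) unfolding dist_max_def min_less_iff_conj max_less_iff_conj by auto
  show ?thesis
  proof (cases "r = 1")
    case True
    with r r' \<open>e > 0\<close> show ?thesis by (intro that[of k]) auto
  next
    case False
    then have "\<bar>left_lim y r - left_lim y 1\<bar> \<le> e / 2"
      using left_lim_bounded[OF c, of r "r - u" "left_lim y 1" "e / 2"] r r' u by force
    moreover have "\<bar>y r - left_lim y 1\<bar> \<le> e / 2" using u r r' False by force
    ultimately have "\<bar>k * left_lim y r + (1 - k) * y r - left_lim y 1\<bar> \<le> e / 2"
      using r by (intro segment_abs_le) auto
    with r'(3) have "\<bar>x 1 - left_lim y 1\<bar> < e" by linarith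
    then show ?thesis by (intro that[of 1]) auto
  qed
qed

lemma dist_M2_eq_0:
  assumes xy: "x \<in> D01" "y \<in> D01" "dist_M2 x y = 0"
  shows "x = y"
proof -
  have int: "x t = y t" if "0 \<le> t" "t < 1" for t
    using dist_M2_eq_0_interior assms that by blast
  have c: "cadlag_on {0..1} x" "cadlag_on {0..1} y" using xy by (auto simp: D01_def)
  have "(y \<longlongrightarrow> left_lim x 1) (at_left 1)"
  proof (rule Lim_transform_eventually)
    show "(x \<longlongrightarrow> left_lim x 1) (at_left 1)" using cadlag_on_D01_cases(2)[OF c(1), of 1] by auto
    show "eventually (\<lambda>s. x s = y s) (at_left 1)"
      unfolding eventually_at_left_field using int by (intro exI[of _ 0]) auto
  qed
  then have L: "left_lim x 1 = left_lim y 1"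
    using cadlag_on_D01_cases(2)[OF c(2), of 1]
    by (intro tendsto_unique[of "at_left 1" y]) auto
  have near: "\<bar>u 1 - left_lim u 1\<bar> \<le> \<bar>v 1 - left_lim v 1\<bar> \<and>
      \<bar>u 1 - v 1\<bar> \<le> \<bar>v 1 - left_lim v 1\<bar> - \<bar>u 1 - left_lim u 1\<bar>"
    if uv: "u \<in> D01" "v \<in> D01" "dist_M2 u v = 0" "left_lim u 1 = left_lim v 1" for u v
  proof -
    have "\<bar>u 1 - v 1\<bar> + \<bar>u 1 - left_lim v 1\<bar> \<le> \<bar>v 1 - left_lim v 1\<bar>"
    proof (rule field_le_epsilon)
      fix e :: real assume "e > 0"
      then obtain k where k: "0 \<le> k" "k \<le> 1"
          "\<bar>u 1 - (k * left_lim v 1 + (1 - k) * v 1)\<bar> < e / 2"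
        using dist_M2_eq_0_endpoint[OF uv(1-3) half_gt_zero] by blast
      define w where "w = k * left_lim v 1 + (1 - k) * v 1"
      have "w - v 1 = k * (left_lim v 1 - v 1)" "w - left_lim v 1 = (1 - k) * (v 1 - left_lim v 1)"
        by (auto simp: w_def algebra_simps)
      then have "\<bar>w - v 1\<bar> + \<bar>w - left_lim v 1\<bar> =
          k * \<bar>v 1 - left_lim v 1\<bar> + (1 - k) * \<bar>v 1 - left_lim v 1\<bar>"
        using k by (simp add: abs_mult abs_minus_commute)
      also have "\<dots> = \<bar>v 1 - left_lim v 1\<bar>" by (simp add: algebra_simps)
      finally show "\<bar>u 1 - v 1\<bar> + \<bar>u 1 - left_lim v 1\<bar> \<le> \<bar>v 1 - left_lim v 1\<bar> + e"
        using k(3) unfolding w_def[symmetric] by linarith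
    qed
    with uv show ?thesis by auto
  qed
  have "x 1 = y 1"
    using near[of x y] near[of y x] assms L dist_M2_commute[of x y] by auto
  with int have "x t = y t" if "t \<in> {0..1}" for t
    using that by (cases "t = 1") auto
  then show ?thesis
    using xy by (auto simp: D01_def intro: extensionalityI)
qed

lemma Metric_space_M2: "Metric_space D01 dist_M2"
proof
  fix x y assume xy: "x \<in> D01" "y \<in> D01"
  show "dist_M2 x y = 0 \<longleftrightarrow> x = y"
  proof
    assume "x = y"
    have "dist_M2 x x \<le> 0"
    proof (rule dist_M2_le)
      fix a and e :: real assume "a \<in> completed_graph x" "e > 0"
      then show "\<exists>b\<in>completed_graph x. dist_max a b < 0 + e"
        by (intro bexI[of _ a]) (auto simp: dist_max_def)
      then show "\<exists>b\<in>completed_graph x. dist_max a b < 0 + e" .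
    qed (use xy in auto)
    with \<open>x = y\<close> show "dist_M2 x y = 0" using dist_M2_nonneg[of x x] by simp
  qed (use dist_M2_eq_0 xy in blast)
qed (auto intro: dist_M2_nonneg dist_M2_commute dist_M2_triangle)

definition M2_topology :: "(real \<Rightarrow> real) topology" where
  "M2_topology = Metric_space.mtopology D01 dist_M2"

section \<open>Convergence in distribution\<close>

definition borel_of :: "'a topology \<Rightarrow> 'a measure" where
  "borel_of T = sigma (topspace T) {U. openin T U}"

definition weak_conv_on :: "'a topology \<Rightarrow> (nat \<Rightarrow> 'a measure) \<Rightarrow> 'a measure \<Rightarrow> bool" where
  "weak_conv_on T \<mu> \<nu> \<longleftrightarrow>
     (\<forall>f. continuous_map T euclideanreal f \<longrightarrow> bounded (f ` topspace T) \<longrightarrow>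
        (\<lambda>n. integral\<^sup>L (\<mu> n) f) \<longlonglongrightarrow> integral\<^sup>L \<nu> f)"

definition conv_in_distribution ::
    "'c topology \<Rightarrow> 'a measure \<Rightarrow> (nat \<Rightarrow> 'a \<Rightarrow> 'c) \<Rightarrow> 'b measure \<Rightarrow> ('b \<Rightarrow> 'c) \<Rightarrow> bool" where
  "conv_in_distribution T M X N Y \<longleftrightarrow>
     (\<forall>n. X n \<in> M \<rightarrow>\<^sub>M borel_of T) \<and> Y \<in> N \<rightarrow>\<^sub>M borel_of T \<and>
     weak_conv_on T (\<lambda>n. distr M (borel_of T) (X n)) (distr N (borel_of T) Y)"

section \<open>Stable Levy processes\<close>

definition levy_process :: "'b measure \<Rightarrow> (real \<Rightarrow> 'b \<Rightarrow> real) \<Rightarrow> bool" where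
  "levy_process N V \<longleftrightarrow>
     prob_space N \<and>
     (\<forall>t\<ge>0. V t \<in> borel_measurable N) \<and>
     (\<forall>\<omega>\<in>space N. V 0 \<omega> = 0 \<and> cadlag_on {0..} (\<lambda>t. V t \<omega>)) \<and>
     (\<forall>s\<ge>0. \<forall>h\<ge>0. distr N borel (\<lambda>\<omega>. V (s + h) \<omega> - V s \<omega>) = distr N borel (V h)) \<and>
     (\<forall>(k::nat) t. 0 \<le> t 0 \<longrightarrow> (\<forall>i<k. t i \<le> t (Suc i)) \<longrightarrow>
        prob_space.indep_vars N (\<lambda>_. borel) (\<lambda>i \<omega>. V (t (Suc i)) \<omega> - V (t i) \<omega>) {..<k})"

text \<open>Stability is invariance under linear combinations of two independent copies, up to scaling
  and an arbitrary shift \<open>d\<close> (strict stability would require \<open>d = 0\<close>); the index enters through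
  the scaling constant.\<close>

definition stable_distribution :: "real \<Rightarrow> real measure \<Rightarrow> bool" where
  "stable_distribution \<alpha> \<mu> \<longleftrightarrow>
     real_distribution \<mu> \<and>
     (\<forall>a>0. \<forall>b>0. \<exists>d.
        distr (\<mu> \<Otimes>\<^sub>M \<mu>) borel (\<lambda>(x, y). a * x + b * y) =
        distr \<mu> borel (\<lambda>x. (a powr \<alpha> + b powr \<alpha>) powr (1 / \<alpha>) * x + d))"

definition degenerate_distribution :: "real measure \<Rightarrow> bool" where
  "degenerate_distribution \<mu> \<longleftrightarrow> (\<exists>c. \<mu> = return borel c)"

definition stable_levy_process :: "real \<Rightarrow> 'b measure \<Rightarrow> (real \<Rightarrow> 'b \<Rightarrow> real) \<Rightarrow> bool" where
  "stable_levy_process \<alpha> N V \<longleftrightarrow>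
     levy_process N V \<and>
     stable_distribution \<alpha> (distr N borel (V 1)) \<and>
     \<not> degenerate_distribution (distr N borel (V 1))"

end

theory Submission
  imports Defs
begin

text \<open>
Let \<open>x\<close> be the innovations, centred, divided by \<open>a n\<close> and shifted in time by \<open>q\<close>, and let
\<open>R m\<close> be the sum of \<open>x 0, ..., x (m - 1)\<close>. Summation by parts (\<open>moving_average_sum\<close>) writes the
sum of the first \<open>m\<close> terms of the moving average as \<open>\<Phi> * (T m - T 0)\<close>, where \<open>T m\<close> is \<open>R m\<close> plus
the sum over \<open>s < q\<close> of \<open>\<beta> s * x (m + q - 1 - s)\<close> and \<open>\<beta> s\<close> is the quotient of the partial
coefficient sum by \<open>\<Phi>\<close>. The hypothesis on the coefficients says that \<open>\<beta> s\<close> lies between 0 and 1.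
Hence, as long as at most one of the \<open>q\<close> innovations after time \<open>m\<close> is large, \<open>T m\<close> is close to
a point between \<open>R m\<close> and \<open>R (m + q)\<close>: a jump of the walk is spread over several steps but never
overshot. The M2 distance compares completed graphs, in which jumps are filled in by vertical
segments, and does not see how the path moves from one end of such a segment to the other.

Divide the unit interval into \<open>k\<close> cells. If no cell contains two disjoint blocks of innovations
with large sums, and no innovation next to a grid point is large, then the path is close, in
the M2 distance, to the step path that records the walk at the grid points only
(\<open>moving_average_path_close\<close>). A block as long as a cell has a large sum with probability of order
\<open>1/k\<close> (\<open>block_tail_bound\<close>, a truncation argument). By a maximal inequality and independence,
two such blocks occur in one cell with probability of order \<open>1/k\<^sup>2\<close> (\<open>two_big_blocks_bound\<close>), so
the exceptional event has probability of order \<open>1/k\<close> for large \<open>n\<close> (\<open>bad_event_bound\<close>).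

For fixed \<open>k\<close> the values at the grid points are sums of \<open>k\<close> independent block sums, so it is
enough that each block sum converges in distribution (\<open>independent_weak_convergence\<close>). This is
done with characteristic functions. Karamata's estimates for truncated moments
(\<open>karamata_low\<close>, \<open>karamata_high\<close>) show that the characteristic exponents converge
(\<open>kern_integral_tendsto\<close>); tightness provides a law with the limiting characteristic function, and
comparing the normings \<open>a (m n)\<close> and \<open>a n\<close> for \<open>m n\<close> asymptotic to \<open>t * n\<close> shows that this law
is stable and that its rescalings form a convolution semigroup (\<open>exponent_scaling\<close>).

The Levy process of this semigroup is constructed on the dyadic rationals by Kolmogorov's extension
theorem and extended by right limits (locale \<open>convolution_semigroup\<close>). Its paths have one-sided
limits by the same two-block estimate, now applied to increments over dyadic intervals.

Weak convergence is tested on bounded Lipschitz functions (\<open>conv_in_distribution_M2I\<close>): the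
moving average path is close to its grid version, the grid versions converge as \<open>n\<close> grows, and the
grid version of the limit is close to the limit for large \<open>k\<close> (\<open>dist_M2_sampled_tendsto_0\<close>).
\<close>

section \<open>Step paths and the M2 distance\<close>

text \<open>The value \<open>v k\<close> is taken only at time 1; for \<open>k = 0\<close> the path is constant.\<close>

definition step_path :: "nat \<Rightarrow> (nat \<Rightarrow> real) \<Rightarrow> real \<Rightarrow> real" where
  "step_path k v = (\<lambda>t\<in>{0..1}. v (nat \<lfloor>real k * t\<rfloor>))"

lemma step_path_at_right:
  assumes "0 \<le> t" 
  shows "eventually (\<lambda>s. nat \<lfloor>real k * s\<rfloor> = nat \<lfloor>real k * t\<rfloor>) (at_right t)"
proof (cases "k = 0")
  case False
  define u where "u = (of_int \<lfloor>real k * t\<rfloor> + 1) / real k"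
  have u: "t < u" using False by (simp add: u_def field_simps) (use floor_correct in linarith)
  have "nat \<lfloor>real k * s\<rfloor> = nat \<lfloor>real k * t\<rfloor>" if "t < s" "s < u" for s
  proof -
    have "real k * s < of_int \<lfloor>real k * t\<rfloor> + 1"
      using that(2) False by (simp add: u_def field_simps)
    moreover have "real k * t \<le> real k * s" using that by (intro mult_left_mono) auto
    then have "of_int \<lfloor>real k * t\<rfloor> \<le> real k * s" using of_int_floor_le[of "real k * t"] by linarith
    ultimately have "\<lfloor>real k * s\<rfloor> = \<lfloor>real k * t\<rfloor>"
      by (intro floor_unique)
    then show ?thesis by simp
  qed
  then show ?thesis unfolding eventually_at_right_field using u by blast
qed simp

lemma floor_at_left:
  assumes "0 < t" "k > 0" "real j < real k * t" "real k * t \<le> real j + 1"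
  shows "eventually (\<lambda>s. s > 0 \<and> nat \<lfloor>real k * s\<rfloor> = j) (at_left t)"
proof -
  have "nat \<lfloor>real k * s\<rfloor> = j" if "max (real j / real k) 0 < s" "s < t" for s
  proof -
    have "real j < real k * s" using that assms by (simp add: field_simps)
    moreover have "real k * s < real k * t" using that assms by simp
    ultimately have "\<lfloor>real k * s\<rfloor> = int j" using assms(4) by (intro floor_unique) (simp, simp)
    then show ?thesis by simp
  qed
  moreover have "max (real j / real k) 0 < t" using assms by (simp add: field_simps)
  ultimately show ?thesis unfolding eventually_at_left_field
    by (metis max_less_iff_conj)
qed

lemma grid_cell_exists:
  assumes "0 < t" "t \<le> 1" "k > 0"
  obtains j where "j < k" "real j < real k * t" "real k * t \<le> real j + 1"
proof -
  define j where "j = nat (\<lceil>real k * t\<rceil> - 1)"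
  have p: "0 < real k * t" using assms by simp
  have "real k * t \<le> real k" using assms by (simp add: mult_left_le)
  then have "\<lceil>real k * t\<rceil> \<le> int k" by (simp add: ceiling_le_iff)
  moreover have "1 \<le> \<lceil>real k * t\<rceil>" using p by linarith
  ultimately have "int j = \<lceil>real k * t\<rceil> - 1" by (simp add: j_def)
  then have "real j = of_int \<lceil>real k * t\<rceil> - 1" by (metis of_int_1 of_int_diff of_int_of_nat_eq)
  then show ?thesis using \<open>\<lceil>real k * t\<rceil> \<le> int k\<close> \<open>int j = _\<close> 
    by (intro that[of j]) (linarith)+
qed

lemma step_path_at_left:
  assumes "0 < t" "t \<le> 1" "k > 0" "real j < real k * t" "real k * t \<le> real j + 1"
  shows "(step_path k v \<longlongrightarrow> v j) (at_left t)"
proof (rule tendsto_eventually)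
  have "eventually (\<lambda>s. s < t) (at_left t)" by (simp add: eventually_at_filter)
  with floor_at_left[OF assms(1,3,4,5)]
  show "eventually (\<lambda>s. step_path k v s = v j) (at_left t)"
    by eventually_elim (use assms in \<open>auto simp: step_path_def\<close>)
qed

lemma left_lim_step_path:
  assumes "0 < t" "t \<le> 1" "k > 0" "real j < real k * t" "real k * t \<le> real j + 1"
  shows "left_lim (step_path k v) t = v j"
  using step_path_at_left[OF assms, of v] assms by (simp add: left_lim_def tendsto_Lim)

lemma step_path_in_D01: "step_path k v \<in> D01"
proof -
  have "cadlag_on {0..1} (step_path k v)"
    unfolding cadlag_on_def
  proof (intro ballI conjI)
    fix t :: real assume t: "t \<in> {0..1}"
    have "eventually (\<lambda>s. nat \<lfloor>real k * s\<rfloor> = nat \<lfloor>real k * t\<rfloor>) (at t within {0..1} \<inter> {t<..})"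
      using step_path_at_right[of t k] t
      by (intro filter_leD[OF at_le[of "{0..1} \<inter> {t<..}" "{t<..}"]]) auto
    moreover have "eventually (\<lambda>s. s \<in> {0..1}) (at t within {0..1} \<inter> {t<..})"
      by (auto simp: eventually_at_filter)
    ultimately have "eventually (\<lambda>s. step_path k v s = step_path k v t) (at t within {0..1} \<inter> {t<..})"
      by eventually_elim (use t in \<open>auto simp: step_path_def\<close>)
    then show "(step_path k v \<longlongrightarrow> step_path k v t) (at t within {0..1} \<inter> {t<..})"
      by (rule tendsto_eventually)
    show "\<exists>l. (step_path k v \<longlongrightarrow> l) (at t within {0..1} \<inter> {..<t})"
    proof (cases "t = 0")
      case True
      have "{0..1} \<inter> {..<t} = {}" using True by auto
      then show ?thesis by simp
    next
      case False
      then have t: "0 < t" "t \<le> 1" using t by auto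
      have "\<exists>l. (step_path k v \<longlongrightarrow> l) (at_left t)"
      proof (cases "k = 0")
        case True
        have "eventually (\<lambda>s. 0 < s \<and> s < t) (at_left t)"
          using t eventually_at_left_field by blast
        then have "eventually (\<lambda>s. step_path k v s = v 0) (at_left t)"
          by eventually_elim (use t True in \<open>auto simp: step_path_def\<close>)
        then show ?thesis using tendsto_eventually by blast
      next
        case False
        then obtain j where "j < k" "real j < real k * t" "real k * t \<le> real j + 1"
          using grid_cell_exists[OF t, of k] by auto
        then show ?thesis using step_path_at_left[OF t, of k j v] False by blast
      qed
      then show ?thesis
        by (meson at_le inf_le2 tendsto_mono)
    qed
  qed
  then show ?thesis by (auto simp: D01_def step_path_def)
qed

text \<open>The point of the completed graph of \<open>x\<close> at time \<open>t\<close> with weight \<open>c\<close> is matched with the point of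
the completed graph of \<open>y\<close> with the same \<open>t\<close> and \<open>c\<close>; the uniform bound passes to left limits.\<close>

lemma dist_M2_le_uniform:
  assumes xy: "x \<in> D01" "y \<in> D01" and le: "\<And>t. t \<in> {0..1} \<Longrightarrow> \<bar>x t - y t\<bar> \<le> r"
  shows "dist_M2 x y \<le> r"
proof -
  have *: "\<exists>b\<in>completed_graph v. dist_max a b < r + e"
    if uv: "u \<in> D01" "v \<in> D01" "\<And>t. t \<in> {0..1} \<Longrightarrow> \<bar>u t - v t\<bar> \<le> r"
      and a: "a \<in> completed_graph u" and e: "e > 0" for u v a and e :: real
  proof -
    obtain t c where t: "t \<in> {0..1}" "c \<in> {0..1}" "a = (t, c * left_lim u t + (1 - c) * u t)"
      using a by (auto simp: completed_graph_def)
    have "\<bar>left_lim u t - left_lim v t\<bar> \<le> r"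
    proof (cases "t = 0")
      case False
      then have t': "0 < t" "t \<le> 1" using t by auto
      have c: "cadlag_on {0..1} u" "cadlag_on {0..1} v" using uv by (auto simp: D01_def)
      show ?thesis
      proof (rule tendsto_upperbound)
        show "((\<lambda>s. \<bar>u s - v s\<bar>) \<longlongrightarrow> \<bar>left_lim u t - left_lim v t\<bar>) (at_left t)"
          using t' cadlag_on_D01_cases(2)[OF c(1), of t] cadlag_on_D01_cases(2)[OF c(2), of t]
          by (intro tendsto_intros) auto
        have "eventually (\<lambda>s. 0 < s \<and> s < t) (at_left t)"
          using t' eventually_at_left_field by blast
        then show "eventually (\<lambda>s. \<bar>u s - v s\<bar> \<le> r) (at_left t)"
          by eventually_elim (use uv(3) t' in auto)
      qed simp
    qed (use uv(3)[of 0] in \<open>auto simp: left_lim_def\<close>)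
    then have "\<bar>c * (left_lim u t - left_lim v t) + (1 - c) * (u t - v t) - 0\<bar> \<le> r"
      using t uv(3)[of t] by (intro segment_abs_le) auto
    then have "dist_max a (t, c * left_lim v t + (1 - c) * v t) \<le> r"
      using t uv(3)[of t] by (auto simp: dist_max_def algebra_simps)
    moreover have "(t, c * left_lim v t + (1 - c) * v t) \<in> completed_graph v"
      using t by (auto simp: completed_graph_def)
    ultimately show ?thesis using e by force
  qed
  show ?thesis
    by (rule dist_M2_le[OF xy]) (use * xy le abs_minus_commute in \<open>metis\<close>)+
qed

lemma step_path_index_le:
  assumes "t \<in> {0..1}"
  shows "nat \<lfloor>real k * t\<rfloor> \<le> k"
proof -
  have "real k * t \<le> real k" using assms by (simp add: mult_left_le)
  then show ?thesis using assms by (simp add: floor_le_iff nat_le_iff)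
qed

lemma step_path_cong:
  assumes "\<And>j. j \<le> k \<Longrightarrow> v j = w j"
  shows "step_path k v = step_path k w"
  unfolding step_path_def using assms step_path_index_le by (intro restrict_ext) auto

lemma dist_M2_step_path_le:
  assumes "\<And>j. j \<le> k \<Longrightarrow> \<bar>v j - w j\<bar> \<le> r"
  shows "dist_M2 (step_path k v) (step_path k w) \<le> r"
proof (rule dist_M2_le_uniform[OF step_path_in_D01 step_path_in_D01])
  fix t :: real assume t: "t \<in> {0..1}"
  then show "\<bar>step_path k v t - step_path k w t\<bar> \<le> r"
    using assms[OF step_path_index_le[OF t]] by (simp add: step_path_def)
qed

lemma left_lim_le:
  assumes "x \<in> D01" "0 \<le> a" "a < t" "t \<le> 1" "\<And>s. a \<le> s \<Longrightarrow> s < t \<Longrightarrow> \<sigma> * x s \<le> c"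
  shows "\<sigma> * left_lim x t \<le> c"
proof (rule tendsto_upperbound)
  show "((\<lambda>s. \<sigma> * x s) \<longlongrightarrow> \<sigma> * left_lim x t) (at_left t)"
    using cadlag_on_D01_cases(2)[of x t] assms by (intro tendsto_intros) (auto simp: D01_def)
  show "eventually (\<lambda>s. \<sigma> * x s \<le> c) (at_left t)"
    unfolding eventually_at_left_field using assms by (intro exI[of _ a]) auto
qed simp

lemma between_convex:
  fixes u v c :: real
  assumes "(u \<le> c \<and> c \<le> v) \<or> (v \<le> c \<and> c \<le> u)"
  shows "\<exists>k\<in>{0..1}. c = k * u + (1 - k) * v"
proof (cases "u = v")
  case False
  define l where "l = (c - v) / (u - v)"
  have "c = v + l * (u - v)" using False by (simp add: l_def)
  then have "c = l * u + (1 - l) * v"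
    by (simp add: algebra_simps)
  moreover have "l \<in> {0..1}"
    using assms False by (auto simp: l_def divide_simps)
  ultimately show ?thesis by blast
qed (use assms in \<open>auto intro: bexI[of _ 0]\<close>)

text \<open>An intermediate value property: a level between two values of a path is crossed at the first time
\<open>t\<close> at which the path is at or beyond it, because the left limit at \<open>t\<close> is still on the near side,
so that the vertical segment over \<open>t\<close> contains the level. The sign \<open>\<sigma>\<close> covers upward and downward
crossings by one argument.\<close>

lemma completed_graph_intermediate_aux:
  fixes \<sigma> :: real
  assumes x: "x \<in> D01" and ab: "0 \<le> a" "a \<le> b" "b \<le> 1" and \<sigma>: "\<sigma> \<in> {1, -1}"
    and c: "\<sigma> * x a \<le> \<sigma> * c" "\<sigma> * c \<le> \<sigma> * x b"
  shows "\<exists>t\<in>{a..b}. (t, c) \<in> completed_graph x"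
proof -
  define A where "A = {s \<in> {a..b}. \<sigma> * c \<le> \<sigma> * x s}"
  define t where "t = Inf A"
  have bA: "b \<in> A" using ab c by (simp add: A_def)
  have bdd: "bdd_below A" by (auto simp: A_def intro!: bdd_belowI[of _ a])
  have tab: "a \<le> t" "t \<le> b"
    using bA bdd by (auto simp: t_def A_def intro!: cInf_greatest cInf_lower)
  have below: "\<sigma> * x s \<le> \<sigma> * c" if "a \<le> s" "s < t" for s
  proof (rule ccontr)
    assume "\<not> ?thesis"
    then have "s \<in> A" using that tab by (auto simp: A_def)
    then have "t \<le> s" using bdd by (auto simp: t_def intro: cInf_lower)
    with that show False by simp
  qed
  have at: "\<sigma> * c \<le> \<sigma> * x t"
  proof (cases "t \<in> A")
    case False
    then have "t < b" using bA tab by (cases "t = b") auto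
    have "cadlag_on {0..1} x" using x by (simp add: D01_def)
    then have lim: "((\<lambda>s. \<sigma> * x s) \<longlongrightarrow> \<sigma> * x t) (at_right t)"
      using cadlag_on_D01_cases(1)[of x t] tab ab \<open>t < b\<close> by (intro tendsto_intros) auto
    show ?thesis
    proof (rule ccontr)
      assume "\<not> ?thesis"
      then have "eventually (\<lambda>s. \<sigma> * x s < \<sigma> * c) (at_right t)"
        using order_tendstoD(2)[OF lim] by auto
      then obtain u where u: "u > t" "\<And>s. t < s \<Longrightarrow> s < u \<Longrightarrow> \<sigma> * x s < \<sigma> * c"
        by (auto simp: eventually_at_right_field)
      have "\<exists>s\<in>A. s < u" using u(1) bA bdd unfolding t_def
        by (subst (asm) cInf_less_iff) auto
      then obtain s where s: "s \<in> A" "s < u" by blast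
      have "t \<le> s" using s bdd by (auto simp: t_def intro: cInf_lower)
      then have "t < s" using s False by (cases "s = t") auto
      then show False using u(2)[of s] s by (auto simp: A_def)
    qed
  qed (simp add: A_def)
  have left: "\<sigma> * left_lim x t \<le> \<sigma> * c \<or> c = x t"
  proof (cases "t = a")
    case True
    then show ?thesis using at c \<sigma> by auto
  next
    case False
    then show ?thesis using left_lim_le[OF x ab(1), of t \<sigma> "\<sigma> * c"] below tab ab by auto
  qed
  have "\<exists>k\<in>{0..1}. c = k * left_lim x t + (1 - k) * x t"
    using left
  proof
    assume "\<sigma> * left_lim x t \<le> \<sigma> * c"
    then show ?thesis using at \<sigma> by (intro between_convex) auto
  qed (auto intro: bexI[of _ 0])
  then show ?thesis using tab ab by (intro bexI[of _ t]) (auto simp: completed_graph_def)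
qed

lemma completed_graph_intermediate:
  assumes x: "x \<in> D01" and ab: "0 \<le> a" "a \<le> b" "b \<le> 1"
    and c: "c \<in> closed_segment (x a) (x b)"
  shows "\<exists>t\<in>{a..b}. (t, c) \<in> completed_graph x"
  using completed_graph_intermediate_aux[OF x ab, of 1 c] completed_graph_intermediate_aux[OF x ab, of "-1" c] c
  by (auto simp: closed_segment_eq_real_ivl split: if_splits)

text \<open>This is the property of the M2 distance behind the whole proof. Within a cell the path may take any
values between the two grid values: they are matched with points of the vertical segment of the step
path at the right end of the cell. Conversely, each point of that segment is approximately a point of
the completed graph of \<open>x\<close>, by the intermediate value property.\<close>

lemma dist_M2_step_path_grid:
  assumes x: "x \<in> D01" and k: "k > 0"
    and seg: "\<And>j t. j < k \<Longrightarrow> real j \<le> real k * t \<Longrightarrow> real k * t \<le> real j + 1 \<Longrightarrow>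
        min (v j) (v (Suc j)) - r \<le> x t \<and> x t \<le> max (v j) (v (Suc j)) + r"
    and node: "\<And>j. j \<le> k \<Longrightarrow> \<bar>x (real j / real k) - v j\<bar> \<le> r"
  shows "dist_M2 x (step_path k v) \<le> 1 / real k + r"
proof (rule dist_M2_le[OF x step_path_in_D01])
  have r: "r \<ge> 0" using node[of 0] by simp
  fix a and e :: real assume a: "a \<in> completed_graph x" and e: "e > 0"
  obtain t c where t: "t \<in> {0..1}" "c \<in> {0..1}" "a = (t, c * left_lim x t + (1 - c) * x t)"
    using a by (auto simp: completed_graph_def)
  define z where "z = c * left_lim x t + (1 - c) * x t"
  show "\<exists>b\<in>completed_graph (step_path k v). dist_max a b < 1 / real k + r + e"
  proof (cases "t = 0")
    case True
    have "\<bar>x 0 - v 0\<bar> \<le> r" using node[of 0] by simp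
    then have "dist_max a (0, step_path k v 0) \<le> r"
      using t r True by (auto simp: dist_max_def left_lim_def step_path_def algebra_simps)
    moreover have "0 < 1 / real k" using k by simp
    ultimately have "dist_max a (0, step_path k v 0) < 1 / real k + r + e" using e by linarith
    then show ?thesis using graph_in_completed_graph[of 0 "step_path k v"] by force
  next
    case False
    then have t': "0 < t" "t \<le> 1" using t by auto
    obtain j where j: "j < k" "real j < real k * t" "real k * t \<le> real j + 1"
      using grid_cell_exists[OF t' k] by blast
    define lo hi where "lo = min (v j) (v (Suc j))" and "hi = max (v j) (v (Suc j))"
    have jk: "real j / real k < t" "0 \<le> real j / real k" using j k by (auto simp: field_simps)
    have cell: "lo - r \<le> x s \<and> x s \<le> hi + r" if "real j / real k \<le> s" "s \<le> t" for s
    proof -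
      have "real j \<le> real k * s" using that k by (simp add: field_simps)
      moreover have "real k * s \<le> real k * t" using that by (simp add: mult_left_mono)
      ultimately show ?thesis using seg[of j s] j unfolding lo_def hi_def by linarith
    qed
    have l: "1 * left_lim x t \<le> hi + r"
      by (rule left_lim_le[OF x jk(2,1) t'(2)]) (use cell in auto)
    have l': "-1 * left_lim x t \<le> - (lo - r)"
      by (rule left_lim_le[OF x jk(2,1) t'(2)]) (use cell in force)
    define h where "h = (hi - lo) / 2 + r"
    define m where "m = (hi + lo) / 2"
    have "\<bar>z - m\<bar> \<le> h" unfolding z_def
      using t cell[of t] jk l l'
      by (intro segment_abs_le) (auto simp: h_def m_def abs_le_iff field_simps)
    then have z: "lo - r \<le> z" "z \<le> hi + r" by (auto simp: h_def m_def abs_le_iff field_simps)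
    \<comment> \<open>The vertical segment of the step path at the right end of the cell runs from \<open>lo\<close> to \<open>hi\<close>; clip \<open>z\<close> to it.\<close>
    define w where "w = max lo (min hi z)"
    have "lo \<le> hi" by (simp add: lo_def hi_def)
    then have w: "\<bar>z - w\<bar> \<le> r" "lo \<le> w" "w \<le> hi" using z r by (auto simp: w_def max_def min_def)
    define s where "s = (real j + 1) / real k"
    have s: "0 < s" "s \<le> 1" "real k * s = real j + 1"
      using j k by (auto simp: s_def field_simps)
    have ks: "\<lfloor>real k * s\<rfloor> = int j + 1" by (simp add: s)
    have "left_lim (step_path k v) s = v j"
      using s j by (intro left_lim_step_path) (auto simp: s_def field_simps)
    moreover have "step_path k v s = v (Suc j)"
      using s by (simp add: step_path_def ks nat_add_distrib)
    ultimately have "(s, w) \<in> completed_graph (step_path k v)"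
      using between_convex[of "v j" w "v (Suc j)"] w s
      by (auto simp: completed_graph_def lo_def hi_def min_def max_def split: if_splits)
    moreover have "\<bar>t - s\<bar> \<le> 1 / real k"
      using j k by (auto simp: s_def abs_le_iff field_simps)
    then have "dist_max a (s, w) \<le> 1 / real k + r"
      using w r t z_def by (auto simp: dist_max_def)
    ultimately show ?thesis using e by (intro bexI[of _ "(s, w)"]) auto
  qed
next
  have r: "r \<ge> 0" using node[of 0] by simp
  fix a and e :: real assume a: "a \<in> completed_graph (step_path k v)" and e: "e > 0"
  obtain s c where s: "s \<in> {0..1}" "c \<in> {0..1}"
      "a = (s, c * left_lim (step_path k v) s + (1 - c) * step_path k v s)"
    using a by (auto simp: completed_graph_def)
  have near: "\<exists>b\<in>completed_graph x. dist_max a b < 1 / real k + r + e"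
    if "j \<le> k" "snd a = v j" "real j \<le> real k * s" "real k * s \<le> real j + 1" for j
  proof -
    have "s \<le> (real j + 1) / real k" using that k by (simp add: field_simps)
    then have "real j / real k \<le> s" "s - real j / real k \<le> 1 / real k" "0 \<le> real j / real k" "real j / real k \<le> 1"
      using that k by (auto simp: add_divide_distrib) (simp_all add: field_simps)
    moreover have "(real j / real k, x (real j / real k)) \<in> completed_graph x"
      using calculation by (intro graph_in_completed_graph) auto
    moreover have "dist_max a (real j / real k, x (real j / real k)) \<le> 1 / real k + r"
      using calculation node[OF that(1)] that r s by (auto simp: dist_max_def)
    ultimately show ?thesis using e by (intro bexI[of _ "(real j / real k, x (real j / real k))"]) auto
  qed
  show "\<exists>b\<in>completed_graph x. dist_max a b < 1 / real k + r + e"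
  proof (cases "s = 0")
    case True
    then show ?thesis using near[of 0] s by (simp add: left_lim_def step_path_def algebra_simps)
  next
    case False
    then have s': "0 < s" "s \<le> 1" using s by auto
    obtain j where j: "j < k" "real j < real k * s" "real k * s \<le> real j + 1"
      using grid_cell_exists[OF s' k] by blast
    have ll: "left_lim (step_path k v) s = v j"
      using s' j k by (intro left_lim_step_path) auto
    show ?thesis
    proof (cases "real k * s = real j + 1")
      case False
      then have "\<lfloor>real k * s\<rfloor> = int j" using j by (intro floor_unique) auto
      then have "step_path k v s = v j" using s' by (simp add: step_path_def)
      then show ?thesis using near[of j] s ll j by (simp add: algebra_simps)
    next
      case True
      define u where "u = real j / real k"
      have su: "s = real (Suc j) / real k" using True k by (simp add: field_simps)
      have us: "0 \<le> u" "u \<le> s" "s - u = 1 / real k" using k by (auto simp: u_def su field_simps)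
      have "\<lfloor>real k * s\<rfloor> = int j + 1" by (simp add: True)
      then have sp: "step_path k v s = v (Suc j)" using s' by (simp add: step_path_def nat_add_distrib)
      \<comment> \<open>At the right end of cell \<open>j\<close> the point lies on the vertical segment of the step path; move its ends to the values of \<open>x\<close>.\<close>
      define w where "w = c * v j + (1 - c) * v (Suc j)"
      define w' where "w' = c * x u + (1 - c) * x s"
      have n: "\<bar>x u - v j\<bar> \<le> r" "\<bar>x s - v (Suc j)\<bar> \<le> r"
        using node[of j] node[of "Suc j"] j by (auto simp: u_def su)
      have "w' - w = c * (x u - v j) + (1 - c) * (x s - v (Suc j)) - 0"
        by (simp add: w_def w'_def algebra_simps)
      also have "\<bar>\<dots>\<bar> \<le> r" using n s by (intro segment_abs_le) auto
      finally have ww: "\<bar>w' - w\<bar> \<le> r" .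
      have "w' \<in> closed_segment (x u) (x s)"
        using s unfolding closed_segment_def w'_def
        by (intro CollectI exI[of _ "1 - c"]) auto
      then obtain t where t: "t \<in> {u..s}" "(t, w') \<in> completed_graph x"
        using completed_graph_intermediate[OF x us(1,2) s'(2)] by blast
      have "dist_max a (t, w') \<le> 1 / real k + r"
        using s t us ww r k ll sp by (auto simp: dist_max_def w_def abs_minus_commute)
      then show ?thesis using t e by (intro bexI[of _ "(t, w')"]) auto
    qed
  qed
qed

text \<open>Around every time \<open>t\<close> there is a neighbourhood in which the path oscillates by at most \<open>e\<close> on each
side of \<open>t\<close>. By compactness three points close together lie in one such neighbourhood, and the
middle one shares its side of \<open>t\<close> with one of the others.\<close>

lemma cadlag_three_points:
  assumes x: "x \<in> D01" and e: "e > 0"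
  obtains d where "d > 0"
    "\<And>s t u. 0 \<le> s \<Longrightarrow> s \<le> t \<Longrightarrow> t \<le> u \<Longrightarrow> u \<le> 1 \<Longrightarrow> u - s < d \<Longrightarrow>
        \<bar>x t - x s\<bar> \<le> e \<or> \<bar>x u - x t\<bar> \<le> e"
proof -
  have c: "cadlag_on {0..1} x" using x by (simp add: D01_def)
  \<comment> \<open>The time \<open>t\<close> itself counts as lying on the right, in accordance with right continuity.\<close>
  have "\<exists>G. open G \<and> t \<in> G \<and> (\<forall>s\<in>G \<inter> {0..1}. \<forall>u\<in>G \<inter> {0..1}. (s < t \<longleftrightarrow> u < t) \<longrightarrow> \<bar>x s - x u\<bar> \<le> e)"
    if t: "t \<in> {0..1}" for t
  proof -
    have "\<exists>u>t. \<forall>s. t \<le> s \<and> s < u \<and> s \<le> 1 \<longrightarrow> \<bar>x s - x t\<bar> < e / 2"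
    proof (cases "t < 1")
      case True
      have "eventually (\<lambda>s. dist (x s) (x t) < e / 2) (at_right t)"
        using cadlag_on_D01_cases(1)[OF c, of t] t True e by (intro tendstoD) auto
      then obtain u where "u > t" "\<And>s. t < s \<Longrightarrow> s < u \<Longrightarrow> \<bar>x s - x t\<bar> < e / 2"
        by (auto simp: eventually_at_right_field dist_real_def)
      then show ?thesis using e by (intro exI[of _ u]) (auto simp: le_less)
    qed (use t e in \<open>auto intro!: exI[of _ 2]\<close>)
    then obtain u where u: "u > t" "\<And>s. t \<le> s \<Longrightarrow> s < u \<Longrightarrow> s \<le> 1 \<Longrightarrow> \<bar>x s - x t\<bar> < e / 2" by blast
    have "\<exists>l<t. \<forall>s. l < s \<and> s < t \<and> 0 \<le> s \<longrightarrow> \<bar>x s - left_lim x t\<bar> < e / 2"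
    proof (cases "0 < t")
      case True
      have "eventually (\<lambda>s. dist (x s) (left_lim x t) < e / 2) (at_left t)"
        using cadlag_on_D01_cases(2)[OF c, of t] t True e by (intro tendstoD) auto
      then show ?thesis
        by (auto simp: eventually_at_left_field dist_real_def)
    qed (use t e in \<open>auto intro!: exI[of _ "-1"]\<close>)
    then obtain l where l: "l < t" "\<And>s. l < s \<Longrightarrow> s < t \<Longrightarrow> 0 \<le> s \<Longrightarrow> \<bar>x s - left_lim x t\<bar> < e / 2" by blast
    show ?thesis
    proof (intro exI[of _ "{l<..<u}"] conjI ballI impI)
      fix s w assume sw: "s \<in> {l<..<u} \<inter> {0..1}" "w \<in> {l<..<u} \<inter> {0..1}" "(s < t) = (w < t)"
      show "\<bar>x s - x w\<bar> \<le> e"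
      proof (cases "s < t")
        case True
        then have "\<bar>x s - left_lim x t\<bar> < e / 2" "\<bar>x w - left_lim x t\<bar> < e / 2"
          using l(2)[of s] l(2)[of w] sw by auto
        then show ?thesis by linarith
      next
        case False
        then have "\<bar>x s - x t\<bar> < e / 2" "\<bar>x w - x t\<bar> < e / 2"
          using u(2)[of s] u(2)[of w] sw by auto
        then show ?thesis by linarith
      qed
    qed (use l u in auto)
  qed
  then obtain G where G: "\<And>t. t \<in> {0..1} \<Longrightarrow> open (G t) \<and> t \<in> G t \<and>
      (\<forall>s\<in>G t \<inter> {0..1}. \<forall>u\<in>G t \<inter> {0..1}. (s < t \<longleftrightarrow> u < t) \<longrightarrow> \<bar>x s - x u\<bar> \<le> e)"
    by metis
  obtain d where d: "d > 0" "\<And>t. t \<in> {0..1::real} \<Longrightarrow> \<exists>H\<in>G ` {0..1}. ball t d \<subseteq> H"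
    by (rule Heine_Borel_lemma[of "{0..1::real}" "G ` {0..1}"]) (use G in auto)
  show ?thesis
  proof (rule that[OF d(1)])
    fix s t u :: real assume *: "0 \<le> s" "s \<le> t" "t \<le> u" "u \<le> 1" "u - s < d"
    obtain r where r: "r \<in> {0..1}" "ball s d \<subseteq> G r" using d(2)[of s] * by auto
    have "s \<in> ball s d" "t \<in> ball s d" "u \<in> ball s d" using * d by (auto simp: dist_real_def)
    then have in_G: "s \<in> G r \<inter> {0..1}" "t \<in> G r \<inter> {0..1}" "u \<in> G r \<inter> {0..1}" using r * by auto
    show "\<bar>x t - x s\<bar> \<le> e \<or> \<bar>x u - x t\<bar> \<le> e"
      using G[OF r(1)] in_G * by (cases "t < r") auto
  qed
qed

text \<open>By \<open>cadlag_three_points\<close> every value inside a fine cell is close to one of the two end values of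
the cell, so that \<open>dist_M2_step_path_grid\<close> applies.\<close>

lemma dist_M2_sampled_tendsto_0:
  assumes x: "x \<in> D01"
  shows "(\<lambda>k. dist_M2 x (step_path k (\<lambda>j. x (real j / real k)))) \<longlonglongrightarrow> 0"
proof (rule LIMSEQ_I)
  fix e :: real assume "0 < e"
  then have e2: "e / 2 > 0" by simp
  obtain d where d: "d > 0" "\<And>s t u. 0 \<le> s \<Longrightarrow> s \<le> t \<Longrightarrow> t \<le> u \<Longrightarrow> u \<le> 1 \<Longrightarrow> u - s < d \<Longrightarrow>
        \<bar>x t - x s\<bar> \<le> e / 2 \<or> \<bar>x u - x t\<bar> \<le> e / 2"
    using cadlag_three_points[OF x e2] by blast
  obtain K where K: "K > 0" "inverse (real K) < min d (e / 2)"
    using reals_Archimedean2 ex_inverse_of_nat_less[of "min d (e/2)"] d e2 by auto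
  have "dist_M2 x (step_path k (\<lambda>j. x (real j / real k))) < e" if "k \<ge> K" for k
  proof -
    have k: "k > 0" "1 / real k < d" "1 / real k < e / 2"
    proof -
      show "k > 0" using that K by simp
      have "1 / real k \<le> inverse (real K)" using that K by (simp add: field_simps)
      then show "1 / real k < d" "1 / real k < e / 2" using K by auto
    qed
    have "dist_M2 x (step_path k (\<lambda>j. x (real j / real k))) \<le> 1 / real k + e / 2"
    proof (rule dist_M2_step_path_grid[OF x k(1)])
      fix j t assume jt: "j < k" "real j \<le> real k * t" "real k * t \<le> real j + 1"
      have "\<bar>x t - x (real j / real k)\<bar> \<le> e / 2 \<or> \<bar>x (real (Suc j) / real k) - x t\<bar> \<le> e / 2"
        by (rule d(2)) (use jt k in \<open>auto simp: field_simps\<close>)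
      then show "min (x (real j / real k)) (x (real (Suc j) / real k)) - e / 2 \<le> x t \<and>
         x t \<le> max (x (real j / real k)) (x (real (Suc j) / real k)) + e / 2" by linarith
    qed (use e2 in auto)
    then show ?thesis using k by linarith
  qed
  then show "\<exists>no. \<forall>n\<ge>no. norm (dist_M2 x (step_path n (\<lambda>j. x (real j / real n))) - 0) < e"
    using dist_M2_nonneg by auto
qed

section \<open>Weak convergence in the M2 topology\<close>

lemma topspace_M2 [simp]: "topspace M2_topology = D01"
proof -
  interpret Metric_space D01 dist_M2 by (rule Metric_space_M2)
  show ?thesis by (simp add: M2_topology_def)
qed

lemma openin_M2: "openin M2_topology U \<longleftrightarrow>
    U \<subseteq> D01 \<and> (\<forall>x\<in>U. \<exists>r>0. \<forall>y\<in>D01. dist_M2 x y < r \<longrightarrow> y \<in> U)"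
proof -
  interpret Metric_space D01 dist_M2 by (rule Metric_space_M2)
  have "(mball x r \<subseteq> U) = (\<forall>y\<in>D01. dist_M2 x y < r \<longrightarrow> y \<in> U)" if "x \<in> D01" for x r
    using that by (auto simp: mball_def)
  then have "(\<forall>x. x \<in> U \<longrightarrow> (\<exists>r>0. mball x r \<subseteq> U)) =
      (\<forall>x\<in>U. \<exists>r>0. \<forall>y\<in>D01. dist_M2 x y < r \<longrightarrow> y \<in> U)" if "U \<subseteq> D01"
    using that by (simp add: Ball_def subset_iff)
  then show ?thesis
    unfolding M2_topology_def openin_mtopology by blast
qed

lemma space_borel_of [simp]: "space (borel_of T) = topspace T"
  by (auto simp: borel_of_def space_measure_of_conv)

lemma openin_sets_borel_of: "openin T U \<Longrightarrow> U \<in> sets (borel_of T)"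
  unfolding borel_of_def by (subst sets_measure_of) (auto dest: openin_subset)

lemma measurable_borel_ofI:
  assumes "f \<in> space M \<rightarrow> topspace T"
    and "\<And>U. openin T U \<Longrightarrow> f -` U \<inter> space M \<in> sets M"
  shows "f \<in> M \<rightarrow>\<^sub>M borel_of T"
  unfolding borel_of_def using assms
  by (intro measurable_measure_of) (auto dest: openin_subset)

lemma continuous_map_measurable_borel_of:
  assumes "continuous_map T euclideanreal f"
  shows "f \<in> borel_measurable (borel_of T)"
proof (rule borel_measurableI)
  fix S :: "real set" assume "open S"
  then have "openin T {x \<in> topspace T. f x \<in> S}"
    using assms by (auto simp: continuous_map_def)
  moreover have "f -` S \<inter> space (borel_of T) = {x \<in> topspace T. f x \<in> S}" by auto
  ultimately show "f -` S \<inter> space (borel_of T) \<in> sets (borel_of T)"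
    by (simp add: openin_sets_borel_of)
qed

text \<open>The step path is continuous in the sequence of its values, for the product topology, and the Borel
sets of the product topology on sequences are generated by the coordinates. Together with
\<open>measurable_M2_limit\<close> this yields all measurability statements for random paths.\<close>

lemma measurable_step_path: "step_path k \<in> borel \<rightarrow>\<^sub>M borel_of M2_topology"
proof (rule measurable_borel_ofI)
  fix U assume U: "openin M2_topology U"
  have "open (step_path k -` U)"
  proof (subst open_subopen, intro ballI)
    fix v assume "v \<in> step_path k -` U"
    then have v: "step_path k v \<in> U" by simp
    obtain r where r: "r > 0" "\<And>y. y \<in> D01 \<Longrightarrow> dist_M2 (step_path k v) y < r \<Longrightarrow> y \<in> U"
      using U v unfolding openin_M2 by blast
    define T where "T = {w :: nat \<Rightarrow> real. \<forall>j\<in>{..k}. w j \<in> ball (v j) (r / 2)}"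
    have "open T" unfolding T_def
      by (rule product_topology_basis'[where x="\<lambda>x. x", simplified]) auto
    moreover have "v \<in> T" using r by (auto simp: T_def)
    moreover have "T \<subseteq> step_path k -` U"
    proof
      fix w assume "w \<in> T"
      then have "\<forall>j\<in>{..k}. dist (v j) (w j) < r / 2" by (simp add: T_def)
      then have "\<bar>v j - w j\<bar> \<le> r / 2" if "j \<le> k" for j
        using that by (auto simp: dist_real_def dest!: bspec[of _ _ j])
      then have "dist_M2 (step_path k v) (step_path k w) \<le> r / 2"
        by (rule dist_M2_step_path_le)
      then show "w \<in> step_path k -` U"
        using r step_path_in_D01 by auto
    qed
    ultimately show "\<exists>T. open T \<and> v \<in> T \<and> T \<subseteq> step_path k -` U" by blast
  qed
  then show "step_path k -` U \<inter> space borel \<in> sets borel" by simp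
qed (use step_path_in_D01 in auto)

lemma measurable_step_path_comp:
  assumes "\<And>j. j \<le> k \<Longrightarrow> v j \<in> borel_measurable N"
  shows "(\<lambda>\<omega>. step_path k (\<lambda>j. v j \<omega>)) \<in> N \<rightarrow>\<^sub>M borel_of M2_topology"
proof -
  have eq: "step_path k w = step_path k (\<lambda>j. if j \<le> k then w j else 0)" for w
    by (rule step_path_cong) simp
  have "(\<lambda>\<omega> j. if j \<le> k then v j \<omega> else 0) \<in> N \<rightarrow>\<^sub>M borel"
  proof (rule measurable_coordinatewise_then_product)
    show "(\<lambda>\<omega>. if j \<le> k then v j \<omega> else 0) \<in> borel_measurable N" for j
      using assms by (cases "j \<le> k") auto
  qed
  from measurable_compose[OF this measurable_step_path[of k]]
  have "(\<lambda>\<omega>. step_path k (\<lambda>j. if j \<le> k then v j \<omega> else 0)) \<in> N \<rightarrow>\<^sub>M borel_of M2_topology" .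
  moreover have "(\<lambda>\<omega>. step_path k (\<lambda>j. v j \<omega>)) = (\<lambda>\<omega>. step_path k (\<lambda>j. if j \<le> k then v j \<omega> else 0))"
    by (rule ext) (rule eq)
  ultimately show ?thesis by (simp only:)
qed

text \<open>The limit lies in an open set \<open>U\<close> if and only if, for some \<open>m\<close>, all late members of the sequence
lie in the closed set of points whose ball of radius \<open>1/(m+1)\<close> is contained in \<open>U\<close>.\<close>

lemma measurable_M2_limit:
  assumes f: "\<And>k. f k \<in> N \<rightarrow>\<^sub>M borel_of M2_topology"
    and g: "\<And>\<omega>. \<omega> \<in> space N \<Longrightarrow> g \<omega> \<in> D01"
    and lim: "\<And>\<omega>. \<omega> \<in> space N \<Longrightarrow> (\<lambda>k. dist_M2 (g \<omega>) (f k \<omega>)) \<longlonglongrightarrow> 0"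
  shows "g \<in> N \<rightarrow>\<^sub>M borel_of M2_topology"
proof (rule measurable_borel_ofI)
  interpret Metric_space D01 dist_M2 by (rule Metric_space_M2)
  have fD: "f k \<omega> \<in> D01" if "\<omega> \<in> space N" for k \<omega>
    using measurable_space[OF f that, of k] by simp
  fix U assume U: "openin M2_topology U"
  define C where "C = (\<lambda>m::nat. {x\<in>D01. \<forall>y\<in>D01. dist_M2 x y < 1 / Suc m \<longrightarrow> y \<in> U})"
  have CS: "C m \<in> sets (borel_of M2_topology)" for m
  proof -
    have "openin M2_topology (D01 - C m)"
      unfolding openin_M2
    proof (intro conjI ballI)
      fix x assume "x \<in> D01 - C m"
      then obtain y where y: "x \<in> D01" "y \<in> D01" "dist_M2 x y < 1 / Suc m" "y \<notin> U"
        by (auto simp: C_def)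
      show "\<exists>r>0. \<forall>z\<in>D01. dist_M2 x z < r \<longrightarrow> z \<in> D01 - C m"
      proof (intro exI[of _ "1 / Suc m - dist_M2 x y"] conjI ballI impI)
        fix z assume z: "z \<in> D01" "dist_M2 x z < 1 / Suc m - dist_M2 x y"
        have "dist_M2 z y \<le> dist_M2 z x + dist_M2 x y" using y z by (intro dist_M2_triangle)
        then have "dist_M2 z y < 1 / Suc m" using z dist_M2_commute[of x z] by simp
        then show "z \<in> D01 - C m" using y z by (auto simp: C_def)
      qed (use y in simp)
    qed auto
    then have "D01 - C m \<in> sets (borel_of M2_topology)" by (rule openin_sets_borel_of)
    then have "space (borel_of M2_topology) - (D01 - C m) \<in> sets (borel_of M2_topology)"
      by (rule sets.compl_sets)
    moreover have "space (borel_of M2_topology) - (D01 - C m) = C m" by (auto simp: C_def)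
    ultimately show ?thesis by simp
  qed
  have "g -` U \<inter> space N = (\<Union>m. \<Union>K. \<Inter>k\<in>{K..}. f k -` C m \<inter> space N)"
  proof (intro set_eqI iffI)
    fix \<omega> assume \<omega>: "\<omega> \<in> g -` U \<inter> space N"
    then obtain r where r: "r > 0" "\<And>y. y \<in> D01 \<Longrightarrow> dist_M2 (g \<omega>) y < r \<Longrightarrow> y \<in> U"
      using U unfolding openin_M2 by (metis IntD1 vimageD)
    obtain m where m: "1 / Suc m < r / 2" using r(1) nat_approx_posE[of "r / 2"] by auto
    obtain K where K: "\<And>k. k \<ge> K \<Longrightarrow> dist_M2 (g \<omega>) (f k \<omega>) < r / 2"
      using LIMSEQ_D[OF lim[of \<omega>], of "r / 2"] \<omega> r(1) by auto
    have "f k \<omega> \<in> C m" if "k \<ge> K" for k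
      unfolding C_def
    proof (intro CollectI conjI ballI impI)
      fix y assume y: "y \<in> D01" "dist_M2 (f k \<omega>) y < 1 / real (Suc m)"
      have "dist_M2 (g \<omega>) y \<le> dist_M2 (g \<omega>) (f k \<omega>) + dist_M2 (f k \<omega>) y"
        using \<omega> y fD g by (intro dist_M2_triangle) auto
      then show "y \<in> U" using K[OF that] m y r by auto
    qed (use \<omega> fD in auto)
    then have "\<omega> \<in> (\<Inter>k\<in>{K..}. f k -` C m \<inter> space N)" using \<omega> by auto
    then show "\<omega> \<in> (\<Union>m. \<Union>K. \<Inter>k\<in>{K..}. f k -` C m \<inter> space N)" by blast
  next
    fix \<omega> assume "\<omega> \<in> (\<Union>m. \<Union>K. \<Inter>k\<in>{K..}. f k -` C m \<inter> space N)"
    then obtain m K where mK0: "\<forall>k\<in>{K..}. \<omega> \<in> f k -` C m \<inter> space N" by (auto simp only: UN_iff INT_iff)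
    then have mK: "\<And>k. k \<ge> K \<Longrightarrow> f k \<omega> \<in> C m" "\<omega> \<in> space N" by auto
    obtain K' where K': "\<And>k. k \<ge> K' \<Longrightarrow> dist_M2 (g \<omega>) (f k \<omega>) < 1 / Suc m"
      using LIMSEQ_D[OF lim[of \<omega>], of "1 / Suc m"] mK by auto
    have "f (max K K') \<omega> \<in> C m" "dist_M2 (f (max K K') \<omega>) (g \<omega>) < 1 / Suc m"
      using mK(1)[of "max K K'"] K'[of "max K K'"] dist_M2_commute by auto
    then show "\<omega> \<in> g -` U \<inter> space N" using mK g by (auto simp: C_def)
  qed
  also have "\<dots> \<in> sets N"
    by (intro sets.countable_UN sets.countable_INT image_subsetI measurable_sets[OF f CS]) simp
  finally show "g -` U \<inter> space N \<in> sets N" .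
qed (use g in auto)

definition M2_lipschitz :: "real \<Rightarrow> ((real \<Rightarrow> real) \<Rightarrow> real) \<Rightarrow> bool" where
  "M2_lipschitz L f \<longleftrightarrow> L \<ge> 0 \<and> (\<forall>x\<in>D01. \<forall>y\<in>D01. \<bar>f x - f y\<bar> \<le> L * dist_M2 x y)"

lemma M2_lipschitz_continuous:
  assumes "M2_lipschitz L f"
  shows "continuous_map M2_topology euclideanreal f"
  unfolding continuous_map_def
proof (intro conjI allI impI)
  fix S :: "real set" assume "openin euclidean S"
  then have S: "open S" by simp
  show "openin M2_topology {x \<in> topspace M2_topology. f x \<in> S}"
    unfolding openin_M2
  proof (intro conjI ballI)
    fix x assume "x \<in> {x \<in> topspace M2_topology. f x \<in> S}"
    then have x: "x \<in> D01" "f x \<in> S" by auto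
    obtain e where e: "e > 0" "\<And>z. \<bar>f x - z\<bar> < e \<Longrightarrow> z \<in> S"
      using S x(2) unfolding open_contains_ball by (auto simp: subset_eq dist_real_def)
    show "\<exists>r>0. \<forall>y\<in>D01. dist_M2 x y < r \<longrightarrow> y \<in> {x \<in> topspace M2_topology. f x \<in> S}"
    proof (intro exI[of _ "e / (L + 1)"] conjI ballI impI)
      have L: "L \<ge> 0" using assms by (simp add: M2_lipschitz_def)
      show "e / (L + 1) > 0" using e L by simp
      fix y assume y: "y \<in> D01" "dist_M2 x y < e / (L + 1)"
      have "\<bar>f x - f y\<bar> \<le> L * dist_M2 x y" using assms x y by (auto simp: M2_lipschitz_def)
      also have "\<dots> \<le> (L + 1) * dist_M2 x y" using dist_M2_nonneg by (simp add: mult_right_mono)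
      also have "\<dots> < e" using y L by (simp add: field_simps)
      finally show "y \<in> {x \<in> topspace M2_topology. f x \<in> S}" using e y by auto
    qed
  qed auto
qed auto

text \<open>The functions \<open>h k x = inf (f y + k * dist_M2 x y)\<close> over all \<open>y\<close> increase to \<open>f\<close>: a \<open>y\<close> far
from \<open>x\<close> cannot be nearly optimal once \<open>k\<close> is large, and near \<open>x\<close> the values of \<open>f\<close> are close
to \<open>f x\<close>.\<close>

lemma lipschitz_minorants:
  assumes f: "continuous_map M2_topology euclideanreal f"
    and B: "\<And>x. x \<in> D01 \<Longrightarrow> \<bar>f x\<bar> \<le> B"
  obtains h where "\<And>k::nat. M2_lipschitz (real k) (h k)" "\<And>k x. x \<in> D01 \<Longrightarrow> h k x \<le> f x"
    "\<And>k x. x \<in> D01 \<Longrightarrow> \<bar>h k x\<bar> \<le> B" "\<And>x. x \<in> D01 \<Longrightarrow> (\<lambda>k. h k x) \<longlonglongrightarrow> f x"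
proof -
  interpret Metric_space D01 dist_M2 by (rule Metric_space_M2)
  define h where "h = (\<lambda>(k::nat) x. INF y\<in>D01. f y + real k * dist_M2 x y)"
  have ne: "D01 \<noteq> {}" using step_path_in_D01 by blast
  have lower: "- B \<le> f y + real k * dist_M2 x y" if "y \<in> D01" for x y k
    using B[OF that] mult_nonneg_nonneg[of "real k" "dist_M2 x y"] dist_M2_nonneg[of x y] by linarith
  have bdd: "bdd_below ((\<lambda>y. f y + real k * dist_M2 x y) ` D01)" for x k
    using lower by (intro bdd_belowI2[of _ "-B"]) auto
  have hle: "h k x \<le> f x" if "x \<in> D01" for k x
  proof -
    have "h k x \<le> f x + real k * dist_M2 x x"
      unfolding h_def using that bdd by (intro cINF_lower) auto
    then show ?thesis using that by simp
  qed
  have hB: "\<bar>h k x\<bar> \<le> B" if "x \<in> D01" for k x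
  proof -
    have "- B \<le> h k x" unfolding h_def using ne lower by (intro cINF_greatest) auto
    then show ?thesis using hle[OF that, of k] B[OF that] by linarith
  qed
  have lip: "h k x \<le> h k z + real k * dist_M2 x z" if "x \<in> D01" "z \<in> D01" for k x z
  proof -
    have "h k x - real k * dist_M2 x z \<le> f y + real k * dist_M2 z y" if y: "y \<in> D01" for y
    proof -
      have "h k x \<le> f y + real k * dist_M2 x y"
        unfolding h_def using y bdd by (intro cINF_lower) auto
      also have "\<dots> \<le> f y + real k * (dist_M2 x z + dist_M2 z y)"
        using y \<open>x \<in> D01\<close> \<open>z \<in> D01\<close> by (intro add_left_mono mult_left_mono dist_M2_triangle) auto
      finally show ?thesis by (simp add: algebra_simps)
    qed
    then have "h k x - real k * dist_M2 x z \<le> (INF y\<in>D01. f y + real k * dist_M2 z y)"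
      by (intro cINF_greatest ne)
    then have "h k x - real k * dist_M2 x z \<le> h k z" by (simp only: h_def)
    then show ?thesis by simp
  qed
  have "M2_lipschitz (real k) (h k)" for k
    unfolding M2_lipschitz_def
  proof (intro conjI ballI)
    fix x y assume "x \<in> D01" "y \<in> D01"
    then show "\<bar>h k x - h k y\<bar> \<le> real k * dist_M2 x y"
      using lip[of x y k] lip[of y x k] dist_M2_commute[of x y] by (auto simp: abs_le_iff)
  qed simp
  moreover have "(\<lambda>k. h k x) \<longlonglongrightarrow> f x" if x: "x \<in> D01" for x
  proof (rule LIMSEQ_I)
    fix e :: real assume e: "e > 0"
    define U where "U = {y \<in> topspace M2_topology. f y \<in> {f x - e / 2<..}}"
    have "openin M2_topology U"
      unfolding U_def using f by (rule openin_continuous_map_preimage) simp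
    moreover have "x \<in> U" using x e by (simp add: U_def)
    ultimately obtain r where r0: "r > 0" "\<forall>y\<in>D01. dist_M2 x y < r \<longrightarrow> y \<in> U"
      unfolding openin_M2 by blast
    then have r: "r > 0" "\<And>y. y \<in> D01 \<Longrightarrow> dist_M2 x y < r \<Longrightarrow> f x - e / 2 < f y"
      by (auto simp: U_def)
    obtain K :: nat where K: "real K > 2 * B / r" using reals_Archimedean2 by blast
    have "norm (h k x - f x) < e" if "k \<ge> K" for k
    proof -
      have "f x - e / 2 \<le> f y + real k * dist_M2 x y" if y: "y \<in> D01" for y
      proof (cases "dist_M2 x y < r")
        case True
        have "0 \<le> real k * dist_M2 x y" using dist_M2_nonneg by simp
        with r(2)[OF y True] show ?thesis by linarith
      next
        case False
        have "2 * B \<le> real K * r" using K r by (simp add: field_simps)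
        also have "\<dots> \<le> real k * dist_M2 x y"
          using False \<open>k \<ge> K\<close> r by (intro mult_mono) auto
        finally show ?thesis using B[OF x] B[OF y] e by linarith
      qed
      then have "f x - e / 2 \<le> h k x"
        unfolding h_def using ne by (intro cINF_greatest) auto
      then show ?thesis using hle[OF x, of k] e by simp
    qed
    then show "\<exists>no. \<forall>n\<ge>no. norm (h n x - f x) < e" by blast
  qed
  ultimately show ?thesis using that hle hB by blast
qed

lemma integrable_bounded_M2:
  assumes "prob_space M" "X \<in> M \<rightarrow>\<^sub>M borel_of M2_topology" "continuous_map M2_topology euclideanreal f"
    and B: "\<And>x. x \<in> D01 \<Longrightarrow> \<bar>f x\<bar> \<le> B"
  shows "(\<lambda>\<omega>. f (X \<omega>)) \<in> borel_measurable M" "integrable M (\<lambda>\<omega>. f (X \<omega>))"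
proof -
  interpret prob_space M by fact
  show m: "(\<lambda>\<omega>. f (X \<omega>)) \<in> borel_measurable M"
    using measurable_compose[OF assms(2) continuous_map_measurable_borel_of[OF assms(3)]] .
  show "integrable M (\<lambda>\<omega>. f (X \<omega>))"
    by (rule integrable_const_bound[of _ B])
       (use m B measurable_space[OF assms(2)] in auto)
qed

text \<open>Minorants give the lower bound for the expectations; the upper bound is the same statement for
\<open>- f\<close>.\<close>

lemma eventually_expectation_greater_M2:
  assumes M: "prob_space M" and N: "prob_space N"
    and X: "\<And>n. X n \<in> M \<rightarrow>\<^sub>M borel_of M2_topology" and Y: "Y \<in> N \<rightarrow>\<^sub>M borel_of M2_topology"
    and lip: "\<And>f L B. M2_lipschitz L f \<Longrightarrow> (\<And>x. x \<in> D01 \<Longrightarrow> \<bar>f x\<bar> \<le> B) \<Longrightarrow>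
        (\<lambda>n. integral\<^sup>L M (\<lambda>\<omega>. f (X n \<omega>))) \<longlonglongrightarrow> integral\<^sup>L N (\<lambda>\<omega>. f (Y \<omega>))"
    and f: "continuous_map M2_topology euclideanreal f" and B: "\<And>x. x \<in> D01 \<Longrightarrow> \<bar>f x\<bar> \<le> B" and e: "(e::real) > 0"
  shows "eventually (\<lambda>n. integral\<^sup>L N (\<lambda>\<omega>. f (Y \<omega>)) - e < integral\<^sup>L M (\<lambda>\<omega>. f (X n \<omega>))) sequentially"
proof -
  interpret M: prob_space M by fact
  interpret N: prob_space N by fact
  obtain h where h: "\<And>k::nat. M2_lipschitz (real k) (h k)" "\<And>k x. x \<in> D01 \<Longrightarrow> h k x \<le> f x"
    "\<And>k x. x \<in> D01 \<Longrightarrow> \<bar>h k x\<bar> \<le> B" "\<And>x. x \<in> D01 \<Longrightarrow> (\<lambda>k. h k x) \<longlonglongrightarrow> f x"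
    by (rule lipschitz_minorants[of f B, OF f]) (use B in \<open>blast, metis\<close>)
  note hc = M2_lipschitz_continuous[OF h(1)]
  note fN = integrable_bounded_M2(1)[where f=f and B=B, OF N Y f]
  note fM = integrable_bounded_M2(2)[where f=f and B=B, OF M X f]
  note hN = integrable_bounded_M2(1)[where f="h k" and B=B for k, OF N Y hc]
  note hM = integrable_bounded_M2(2)[where f="h k" and B=B for k, OF M X hc]
  have YD: "Y \<omega> \<in> D01" if "\<omega> \<in> space N" for \<omega> using measurable_space[OF Y that] by simp
  have XD: "X n \<omega> \<in> D01" if "\<omega> \<in> space M" for n \<omega> using measurable_space[OF X that] by simp
  have "(\<lambda>k. integral\<^sup>L N (\<lambda>\<omega>. h k (Y \<omega>))) \<longlonglongrightarrow> integral\<^sup>L N (\<lambda>\<omega>. f (Y \<omega>))"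
  proof (rule integral_dominated_convergence[where w="\<lambda>_. B"])
    show "AE \<omega> in N. (\<lambda>k. h k (Y \<omega>)) \<longlonglongrightarrow> f (Y \<omega>)" using h(4) YD by (intro AE_I2) auto
    show "AE \<omega> in N. norm (h k (Y \<omega>)) \<le> B" for k using h(3) YD by (intro AE_I2) auto
    show "integrable N (\<lambda>_. B)" by simp
  qed (use fN hN B h(3) in blast)+
  then have "eventually (\<lambda>k. integral\<^sup>L N (\<lambda>\<omega>. f (Y \<omega>)) - e < integral\<^sup>L N (\<lambda>\<omega>. h k (Y \<omega>))) sequentially"
    using e by (intro order_tendstoD(1)) auto
  then obtain k where k: "integral\<^sup>L N (\<lambda>\<omega>. f (Y \<omega>)) - e < integral\<^sup>L N (\<lambda>\<omega>. h k (Y \<omega>))"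
    by (auto simp: eventually_sequentially)
  have "eventually (\<lambda>n. integral\<^sup>L N (\<lambda>\<omega>. f (Y \<omega>)) - e < integral\<^sup>L M (\<lambda>\<omega>. h k (X n \<omega>))) sequentially"
  proof (rule order_tendstoD(1)[OF _ k])
    show "(\<lambda>n. integral\<^sup>L M (\<lambda>\<omega>. h k (X n \<omega>))) \<longlonglongrightarrow> integral\<^sup>L N (\<lambda>\<omega>. h k (Y \<omega>))"
      by (rule lip[where f="h k" and B=B, OF h(1)]) (rule h(3))
  qed
  then show ?thesis
  proof eventually_elim
    case (elim n)
    have "integral\<^sup>L M (\<lambda>\<omega>. h k (X n \<omega>)) \<le> integral\<^sup>L M (\<lambda>\<omega>. f (X n \<omega>))"
      by (rule integral_mono[OF hM fM]) (use h B XD in auto)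
    with elim show ?case by linarith
  qed
qed

lemma conv_in_distribution_M2I:
  assumes M: "prob_space M" and N: "prob_space N"
    and X: "\<And>n. X n \<in> M \<rightarrow>\<^sub>M borel_of M2_topology" and Y: "Y \<in> N \<rightarrow>\<^sub>M borel_of M2_topology"
    and lip: "\<And>f L B. M2_lipschitz L f \<Longrightarrow> (\<And>x. x \<in> D01 \<Longrightarrow> \<bar>f x\<bar> \<le> B) \<Longrightarrow>
        (\<lambda>n. integral\<^sup>L M (\<lambda>\<omega>. f (X n \<omega>))) \<longlonglongrightarrow> integral\<^sup>L N (\<lambda>\<omega>. f (Y \<omega>))"
  shows "conv_in_distribution M2_topology M X N Y"
proof -
  have "weak_conv_on M2_topology (\<lambda>n. distr M (borel_of M2_topology) (X n)) (distr N (borel_of M2_topology) Y)"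
    unfolding weak_conv_on_def
  proof (intro allI impI)
    fix f :: "(real \<Rightarrow> real) \<Rightarrow> real"
    assume f: "continuous_map M2_topology euclideanreal f" "bounded (f ` topspace M2_topology)"
    then obtain B where B: "\<And>x. x \<in> D01 \<Longrightarrow> \<bar>f x\<bar> \<le> B" by (auto simp: bounded_iff)
    have f': "continuous_map M2_topology euclideanreal (\<lambda>x. - f x)"
      using f(1) by (rule continuous_map_minus)
    have "(\<lambda>n. integral\<^sup>L M (\<lambda>\<omega>. f (X n \<omega>))) \<longlonglongrightarrow> integral\<^sup>L N (\<lambda>\<omega>. f (Y \<omega>))"
    proof (rule LIMSEQ_I)
      fix e :: real assume e: "e > 0"
      have B': "\<And>x. x \<in> D01 \<Longrightarrow> \<bar>- f x\<bar> \<le> B" using B by simp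
      have 1: "eventually (\<lambda>n. integral\<^sup>L N (\<lambda>\<omega>. f (Y \<omega>)) - e < integral\<^sup>L M (\<lambda>\<omega>. f (X n \<omega>))) sequentially"
        by (rule eventually_expectation_greater_M2[where f=f and X=X and Y=Y and B=B, OF M N X Y lip f(1) _ e])
          (use B in auto)
      have 2: "eventually (\<lambda>n. integral\<^sup>L N (\<lambda>\<omega>. - f (Y \<omega>)) - e < integral\<^sup>L M (\<lambda>\<omega>. - f (X n \<omega>))) sequentially"
        by (rule eventually_expectation_greater_M2[where f="\<lambda>x. - f x" and X=X and Y=Y and B=B, OF M N X Y lip f' _ e])
          (use B' in auto)
      have "eventually (\<lambda>n. norm (integral\<^sup>L M (\<lambda>\<omega>. f (X n \<omega>)) - integral\<^sup>L N (\<lambda>\<omega>. f (Y \<omega>))) < e) sequentially"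
        using 1 2 by eventually_elim (simp add: abs_less_iff)
      then show "\<exists>no. \<forall>n\<ge>no. norm (integral\<^sup>L M (\<lambda>\<omega>. f (X n \<omega>)) - integral\<^sup>L N (\<lambda>\<omega>. f (Y \<omega>))) < e"
        by (simp add: eventually_sequentially)
    qed
    then show "(\<lambda>n. integral\<^sup>L (distr M (borel_of M2_topology) (X n)) f) \<longlonglongrightarrow>
        integral\<^sup>L (distr N (borel_of M2_topology) Y) f"
      using integral_distr[OF X continuous_map_measurable_borel_of[OF f(1)]]
        integral_distr[OF Y continuous_map_measurable_borel_of[OF f(1)]] by (simp only:)
  qed
  with X Y show ?thesis by (simp add: conv_in_distribution_def)
qed

section \<open>Two large increments of a random walk\<close>

text \<open>A sequence of steps for which this fails moves by more than \<open>\<epsilon>\<close> essentially only once between \<open>a\<close>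
and \<open>b\<close>. The empty blocks \<open>i = j\<close> or \<open>k = l\<close> have sum 0.\<close>

definition two_big_blocks :: "real \<Rightarrow> nat \<Rightarrow> nat \<Rightarrow> (nat \<Rightarrow> real) \<Rightarrow> bool" where
  "two_big_blocks \<epsilon> a b x \<longleftrightarrow> (\<exists>i\<in>{a..b}. \<exists>j\<in>{i..b}. \<exists>k\<in>{j..b}. \<exists>l\<in>{k..b}.
      \<bar>\<Sum>m\<in>{i..<j}. x m\<bar> > \<epsilon> \<and> \<bar>\<Sum>m\<in>{k..<l}. x m\<bar> > \<epsilon>)"

context prob_space
begin

text \<open>A Markov property at the first passage above \<open>u\<close>. On the event that \<open>j\<close> is the first passage, which
is determined by the terms before \<open>j\<close>, the condition \<open>G j\<close> concerns the later terms only.\<close>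

lemma first_passage_bound:
  fixes \<xi> :: "nat \<Rightarrow> 'a \<Rightarrow> real" and G :: "nat \<Rightarrow> (nat \<Rightarrow> real) \<Rightarrow> bool"
  assumes ind: "indep_vars (\<lambda>_. borel) \<xi> {a..<b}"
    and G[measurable]: "\<And>j. j \<in> {a..b} \<Longrightarrow> Measurable.pred (PiM {j..<b} (\<lambda>_. borel)) (G j)"
    and p: "\<And>j. j \<in> {a..b} \<Longrightarrow> prob {\<omega>\<in>space M. G j (\<lambda>i\<in>{j..<b}. \<xi> i \<omega>)} \<le> p"
  shows "prob {\<omega>\<in>space M. \<exists>j\<in>{a..b}. \<bar>\<Sum>i\<in>{a..<j}. \<xi> i \<omega>\<bar> > u \<and>
            (\<forall>m\<in>{a..<j}. \<bar>\<Sum>i\<in>{a..<m}. \<xi> i \<omega>\<bar> \<le> u) \<and> G j (\<lambda>i\<in>{j..<b}. \<xi> i \<omega>)}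
      \<le> prob {\<omega>\<in>space M. \<exists>j\<in>{a..b}. \<bar>\<Sum>i\<in>{a..<j}. \<xi> i \<omega>\<bar> > u} * p"
proof -
  have meas[measurable]: "\<xi> i \<in> borel_measurable M" if "i \<in> {a..<b}" for i
    using ind that by (auto simp: indep_vars_def)
  define H where "H = (\<lambda>j (x::nat\<Rightarrow>real). \<bar>\<Sum>i\<in>{a..<j}. x i\<bar> > u \<and> (\<forall>m\<in>{a..<j}. \<bar>\<Sum>i\<in>{a..<m}. x i\<bar> \<le> u))"
  define A where "A = (\<lambda>j. {\<omega>\<in>space M. H j (\<lambda>i\<in>{a..<j}. \<xi> i \<omega>)})"
  define F where "F = (\<lambda>j. {\<omega>\<in>space M. G j (\<lambda>i\<in>{j..<b}. \<xi> i \<omega>)})"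
  have H[measurable]: "Measurable.pred (PiM {a..<j} (\<lambda>_. borel)) (H j)" for j
  proof -
    have "(\<lambda>x. \<Sum>i\<in>{a..<m}. x i) \<in> borel_measurable (PiM {a..<j} (\<lambda>_. borel::real measure))" if "m \<le> j" for m
      using that by (intro borel_measurable_sum measurable_component_singleton) auto
    then show ?thesis unfolding H_def
      by (intro pred_intros_logic pred_intros_finite borel_measurable_pred_less borel_measurable_abs
          measurable_const) auto
  qed
  have Aeq: "\<omega> \<in> A j \<longleftrightarrow> \<omega> \<in> space M \<and> \<bar>\<Sum>i\<in>{a..<j}. \<xi> i \<omega>\<bar> > u \<and> (\<forall>m\<in>{a..<j}. \<bar>\<Sum>i\<in>{a..<m}. \<xi> i \<omega>\<bar> \<le> u)" for \<omega> j
    unfolding A_def H_def by auto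
  have Am: "A j \<in> events" if "j \<in> {a..b}" for j
  proof -
    have "(\<lambda>\<omega>. \<lambda>i\<in>{a..<j}. \<xi> i \<omega>) \<in> M \<rightarrow>\<^sub>M PiM {a..<j} (\<lambda>_. borel)"
      using that by (intro measurable_restrict meas) auto
    from measurable_compose[OF this H[of j]] show ?thesis unfolding A_def by simp
  qed
  have Fm: "F j \<in> events" if "j \<in> {a..b}" for j
  proof -
    have "(\<lambda>\<omega>. \<lambda>i\<in>{j..<b}. \<xi> i \<omega>) \<in> M \<rightarrow>\<^sub>M PiM {j..<b} (\<lambda>_. borel)"
      using that by (intro measurable_restrict meas) auto
    from measurable_compose[OF this G[OF that]] show ?thesis unfolding F_def by simp
  qed
  have AF: "prob (A j \<inter> F j) \<le> prob (A j) * p" if j: "j \<in> {a..b}" for j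
  proof -
    define XA where "XA = {x \<in> space (PiM {a..<j} (\<lambda>_. borel::real measure)). H j x}"
    define XB where "XB = {x \<in> space (PiM {j..<b} (\<lambda>_. borel::real measure)). G j x}"
    have XA: "XA \<in> sets (PiM {a..<j} (\<lambda>_. borel))" using H[of j] by (simp add: XA_def pred_def)
    have XB: "XB \<in> sets (PiM {j..<b} (\<lambda>_. borel))" using G[OF j] by (simp add: XB_def pred_def)
    have iv: "indep_var (PiM {a..<j} (\<lambda>_. borel)) (\<lambda>\<omega>. \<lambda>i\<in>{a..<j}. \<xi> i \<omega>)
        (PiM {j..<b} (\<lambda>_. borel)) (\<lambda>\<omega>. \<lambda>i\<in>{j..<b}. \<xi> i \<omega>)"
      using j by (intro indep_var_restrict[OF ind]) auto
    have "A j \<inter> F j = (\<lambda>\<omega>. (\<lambda>i\<in>{a..<j}. \<xi> i \<omega>, \<lambda>i\<in>{j..<b}. \<xi> i \<omega>)) -` (XA \<times> XB) \<inter> space M"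
      by (auto simp: A_def F_def XA_def XB_def space_PiM)
    also have "prob \<dots> = prob ((\<lambda>\<omega>. \<lambda>i\<in>{a..<j}. \<xi> i \<omega>) -` XA \<inter> space M) * prob ((\<lambda>\<omega>. \<lambda>i\<in>{j..<b}. \<xi> i \<omega>) -` XB \<inter> space M)"
      by (rule indep_varD[OF iv XA XB])
    also have "(\<lambda>\<omega>. \<lambda>i\<in>{a..<j}. \<xi> i \<omega>) -` XA \<inter> space M = A j"
      by (auto simp: A_def XA_def space_PiM)
    also have "(\<lambda>\<omega>. \<lambda>i\<in>{j..<b}. \<xi> i \<omega>) -` XB \<inter> space M = F j"
      by (auto simp: F_def XB_def space_PiM)
    finally show ?thesis using p[OF j] by (simp add: F_def mult_left_mono)
  qed
  have disj: "disjoint_family_on A {a..b}"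
    unfolding disjoint_family_on_def
  proof (intro ballI impI)
    fix i j assume ij: "i \<in> {a..b}" "j \<in> {a..b}" "i \<noteq> j"
    show "A i \<inter> A j = {}"
    proof (rule ccontr)
      assume "A i \<inter> A j \<noteq> {}"
      then obtain \<omega> where \<omega>: "\<omega> \<in> A i" "\<omega> \<in> A j" by auto
      have "i < j \<or> j < i" using ij by auto
      then show False
      proof
        assume "i < j"
        then have "i \<in> {a..<j}" using ij by auto
        with \<omega>[unfolded Aeq] show False by force
      next
        assume "j < i"
        then have "j \<in> {a..<i}" using ij by auto
        with \<omega>[unfolded Aeq] show False by force
      qed
    qed
  qed
  have un: "{\<omega>\<in>space M. \<exists>j\<in>{a..b}. \<bar>\<Sum>i\<in>{a..<j}. \<xi> i \<omega>\<bar> > u} = (\<Union>j\<in>{a..b}. A j)"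
  proof (intro set_eqI iffI)
    fix \<omega> assume "\<omega> \<in> {\<omega>\<in>space M. \<exists>j\<in>{a..b}. \<bar>\<Sum>i\<in>{a..<j}. \<xi> i \<omega>\<bar> > u}"
    then obtain j where j: "\<omega> \<in> space M" "j \<in> {a..b}" "\<bar>\<Sum>i\<in>{a..<j}. \<xi> i \<omega>\<bar> > u" by auto
    obtain k where k: "k \<in> {a..b} \<and> \<bar>\<Sum>i\<in>{a..<k}. \<xi> i \<omega>\<bar> > u"
      and "\<forall>m<k. \<not> (m \<in> {a..b} \<and> \<bar>\<Sum>i\<in>{a..<m}. \<xi> i \<omega>\<bar> > u)"
      using ex_least_nat_le[of "\<lambda>k. k \<in> {a..b} \<and> \<bar>\<Sum>i\<in>{a..<k}. \<xi> i \<omega>\<bar> > u" j] j by blast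
    then have "\<omega> \<in> A k" unfolding Aeq using j k by force
    then show "\<omega> \<in> (\<Union>j\<in>{a..b}. A j)" using k by blast
  qed (auto simp: Aeq)
  have "{\<omega>\<in>space M. \<exists>j\<in>{a..b}. \<bar>\<Sum>i\<in>{a..<j}. \<xi> i \<omega>\<bar> > u \<and>
            (\<forall>m\<in>{a..<j}. \<bar>\<Sum>i\<in>{a..<m}. \<xi> i \<omega>\<bar> \<le> u) \<and> G j (\<lambda>i\<in>{j..<b}. \<xi> i \<omega>)}
      = (\<Union>j\<in>{a..b}. A j \<inter> F j)"
    unfolding set_eq_iff UN_iff Int_iff Aeq by (auto simp: F_def)
  also have "prob \<dots> \<le> (\<Sum>j\<in>{a..b}. prob (A j \<inter> F j))"
    using Am Fm by (intro finite_measure_subadditive_finite) auto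
  also have "\<dots> \<le> (\<Sum>j\<in>{a..b}. prob (A j) * p)"
    by (intro sum_mono AF)
  also have "\<dots> = prob (\<Union>j\<in>{a..b}. A j) * p"
    using Am disj by (subst finite_measure_finite_Union) (auto simp: sum_distrib_right)
  finally show ?thesis unfolding un .
qed

text \<open>Ottaviani's argument: if the walk first exceeds \<open>2 * \<epsilon>\<close> at time \<open>j\<close>, then the sum up to \<open>b\<close> or the
sum from \<open>j\<close> to \<open>b\<close> exceeds \<open>\<epsilon>\<close>, and the latter is independent of the passage.\<close>

lemma maximal_inequality:
  fixes \<xi> :: "nat \<Rightarrow> 'a \<Rightarrow> real"
  assumes ind: "indep_vars (\<lambda>_. borel) \<xi> {a..<b}" and ab: "a \<le> b"
    and p: "\<And>i j. a \<le> i \<Longrightarrow> i \<le> j \<Longrightarrow> j \<le> b \<Longrightarrow> prob {\<omega>\<in>space M. \<bar>\<Sum>k\<in>{i..<j}. \<xi> k \<omega>\<bar> > \<epsilon>} \<le> p"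
  shows "prob {\<omega>\<in>space M. \<exists>j\<in>{a..b}. \<bar>\<Sum>i\<in>{a..<j}. \<xi> i \<omega>\<bar> > 2 * \<epsilon>} \<le> 2 * p"
proof -
  have meas[measurable]: "\<xi> i \<in> borel_measurable M" if "i \<in> {a..<b}" for i
    using ind that by (auto simp: indep_vars_def)
  define G where "G = (\<lambda>j (x::nat \<Rightarrow> real). \<bar>\<Sum>i\<in>{j..<b}. x i\<bar> > \<epsilon>)"
  define E where "E = {\<omega>\<in>space M. \<exists>j\<in>{a..b}. \<bar>\<Sum>i\<in>{a..<j}. \<xi> i \<omega>\<bar> > 2 * \<epsilon>}"
  define E1 where "E1 = {\<omega>\<in>space M. \<bar>\<Sum>i\<in>{a..<b}. \<xi> i \<omega>\<bar> > \<epsilon>}"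
  define E2 where "E2 = {\<omega>\<in>space M. \<exists>j\<in>{a..b}. \<bar>\<Sum>i\<in>{a..<j}. \<xi> i \<omega>\<bar> > 2 * \<epsilon> \<and>
            (\<forall>m\<in>{a..<j}. \<bar>\<Sum>i\<in>{a..<m}. \<xi> i \<omega>\<bar> \<le> 2 * \<epsilon>) \<and> G j (\<lambda>i\<in>{j..<b}. \<xi> i \<omega>)}"
  have Smeas: "(\<lambda>\<omega>. \<Sum>i\<in>{m..<j}. \<xi> i \<omega>) \<in> borel_measurable M" if "a \<le> m" "j \<le> b" for m j
    using that by (intro borel_measurable_sum meas) auto
  have Geq: "G j (\<lambda>i\<in>{j..<b}. \<xi> i \<omega>) \<longleftrightarrow> \<bar>\<Sum>i\<in>{j..<b}. \<xi> i \<omega>\<bar> > \<epsilon>" for j \<omega>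
    by (simp add: G_def)
  have E1m: "E1 \<in> events" unfolding E1_def using ab
    by (intro predE borel_measurable_pred_less borel_measurable_abs Smeas measurable_const) auto
  have E2m: "E2 \<in> events" unfolding E2_def Geq
    by (intro predE pred_intros_finite pred_intros_logic borel_measurable_pred_less
        borel_measurable_abs Smeas measurable_const) auto
  have Gp: "prob E2 \<le> prob E * p"
    unfolding E2_def E_def
  proof (rule first_passage_bound[OF ind])
    fix j assume j: "j \<in> {a..b}"
    show "Measurable.pred (PiM {j..<b} (\<lambda>_. borel)) (G j)"
      unfolding G_def
      by (intro borel_measurable_pred_less borel_measurable_abs borel_measurable_sum
          measurable_component_singleton measurable_const) auto
    show "prob {\<omega>\<in>space M. G j (\<lambda>i\<in>{j..<b}. \<xi> i \<omega>)} \<le> p"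
      unfolding Geq using p[of j b] j by simp
  qed
  have "E \<subseteq> E1 \<union> E2"
  proof
    fix \<omega> assume "\<omega> \<in> E"
    then obtain j where j: "\<omega> \<in> space M" "j \<in> {a..b}" "\<bar>\<Sum>i\<in>{a..<j}. \<xi> i \<omega>\<bar> > 2 * \<epsilon>" by (auto simp: E_def)
    obtain k where k: "k \<in> {a..b} \<and> \<bar>\<Sum>i\<in>{a..<k}. \<xi> i \<omega>\<bar> > 2 * \<epsilon>"
      and "\<forall>m<k. \<not> (m \<in> {a..b} \<and> \<bar>\<Sum>i\<in>{a..<m}. \<xi> i \<omega>\<bar> > 2 * \<epsilon>)"
      using ex_least_nat_le[of "\<lambda>k. k \<in> {a..b} \<and> \<bar>\<Sum>i\<in>{a..<k}. \<xi> i \<omega>\<bar> > 2 * \<epsilon>" j] j by blast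
    then have first: "\<forall>m\<in>{a..<k}. \<bar>\<Sum>i\<in>{a..<m}. \<xi> i \<omega>\<bar> \<le> 2 * \<epsilon>" using k by force
    have "(\<Sum>i\<in>{a..<b}. \<xi> i \<omega>) = (\<Sum>i\<in>{a..<k}. \<xi> i \<omega>) + (\<Sum>i\<in>{k..<b}. \<xi> i \<omega>)"
      using k by (intro sum.atLeastLessThan_concat[symmetric]) auto
    then have "\<bar>\<Sum>i\<in>{a..<b}. \<xi> i \<omega>\<bar> > \<epsilon> \<or> \<bar>\<Sum>i\<in>{k..<b}. \<xi> i \<omega>\<bar> > \<epsilon>"
      using k by linarith
    then show "\<omega> \<in> E1 \<union> E2"
      using k first j unfolding E1_def E2_def Geq by blast
  qed
  then have "prob E \<le> prob (E1 \<union> E2)" using E1m E2m by (intro finite_measure_mono) auto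
  also have "\<dots> \<le> prob E1 + prob E2" using E1m E2m by (rule measure_Un_le)
  finally have "prob E \<le> prob E1 + prob E2" .
  moreover have "prob E1 \<le> p" unfolding E1_def using p[of a b] ab by simp
  moreover have "0 \<le> p" by (rule order_trans[OF measure_nonneg p[of a a]]) (use ab in auto)
  then have "prob E * p \<le> p" by (intro mult_left_le_one_le) auto
  ultimately show ?thesis using Gp unfolding E_def by linarith
qed

text \<open>If the first block has a sum above \<open>4 * \<epsilon>\<close>, the walk started at \<open>a\<close> exceeds \<open>2 * \<epsilon>\<close> by the
end of this block. The walk restarted at the first passage then has to exceed \<open>2 * \<epsilon>\<close> as well, on
account of the second block. Each of the two events has probability at most \<open>2 * p\<close> by the maximal
inequality, and the probabilities multiply by \<open>first_passage_bound\<close>.\<close>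

lemma two_big_blocks_bound:
  fixes \<xi> :: "nat \<Rightarrow> 'a \<Rightarrow> real"
  assumes ind: "indep_vars (\<lambda>_. borel) \<xi> {a..<b}"
    and p: "\<And>i j. a \<le> i \<Longrightarrow> i \<le> j \<Longrightarrow> j \<le> b \<Longrightarrow> prob {\<omega>\<in>space M. \<bar>\<Sum>k\<in>{i..<j}. \<xi> k \<omega>\<bar> > \<epsilon>} \<le> p"
  shows "prob {\<omega>\<in>space M. two_big_blocks (4 * \<epsilon>) a b (\<lambda>i. \<xi> i \<omega>)} \<le> 4 * p\<^sup>2"
proof (cases "a \<le> b")
  case False
  then have "{\<omega>\<in>space M. two_big_blocks (4 * \<epsilon>) a b (\<lambda>i. \<xi> i \<omega>)} = {}" by (auto simp: two_big_blocks_def)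
  then show ?thesis by (simp only: measure_empty) simp
next
  case ab: True
  have meas[measurable]: "\<xi> i \<in> borel_measurable M" if "i \<in> {a..<b}" for i
    using ind that by (auto simp: indep_vars_def)
  have Smeas: "(\<lambda>\<omega>. \<Sum>i\<in>{m..<j}. \<xi> i \<omega>) \<in> borel_measurable M" if "a \<le> m" "j \<le> b" for m j
    using that by (intro borel_measurable_sum meas) auto
  define G where "G = (\<lambda>j (x::nat \<Rightarrow> real). \<exists>m\<in>{j..b}. \<bar>\<Sum>i\<in>{j..<m}. x i\<bar> > 2 * \<epsilon>)"
  define E where "E = {\<omega>\<in>space M. \<exists>j\<in>{a..b}. \<bar>\<Sum>i\<in>{a..<j}. \<xi> i \<omega>\<bar> > 2 * \<epsilon>}"
  define E2 where "E2 = {\<omega>\<in>space M. \<exists>j\<in>{a..b}. \<bar>\<Sum>i\<in>{a..<j}. \<xi> i \<omega>\<bar> > 2 * \<epsilon> \<and>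
            (\<forall>m\<in>{a..<j}. \<bar>\<Sum>i\<in>{a..<m}. \<xi> i \<omega>\<bar> \<le> 2 * \<epsilon>) \<and> G j (\<lambda>i\<in>{j..<b}. \<xi> i \<omega>)}"
  have Geq: "G j (\<lambda>i\<in>{j..<b}. \<xi> i \<omega>) \<longleftrightarrow> (\<exists>m\<in>{j..b}. \<bar>\<Sum>i\<in>{j..<m}. \<xi> i \<omega>\<bar> > 2 * \<epsilon>)" for j \<omega>
    by (auto simp: G_def)
  have E2m: "E2 \<in> events" unfolding E2_def Geq
    by (intro predE pred_intros_finite pred_intros_logic borel_measurable_pred_less
        borel_measurable_abs Smeas measurable_const) auto
  have Gp: "prob E2 \<le> prob E * (2 * p)"
    unfolding E2_def E_def
  proof (rule first_passage_bound[OF ind])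
    fix j assume j: "j \<in> {a..b}"
    have "(\<lambda>x. \<Sum>i\<in>{j..<m}. x i) \<in> borel_measurable (PiM {j..<b} (\<lambda>_. borel::real measure))" if "m \<le> b" for m
      using that by (intro borel_measurable_sum measurable_component_singleton) auto
    then show "Measurable.pred (PiM {j..<b} (\<lambda>_. borel)) (G j)"
      unfolding G_def
      by (intro pred_intros_finite borel_measurable_pred_less borel_measurable_abs measurable_const) auto
    have "indep_vars (\<lambda>_. borel) \<xi> {j..<b}" by (rule indep_vars_subset[OF ind]) (use j in auto)
    then show "prob {\<omega>\<in>space M. G j (\<lambda>i\<in>{j..<b}. \<xi> i \<omega>)} \<le> 2 * p"
      unfolding Geq using p j by (intro maximal_inequality) auto
  qed
  have "{\<omega>\<in>space M. two_big_blocks (4 * \<epsilon>) a b (\<lambda>i. \<xi> i \<omega>)} \<subseteq> E2"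
  proof
    fix \<omega> assume "\<omega> \<in> {\<omega>\<in>space M. two_big_blocks (4 * \<epsilon>) a b (\<lambda>i. \<xi> i \<omega>)}"
    then obtain i j k l where *: "a \<le> i" "i \<le> j" "j \<le> k" "k \<le> l" "l \<le> b" "\<omega> \<in> space M"
      "\<bar>\<Sum>m\<in>{i..<j}. \<xi> m \<omega>\<bar> > 4 * \<epsilon>" "\<bar>\<Sum>m\<in>{k..<l}. \<xi> m \<omega>\<bar> > 4 * \<epsilon>"
      by (auto simp: two_big_blocks_def)
    define S where "S = (\<lambda>i j. \<Sum>m\<in>{i..<j}. \<xi> m \<omega>)"
    have cat: "S i k = S i j + S j k" if "i \<le> j" "j \<le> k" for i j k
      unfolding S_def using that by (intro sum.atLeastLessThan_concat[symmetric]) auto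
    have big: "\<bar>S i j\<bar> > 4 * \<epsilon>" "\<bar>S k l\<bar> > 4 * \<epsilon>" using * by (simp_all add: S_def)
    have "\<bar>S a i\<bar> > 2 * \<epsilon> \<or> \<bar>S a j\<bar> > 2 * \<epsilon>"
      using big(1) cat[OF *(1,2)] by linarith
    then obtain j0 where j0: "j0 \<in> {a..j}" "\<bar>S a j0\<bar> > 2 * \<epsilon>"
      using * by (meson atLeastAtMost_iff order_trans order_refl)
    have "j0 \<in> {a..b} \<and> \<bar>S a j0\<bar> > 2 * \<epsilon>" using j0 * by auto
    then obtain t where tj0: "t \<le> j0" and t: "t \<in> {a..b} \<and> \<bar>S a t\<bar> > 2 * \<epsilon>"
      and least: "\<forall>m<t. \<not> (m \<in> {a..b} \<and> \<bar>S a m\<bar> > 2 * \<epsilon>)"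
      using ex_least_nat_le[of "\<lambda>k. k \<in> {a..b} \<and> \<bar>S a k\<bar> > 2 * \<epsilon>" j0] by blast
    have tj: "t \<le> j" using tj0 j0 by simp
    from least have first: "\<forall>m\<in>{a..<t}. \<bar>S a m\<bar> \<le> 2 * \<epsilon>" using t by force
    have "\<bar>S t k\<bar> > 2 * \<epsilon> \<or> \<bar>S t l\<bar> > 2 * \<epsilon>"
      using big(2) cat[of t k l] * tj by linarith
    then have "\<exists>m\<in>{t..b}. \<bar>S t m\<bar> > 2 * \<epsilon>" using * tj by (meson atLeastAtMost_iff order_trans)
    then show "\<omega> \<in> E2"
      unfolding E2_def Geq using t first * by (auto simp: S_def)
  qed
  then have "prob {\<omega>\<in>space M. two_big_blocks (4 * \<epsilon>) a b (\<lambda>i. \<xi> i \<omega>)} \<le> prob E2"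
    using E2m by (intro finite_measure_mono)
  also note Gp
  also have "prob E * (2 * p) \<le> (2 * p) * (2 * p)"
  proof (intro mult_right_mono)
    show "prob E \<le> 2 * p" unfolding E_def by (rule maximal_inequality[OF ind ab p])
    have "0 \<le> p" by (rule order_trans[OF measure_nonneg p[of a a]]) (use ab in auto)
    then show "0 \<le> 2 * p" by simp
  qed
  finally show ?thesis by (simp add: power2_eq_square)
qed

end

section \<open>Karamata estimates for a regularly varying law\<close>

text \<open>The hypotheses on one innovation, expressed by its law \<open>\<nu>\<close>.\<close>

locale heavy_tail = real_distribution \<nu> for \<nu> :: "real measure" +
  fixes \<alpha> :: real and a :: "nat \<Rightarrow> real" and p r :: real
  assumes alpha: "0 < \<alpha>" "\<alpha> < 2"
    and G_pos: "\<And>x. x > 0 \<Longrightarrow> measure \<nu> {y. \<bar>y\<bar> > x} > 0"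
    and G_rv: "\<And>c. c > 0 \<Longrightarrow>
      ((\<lambda>x. measure \<nu> {y. \<bar>y\<bar> > c * x} / measure \<nu> {y. \<bar>y\<bar> > x}) \<longlongrightarrow> c powr (- \<alpha>)) at_top"
    and right_tail: "((\<lambda>x. measure \<nu> {y. y > x} / measure \<nu> {y. \<bar>y\<bar> > x}) \<longlongrightarrow> p) at_top"
    and left_tail: "((\<lambda>x. measure \<nu> {y. y < - x} / measure \<nu> {y. \<bar>y\<bar> > x}) \<longlongrightarrow> r) at_top"
    and symmetric: "\<alpha> = 1 \<Longrightarrow> distr \<nu> borel uminus = \<nu>"
    and a_pos: "\<And>n. n \<ge> 1 \<Longrightarrow> a n > 0"
    and a_norm: "(\<lambda>n. real n * measure \<nu> {y. \<bar>y\<bar> > a n}) \<longlonglongrightarrow> 1"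
begin

definition G :: "real \<Rightarrow> real" where "G x = measure \<nu> {y. \<bar>y\<bar> > x}"

definition centre :: real where "centre = (if \<alpha> \<le> 1 then 0 else integral\<^sup>L \<nu> (\<lambda>y. y))"

lemma prob_UNIV [simp]: "prob UNIV = 1"
  using prob_space by (simp add: space_eq_univ)

lemma G_antimono: "x \<le> y \<Longrightarrow> G y \<le> G x"
  unfolding G_def by (intro finite_measure_mono) auto

lemma G_gt_0: "x > 0 \<Longrightarrow> G x > 0"
  using G_pos by (simp add: G_def)

lemma G_nonneg [simp]: "G x \<ge> 0"
  by (simp add: G_def)

lemma a_at_top: "filterlim a at_top sequentially"
proof (subst filterlim_at_top_gt[of _ _ 0], intro allI impI)
  fix K :: real assume K: "K > 0"
  have "(\<lambda>n. real n * G (a n) / real n) \<longlonglongrightarrow> 0"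
    using a_norm unfolding G_def[symmetric] 
    by (intro tendsto_divide_0[OF _ filterlim_at_top_imp_at_infinity[OF filterlim_real_sequentially]])
  then have "eventually (\<lambda>n. real n * G (a n) / real n < G K) sequentially"
    by (rule order_tendstoD) (rule G_gt_0[OF K])
  then show "eventually (\<lambda>n. K \<le> a n) sequentially"
    using eventually_gt_at_top[of 0]
  proof eventually_elim
    case (elim n)
    then have "G (a n) < G K" by simp
    then show ?case using G_antimono[of "a n" K] by linarith
  qed
qed

lemma scaled_at_top: "x > 0 \<Longrightarrow> filterlim (\<lambda>n. x * a n) at_top sequentially"
  by (rule filterlim_tendsto_pos_mult_at_top[OF tendsto_const _ a_at_top])

lemma nG_tendsto: 
  assumes "x > 0" 
  shows "(\<lambda>n. real n * G (x * a n)) \<longlonglongrightarrow> x powr (- \<alpha>)"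
proof -
  have "(\<lambda>n. G (x * a n) / G (a n)) \<longlonglongrightarrow> x powr (- \<alpha>)"
    using filterlim_compose[OF G_rv[OF assms] a_at_top] by (simp add: G_def)
  from tendsto_mult[OF a_norm[folded G_def] this]
  have "(\<lambda>n. real n * G (a n) * (G (x * a n) / G (a n))) \<longlonglongrightarrow> x powr (- \<alpha>)" by simp
  then show ?thesis
  proof (rule Lim_transform_eventually)
    show "eventually (\<lambda>n. real n * G (a n) * (G (x * a n) / G (a n)) = real n * G (x * a n)) sequentially"
      using eventually_ge_at_top[of 1]
    proof eventually_elim
      case (elim n)
      have "G (a n) > 0" using a_pos[OF elim] by (rule G_gt_0)
      then show ?case by simp
    qed
  qed
qed

lemma one_sided_tail_tendsto:
  assumes "x > 0" "\<sigma> \<in> {1, -1::real}"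
  obtains h where "(\<lambda>n. real n * measure \<nu> {y. \<sigma> * y > x * a n}) \<longlonglongrightarrow> h"
proof -
  have "\<exists>q. ((\<lambda>z. measure \<nu> {y. \<sigma> * y > z} / measure \<nu> {y. \<bar>y\<bar> > z}) \<longlongrightarrow> q) at_top"
  proof (cases "\<sigma> = 1")
    case True
    then show ?thesis using right_tail by auto
  next
    case False
    have "{y. - y > z} = {y. y < - z}" for z :: real by auto
    then show ?thesis using left_tail assms False by auto
  qed
  then obtain q where q: "((\<lambda>z. measure \<nu> {y. \<sigma> * y > z} / G z) \<longlongrightarrow> q) at_top"
    by (auto simp: G_def)
  have "(\<lambda>n. measure \<nu> {y. \<sigma> * y > x * a n} / G (x * a n)) \<longlonglongrightarrow> q"
    using filterlim_compose[OF q scaled_at_top[OF assms(1)]] .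
  from tendsto_mult[OF nG_tendsto[OF assms(1)] this]
  have "(\<lambda>n. real n * G (x * a n) * (measure \<nu> {y. \<sigma> * y > x * a n} / G (x * a n))) \<longlonglongrightarrow> x powr (- \<alpha>) * q" .
  then have "(\<lambda>n. real n * measure \<nu> {y. \<sigma> * y > x * a n}) \<longlonglongrightarrow> x powr (- \<alpha>) * q"
  proof (rule Lim_transform_eventually)
    show "eventually (\<lambda>n. real n * G (x * a n) * (measure \<nu> {y. \<sigma> * y > x * a n} / G (x * a n)) =
      real n * measure \<nu> {y. \<sigma> * y > x * a n}) sequentially"
      using eventually_ge_at_top[of 1]
    proof eventually_elim
      case (elim n)
      have "G (x * a n) > 0" using a_pos[OF elim] assms by (intro G_gt_0) simp
      then show ?case by simp
    qed
  qed
  then show ?thesis by (rule that)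
qed

definition low_moment :: "nat \<Rightarrow> real \<Rightarrow> real" where
  "low_moment \<beta> x = (\<integral>y. \<bar>y\<bar> ^ \<beta> * indicator {y. \<bar>y\<bar> \<le> x} y \<partial>\<nu>)"

lemma integrable_low: "integrable \<nu> (\<lambda>y. \<bar>y\<bar> ^ \<beta> * indicator {y. \<bar>y\<bar> \<le> x} y)"
  by (rule integrable_const_bound[of _ "\<bar>x\<bar> ^ \<beta>"])
     (auto simp: indicator_def intro!: power_mono)

lemma low_moment_le: 
  assumes "x \<ge> 0" 
  shows "low_moment \<beta> x \<le> x ^ \<beta>"
proof -
  have "low_moment \<beta> x \<le> (\<integral>y. x ^ \<beta> \<partial>\<nu>)"
    unfolding low_moment_def using assms
    by (intro integral_mono integrable_low) (auto simp: indicator_def intro!: power_mono)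
  then show ?thesis by (simp add: prob_space)
qed

text \<open>The part of the moment between \<open>x\<close> and \<open>2 * x\<close> is at most \<open>(2 * x) ^ \<beta>\<close> times the mass beyond
\<open>x\<close>.\<close>

lemma low_moment_double:
  assumes "x \<ge> 0"
  shows "low_moment \<beta> (2 * x) \<le> low_moment \<beta> x + (2 * x) ^ \<beta> * G x"
proof -
  define c where "c = (2 * x) ^ \<beta>"
  have "c \<ge> 0" using assms by (simp add: c_def)
  moreover have "\<bar>y\<bar> ^ \<beta> \<le> c" if "\<bar>y\<bar> \<le> 2 * x" for y
    unfolding c_def using that by (rule power_mono) simp
  ultimately have c: "c \<ge> 0" "\<And>y. \<bar>y\<bar> \<le> 2 * x \<Longrightarrow> \<bar>y\<bar> ^ \<beta> \<le> c" .
  have int: "integrable \<nu> (\<lambda>y. c * indicator {y. \<bar>y\<bar> > x} y)"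
    by (intro integrable_mult_right integrable_real_indicator) (auto simp: less_top[symmetric])
  have "low_moment \<beta> (2 * x) \<le> (\<integral>y. \<bar>y\<bar> ^ \<beta> * indicator {y. \<bar>y\<bar> \<le> x} y + c * indicator {y. \<bar>y\<bar> > x} y \<partial>\<nu>)"
    unfolding low_moment_def
    by (intro integral_mono integrable_low Bochner_Integration.integrable_add int)
       (use c in \<open>auto simp: indicator_def\<close>)
  also have "\<dots> = low_moment \<beta> x + c * G x"
    unfolding low_moment_def G_def
    by (subst Bochner_Integration.integral_add[OF integrable_low int]) simp
  finally show ?thesis by (simp only: c_def)
qed

lemma G_doubling_lower:
  assumes "0 < \<rho>" "\<rho> < 2 powr (- \<alpha>)"
  obtains x0 where "x0 > 0" "\<And>x. x \<ge> x0 \<Longrightarrow> \<rho> * G x \<le> G (2 * x)"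
proof -
  have "eventually (\<lambda>x. G (2 * x) / G x > \<rho>) at_top"
    using order_tendstoD(1)[OF G_rv[of 2] assms(2)] by (simp add: G_def)
  then obtain x1 where x1: "\<And>x. x \<ge> x1 \<Longrightarrow> G (2 * x) / G x > \<rho>"
    by (auto simp: eventually_at_top_linorder)
  show ?thesis
  proof (rule that[of "max x1 1"])
    fix x assume "x \<ge> max x1 1"
    then have "G (2 * x) / G x > \<rho>" "G x > 0" using x1 G_gt_0[of x] by auto
    then show "\<rho> * G x \<le> G (2 * x)" by (simp add: field_simps)
  qed simp
qed

lemma G_doubling_upper:
  assumes "2 powr (- \<alpha>) < \<rho>"
  obtains x0 where "x0 > 0" "\<And>x. x \<ge> x0 \<Longrightarrow> G (2 * x) \<le> \<rho> * G x"
proof -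
  have "eventually (\<lambda>x. G (2 * x) / G x < \<rho>) at_top"
    using order_tendstoD(2)[OF G_rv[of 2] assms] by (simp add: G_def)
  then obtain x1 where x1: "\<And>x. x \<ge> x1 \<Longrightarrow> G (2 * x) / G x < \<rho>"
    by (auto simp: eventually_at_top_linorder)
  show ?thesis
  proof (rule that[of "max x1 1"])
    fix x assume "x \<ge> max x1 1"
    then have "G (2 * x) / G x < \<rho>" "G x > 0" using x1 G_gt_0[of x] by auto
    then show "G (2 * x) \<le> \<rho> * G x" by (simp add: field_simps)
  qed simp
qed

text \<open>Karamata's estimates only need bounds up to constants. These follow from the behaviour of the tail
under doubling, by induction along \<open>x, 2 * x, 4 * x, ...\<close>.\<close>

lemma dyadic_induct:
  fixes x0 :: real
  assumes "x0 > 0" "x \<ge> x0"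
    and base: "\<And>x. x0 \<le> x \<Longrightarrow> x \<le> 2 * x0 \<Longrightarrow> P x"
    and step: "\<And>x. x0 \<le> x \<Longrightarrow> P x \<Longrightarrow> P (2 * x)"
  shows "P x"
proof -
  have *: "x0 \<le> x \<Longrightarrow> x \<le> 2 ^ k * (2 * x0) \<Longrightarrow> P x" for k x
  proof (induction k arbitrary: x)
    case 0
    then show ?case using base by simp
  next
    case (Suc k)
    show ?case
    proof (cases "x \<le> 2 * x0")
      case False
      then have "P (x / 2)" using Suc.prems by (intro Suc.IH) auto
      then show ?thesis using step[of "x / 2"] False by simp
    qed (use base Suc.prems in auto)
  qed
  obtain k where "x / (2 * x0) < 2 ^ k" using real_arch_pow[of 2 "x / (2 * x0)"] by auto
  then have "x \<le> 2 ^ k * (2 * x0)" using assms(1) by (simp add: field_simps)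
  then show ?thesis using * assms by blast
qed

text \<open>Doubling \<open>x\<close> multiplies \<open>x ^ \<beta> * G x\<close> by at least some \<open>s > 1\<close>, because the limiting factor
\<open>2 powr (\<beta> - \<alpha>)\<close> exceeds 1, whereas the truncated moment grows by at most
\<open>2 ^ \<beta> * (x ^ \<beta> * G x)\<close>. A bound with a constant \<open>C \<ge> 2 ^ \<beta> / (s - 1)\<close> is therefore preserved.\<close>

lemma karamata_low:
  assumes \<beta>: "real \<beta> > \<alpha>"
  obtains C x0 where "x0 > 0" "C > 0" "\<And>x. x \<ge> x0 \<Longrightarrow> low_moment \<beta> x \<le> C * (x ^ \<beta> * G x)"
proof -
  have "2 powr (- \<alpha>) * 2 ^ \<beta> = 2 powr (real \<beta> - \<alpha>)"
    by (simp add: powr_diff powr_minus field_simps powr_realpow)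
  also have "\<dots> > 1" using \<beta> by simp
  finally have gt: "1 / 2 ^ \<beta> < 2 powr (- \<alpha>)" by (simp add: field_simps)
  then obtain \<rho> where \<rho>: "1 / 2 ^ \<beta> < \<rho>" "\<rho> < 2 powr (- \<alpha>)" using dense by blast
  have "0 < 1 / (2::real) ^ \<beta>" by simp
  with \<rho> have "\<rho> > 0" by linarith
  obtain x0 where x0: "x0 > 0" "\<And>x. x \<ge> x0 \<Longrightarrow> \<rho> * G x \<le> G (2 * x)"
    using G_doubling_lower[OF \<open>\<rho> > 0\<close> \<rho>(2)] by blast
  define s where "s = \<rho> * 2 ^ \<beta>"
  have s: "s > 1" using \<rho>(1) by (simp add: s_def field_simps)
  \<comment> \<open>The first entry makes the doubling step work, the second one the initial interval from \<open>x0\<close> to \<open>2 * x0\<close>.\<close>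
  define C where "C = max (2 ^ \<beta> / (s - 1)) (2 ^ \<beta> / G (2 * x0))"
  have Gx0: "G (2 * x0) > 0" using x0 by (intro G_gt_0) simp
  have C: "C > 0" using s by (simp add: C_def less_max_iff_disj)
  have "low_moment \<beta> x \<le> C * (x ^ \<beta> * G x)" if "x \<ge> x0" for x
    using x0(1) that
  proof (rule dyadic_induct)
    fix x assume x: "x0 \<le> x" "x \<le> 2 * x0"
    have "low_moment \<beta> x \<le> x ^ \<beta>" using x x0 by (intro low_moment_le) auto
    also have "\<dots> \<le> x ^ \<beta> * (C * G (2 * x0))"
    proof -
      have "1 \<le> (2::real) ^ \<beta>" by simp
      also have "\<dots> = 2 ^ \<beta> / G (2 * x0) * G (2 * x0)" using Gx0 by simp
      also have "\<dots> \<le> C * G (2 * x0)" using Gx0 by (intro mult_right_mono) (auto simp: C_def)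
      finally show ?thesis using x x0 mult_left_mono[of 1 "C * G (2 * x0)" "x ^ \<beta>"] by simp
    qed
    also have "\<dots> \<le> x ^ \<beta> * (C * G x)"
      using x x0 C by (intro mult_left_mono G_antimono) auto
    finally show "low_moment \<beta> x \<le> C * (x ^ \<beta> * G x)" by (simp add: algebra_simps)
  next
    fix x assume x: "x0 \<le> x" "low_moment \<beta> x \<le> C * (x ^ \<beta> * G x)"
    define h where "h = x ^ \<beta> * G x"
    have h: "h \<ge> 0" using x x0 by (simp add: h_def)
    have "low_moment \<beta> (2 * x) \<le> C * h + 2 ^ \<beta> * h"
      using low_moment_double[of x \<beta>] x x0 by (simp add: h_def power_mult_distrib algebra_simps)
    also have "\<dots> \<le> C * (s * h)"
    proof -
      have "2 ^ \<beta> / (s - 1) \<le> C" by (simp add: C_def)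
      then have "2 ^ \<beta> \<le> C * (s - 1)" using s by (simp add: field_simps)
      then have "2 ^ \<beta> * h \<le> C * (s - 1) * h" using h by (rule mult_right_mono)
      then show ?thesis by (simp add: algebra_simps)
    qed
    also have "s * h \<le> (2 * x) ^ \<beta> * G (2 * x)"
    proof -
      have "(2 * x) ^ \<beta> * (\<rho> * G x) \<le> (2 * x) ^ \<beta> * G (2 * x)"
        using x0 x by (intro mult_left_mono x0) auto
      then show ?thesis by (simp add: s_def h_def power_mult_distrib algebra_simps)
    qed
    then have "C * (s * h) \<le> C * ((2 * x) ^ \<beta> * G (2 * x))" using C by (intro mult_left_mono) auto
    finally show "low_moment \<beta> (2 * x) \<le> C * ((2 * x) ^ \<beta> * G (2 * x))" .
  qed
  then show ?thesis using that x0 C by blast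
qed

text \<open>For \<open>\<alpha> > 1\<close> the contributions of the dyadic shells beyond \<open>x\<close> are bounded by a geometric sequence
with ratio \<open>2 * \<rho> < 1\<close>. The shells are summed below a cut-off \<open>T\<close>, with a bound that does not depend on
\<open>T\<close>; integrability is a consequence.\<close>

lemma karamata_high:
  assumes \<alpha>1: "\<alpha> > 1"
  shows "integrable \<nu> (\<lambda>y. \<bar>y\<bar>)"
    and "\<exists>C>0. \<exists>x0>0. \<forall>x\<ge>x0. (\<integral>y. \<bar>y\<bar> * indicator {y. \<bar>y\<bar> > x} y \<partial>\<nu>) \<le> C * (x * G x)"
proof -
  have "2 powr (- \<alpha>) < 2 powr (-1::real)" using \<alpha>1 by (intro powr_less_mono) auto
  then have "2 powr (- \<alpha>) < 1 / 2" by (simp add: powr_minus)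
  then obtain \<rho> where \<rho>: "2 powr (- \<alpha>) < \<rho>" "\<rho> < 1 / 2" using dense by blast
  obtain x0 where x0: "x0 > 0" "\<And>x. x \<ge> x0 \<Longrightarrow> G (2 * x) \<le> \<rho> * G x"
    using G_doubling_upper[OF \<rho>(1)] by blast
  \<comment> \<open>The fixed point of the recursion \<open>C = 2 + C * (2 * \<rho>)\<close> for the constant.\<close>
  define C where "C = 2 / (1 - 2 * \<rho>)"
  have C: "C > 0" "2 + C * (2 * \<rho>) = C" using \<rho> by (auto simp: C_def field_simps)
  define W where "W = (\<lambda>T x. \<integral>y. \<bar>y\<bar> * indicator {y. x < \<bar>y\<bar> \<and> \<bar>y\<bar> \<le> T} y \<partial>\<nu>)"
  have iW: "integrable \<nu> (\<lambda>y. \<bar>y\<bar> * indicator {y. x < \<bar>y\<bar> \<and> \<bar>y\<bar> \<le> T} y)" for T x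
    by (rule integrable_const_bound[of _ "\<bar>T\<bar>"]) (auto simp: indicator_def)
  have W2: "W T x \<le> 2 * x * G x + W T (2 * x)" if "x > 0" for x T
  proof -
    have "W T x \<le> (\<integral>y. 2 * x * indicator {y. \<bar>y\<bar> > x} y + \<bar>y\<bar> * indicator {y. 2 * x < \<bar>y\<bar> \<and> \<bar>y\<bar> \<le> T} y \<partial>\<nu>)"
      unfolding W_def using that
      by (intro integral_mono iW Bochner_Integration.integrable_add integrable_mult_right integrable_real_indicator)
         (auto simp: indicator_def less_top[symmetric])
    also have "\<dots> = 2 * x * G x + W T (2 * x)"
      unfolding W_def G_def
      by (subst Bochner_Integration.integral_add)
         (auto intro!: iW integrable_mult_right integrable_real_indicator simp: less_top[symmetric])
    finally show ?thesis .
  qed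
  have Wbound: "W T x \<le> C * (x * G x)" if "x \<ge> x0" for T x
  proof -
    have *: "x \<ge> x0 \<Longrightarrow> T \<le> 2 ^ k * x \<Longrightarrow> W T x \<le> C * (x * G x)" for k x
    proof (induction k arbitrary: x)
      case 0
      then have "{y. x < \<bar>y\<bar> \<and> \<bar>y\<bar> \<le> T} = {}" by auto
      then have "W T x = 0" by (simp add: W_def)
      then show ?case using C x0 0 by simp
    next
      case (Suc k)
      have "W T (2 * x) \<le> C * (2 * x * G (2 * x))"
        using Suc.prems x0 by (intro Suc.IH) auto
      also have "\<dots> \<le> C * (2 * x * (\<rho> * G x))"
        using Suc.prems x0 C by (intro mult_left_mono x0) auto
      finally have "W T x \<le> 2 * x * G x + C * (2 * x * (\<rho> * G x))"
        using W2[of x T] Suc.prems x0 by simp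
      also have "\<dots> = (2 + C * (2 * \<rho>)) * (x * G x)" by (simp add: algebra_simps)
      finally show ?case by (simp add: C)
    qed
    obtain k where "T / x < 2 ^ k" using real_arch_pow[of 2 "T / x"] by auto
    then have "T \<le> 2 ^ k * x" using that x0 by (simp add: field_simps)
    with * that show ?thesis by blast
  qed
  have lowb: "(\<integral>y. \<bar>y\<bar> * indicator {y. \<bar>y\<bar> \<le> T} y \<partial>\<nu>) \<le> x0 + C * (x0 * G x0)" for T
  proof -
    have "(\<integral>y. \<bar>y\<bar> * indicator {y. \<bar>y\<bar> \<le> T} y \<partial>\<nu>) \<le> (\<integral>y. x0 + \<bar>y\<bar> * indicator {y. x0 < \<bar>y\<bar> \<and> \<bar>y\<bar> \<le> T} y \<partial>\<nu>)"
      using x0 integrable_low[of 1 T]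
      by (intro integral_mono iW Bochner_Integration.integrable_add)
         (auto simp: indicator_def)
    also have "\<dots> = x0 + W T x0"
      unfolding W_def by (subst Bochner_Integration.integral_add) (auto intro!: iW simp: prob_space)
    finally show ?thesis using Wbound[of x0 T] by simp
  qed
  have ilow: "integrable \<nu> (\<lambda>y. \<bar>y\<bar> * indicator {y. \<bar>y\<bar> \<le> T} y)" for T
    using integrable_low[of 1 T] by simp
  have ptw: "(\<lambda>n. \<bar>y\<bar> * indicator {y. \<bar>y\<bar> \<le> real n} y) \<longlonglongrightarrow> \<bar>y\<bar>" for y :: real
  proof (rule tendsto_eventually)
    obtain N where "\<bar>y\<bar> \<le> real N" using real_arch_simple by blast
    then have "\<bar>y\<bar> \<le> real n" if "n \<ge> N" for n using that by (meson of_nat_mono order_trans)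
    then show "eventually (\<lambda>n. \<bar>y\<bar> * indicator {y. \<bar>y\<bar> \<le> real n} y = \<bar>y\<bar>) sequentially"
      by (intro eventually_sequentiallyI[of N]) (simp add: indicator_def)
  qed
  have inc: "incseq (\<lambda>n. \<integral>y. \<bar>y\<bar> * indicator {y. \<bar>y\<bar> \<le> real n} y \<partial>\<nu>)"
    by (intro incseq_SucI integral_mono ilow) (auto simp: indicator_def)
  obtain l where l: "(\<lambda>n. \<integral>y. \<bar>y\<bar> * indicator {y. \<bar>y\<bar> \<le> real n} y \<partial>\<nu>) \<longlonglongrightarrow> l"
    using incseq_convergent[OF inc] lowb by blast
  show int: "integrable \<nu> (\<lambda>y. \<bar>y\<bar>)"
  proof (rule integrable_monotone_convergence[OF ilow _ _ l])
    show "AE y in \<nu>. incseq (\<lambda>n. \<bar>y\<bar> * indicator {y. \<bar>y\<bar> \<le> real n} y)"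
      by (intro AE_I2) (auto simp: mono_def indicator_def)
    show "AE y in \<nu>. (\<lambda>n. \<bar>y\<bar> * indicator {y. \<bar>y\<bar> \<le> real n} y) \<longlonglongrightarrow> \<bar>y\<bar>"
      by (intro AE_I2 ptw)
  qed simp
  show "\<exists>C>0. \<exists>x0>0. \<forall>x\<ge>x0. (\<integral>y. \<bar>y\<bar> * indicator {y. \<bar>y\<bar> > x} y \<partial>\<nu>) \<le> C * (x * G x)"
  proof (rule exI[of _ C], rule conjI[OF C(1)], rule exI[of _ x0], rule conjI[OF x0(1)], intro allI impI)
    fix x assume x: "x0 \<le> x"
    have "(\<lambda>n. W (real n) x) \<longlonglongrightarrow> (\<integral>y. \<bar>y\<bar> * indicator {y. \<bar>y\<bar> > x} y \<partial>\<nu>)"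
      unfolding W_def
    proof (rule integral_dominated_convergence[where w="\<lambda>y. \<bar>y\<bar>"])
      show "AE y in \<nu>. (\<lambda>n. \<bar>y\<bar> * indicator {y. x < \<bar>y\<bar> \<and> \<bar>y\<bar> \<le> real n} y) \<longlonglongrightarrow> \<bar>y\<bar> * indicator {y. \<bar>y\<bar> > x} y"
      proof (intro AE_I2 tendsto_eventually)
        fix y :: real
        obtain N where "\<bar>y\<bar> \<le> real N" using real_arch_simple by blast
        then have "\<bar>y\<bar> \<le> real n" if "n \<ge> N" for n using that by (meson of_nat_mono order_trans)
        then show "eventually (\<lambda>n. \<bar>y\<bar> * indicator {y. x < \<bar>y\<bar> \<and> \<bar>y\<bar> \<le> real n} y = \<bar>y\<bar> * indicator {y. \<bar>y\<bar> > x} y) sequentially"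
          by (intro eventually_sequentiallyI[of N]) (simp add: indicator_def)
      qed
    qed (use int in \<open>auto simp: indicator_def\<close>)
    then show "(\<integral>y. \<bar>y\<bar> * indicator {y. \<bar>y\<bar> > x} y \<partial>\<nu>) \<le> C * (x * G x)"
      by (rule LIMSEQ_le_const2) (use Wbound[OF x] in blast)
  qed
qed

definition trunc_mean :: "real \<Rightarrow> real" where
  "trunc_mean x = (\<integral>y. y * indicator {y. \<bar>y\<bar> \<le> x} y \<partial>\<nu>)"

lemma integrable_trunc: "integrable \<nu> (\<lambda>y. y * indicator {y. \<bar>y\<bar> \<le> x} y)"
  by (rule integrable_const_bound[of _ "\<bar>x\<bar>"]) (auto simp: indicator_def)

lemma trunc_mean_abs_le_low: "\<bar>trunc_mean x\<bar> \<le> low_moment 1 x"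
proof -
  have "\<bar>trunc_mean x\<bar> \<le> (\<integral>y. \<bar>y * indicator {y. \<bar>y\<bar> \<le> x} y\<bar> \<partial>\<nu>)"
    unfolding trunc_mean_def by (rule integral_abs_bound)
  also have "\<dots> = low_moment 1 x"
    unfolding low_moment_def by (intro Bochner_Integration.integral_cong) (auto simp: indicator_def)
  finally show ?thesis .
qed

lemma odd_integral_eq_0:
  fixes f :: "real \<Rightarrow> real"
  assumes "\<alpha> = 1" "f \<in> borel_measurable borel" "\<And>y. f (- y) = - f y"
  shows "(\<integral>y. f y \<partial>\<nu>) = 0"
proof -
  have "(\<integral>y. f y \<partial>\<nu>) = (\<integral>y. f y \<partial>distr \<nu> borel uminus)" using symmetric[OF assms(1)] by simp
  also have "\<dots> = (\<integral>y. f (- y) \<partial>\<nu>)" using assms by (intro integral_distr) auto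
  also have "\<dots> = - (\<integral>y. f y \<partial>\<nu>)" using assms by simp
  finally show ?thesis by simp
qed

text \<open>For \<open>\<alpha> < 1\<close> the centre is 0 and the truncated mean is itself of the right order; for \<open>\<alpha> = 1\<close> both
vanish by symmetry; for \<open>\<alpha> > 1\<close> their difference is the tail of the mean.\<close>

lemma centring_error:
  obtains C x0 where "x0 > 0" "C > 0" "\<And>x. x \<ge> x0 \<Longrightarrow> \<bar>trunc_mean x - centre\<bar> \<le> C * (x * G x)"
proof -
  consider "\<alpha> < 1" | "\<alpha> = 1" | "\<alpha> > 1" by linarith
  then show ?thesis
  proof cases
    case 1
    obtain C x0 where "x0 > 0" "C > 0" "\<And>x. x \<ge> x0 \<Longrightarrow> low_moment 1 x \<le> C * (x ^ 1 * G x)"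
    proof -
      have "real 1 > \<alpha>" using 1 by simp
      from karamata_low[OF this] show ?thesis using that by blast
    qed
    then show ?thesis using trunc_mean_abs_le_low 1
      by (intro that[of x0 C]) (auto simp: centre_def intro: order_trans)
  next
    case 2
    have "trunc_mean x = 0" for x
      unfolding trunc_mean_def by (rule odd_integral_eq_0[OF 2]) (auto simp: indicator_def)
    moreover have "centre = 0" using 2 unfolding centre_def by simp
    ultimately show ?thesis by (intro that[of 1 1]) auto
  next
    case 3
    obtain C x0 where Cx: "C > 0" "x0 > 0" "\<And>x. x \<ge> x0 \<Longrightarrow> (\<integral>y. \<bar>y\<bar> * indicator {y. \<bar>y\<bar> > x} y \<partial>\<nu>) \<le> C * (x * G x)"
      using karamata_high(2)[OF 3] by blast
    have int: "integrable \<nu> (\<lambda>y. y)" 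
      by (rule integrable_abs_iff[THEN iffD1, OF _ karamata_high(1)[OF 3]]) simp
    show ?thesis
    proof (rule that[OF Cx(2,1)])
      fix x assume x: "x0 \<le> x"
      have "centre - trunc_mean x = (\<integral>y. y - y * indicator {y. \<bar>y\<bar> \<le> x} y \<partial>\<nu>)"
        using 3 int integrable_trunc by (simp add: centre_def trunc_mean_def)
      also have "\<dots> = (\<integral>y. y * indicator {y. \<bar>y\<bar> > x} y \<partial>\<nu>)"
        by (intro Bochner_Integration.integral_cong) (auto simp: indicator_def)
      finally have "\<bar>trunc_mean x - centre\<bar> = \<bar>\<integral>y. y * indicator {y. \<bar>y\<bar> > x} y \<partial>\<nu>\<bar>" by linarith
      also have "\<dots> \<le> (\<integral>y. \<bar>y * indicator {y. \<bar>y\<bar> > x} y\<bar> \<partial>\<nu>)" by (rule integral_abs_bound)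
      also have "\<dots> = (\<integral>y. \<bar>y\<bar> * indicator {y. \<bar>y\<bar> > x} y \<partial>\<nu>)"
        by (intro Bochner_Integration.integral_cong) (auto simp: indicator_def)
      also have "\<dots> \<le> C * (x * G x)" by (rule Cx(3)[OF x])
      finally show "\<bar>trunc_mean x - centre\<bar> \<le> C * (x * G x)" .
    qed
  qed
qed

lemma low_moment_lower:
  obtains K l where "l > 0" "\<And>x. x \<ge> K \<Longrightarrow> l \<le> low_moment 2 x"
proof -
  have "(\<lambda>n. measure \<nu> {y. 1 < \<bar>y\<bar> \<and> \<bar>y\<bar> \<le> real n}) \<longlonglongrightarrow> measure \<nu> (\<Union>n. {y. 1 < \<bar>y\<bar> \<and> \<bar>y\<bar> \<le> real n})"
    by (intro finite_Lim_measure_incseq) (auto simp: incseq_def)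
  also have "(\<Union>n. {y. 1 < \<bar>y\<bar> \<and> \<bar>y\<bar> \<le> real n}) = {y::real. \<bar>y\<bar> > 1}"
    using real_arch_simple by auto
  finally have "eventually (\<lambda>n. measure \<nu> {y. 1 < \<bar>y\<bar> \<and> \<bar>y\<bar> \<le> real n} > 0) sequentially"
    using G_pos[of 1] by (intro order_tendstoD(1)) auto
  then obtain N where N: "measure \<nu> {y. 1 < \<bar>y\<bar> \<and> \<bar>y\<bar> \<le> real N} > 0"
    by (auto simp: eventually_sequentially)
  have "measure \<nu> {y. 1 < \<bar>y\<bar> \<and> \<bar>y\<bar> \<le> real N} \<le> low_moment 2 x" if "x \<ge> real N" for x
  proof -
    have "measure \<nu> {y. 1 < \<bar>y\<bar> \<and> \<bar>y\<bar> \<le> real N} = (\<integral>y. indicator {y. 1 < \<bar>y\<bar> \<and> \<bar>y\<bar> \<le> real N} y \<partial>\<nu>)" by simp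
    also have "\<dots> \<le> low_moment 2 x"
      unfolding low_moment_def using that
      by (intro integral_mono integrable_low integrable_real_indicator)
         (auto simp: indicator_def less_top[symmetric] abs_le_square_iff[of 1, simplified, symmetric])
    finally show ?thesis .
  qed
  then show ?thesis using N that by blast
qed

text \<open>The truncated second moment is bounded below and at most of order \<open>x\<^sup>2 * G x\<close>. This bound absorbs
the constant contribution of the centre to second moments.\<close>

lemma x2G_lower:
  obtains C x0 where "x0 > 0" "C > 0" "\<And>x. x \<ge> x0 \<Longrightarrow> C \<le> x\<^sup>2 * G x"
proof -
  have "real 2 > \<alpha>" using alpha by simp
  from karamata_low[OF this] obtain C x0 where Cx: "x0 > 0" "C > 0" "\<And>x. x \<ge> x0 \<Longrightarrow> low_moment 2 x \<le> C * (x ^ 2 * G x)"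
    by blast
  obtain K l where K: "l > 0" "\<And>x. x \<ge> K \<Longrightarrow> l \<le> low_moment 2 x" using low_moment_lower by blast
  show ?thesis
  proof (rule that[of "max x0 K" "l / C"])
    fix x assume "x \<ge> max x0 K"
    then have "l \<le> C * (x ^ 2 * G x)" using Cx(3)[of x] K(2)[of x] by auto
    then show "l / C \<le> x\<^sup>2 * G x" using Cx by (simp add: field_simps)
  qed (use Cx K in auto)
qed

end

section \<open>A tail bound for sums of heavy-tailed variables\<close>

lemma (in prob_space) second_moment_sum:
  fixes X :: "'i \<Rightarrow> 'a \<Rightarrow> real"
  assumes "finite I" "indep_vars (\<lambda>_. borel) X I"
    and "\<And>i. i \<in> I \<Longrightarrow> integrable M (X i)" "\<And>i. i \<in> I \<Longrightarrow> integrable M (\<lambda>\<omega>. (X i \<omega>)\<^sup>2)"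
    and "\<And>i. i \<in> I \<Longrightarrow> expectation (X i) = e" "\<And>i. i \<in> I \<Longrightarrow> expectation (\<lambda>\<omega>. (X i \<omega>)\<^sup>2) = v"
  shows "integrable M (\<lambda>\<omega>. (\<Sum>i\<in>I. X i \<omega>)\<^sup>2) \<and>
    expectation (\<lambda>\<omega>. (\<Sum>i\<in>I. X i \<omega>)\<^sup>2) \<le> real (card I) * v + (real (card I) * e)\<^sup>2"
  using assms
proof (induction I)
  case empty
  then show ?case by simp
next
  case (insert j I)
  define S where "S = (\<lambda>\<omega>. \<Sum>i\<in>I. X i \<omega>)"
  have IH: "integrable M (\<lambda>\<omega>. (S \<omega>)\<^sup>2)" "expectation (\<lambda>\<omega>. (S \<omega>)\<^sup>2) \<le> real (card I) * v + (real (card I) * e)\<^sup>2"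
    using insert.IH indep_vars_subset[OF insert.prems(1)] insert.prems by (auto simp: S_def)
  have iS: "integrable M S" unfolding S_def using insert.prems by (intro Bochner_Integration.integrable_sum) auto
  have eS: "expectation S = real (card I) * e"
    unfolding S_def using insert.prems by (subst Bochner_Integration.integral_sum) auto
  have ind: "indep_var borel (X j) borel S"
    unfolding S_def using insert.hyps insert.prems by (intro indep_vars_sum) auto
  have iXS: "integrable M (\<lambda>\<omega>. X j \<omega> * S \<omega>)"
    using insert.prems iS by (intro indep_var_integrable[OF ind]) auto
  have eXS: "expectation (\<lambda>\<omega>. X j \<omega> * S \<omega>) = e * (real (card I) * e)"
    using insert.prems iS by (subst indep_var_lebesgue_integral[OF ind]) (auto simp: eS)
  have eq: "(\<lambda>\<omega>. (\<Sum>i\<in>insert j I. X i \<omega>)\<^sup>2) = (\<lambda>\<omega>. (X j \<omega>)\<^sup>2 + 2 * (X j \<omega> * S \<omega>) + (S \<omega>)\<^sup>2)"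
    using insert.hyps by (auto simp: S_def power2_eq_square algebra_simps)
  have i1: "integrable M (\<lambda>\<omega>. (X j \<omega>)\<^sup>2)" using insert.prems by auto
  have "integrable M (\<lambda>\<omega>. (\<Sum>i\<in>insert j I. X i \<omega>)\<^sup>2)"
    unfolding eq using i1 iXS IH(1) by auto
  moreover have "expectation (\<lambda>\<omega>. (\<Sum>i\<in>insert j I. X i \<omega>)\<^sup>2) = v + 2 * (e * (real (card I) * e)) + expectation (\<lambda>\<omega>. (S \<omega>)\<^sup>2)"
    unfolding eq using i1 iXS IH(1) insert.prems by (simp add: eXS)
  moreover have "v + 2 * (e * (real (card I) * e)) + (real (card I) * v + (real (card I) * e)\<^sup>2)
      \<le> real (card (insert j I)) * v + (real (card (insert j I)) * e)\<^sup>2"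
    using insert.hyps by (simp add: power2_eq_square algebra_simps)
  ultimately show ?case using IH(2) by simp
qed

context heavy_tail
begin

text \<open>From \<open>(u - c)\<^sup>2 \<le> 2 * u\<^sup>2 + 2 * c\<^sup>2\<close>.\<close>

lemma trunc_second_moment:
  "integrable \<nu> (\<lambda>y. (y * indicator {y. \<bar>y\<bar> \<le> x} y - c)\<^sup>2)"
  "(\<integral>y. (y * indicator {y. \<bar>y\<bar> \<le> x} y - c)\<^sup>2 \<partial>\<nu>) \<le> 2 * low_moment 2 x + 2 * c\<^sup>2"
proof -
  have sq: "(u - c)\<^sup>2 \<le> 2 * u\<^sup>2 + 2 * c\<^sup>2" for u :: real
    using zero_le_power2[of "u + c"] by (simp add: power2_eq_square algebra_simps)
  have i2: "integrable \<nu> (\<lambda>y. 2 * (\<bar>y\<bar> ^ 2 * indicator {y. \<bar>y\<bar> \<le> x} y) + 2 * c\<^sup>2)"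
    by (intro Bochner_Integration.integrable_add integrable_mult_right integrable_low integrable_const)
  have le: "(y * indicator {y. \<bar>y\<bar> \<le> x} y - c)\<^sup>2 \<le> 2 * (\<bar>y\<bar> ^ 2 * indicator {y. \<bar>y\<bar> \<le> x} y) + 2 * c\<^sup>2" for y :: real
    using sq[of "y * indicator {y. \<bar>y\<bar> \<le> x} y"] by (auto simp: indicator_def split: if_splits)
  show i1: "integrable \<nu> (\<lambda>y. (y * indicator {y. \<bar>y\<bar> \<le> x} y - c)\<^sup>2)"
    by (rule Bochner_Integration.integrable_bound[OF i2]) (use le in \<open>auto intro!: AE_I2 order_trans[OF le]\<close>)
  have "(\<integral>y. (y * indicator {y. \<bar>y\<bar> \<le> x} y - c)\<^sup>2 \<partial>\<nu>) \<le> (\<integral>y. 2 * (\<bar>y\<bar> ^ 2 * indicator {y. \<bar>y\<bar> \<le> x} y) + 2 * c\<^sup>2 \<partial>\<nu>)"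
    by (rule integral_mono[OF i1 i2 le])
  also have "\<dots> = 2 * low_moment 2 x + 2 * c\<^sup>2"
  proof -
    have "(\<integral>y. 2 * (\<bar>y\<bar> ^ 2 * indicator {y. \<bar>y\<bar> \<le> x} y) \<partial>\<nu>) = 2 * low_moment 2 x"
      unfolding low_moment_def by (rule integral_mult_right_zero)
    moreover have "(\<integral>y. 2 * c\<^sup>2 \<partial>\<nu>) = 2 * c\<^sup>2" by (simp add: prob_space)
    ultimately show ?thesis
      by (subst Bochner_Integration.integral_add[OF integrable_mult_right[OF integrable_low] integrable_const]) simp
  qed
  finally show "(\<integral>y. (y * indicator {y. \<bar>y\<bar> \<le> x} y - c)\<^sup>2 \<partial>\<nu>) \<le> 2 * low_moment 2 x + 2 * c\<^sup>2" .
qed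

text \<open>Truncate each term at \<open>x\<close>. Either some term exceeds \<open>x\<close>, which accounts for \<open>card I * G x\<close>, or the
sum is unaffected by the truncation. Chebyshev's inequality bounds the truncated sum: its variance is
controlled by \<open>karamata_low\<close> and its mean by \<open>centring_error\<close>.\<close>

lemma sum_tail_bound:
  obtains C x0 where "x0 > 0" "C > 0"
    "\<And>(M :: 'a measure) (\<xi> :: nat \<Rightarrow> 'a \<Rightarrow> real) I x. prob_space M \<Longrightarrow> prob_space.indep_vars M (\<lambda>_. borel) \<xi> I \<Longrightarrow>
      (\<And>i. i \<in> I \<Longrightarrow> distr M borel (\<xi> i) = \<nu>) \<Longrightarrow> finite I \<Longrightarrow> x \<ge> x0 \<Longrightarrow>
      measure M {\<omega>\<in>space M. \<bar>\<Sum>i\<in>I. \<xi> i \<omega> - centre\<bar> > x} \<le> C * (real (card I) * G x + (real (card I) * G x)\<^sup>2)"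
proof -
  have "real 2 > \<alpha>" using alpha by simp
  from karamata_low[OF this] obtain C1 x1 where C1: "x1 > 0" "C1 > 0" "\<And>x. x \<ge> x1 \<Longrightarrow> low_moment 2 x \<le> C1 * (x ^ 2 * G x)"
    by blast
  obtain C2 x2 where C2: "x2 > 0" "C2 > 0" "\<And>x. x \<ge> x2 \<Longrightarrow> \<bar>trunc_mean x - centre\<bar> \<le> C2 * (x * G x)"
    using centring_error by blast
  obtain C3 x3 where C3: "x3 > 0" "C3 > 0" "\<And>x. x \<ge> x3 \<Longrightarrow> C3 \<le> x\<^sup>2 * G x"
    using x2G_lower by blast
  define D where "D = 2 * C1 + 2 * centre\<^sup>2 / C3"
  define C where "C = 1 + D + C2\<^sup>2"
  have D: "D \<ge> 0" using C1 C3 by (simp add: D_def)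
  define x0 where "x0 = max x1 (max x2 x3)"
  show ?thesis
  proof (rule that[of x0 C])
    show "x0 > 0" using C1 by (simp add: x0_def less_max_iff_disj)
    show "C > 0" using D by (simp add: C_def add_pos_nonneg)
    fix M :: "'a measure" and \<xi> :: "nat \<Rightarrow> 'a \<Rightarrow> real" and I x
    assume M: "prob_space M" and ind: "prob_space.indep_vars M (\<lambda>_. borel) \<xi> I"
      and law: "\<And>i. i \<in> I \<Longrightarrow> distr M borel (\<xi> i) = \<nu>" and I: "finite I" and x: "x \<ge> x0"
    interpret P: prob_space M by fact
    have x': "x > 0" "x \<ge> x1" "x \<ge> x2" "x \<ge> x3" using x C1 by (auto simp: x0_def)
    define c where "c = centre"
    define m where "m = real (card I)"
    define t where "t = (\<lambda>y::real. y * indicator {y. \<bar>y\<bar> \<le> x} y - c)"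
    define T where "T = (\<lambda>i \<omega>. t (\<xi> i \<omega>))"
    have tm: "t \<in> borel_measurable borel" unfolding t_def by measurable
    have meas: "\<xi> i \<in> borel_measurable M" if "i \<in> I" for i
      using ind that by (auto simp: P.indep_vars_def)
    have indT: "P.indep_vars (\<lambda>_. borel) T I"
      unfolding T_def by (rule P.indep_vars_compose2[OF ind]) (use tm in auto)
    have ed: "P.expectation (\<lambda>\<omega>. f (\<xi> i \<omega>)) = (\<integral>y. f y \<partial>\<nu>)" if "i \<in> I" "f \<in> borel_measurable borel" for i and f :: "real \<Rightarrow> real"
      using integral_distr[OF meas[OF that(1)] that(2)] law[OF that(1)] by simp
    have id: "integrable M (\<lambda>\<omega>. f (\<xi> i \<omega>))" if "i \<in> I" "f \<in> borel_measurable borel" "integrable \<nu> f" for i and f :: "real \<Rightarrow> real"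
      using integrable_distr_eq[OF meas[OF that(1)] that(2)] law[OF that(1)] that(3) by simp
    have it: "integrable \<nu> t" unfolding t_def by (intro Bochner_Integration.integrable_diff integrable_trunc integrable_const)
    have it2: "integrable \<nu> (\<lambda>y. (t y)\<^sup>2)" unfolding t_def by (rule trunc_second_moment)
    have et: "(\<integral>y. t y \<partial>\<nu>) = trunc_mean x - c"
      unfolding t_def trunc_mean_def
      by (subst Bochner_Integration.integral_diff[OF integrable_trunc integrable_const]) simp
    define v where "v = (\<integral>y. (t y)\<^sup>2 \<partial>\<nu>)"
    have sm: "integrable M (\<lambda>\<omega>. (\<Sum>i\<in>I. T i \<omega>)\<^sup>2)"
      "P.expectation (\<lambda>\<omega>. (\<Sum>i\<in>I. T i \<omega>)\<^sup>2) \<le> m * v + (m * (trunc_mean x - c))\<^sup>2"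
    proof -
      have "integrable M (\<lambda>\<omega>. (\<Sum>i\<in>I. T i \<omega>)\<^sup>2) \<and> P.expectation (\<lambda>\<omega>. (\<Sum>i\<in>I. T i \<omega>)\<^sup>2)
        \<le> real (card I) * v + (real (card I) * (trunc_mean x - c))\<^sup>2"
      proof (rule P.second_moment_sum[OF I indT])
        fix i assume i: "i \<in> I"
        show "integrable M (T i)" unfolding T_def by (rule id[OF i tm it])
        show "integrable M (\<lambda>\<omega>. (T i \<omega>)\<^sup>2)" unfolding T_def using id[OF i _ it2] tm by simp
        show "P.expectation (T i) = trunc_mean x - c" unfolding T_def using ed[OF i tm] et by simp
        show "P.expectation (\<lambda>\<omega>. (T i \<omega>)\<^sup>2) = v" unfolding T_def v_def using ed[OF i, of "\<lambda>y. (t y)\<^sup>2"] tm by simp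
      qed
      then show "integrable M (\<lambda>\<omega>. (\<Sum>i\<in>I. T i \<omega>)\<^sup>2)"
        "P.expectation (\<lambda>\<omega>. (\<Sum>i\<in>I. T i \<omega>)\<^sup>2) \<le> m * v + (m * (trunc_mean x - c))\<^sup>2" by (auto simp: m_def)
    qed
    define E1 where "E1 = (\<lambda>i. {\<omega>\<in>space M. \<bar>\<xi> i \<omega>\<bar> > x})"
    define E2 where "E2 = {\<omega>\<in>space M. \<bar>\<Sum>i\<in>I. T i \<omega>\<bar> > x}"
    have Tm: "T i \<in> borel_measurable M" if "i \<in> I" for i
      unfolding T_def using measurable_compose[OF meas[OF that] tm] .
    have E1m: "E1 i \<in> P.events" if "i \<in> I" for i unfolding E1_def using meas[OF that] by measurable
    have "(\<lambda>\<omega>. \<Sum>i\<in>I. T i \<omega>) \<in> borel_measurable M" using Tm by (intro borel_measurable_sum)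
    then have E2m: "E2 \<in> P.events" unfolding E2_def by measurable
    have PE1: "P.prob (E1 i) = G x" if "i \<in> I" for i
    proof -
      have "G x = measure (distr M borel (\<xi> i)) {y. \<bar>y\<bar> > x}" by (simp add: G_def law[OF that])
      also have "\<dots> = P.prob (\<xi> i -` {y. \<bar>y\<bar> > x} \<inter> space M)"
        using meas[OF that] by (intro measure_distr) auto
      also have "\<xi> i -` {y. \<bar>y\<bar> > x} \<inter> space M = E1 i" by (auto simp: E1_def)
      finally show ?thesis by simp
    qed
    have "P.prob E2 = (\<integral>\<omega>. indicator E2 \<omega> \<partial>M)" using E2m by simp
    also have "\<dots> \<le> (\<integral>\<omega>. (\<Sum>i\<in>I. T i \<omega>)\<^sup>2 / x\<^sup>2 \<partial>M)"
    proof (rule integral_mono)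
      show "integrable M (indicator E2 :: 'a \<Rightarrow> real)" using E2m by (simp add: P.emeasure_eq_measure)
      show "integrable M (\<lambda>\<omega>. (\<Sum>i\<in>I. T i \<omega>)\<^sup>2 / x\<^sup>2)" using sm(1) by simp
      fix \<omega> assume "\<omega> \<in> space M"
      have "x\<^sup>2 \<le> (\<Sum>i\<in>I. T i \<omega>)\<^sup>2" if "\<omega> \<in> E2"
        using that x' abs_le_square_iff[of x "\<Sum>i\<in>I. T i \<omega>"] by (simp add: E2_def)
      then show "indicator E2 \<omega> \<le> (\<Sum>i\<in>I. T i \<omega>)\<^sup>2 / x\<^sup>2" using x' by (auto simp: indicator_def field_simps)
    qed
    also have "\<dots> = P.expectation (\<lambda>\<omega>. (\<Sum>i\<in>I. T i \<omega>)\<^sup>2) / x\<^sup>2" by simp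
    also have "\<dots> \<le> (m * v + (m * (trunc_mean x - c))\<^sup>2) / x\<^sup>2" using sm(2) by (intro divide_right_mono) auto
    also have "\<dots> \<le> (m * (D * (x\<^sup>2 * G x)) + (m * (C2 * (x * G x)))\<^sup>2) / x\<^sup>2"
    proof -
      have "v \<le> 2 * low_moment 2 x + 2 * c\<^sup>2" unfolding v_def t_def by (rule trunc_second_moment)
      also have "\<dots> \<le> D * (x\<^sup>2 * G x)"
      proof -
        have "1 \<le> x\<^sup>2 * G x / C3" using C3(3)[OF x'(4)] C3 by (simp add: field_simps)
        then have "2 * c\<^sup>2 * 1 \<le> 2 * c\<^sup>2 * (x\<^sup>2 * G x / C3)" by (intro mult_left_mono) auto
        then show ?thesis using C1(3)[OF x'(2)] by (simp add: D_def c_def algebra_simps)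
      qed
      finally have "m * v \<le> m * (D * (x\<^sup>2 * G x))" by (intro mult_left_mono) (auto simp: m_def)
      moreover have "\<bar>m * (trunc_mean x - c)\<bar> \<le> \<bar>m * (C2 * (x * G x))\<bar>"
        using C2 C2(3)[OF x'(3)] x' by (auto simp: abs_mult m_def c_def intro!: mult_left_mono)
      then have "(m * (trunc_mean x - c))\<^sup>2 \<le> (m * (C2 * (x * G x)))\<^sup>2" by (simp add: abs_le_square_iff)
      ultimately show ?thesis by (intro divide_right_mono) auto
    qed
    also have "\<dots> = D * (m * G x) + C2\<^sup>2 * (m * G x)\<^sup>2"
      using x' by (simp add: field_simps power2_eq_square)
    finally have PE2: "P.prob E2 \<le> D * (m * G x) + C2\<^sup>2 * (m * G x)\<^sup>2" .
    have "{\<omega>\<in>space M. \<bar>\<Sum>i\<in>I. \<xi> i \<omega> - centre\<bar> > x} \<subseteq> (\<Union>i\<in>I. E1 i) \<union> E2"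
    proof
      fix \<omega> assume \<omega>: "\<omega> \<in> {\<omega>\<in>space M. \<bar>\<Sum>i\<in>I. \<xi> i \<omega> - centre\<bar> > x}"
      show "\<omega> \<in> (\<Union>i\<in>I. E1 i) \<union> E2"
      proof (cases "\<omega> \<in> (\<Union>i\<in>I. E1 i)")
        case False
        then have "T i \<omega> = \<xi> i \<omega> - centre" if "i \<in> I" for i
          using that \<omega> by (auto simp: E1_def T_def t_def c_def indicator_def not_less)
        then show ?thesis using \<omega> by (simp add: E2_def)
      qed simp
    qed
    then have "P.prob {\<omega>\<in>space M. \<bar>\<Sum>i\<in>I. \<xi> i \<omega> - centre\<bar> > x} \<le> P.prob ((\<Union>i\<in>I. E1 i) \<union> E2)"
      using E1m E2m I by (intro P.finite_measure_mono) auto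
    also have "\<dots> \<le> P.prob (\<Union>i\<in>I. E1 i) + P.prob E2"
      using E1m E2m I by (intro measure_Un_le) auto
    also have "P.prob (\<Union>i\<in>I. E1 i) \<le> (\<Sum>i\<in>I. P.prob (E1 i))"
      using E1m I by (intro measure_UNION_le) auto
    also have "\<dots> = m * G x" using PE1 by (simp add: m_def)
    also have "m * G x + P.prob E2 \<le> m * G x + (D * (m * G x) + C2\<^sup>2 * (m * G x)\<^sup>2)" using PE2 by simp
    also have "\<dots> \<le> C * (m * G x + (m * G x)\<^sup>2)"
    proof -
      have "0 \<le> m * G x" "0 \<le> (m * G x)\<^sup>2" by (auto simp: m_def)
      then have "0 \<le> C2\<^sup>2 * (m * G x) + (1 + D) * (m * G x)\<^sup>2" using D by simp
      then show ?thesis by (simp add: C_def algebra_simps)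
    qed
    finally show "P.prob {\<omega>\<in>space M. \<bar>\<Sum>i\<in>I. \<xi> i \<omega> - centre\<bar> > x} \<le> C * (real (card I) * G x + (real (card I) * G x)\<^sup>2)"
      by (simp add: m_def)
  qed
qed

end

section \<open>The characteristic exponent of the limit\<close>

text \<open>A Cauchy argument, used to prove that characteristic exponents converge without computing the limit.\<close>

lemma convergent_if_approximable:
  fixes x :: "nat \<Rightarrow> 'b::banach"
  assumes "\<And>e. e > 0 \<Longrightarrow> \<exists>s. convergent s \<and> eventually (\<lambda>n. norm (x n - s n) \<le> e) sequentially"
  shows "convergent x"
proof (rule Cauchy_convergent, rule CauchyI)
  fix e :: real assume "e > 0"
  then obtain s where s: "convergent s" "eventually (\<lambda>n. norm (x n - s n) \<le> e / 4) sequentially"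
    using assms[of "e / 4"] by auto
  obtain N1 where N1: "\<And>n. n \<ge> N1 \<Longrightarrow> norm (x n - s n) \<le> e / 4"
    using s(2) by (auto simp: eventually_sequentially)
  obtain N2 where N2: "\<And>m n. m \<ge> N2 \<Longrightarrow> n \<ge> N2 \<Longrightarrow> norm (s m - s n) < e / 4"
    using CauchyD[OF convergent_Cauchy[OF s(1)], of "e / 4"] \<open>e > 0\<close> by auto
  have "norm (x m - x n) < e" if mn: "m \<ge> max N1 N2" "n \<ge> max N1 N2" for m n
  proof -
    have "x m - x n = (x m - s m) + (s m - s n) - (x n - s n)" by simp
    also have "norm \<dots> \<le> norm (x m - s m) + norm (s m - s n) + norm (x n - s n)"
      using norm_triangle_ineq4[of "(x m - s m) + (s m - s n)" "x n - s n"]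
        norm_triangle_ineq[of "x m - s m" "s m - s n"] by linarith
    also have "\<dots> < e" using N1[of m] N1[of n] N2[of m n] mn \<open>e > 0\<close> by auto
    finally show ?thesis .
  qed
  then show "\<exists>M. \<forall>m\<ge>M. \<forall>n\<ge>M. norm (x m - x n) < e" by blast
qed

context heavy_tail
begin

lemma one_sided_tail_convergent:
  assumes "x > 0" "\<sigma> \<in> {1, -1::real}"
  shows "convergent (\<lambda>n. real n * measure \<nu> {y. \<sigma> * y > x * a n})"
  using one_sided_tail_tendsto[OF assms] by (auto simp: convergent_def)

text \<open>On the shell where \<open>\<sigma> * y / a n\<close> lies between \<open>\<delta>\<close> and \<open>K\<close>, the function \<open>g\<close> is uniformly close to
a function that is constant on finitely many intervals. The integral of the latter is a combination of
one-sided tails at multiples of \<open>a n\<close>, and these converge.\<close>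

lemma middle_convergent:
  fixes g :: "real \<Rightarrow> complex"
  assumes g: "continuous_on UNIV g" and \<delta>: "0 < \<delta>" "\<delta> < K" and \<sigma>: "\<sigma> \<in> {1, -1::real}"
  shows "convergent (\<lambda>n. of_nat n * (\<integral>y. g (y / a n) * of_real (indicator {y. \<delta> * a n < \<sigma> * y \<and> \<sigma> * y \<le> K * a n} y) \<partial>\<nu>))"
proof (rule convergent_if_approximable)
  fix e :: real assume e: "e > 0"
  \<comment> \<open>The total mass of the shell, times \<open>n\<close>, is eventually below \<open>\<delta> powr (- \<alpha>) + 1\<close>.\<close>
  define e' where "e' = e / (\<delta> powr (- \<alpha>) + 1)"
  have "\<delta> powr (- \<alpha>) + 1 > 0" by (rule add_nonneg_pos) auto
  then have e': "e' > 0" "e' * (\<delta> powr (- \<alpha>) + 1) = e" using e by (auto simp: e'_def)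
  have "uniformly_continuous_on {-K..K} g"
    by (intro compact_uniformly_continuous continuous_on_subset[OF g]) auto
  then obtain d where d: "d > 0" "\<And>y z. y \<in> {-K..K} \<Longrightarrow> z \<in> {-K..K} \<Longrightarrow> \<bar>y - z\<bar> < d \<Longrightarrow> norm (g y - g z) < e'"
    using e'(1) unfolding uniformly_continuous_on_def dist_norm by (metis real_norm_def)
  obtain N :: nat where N: "real N > (K - \<delta>) / d" using reals_Archimedean2 by blast
  then have "N > 0" using \<delta> d by (cases N) (auto simp: field_simps)
  define x where "x = (\<lambda>i::nat. \<delta> + real i * ((K - \<delta>) / real N))"
  have step: "x (Suc i) - x i = (K - \<delta>) / real N" for i unfolding x_def by (simp only: of_nat_Suc distrib_right)
  have stepd: "(K - \<delta>) / real N < d" using N d \<open>N > 0\<close> by (simp add: field_simps)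
  have x0: "x 0 = \<delta>" "x N = K" using \<open>N > 0\<close> by (auto simp: x_def)
  have xm: "x i \<le> x j" if "i \<le> j" for i j unfolding x_def by (intro add_left_mono mult_right_mono) (use that \<delta> in auto)
  have xpos: "x i > 0" for i using xm[of 0 i] x0 \<delta> by simp
  define F where "F = (\<lambda>n s y. indicator {y. \<sigma> * y > s * a n} y :: real)"
  define I where "I = (\<lambda>n i y. F n (x i) y - F n (x (Suc i)) y)"
  define s where "s = (\<lambda>n. \<Sum>i<N. g (\<sigma> * x (Suc i)) * of_real (real n * measure \<nu> {y. \<sigma> * y > x i * a n} - real n * measure \<nu> {y. \<sigma> * y > x (Suc i) * a n}))"
  have conv: "convergent s"
    unfolding s_def
    by (intro convergent_sum convergent_mult convergent_const convergent_of_real convergent_diff one_sided_tail_convergent xpos \<sigma>)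
  have iF: "integrable \<nu> (F n z)" for n z
    unfolding F_def by (rule integrable_const_bound[of _ 1]) (auto simp: indicator_def)
  have "eventually (\<lambda>n. real n * G (\<delta> * a n) < \<delta> powr (- \<alpha>) + 1) sequentially"
    by (rule order_tendstoD(2)[OF nG_tendsto[OF \<delta>(1)]]) simp
  then have "eventually (\<lambda>n. norm (of_nat n * (\<integral>y. g (y / a n) * of_real (indicator {y. \<delta> * a n < \<sigma> * y \<and> \<sigma> * y \<le> K * a n} y) \<partial>\<nu>) - s n) \<le> e) sequentially"
    using eventually_ge_at_top[of 1]
  proof eventually_elim
    case (elim n)
    have an: "a n > 0" by (rule a_pos[OF elim(2)])
    have In: "I n i y = indicator {y. x i * a n < \<sigma> * y \<and> \<sigma> * y \<le> x (Suc i) * a n} y" for i y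
    proof -
      have "x i * a n \<le> x (Suc i) * a n" using xm[of i "Suc i"] an by (intro mult_right_mono) auto
      then show ?thesis by (auto simp: I_def F_def indicator_def)
    qed
    have tot: "(\<Sum>i<N. I n i y) = indicator {y. \<delta> * a n < \<sigma> * y \<and> \<sigma> * y \<le> K * a n} y" for y
    proof -
      have "(\<Sum>i<N. I n i y) = F n (x 0) y - F n (x N) y"
        unfolding I_def by (rule sum_lessThan_telescope')
      moreover have "\<delta> * a n \<le> K * a n" using \<delta> an by simp
      ultimately show ?thesis by (auto simp: x0 F_def indicator_def)
    qed
    have s_int: "s n = of_nat n * (\<integral>y. (\<Sum>i<N. g (\<sigma> * x (Suc i)) * of_real (I n i y)) \<partial>\<nu>)"
    proof -
      have "(\<integral>y. (\<Sum>i<N. g (\<sigma> * x (Suc i)) * of_real (I n i y)) \<partial>\<nu>) = (\<Sum>i<N. \<integral>y. g (\<sigma> * x (Suc i)) * of_real (I n i y) \<partial>\<nu>)"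
        unfolding I_def by (intro Bochner_Integration.integral_sum integrable_mult_right integrable_of_real Bochner_Integration.integrable_diff iF)
      also have "\<dots> = (\<Sum>i<N. g (\<sigma> * x (Suc i)) * of_real (measure \<nu> {y. \<sigma> * y > x i * a n} - measure \<nu> {y. \<sigma> * y > x (Suc i) * a n}))"
      proof (rule sum.cong[OF refl])
        fix i
        have "(\<integral>y. I n i y \<partial>\<nu>) = measure \<nu> {y. \<sigma> * y > x i * a n} - measure \<nu> {y. \<sigma> * y > x (Suc i) * a n}"
          unfolding I_def by (subst Bochner_Integration.integral_diff[OF iF iF]) (simp add: F_def)
        then show "(\<integral>y. g (\<sigma> * x (Suc i)) * of_real (I n i y) \<partial>\<nu>) =
          g (\<sigma> * x (Suc i)) * of_real (measure \<nu> {y. \<sigma> * y > x i * a n} - measure \<nu> {y. \<sigma> * y > x (Suc i) * a n})"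
          by (simp only: integral_mult_right_zero integral_complex_of_real)
      qed
      finally show ?thesis by (simp add: s_def sum_distrib_left algebra_simps)
    qed
    define H where "H = (\<lambda>y. g (y / a n) * of_real (indicator {y. \<delta> * a n < \<sigma> * y \<and> \<sigma> * y \<le> K * a n} y))"
    define S where "S = (\<lambda>y. \<Sum>i<N. g (\<sigma> * x (Suc i)) * of_real (I n i y))"
    have gm: "g \<in> borel_measurable borel" using g by (rule borel_measurable_continuous_onI)
    have Im: "I n i \<in> borel_measurable borel" for i unfolding In[abs_def] by measurable
    have ptw: "norm (H y - S y) \<le> e' * F n \<delta> y" for y
    proof -
      have "H y - S y = (\<Sum>i<N. (g (y / a n) - g (\<sigma> * x (Suc i))) * of_real (I n i y))"
        unfolding H_def S_def tot[symmetric] by (simp add: sum_distrib_left sum_subtractf algebra_simps)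
      also have "norm \<dots> \<le> (\<Sum>i<N. e' * I n i y)"
      proof (intro sum_norm_le)
        fix i assume "i \<in> {..<N}"
        then have iN: "x (Suc i) \<le> K" using xm[of "Suc i" N] x0 by simp
        show "norm ((g (y / a n) - g (\<sigma> * x (Suc i))) * of_real (I n i y)) \<le> e' * I n i y"
        proof (cases "x i * a n < \<sigma> * y \<and> \<sigma> * y \<le> x (Suc i) * a n")
          case True
          then have "x i < \<sigma> * (y / a n)" "\<sigma> * (y / a n) \<le> x (Suc i)" using an by (auto simp: field_simps)
          moreover have "x (Suc i) - x i < d" using step stepd by simp
          ultimately have "\<bar>y / a n - \<sigma> * x (Suc i)\<bar> < d" "y / a n \<in> {-K..K}" "\<sigma> * x (Suc i) \<in> {-K..K}"
            using \<sigma> iN xpos[of i] xpos[of "Suc i"] by auto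
          then have "norm (g (y / a n) - g (\<sigma> * x (Suc i))) < e'" using d(2) by blast
          then show ?thesis using True by (simp add: In)
        qed (simp add: In)
      qed
      also have "\<dots> = e' * (\<Sum>i<N. I n i y)" by (simp add: sum_distrib_left)
      also have "\<dots> \<le> e' * F n \<delta> y" using e' by (intro mult_left_mono) (auto simp: tot F_def indicator_def)
      finally show ?thesis .
    qed
    have Sm: "S \<in> borel_measurable borel"
      unfolding S_def by (intro borel_measurable_sum borel_measurable_times borel_measurable_const
          measurable_compose[OF Im borel_measurable_of_real])
    have Hm: "H \<in> borel_measurable borel"
      unfolding H_def using gm by measurable
    have iS: "integrable \<nu> S"
      unfolding S_def I_def
      by (intro Bochner_Integration.integrable_sum integrable_mult_right integrable_of_real Bochner_Integration.integrable_diff iF)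
    have iHS: "integrable \<nu> (\<lambda>y. H y - S y)"
      by (rule Bochner_Integration.integrable_bound[OF integrable_mult_right[OF iF, of e' n \<delta>]])
         (use Hm Sm ptw e' in \<open>auto intro!: AE_I2 borel_measurable_diff simp: F_def abs_mult\<close>)
    have iH: "integrable \<nu> H" using Bochner_Integration.integrable_add[OF iHS iS] by simp
    have "norm ((\<integral>y. H y \<partial>\<nu>) - (\<integral>y. S y \<partial>\<nu>)) = norm (\<integral>y. H y - S y \<partial>\<nu>)"
      by (subst Bochner_Integration.integral_diff[OF iH iS]) simp
    also have "\<dots> \<le> (\<integral>y. norm (H y - S y) \<partial>\<nu>)" by (rule integral_norm_bound)
    also have "\<dots> \<le> (\<integral>y. e' * F n \<delta> y \<partial>\<nu>)"
      by (rule integral_mono[OF integrable_norm[OF iHS] integrable_mult_right[OF iF] ptw])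
    also have "\<dots> = e' * measure \<nu> {y. \<sigma> * y > \<delta> * a n}" by (simp add: F_def)
    also have "\<dots> \<le> e' * G (\<delta> * a n)"
      unfolding G_def using e' \<sigma> by (intro mult_left_mono finite_measure_mono) auto
    finally have "real n * norm ((\<integral>y. H y \<partial>\<nu>) - (\<integral>y. S y \<partial>\<nu>)) \<le> real n * (e' * G (\<delta> * a n))"
      by (rule mult_left_mono) simp
    also have "\<dots> = e' * (real n * G (\<delta> * a n))" by simp
    also have "\<dots> \<le> e' * (\<delta> powr (- \<alpha>) + 1)" using elim e' by (intro mult_left_mono) auto
    also have "\<dots> = e" by (rule e'(2))
    finally have "real n * norm ((\<integral>y. H y \<partial>\<nu>) - (\<integral>y. S y \<partial>\<nu>)) \<le> e" .
    moreover have "of_nat n * (\<integral>y. H y \<partial>\<nu>) - s n = of_nat n * ((\<integral>y. H y \<partial>\<nu>) - (\<integral>y. S y \<partial>\<nu>))"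
      unfolding s_int S_def by (simp add: algebra_simps)
    ultimately show ?case unfolding H_def by (simp add: norm_mult)
  qed
  with conv show "\<exists>s. convergent s \<and> eventually (\<lambda>n. norm (of_nat n * (\<integral>y. g (y / a n) * of_real (indicator {y. \<delta> * a n < \<sigma> * y \<and> \<sigma> * y \<le> K * a n} y) \<partial>\<nu>) - s n) \<le> e) sequentially"
    by blast
qed

text \<open>By \<open>karamata_low\<close> the expression is at most \<open>C * \<delta> ^ \<beta>\<close> times \<open>n * G (\<delta> * a n)\<close>, which tends to
\<open>C * \<delta> powr (\<beta> - \<alpha>)\<close>.\<close>

lemma small_jumps_negligible:
  assumes \<beta>: "real \<beta> > \<alpha>" and e: "e > 0"
  obtains \<delta>0 where "\<delta>0 > 0" "\<And>\<delta>. 0 < \<delta> \<Longrightarrow> \<delta> \<le> \<delta>0 \<Longrightarrow>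
    eventually (\<lambda>n. real n * low_moment \<beta> (\<delta> * a n) / a n ^ \<beta> \<le> e) sequentially"
proof -
  obtain C x0 where C: "x0 > 0" "C > 0" "\<And>x. x \<ge> x0 \<Longrightarrow> low_moment \<beta> x \<le> C * (x ^ \<beta> * G x)"
    using karamata_low[OF \<beta>] by blast
  define s where "s = real \<beta> - \<alpha>"
  define \<delta>0 where "\<delta>0 = (e / (2 * C)) powr (1 / s)"
  have s: "s > 0" using \<beta> by (simp add: s_def)
  have d0: "\<delta>0 > 0" "\<delta>0 powr s = e / (2 * C)" using e C s by (auto simp: \<delta>0_def powr_powr)
  show ?thesis
  proof (rule that[OF d0(1)])
    fix \<delta> assume \<delta>: "0 < \<delta>" "\<delta> \<le> \<delta>0"
    have "\<delta> powr s \<le> e / (2 * C)" using \<delta> s d0 by (metis powr_mono2 less_imp_le)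
    then have lt: "C * \<delta> ^ \<beta> * \<delta> powr (- \<alpha>) < e"
    proof -
      assume "\<delta> powr s \<le> e / (2 * C)"
      then have "C * \<delta> powr s \<le> e / 2" using C by (simp add: field_simps)
      moreover have "\<delta> ^ \<beta> * \<delta> powr (- \<alpha>) = \<delta> powr s"
        using \<delta> by (simp add: s_def powr_diff powr_minus powr_realpow field_simps)
      ultimately show ?thesis using e by (simp add: mult.assoc)
    qed
    have "(\<lambda>n. C * \<delta> ^ \<beta> * (real n * G (\<delta> * a n))) \<longlonglongrightarrow> C * \<delta> ^ \<beta> * \<delta> powr (- \<alpha>)"
      by (intro tendsto_intros nG_tendsto \<delta>)
    then have "eventually (\<lambda>n. C * \<delta> ^ \<beta> * (real n * G (\<delta> * a n)) < e) sequentially"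
      by (rule order_tendstoD(2)) (rule lt)
    moreover have "eventually (\<lambda>n. x0 \<le> \<delta> * a n) sequentially"
      using scaled_at_top[OF \<delta>(1)] unfolding filterlim_at_top by blast
    ultimately show "eventually (\<lambda>n. real n * low_moment \<beta> (\<delta> * a n) / a n ^ \<beta> \<le> e) sequentially"
      using eventually_ge_at_top[of 1]
    proof eventually_elim
      case (elim n)
      have an: "a n > 0" by (rule a_pos[OF elim(3)])
      have "real n * low_moment \<beta> (\<delta> * a n) \<le> real n * (C * ((\<delta> * a n) ^ \<beta> * G (\<delta> * a n)))"
        using C(3)[OF elim(2)] by (rule mult_left_mono) simp
      also have "\<dots> = a n ^ \<beta> * (C * \<delta> ^ \<beta> * (real n * G (\<delta> * a n)))"
        by (simp add: power_mult_distrib algebra_simps)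
      also have "\<dots> \<le> a n ^ \<beta> * e" using elim an by (intro mult_left_mono) auto
      finally show ?case using an by (simp add: field_simps)
    qed
  qed
qed

end

lemma norm_exp_i_minus_1_le:
  "norm (iexp x - 1) \<le> \<bar>x\<bar>" "norm (iexp x - 1) \<le> 2"
  "norm (iexp x - 1 - \<i> * x) \<le> 2 * \<bar>x\<bar>" "norm (iexp x - 1 - \<i> * x) \<le> x\<^sup>2"
proof -
  show "norm (iexp x - 1) \<le> \<bar>x\<bar>" using iexp_approx1[of x 0] by simp
  have "norm (iexp x - 1) \<le> norm (iexp x) + norm (1::complex)" by (rule norm_triangle_ineq4)
  then show "norm (iexp x - 1) \<le> 2" by simp
  show "norm (iexp x - 1 - \<i> * x) \<le> 2 * \<bar>x\<bar>" using iexp_approx2[of x 1] by (simp add: diff_diff_eq)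
  have "norm (iexp x - 1 - \<i> * x) \<le> x\<^sup>2 / 2" using iexp_approx1[of x 1] by (simp add: diff_diff_eq numeral_2_eq_2)
  then show "norm (iexp x - 1 - \<i> * x) \<le> x\<^sup>2" by (rule order_trans) simp
qed

context heavy_tail
begin

text \<open>The function \<open>exp (i y) - 1\<close>, compensated in accordance with the centring: for \<open>\<alpha> > 1\<close> the linear
term is removed, as the mean is, and for \<open>\<alpha> = 1\<close> the imaginary part, whose integral vanishes by
symmetry (see \<open>char_eq_kern\<close>).\<close>

definition kern :: "real \<Rightarrow> complex" where
  "kern y = (if \<alpha> < 1 then iexp y - 1 else if \<alpha> = 1 then of_real (cos y - 1) else iexp y - 1 - \<i> * of_real y)"

text \<open>An order of vanishing of \<open>kern\<close> at 0. It exceeds \<open>\<alpha>\<close>, so that \<open>small_jumps_negligible\<close> applies.\<close>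

definition small_order :: nat where "small_order = (if \<alpha> < 1 then 1 else 2)"

lemma small_order: "real small_order > \<alpha>"
  using alpha by (simp add: small_order_def)

lemma cos_minus_1_le: "\<bar>cos y - 1\<bar> \<le> y\<^sup>2" for y :: real
proof -
  have "\<bar>cos y - 1\<bar> = \<bar>Re (iexp y - 1 - \<i> * of_real y)\<bar>" by (simp add: Re_exp)
  also have "\<dots> \<le> norm (iexp y - 1 - \<i> * of_real y)" by (rule abs_Re_le_cmod)
  also have "\<dots> \<le> y\<^sup>2" by (rule norm_exp_i_minus_1_le)
  finally show ?thesis .
qed

lemma kern_small: "norm (kern y) \<le> \<bar>y\<bar> ^ small_order"
  using norm_exp_i_minus_1_le[of y] cos_minus_1_le[of y]
  by (auto simp: kern_def small_order_def simp flip: of_real_diff)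

lemma kern_large: "\<alpha> \<le> 1 \<Longrightarrow> norm (kern y) \<le> 2" "\<alpha> > 1 \<Longrightarrow> norm (kern y) \<le> 2 * \<bar>y\<bar>"
proof -
  have "\<bar>cos y - 1\<bar> \<le> 2" using cos_ge_minus_one[of y] cos_le_one[of y] by linarith
  then have "norm (of_real (cos y - 1) :: complex) \<le> 2" by (simp only: norm_of_real)
  then show "\<alpha> \<le> 1 \<Longrightarrow> norm (kern y) \<le> 2"
    using norm_exp_i_minus_1_le[of y] by (auto simp: kern_def)
  show "\<alpha> > 1 \<Longrightarrow> norm (kern y) \<le> 2 * \<bar>y\<bar>"
    using norm_exp_i_minus_1_le[of y] by (auto simp: kern_def)
qed

lemma kern_continuous: "continuous_on UNIV kern"
proof -
  have "continuous_on UNIV (\<lambda>y::real. iexp y - 1)" "continuous_on UNIV (\<lambda>y. complex_of_real (cos y - 1))"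
    "continuous_on UNIV (\<lambda>y::real. iexp y - 1 - \<i> * of_real y)"
    by (intro continuous_intros)+
  then show ?thesis unfolding kern_def[abs_def] by (cases "\<alpha> < 1"; cases "\<alpha> = 1") auto
qed

lemma kern_measurable[measurable]: "kern \<in> borel_measurable borel"
  using kern_continuous by (rule borel_measurable_continuous_onI)

lemma integrable_id: "\<alpha> > 1 \<Longrightarrow> integrable \<nu> (\<lambda>y. y)"
  by (rule integrable_abs_iff[THEN iffD1, OF _ karamata_high(1)]) simp

lemma integrable_kern: "integrable \<nu> (\<lambda>y. kern (v * y))"
proof (cases "\<alpha> \<le> 1")
  case True
  show ?thesis by (rule integrable_const_bound[of _ 2]) (use kern_large(1)[OF True] in auto)
next
  case False
  then have "integrable \<nu> (\<lambda>y. 2 * \<bar>v\<bar> * \<bar>y\<bar>)" by (intro integrable_mult_right karamata_high) auto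
  then show ?thesis
    by (rule Bochner_Integration.integrable_bound)
       (use kern_large(2)[of "v * y" for y] False in \<open>auto intro!: AE_I2 simp: abs_mult mult.assoc\<close>)
qed

lemma ex_powr_neg_less:
  assumes "s > 0" "e > (0::real)"
  obtains K0 where "K0 > 0" "\<And>K. K \<ge> K0 \<Longrightarrow> K powr (- s) < e"
proof -
  have "((\<lambda>K. K powr (- s)) \<longlongrightarrow> 0) at_top"
    using assms by (intro tendsto_neg_powr filterlim_ident) auto
  then have "eventually (\<lambda>K. K powr (- s) < e) at_top" using assms by (intro order_tendstoD(2))
  then obtain K0 where "\<And>K. K \<ge> K0 \<Longrightarrow> K powr (- s) < e" by (auto simp: eventually_at_top_linorder)
  then show ?thesis by (intro that[of "max K0 1"]) auto
qed

text \<open>For \<open>\<alpha> \<le> 1\<close> the kernel is bounded and \<open>n * G (K * a n)\<close> tends to \<open>K powr (- \<alpha>)\<close>. For \<open>\<alpha> > 1\<close> it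
grows linearly and \<open>karamata_high\<close> yields the order \<open>K powr (1 - \<alpha>)\<close>.\<close>

lemma large_jumps_negligible:
  assumes e: "e > 0"
  obtains K where "K > 0"
    "eventually (\<lambda>n. real n * (\<integral>y. norm (kern (u / a n * y)) * indicator {y. \<bar>y\<bar> > K * a n} y \<partial>\<nu>) \<le> e) sequentially"
proof (cases "\<alpha> \<le> 1")
  case True
  have "e / 2 > 0" using e by simp
  then obtain K where K: "K > 0" "K powr (- \<alpha>) < e / 2" using ex_powr_neg_less[OF alpha(1)] by blast
  have "eventually (\<lambda>n. real n * G (K * a n) < e / 2) sequentially"
    by (rule order_tendstoD(2)[OF nG_tendsto[OF K(1)] K(2)])
  then have "eventually (\<lambda>n. real n * (\<integral>y. norm (kern (u / a n * y)) * indicator {y. \<bar>y\<bar> > K * a n} y \<partial>\<nu>) \<le> e) sequentially"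
  proof eventually_elim
    case (elim n)
    have "(\<integral>y. norm (kern (u / a n * y)) * indicator {y. \<bar>y\<bar> > K * a n} y \<partial>\<nu>) \<le> (\<integral>y. 2 * indicator {y. \<bar>y\<bar> > K * a n} y \<partial>\<nu>)"
    proof (rule integral_mono)
      show "integrable \<nu> (\<lambda>y. norm (kern (u / a n * y)) * indicator {y. \<bar>y\<bar> > K * a n} y)"
        by (rule integrable_const_bound[of _ 2]) (use kern_large(1)[OF True] in \<open>auto simp: indicator_def\<close>)
      show "integrable \<nu> (\<lambda>y. 2 * indicator {y. \<bar>y\<bar> > K * a n} y :: real)"
        by (rule integrable_const_bound[of _ 2]) (auto simp: indicator_def)
    qed (use kern_large(1)[OF True] in \<open>auto simp: indicator_def\<close>)
    also have "\<dots> = 2 * G (K * a n)" by (simp add: G_def)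
    finally have "real n * (\<integral>y. norm (kern (u / a n * y)) * indicator {y. \<bar>y\<bar> > K * a n} y \<partial>\<nu>) \<le> real n * (2 * G (K * a n))"
      by (rule mult_left_mono) simp
    then show ?case using elim by simp
  qed
  then show ?thesis using that K by blast
next
  case False
  then have \<alpha>1: "\<alpha> > 1" by simp
  obtain C x0 where C: "C > 0" "x0 > 0" "\<And>x. x \<ge> x0 \<Longrightarrow> (\<integral>y. \<bar>y\<bar> * indicator {y. \<bar>y\<bar> > x} y \<partial>\<nu>) \<le> C * (x * G x)"
    using karamata_high(2)[OF \<alpha>1] by blast
  define D where "D = 2 * (\<bar>u\<bar> + 1) * C"
  have D: "D > 0" using C by (simp add: D_def)
  then have s1: "\<alpha> - 1 > 0" "e / D > 0" using \<alpha>1 e by auto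
  obtain K where K: "K > 0" "K powr (- (\<alpha> - 1)) < e / D" using ex_powr_neg_less[OF s1] by blast
  have lt: "D * K * K powr (- \<alpha>) < e"
  proof -
    have "K powr (- (\<alpha> - 1)) = K * K powr (- \<alpha>)" using K(1) by (simp add: powr_diff powr_minus field_simps)
    then show ?thesis using K D by (simp add: field_simps)
  qed
  have "(\<lambda>n. D * K * (real n * G (K * a n))) \<longlonglongrightarrow> D * K * K powr (- \<alpha>)"
    by (intro tendsto_intros nG_tendsto K)
  then have "eventually (\<lambda>n. D * K * (real n * G (K * a n)) < e) sequentially"
    by (rule order_tendstoD(2)) (rule lt)
  moreover have "eventually (\<lambda>n. x0 \<le> K * a n) sequentially"
    using scaled_at_top[OF K(1)] unfolding filterlim_at_top by blast
  ultimately have "eventually (\<lambda>n. real n * (\<integral>y. norm (kern (u / a n * y)) * indicator {y. \<bar>y\<bar> > K * a n} y \<partial>\<nu>) \<le> e) sequentially"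
    using eventually_ge_at_top[of 1]
  proof eventually_elim
    case (elim n)
    have an: "a n > 0" by (rule a_pos[OF elim(3)])
    have iabs: "integrable \<nu> (\<lambda>y. \<bar>y\<bar> * indicator {y. \<bar>y\<bar> > K * a n} y)"
      by (rule Bochner_Integration.integrable_bound[OF karamata_high(1)[OF \<alpha>1]]) (auto simp: indicator_def)
    define c where "c = 2 * (\<bar>u\<bar> + 1) / a n"
    have c: "c \<ge> 0" using an by (simp add: c_def)
    have kb: "norm (kern (u / a n * y)) \<le> c * \<bar>y\<bar>" for y
    proof -
      have "norm (kern (u / a n * y)) \<le> 2 * \<bar>u / a n * y\<bar>" by (rule kern_large(2)[OF \<alpha>1])
      also have "\<dots> = (2 * \<bar>u\<bar> / a n) * \<bar>y\<bar>" using an by (simp add: abs_mult)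
      also have "\<dots> \<le> c * \<bar>y\<bar>" unfolding c_def using an by (intro mult_right_mono divide_right_mono) auto
      finally show ?thesis .
    qed
    have kb': "norm (kern (u / a n * y)) * indicator {y. \<bar>y\<bar> > K * a n} y \<le> c * (\<bar>y\<bar> * indicator {y. \<bar>y\<bar> > K * a n} y)" for y
      using kb[of y] by (auto simp: indicator_def)
    have ic: "integrable \<nu> (\<lambda>y. c * (\<bar>y\<bar> * indicator {y. \<bar>y\<bar> > K * a n} y))"
      using iabs by (rule integrable_mult_right)
    have ik: "integrable \<nu> (\<lambda>y. norm (kern (u / a n * y)) * indicator {y. \<bar>y\<bar> > K * a n} y)"
      by (rule Bochner_Integration.integrable_bound[OF ic])
         (use kb' c in \<open>auto intro!: AE_I2 simp: abs_mult\<close>)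
    have "(\<integral>y. norm (kern (u / a n * y)) * indicator {y. \<bar>y\<bar> > K * a n} y \<partial>\<nu>) \<le> (\<integral>y. c * (\<bar>y\<bar> * indicator {y. \<bar>y\<bar> > K * a n} y) \<partial>\<nu>)"
      by (rule integral_mono[OF ik ic kb'])
    also have "\<dots> = c * (\<integral>y. \<bar>y\<bar> * indicator {y. \<bar>y\<bar> > K * a n} y \<partial>\<nu>)" by (rule integral_mult_right_zero)
    also have "\<dots> \<le> c * (C * (K * a n * G (K * a n)))" using C(3)[OF elim(2)] c by (rule mult_left_mono)
    also have "\<dots> = D * K * G (K * a n)" using an by (simp add: c_def D_def field_simps)
    finally have "real n * (\<integral>y. norm (kern (u / a n * y)) * indicator {y. \<bar>y\<bar> > K * a n} y \<partial>\<nu>) \<le> real n * (D * K * G (K * a n))"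
      by (rule mult_left_mono) simp
    also have "\<dots> = D * K * (real n * G (K * a n))" by simp
    also have "\<dots> \<le> e" using elim(1) by (rule less_imp_le)
    finally show ?case .
  qed
  then show ?thesis using that K by blast
qed

text \<open>The range of \<open>y / a n\<close> is divided into a small, a middle and a large part; the outer parts are
uniformly negligible and the middle one converges.\<close>

lemma kern_integral_convergent: "convergent (\<lambda>n. of_nat n * (\<integral>y. kern (u / a n * y) \<partial>\<nu>))"
proof (rule convergent_if_approximable)
  fix e :: real assume "e > 0"
  define \<beta> where "\<beta> = small_order"
  have e2: "e / 2 > 0" using \<open>e > 0\<close> by simp
  have e3: "e / (2 * (\<bar>u\<bar> ^ \<beta> + 1)) > 0" using \<open>e > 0\<close> by (simp add: add_nonneg_pos)
  obtain K where K: "K > 0" "eventually (\<lambda>n. real n * (\<integral>y. norm (kern (u / a n * y)) * indicator {y. \<bar>y\<bar> > K * a n} y \<partial>\<nu>) \<le> e / 2) sequentially"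
    using large_jumps_negligible[OF e2] by blast
  obtain \<delta>0 where d0: "\<delta>0 > 0" "\<And>\<delta>. 0 < \<delta> \<Longrightarrow> \<delta> \<le> \<delta>0 \<Longrightarrow>
    eventually (\<lambda>n. real n * low_moment \<beta> (\<delta> * a n) / a n ^ \<beta> \<le> e / (2 * (\<bar>u\<bar> ^ \<beta> + 1))) sequentially"
    using small_jumps_negligible[OF small_order e3] unfolding \<beta>_def by blast
  define \<delta> where "\<delta> = min \<delta>0 (K / 2)"
  have \<delta>: "0 < \<delta>" "\<delta> \<le> \<delta>0" "\<delta> < K" using d0 K by (auto simp: \<delta>_def)
  define g where "g = (\<lambda>z. kern (u * z))"
  have g: "continuous_on UNIV g" unfolding g_def
    by (intro continuous_on_compose2[OF kern_continuous] continuous_intros) auto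
  define mid where "mid = (\<lambda>\<sigma> n. of_nat n * (\<integral>y. g (y / a n) * of_real (indicator {y. \<delta> * a n < \<sigma> * y \<and> \<sigma> * y \<le> K * a n} y) \<partial>\<nu>))"
  define s where "s = (\<lambda>n. mid 1 n + mid (-1) n)"
  have "convergent s"
    unfolding s_def mid_def by (intro convergent_add middle_convergent g \<delta>) auto
  moreover have "eventually (\<lambda>n. norm (of_nat n * (\<integral>y. kern (u / a n * y) \<partial>\<nu>) - s n) \<le> e) sequentially"
    using K(2) d0(2)[OF \<delta>(1,2)] eventually_ge_at_top[of 1]
  proof eventually_elim
    case (elim n)
    have an: "a n > 0" by (rule a_pos[OF elim(3)])
    define k where "k = (\<lambda>y. kern (u / a n * y))"
    have gk: "g (y / a n) = k y" for y by (simp add: g_def k_def)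
    have km: "k \<in> borel_measurable borel" unfolding k_def by measurable
    have ik: "integrable \<nu> k" unfolding k_def by (rule integrable_kern)
    define I1 where "I1 = (\<lambda>y. indicator {y. \<bar>y\<bar> \<le> \<delta> * a n} y :: real)"
    define I2 where "I2 = (\<lambda>\<sigma> y. indicator {y. \<delta> * a n < \<sigma> * y \<and> \<sigma> * y \<le> K * a n} y :: real)"
    define I3 where "I3 = (\<lambda>y. indicator {y. \<bar>y\<bar> > K * a n} y :: real)"
    have lt: "0 < \<delta> * a n" "\<delta> * a n < K * a n" using \<delta> an by auto
    have part: "1 = I1 y + I2 1 y + I2 (-1) y + I3 y" for y
      using lt by (auto simp: I1_def I2_def I3_def indicator_def abs_if)
    have iI: "integrable \<nu> (\<lambda>y. k y * of_real (J y))" if "J \<in> borel_measurable borel" "\<And>y. J y = 0 \<or> J y = (1::real)" for J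
      by (rule Bochner_Integration.integrable_bound[OF ik])
         (use that km in \<open>auto intro!: AE_I2 simp: norm_mult\<close>, metis abs_1 abs_zero mult_cancel_left1 mult_zero_right norm_ge_zero order_refl)
    have i1: "integrable \<nu> (\<lambda>y. k y * of_real (I1 y))" by (rule iI) (auto simp: I1_def indicator_def)
    have i2: "integrable \<nu> (\<lambda>y. k y * of_real (I2 \<sigma> y))" for \<sigma> by (rule iI) (auto simp: I2_def indicator_def)
    have i3: "integrable \<nu> (\<lambda>y. k y * of_real (I3 y))" by (rule iI) (auto simp: I3_def indicator_def)
    have "(\<integral>y. k y \<partial>\<nu>) = (\<integral>y. k y * of_real (I1 y) + k y * of_real (I2 1 y) + k y * of_real (I2 (-1) y) + k y * of_real (I3 y) \<partial>\<nu>)"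
    proof (rule Bochner_Integration.integral_cong[OF refl])
      fix y
      have "k y = k y * of_real (I1 y + I2 1 y + I2 (-1) y + I3 y)" by (subst part[symmetric]) simp
      then show "k y = k y * of_real (I1 y) + k y * of_real (I2 1 y) + k y * of_real (I2 (-1) y) + k y * of_real (I3 y)"
        by (simp add: algebra_simps)
    qed
    also have "\<dots> = (\<integral>y. k y * of_real (I1 y) \<partial>\<nu>) + (\<integral>y. k y * of_real (I2 1 y) \<partial>\<nu>) + (\<integral>y. k y * of_real (I2 (-1) y) \<partial>\<nu>) + (\<integral>y. k y * of_real (I3 y) \<partial>\<nu>)"
      by (simp only: Bochner_Integration.integral_add Bochner_Integration.integrable_add i1 i2 i3)
    finally have eq: "of_nat n * (\<integral>y. k y \<partial>\<nu>) - s n = of_nat n * (\<integral>y. k y * of_real (I1 y) \<partial>\<nu>) + of_nat n * (\<integral>y. k y * of_real (I3 y) \<partial>\<nu>)"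
      unfolding s_def mid_def gk I2_def by (simp add: algebra_simps)
    have n1: "norm (of_nat n * (\<integral>y. k y * of_real (I1 y) \<partial>\<nu>)) \<le> e / 2"
    proof -
      define c where "c = (\<bar>u\<bar> / a n) ^ \<beta>"
      have c: "c \<ge> 0" using an by (simp add: c_def)
      have kb: "norm (k y * of_real (I1 y)) \<le> c * (\<bar>y\<bar> ^ \<beta> * indicator {y. \<bar>y\<bar> \<le> \<delta> * a n} y)" for y
      proof -
        have "norm (k y) \<le> \<bar>u / a n * y\<bar> ^ \<beta>" unfolding k_def \<beta>_def by (rule kern_small)
        also have "\<dots> = c * \<bar>y\<bar> ^ \<beta>" using an by (simp add: c_def abs_mult power_mult_distrib power_divide)
        finally show ?thesis by (simp add: I1_def indicator_def)
      qed
      have "norm (\<integral>y. k y * of_real (I1 y) \<partial>\<nu>) \<le> (\<integral>y. norm (k y * of_real (I1 y)) \<partial>\<nu>)" by (rule integral_norm_bound)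
      also have "\<dots> \<le> (\<integral>y. c * (\<bar>y\<bar> ^ \<beta> * indicator {y. \<bar>y\<bar> \<le> \<delta> * a n} y) \<partial>\<nu>)"
        by (rule integral_mono[OF integrable_norm[OF i1] integrable_mult_right[OF integrable_low] kb])
      also have "\<dots> = c * low_moment \<beta> (\<delta> * a n)" unfolding low_moment_def by (rule integral_mult_right_zero)
      finally have "real n * norm (\<integral>y. k y * of_real (I1 y) \<partial>\<nu>) \<le> real n * (c * low_moment \<beta> (\<delta> * a n))"
        by (rule mult_left_mono) simp
      also have "\<dots> = \<bar>u\<bar> ^ \<beta> * (real n * low_moment \<beta> (\<delta> * a n) / a n ^ \<beta>)"
        by (simp add: c_def power_divide)
      also have "\<dots> \<le> \<bar>u\<bar> ^ \<beta> * (e / (2 * (\<bar>u\<bar> ^ \<beta> + 1)))" using elim by (intro mult_left_mono) auto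
      also have "\<dots> \<le> e / 2"
      proof -
        have "\<bar>u\<bar> ^ \<beta> + 1 > 0" by (rule add_nonneg_pos) auto
        then show ?thesis using \<open>e > 0\<close> by (simp add: field_simps)
      qed
      finally show ?thesis by (simp add: norm_mult)
    qed
    have n3: "norm (of_nat n * (\<integral>y. k y * of_real (I3 y) \<partial>\<nu>)) \<le> e / 2"
    proof -
      have "norm (\<integral>y. k y * of_real (I3 y) \<partial>\<nu>) \<le> (\<integral>y. norm (k y * of_real (I3 y)) \<partial>\<nu>)" by (rule integral_norm_bound)
      also have "\<dots> = (\<integral>y. norm (kern (u / a n * y)) * indicator {y. \<bar>y\<bar> > K * a n} y \<partial>\<nu>)"
        by (intro Bochner_Integration.integral_cong) (auto simp: k_def I3_def norm_mult)
      finally have "real n * norm (\<integral>y. k y * of_real (I3 y) \<partial>\<nu>) \<le> real n * (\<integral>y. norm (kern (u / a n * y)) * indicator {y. \<bar>y\<bar> > K * a n} y \<partial>\<nu>)"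
        by (rule mult_left_mono) simp
      then show ?thesis using elim(1) by (simp add: norm_mult)
    qed
    have "norm (of_nat n * (\<integral>y. k y \<partial>\<nu>) - s n) \<le> e / 2 + e / 2"
      unfolding eq by (rule norm_triangle_mono[OF n1 n3])
    then show ?case by (simp add: k_def)
  qed
  ultimately show "\<exists>s. convergent s \<and> eventually (\<lambda>n. norm (of_nat n * (\<integral>y. kern (u / a n * y) \<partial>\<nu>) - s n) \<le> e) sequentially"
    by blast
qed

definition exponent :: "real \<Rightarrow> complex" where
  "exponent u = lim (\<lambda>n. of_nat n * (\<integral>y. kern (u / a n * y) \<partial>\<nu>))"

lemma kern_integral_tendsto: "(\<lambda>n. of_nat n * (\<integral>y. kern (u / a n * y) \<partial>\<nu>)) \<longlonglongrightarrow> exponent u"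
  unfolding exponent_def by (rule convergent_LIMSEQ_iff[THEN iffD1, OF kern_integral_convergent])

lemma char_eq_kern:
  "char \<nu> v - 1 = (\<integral>y. kern (v * y) \<partial>\<nu>) + \<i> * of_real (v * centre)"
proof -
  have ie: "integrable \<nu> (\<lambda>y. iexp (v * y))" by (rule integrable_const_bound[of _ 1]) auto
  have i0: "(\<integral>y. iexp (v * y) - 1 \<partial>\<nu>) = char \<nu> v - 1"
    unfolding char_def by (subst Bochner_Integration.integral_diff[OF ie integrable_const]) simp
  consider "\<alpha> < 1" | "\<alpha> = 1" | "\<alpha> > 1" by linarith
  then show ?thesis
  proof cases
    case 1
    have "centre = 0" "kern (v * y) = iexp (v * y) - 1" for y using 1 unfolding centre_def kern_def by auto
    then show ?thesis using i0 by simp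
  next
    case 2
    have c: "centre = 0" "\<And>y. kern (v * y) = of_real (cos (v * y) - 1)" using 2 unfolding centre_def kern_def by auto
    have ic: "integrable \<nu> (\<lambda>y. complex_of_real (cos (v * y) - 1))"
    proof (intro integrable_of_real integrable_const_bound[of _ 2] AE_I2)
      show "norm (cos (v * y) - 1) \<le> 2" for y
        using cos_ge_minus_one[of "v * y"] cos_le_one[of "v * y"] by simp
    qed simp
    have "integrable \<nu> (\<lambda>y. sin (v * y))" by (rule integrable_const_bound[of _ 1]) auto
    then have isn: "integrable \<nu> (\<lambda>y. \<i> * complex_of_real (sin (v * y)))"
      by (intro integrable_mult_right integrable_of_real)
    have "(\<integral>y. sin (v * y) \<partial>\<nu>) = 0" by (rule odd_integral_eq_0[OF 2]) auto
    then have s0: "(\<integral>y. \<i> * complex_of_real (sin (v * y)) \<partial>\<nu>) = 0" by (simp only: integral_mult_right_zero integral_complex_of_real) simp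
    have "(\<integral>y. iexp (v * y) - 1 \<partial>\<nu>) = (\<integral>y. complex_of_real (cos (v * y) - 1) + \<i> * complex_of_real (sin (v * y)) \<partial>\<nu>)"
      by (intro Bochner_Integration.integral_cong refl) (simp add: complex_eq_iff Re_exp Im_exp)
    also have "\<dots> = (\<integral>y. complex_of_real (cos (v * y) - 1) \<partial>\<nu>)"
      by (subst Bochner_Integration.integral_add[OF ic isn]) (simp only: s0 add_0_right)
    finally show ?thesis using i0 c by simp
  next
    case 3
    have c: "centre = (\<integral>y. y \<partial>\<nu>)" "\<And>y. kern (v * y) = (iexp (v * y) - 1) - \<i> * of_real (v * y)" using 3 unfolding centre_def kern_def by auto
    have i1: "integrable \<nu> (\<lambda>y. iexp (v * y) - 1)" using ie by simp
    have "integrable \<nu> (\<lambda>y. v * y)" using integrable_id[OF 3] by simp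
    then have "integrable \<nu> (\<lambda>y. complex_of_real (v * y))" by (rule integrable_of_real)
    then have i2: "integrable \<nu> (\<lambda>y. \<i> * complex_of_real (v * y))" by (rule integrable_mult_right)
    have e1: "(\<integral>y. \<i> * complex_of_real (v * y) \<partial>\<nu>) = \<i> * of_real (v * centre)"
      by (simp only: integral_mult_right_zero integral_complex_of_real c(1))
    show ?thesis unfolding c(2)
      by (subst Bochner_Integration.integral_diff[OF i1 i2]) (simp only: i0 e1 diff_add_cancel)
  qed
qed

end

text \<open>By Skorohod's representation theorem the convergence may be assumed to hold pointwise.\<close>

lemma char_tendsto_joint:
  fixes \<mu> :: "nat \<Rightarrow> real measure"
  assumes \<mu>: "\<And>n. real_distribution (\<mu> n)" and M: "real_distribution M" and w: "weak_conv_m \<mu> M"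
    and v: "v \<longlonglongrightarrow> v0"
  shows "(\<lambda>n. char (\<mu> n) (v n)) \<longlonglongrightarrow> char M v0"
proof -
  obtain \<Omega> :: "real measure" and Y :: "nat \<Rightarrow> real \<Rightarrow> real" and Y0 where Y: "prob_space \<Omega>"
    "\<And>n. Y n \<in> borel_measurable \<Omega>" "\<And>n. distr \<Omega> borel (Y n) = \<mu> n" "Y0 \<in> measurable \<Omega> lborel" "distr \<Omega> borel Y0 = M"
    "\<And>x. x \<in> space \<Omega> \<Longrightarrow> (\<lambda>n. Y n x) \<longlonglongrightarrow> Y0 x"
    using Skorohod[OF \<mu> M w] by blast
  interpret prob_space \<Omega> by fact
  have Y0: "Y0 \<in> borel_measurable \<Omega>" using Y(4) by simp
  have c1: "char (\<mu> n) u = (\<integral>x. iexp (u * Y n x) \<partial>\<Omega>)" for n u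
    unfolding char_def Y(3)[symmetric] using Y(2) by (subst integral_distr) auto
  have c2: "char M u = (\<integral>x. iexp (u * Y0 x) \<partial>\<Omega>)" for u
    unfolding char_def Y(5)[symmetric] using Y0 by (subst integral_distr) auto
  show ?thesis
    unfolding c1 c2
  proof (rule integral_dominated_convergence[where w="\<lambda>_. 1"])
    show "AE x in \<Omega>. (\<lambda>n. iexp (v n * Y n x)) \<longlonglongrightarrow> iexp (v0 * Y0 x)"
      by (intro AE_I2 tendsto_intros v Y(6))
  qed (use Y(2) Y0 in auto)
qed

lemma (in real_distribution) tail_small:
  assumes "e > 0"
  shows "\<exists>K. \<forall>k\<ge>K. prob {x. \<bar>x\<bar> > k} < e"
proof -
  have "(\<lambda>k. prob {x. \<bar>x\<bar> > real k}) \<longlonglongrightarrow> prob (\<Inter>k. {x. \<bar>x\<bar> > real k})"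
    by (intro finite_Lim_measure_decseq) (auto simp: decseq_def)
  also have "(\<Inter>k. {x::real. \<bar>x\<bar> > real k}) = {}"
  proof (intro equals0I)
    fix x :: real assume x: "x \<in> (\<Inter>k. {x. real k < \<bar>x\<bar>})"
    obtain k where k: "\<bar>x\<bar> \<le> real k" using real_arch_simple by blast
    have "x \<in> {x. real k < \<bar>x\<bar>}" using x by blast
    with k show False by simp
  qed
  finally have "eventually (\<lambda>k. prob {x. \<bar>x\<bar> > real k} < e) sequentially"
    using assms by (intro order_tendstoD(2)) auto
  then obtain N where N: "prob {x. \<bar>x\<bar> > real N} < e" by (auto simp: eventually_sequentially)
  have "prob {x. \<bar>x\<bar> > k} < e" if "k \<ge> real N" for k
    by (rule le_less_trans[OF _ N], rule finite_measure_mono) (use that in auto)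
  then show ?thesis by blast
qed

context heavy_tail
begin

text \<open>The product of \<open>n / (a n)\<^sup>2\<close> with a truncated second moment is small by \<open>small_jumps_negligible\<close>, and
the truncated second moment is bounded below.\<close>

lemma n_over_a2_tendsto_0: "(\<lambda>n. real n / (a n)\<^sup>2) \<longlonglongrightarrow> 0"
proof -
  obtain K l where K: "l > 0" "\<And>x. x \<ge> K \<Longrightarrow> l \<le> low_moment 2 x" using low_moment_lower by blast
  show ?thesis
  proof (rule LIMSEQ_I)
    fix e :: real assume e: "e > 0"
    have pre: "real 2 > \<alpha>" "l * (e / 2) > 0" using alpha e K by auto
    obtain \<delta> where \<delta>: "\<delta> > 0"
      "\<And>\<delta>'. 0 < \<delta>' \<Longrightarrow> \<delta>' \<le> \<delta> \<Longrightarrow> eventually (\<lambda>n. real n * low_moment 2 (\<delta>' * a n) / a n ^ 2 \<le> l * (e / 2)) sequentially"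
      by (rule small_jumps_negligible[OF pre]) blast
    note \<delta>(2)[OF \<delta>(1) order_refl]
    moreover
    have "eventually (\<lambda>n. K \<le> \<delta> * a n) sequentially"
      using scaled_at_top[OF \<delta>(1)] unfolding filterlim_at_top by blast
    ultimately have "eventually (\<lambda>n. norm (real n / (a n)\<^sup>2 - 0) < e) sequentially"
    proof eventually_elim
      case (elim n)
      have "l * (real n / (a n)\<^sup>2) = real n * l / (a n)\<^sup>2" by simp
      also have "\<dots> \<le> real n * low_moment 2 (\<delta> * a n) / (a n)\<^sup>2"
        using K(2)[OF elim(2)] by (intro divide_right_mono mult_left_mono) auto
      also have "\<dots> \<le> l * (e / 2)" by (rule elim(1))
      finally have "real n / (a n)\<^sup>2 \<le> e / 2" using K(1) by (rule mult_left_le_imp_le)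
      moreover have "norm (real n / (a n)\<^sup>2 - 0) = real n / (a n)\<^sup>2" by simp
      ultimately show ?case using e by linarith
    qed
    then show "\<exists>no. \<forall>n\<ge>no. norm (real n / (a n)\<^sup>2 - 0) < e" by (simp add: eventually_sequentially)
  qed
qed

text \<open>Write \<open>z n\<close> for \<open>char \<nu> (u / a n) - 1\<close>. The power \<open>(1 + z n) ^ m n\<close> differs from
\<open>exp (m n * z n)\<close> by at most a multiple of \<open>m n * (norm (z n))\<^sup>2\<close>, which vanishes since
\<open>n / (a n)\<^sup>2\<close> does. In the exponential the centring factor cancels the drift exactly, by
\<open>char_eq_kern\<close>.\<close>

lemma char_power_tendsto:
  fixes m :: "nat \<Rightarrow> nat"
  assumes m: "(\<lambda>n. real (m n) / real n) \<longlonglongrightarrow> t"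
  shows "(\<lambda>n. char \<nu> (u / a n) ^ m n * exp (- (\<i> * of_real (u * centre / a n * real (m n))))) \<longlonglongrightarrow>
    exp (of_real t * exponent u)"
proof -
  define w where "w = (\<lambda>n. of_nat n * (\<integral>y. kern (u / a n * y) \<partial>\<nu>))"
  define z where "z = (\<lambda>n. char \<nu> (u / a n) - 1)"
  define E where "E = (\<lambda>n. exp (- (\<i> * complex_of_real (u * centre / a n * real (m n)))))"
  have wl: "w \<longlonglongrightarrow> exponent u" unfolding w_def by (rule kern_integral_tendsto)
  have zw: "z n = w n / of_nat n + \<i> * of_real (u * centre / a n)" if "n \<ge> 1" for n
    using that char_eq_kern[of "u / a n"] by (simp add: z_def w_def)
  have nE: "norm (E n) = 1" for n by (simp add: E_def norm_exp_eq_Re)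
  have z2: "norm (z n) \<le> 2" for n
    unfolding z_def using norm_triangle_ineq4[of "char \<nu> (u / a n)" 1] cmod_char_le_1[of "u / a n"] by simp
  have Re0: "Re (z n) \<le> 0" for n
    unfolding z_def using complex_Re_le_cmod[of "char \<nu> (u / a n)"] cmod_char_le_1[of "u / a n"] by simp
  have sq: "(A + B)\<^sup>2 \<le> 2 * A\<^sup>2 + 2 * B\<^sup>2" for A B :: real
    using zero_le_power2[of "A - B"] unfolding power2_diff power2_sum by linarith
  have q: "(\<lambda>n. real n * (norm (z n))\<^sup>2) \<longlonglongrightarrow> 0"
  proof (rule tendsto_sandwich)
    show "eventually (\<lambda>n. 0 \<le> real n * (norm (z n))\<^sup>2) sequentially" by (intro always_eventually allI) simp
    show "eventually (\<lambda>n. real n * (norm (z n))\<^sup>2 \<le> 2 * (norm (w n))\<^sup>2 / real n + 2 * (u * centre)\<^sup>2 * (real n / (a n)\<^sup>2)) sequentially"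
      using eventually_ge_at_top[of 1]
    proof eventually_elim
      case (elim n)
      have "norm (z n) \<le> norm (w n) / real n + \<bar>u * centre / a n\<bar>"
        using zw[OF elim] norm_triangle_ineq[of "w n / of_nat n" "\<i> * of_real (u * centre / a n)"]
        by (simp add: norm_mult norm_divide abs_mult)
      then have "(norm (z n))\<^sup>2 \<le> (norm (w n) / real n + \<bar>u * centre / a n\<bar>)\<^sup>2" by (intro power_mono) auto
      also have "\<dots> \<le> 2 * (norm (w n) / real n)\<^sup>2 + 2 * \<bar>u * centre / a n\<bar>\<^sup>2"
        by (rule sq)
      also have "\<bar>u * centre / a n\<bar>\<^sup>2 = (u * centre / a n)\<^sup>2" by (rule power2_abs)
      finally have "real n * (norm (z n))\<^sup>2 \<le> real n * (2 * (norm (w n) / real n)\<^sup>2 + 2 * (u * centre / a n)\<^sup>2)"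
        by (rule mult_left_mono) simp
      also have "\<dots> = 2 * (norm (w n))\<^sup>2 / real n + 2 * (u * centre)\<^sup>2 * (real n / (a n)\<^sup>2)"
        using elim by (simp add: field_simps power2_eq_square)
      finally show ?case .
    qed
    have "(\<lambda>n. 2 * (norm (w n))\<^sup>2 / real n) \<longlonglongrightarrow> 0"
      by (rule tendsto_divide_0[OF tendsto_mult[OF tendsto_const tendsto_power[OF tendsto_norm[OF wl]]]
            filterlim_at_top_imp_at_infinity[OF filterlim_real_sequentially]])
    moreover have "(\<lambda>n. 2 * (u * centre)\<^sup>2 * (real n / (a n)\<^sup>2)) \<longlonglongrightarrow> 0"
      by (rule tendsto_mult_right_zero[OF n_over_a2_tendsto_0])
    ultimately show "(\<lambda>n. 2 * (norm (w n))\<^sup>2 / real n + 2 * (u * centre)\<^sup>2 * (real n / (a n)\<^sup>2)) \<longlonglongrightarrow> 0"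
      by (rule tendsto_add_zero)
  qed simp
  have d0: "(\<lambda>n. (char \<nu> (u / a n) ^ m n - exp (z n) ^ m n) * E n) \<longlonglongrightarrow> 0"
  proof (rule Lim_null_comparison)
    show "eventually (\<lambda>n. norm ((char \<nu> (u / a n) ^ m n - exp (z n) ^ m n) * E n) \<le> exp 2 * (real (m n) / real n * (real n * (norm (z n))\<^sup>2))) sequentially"
      using eventually_ge_at_top[of 1]
    proof eventually_elim
      case (elim n)
      have "norm (exp (z n)) \<le> 1" using Re0[of n] by (simp add: norm_exp_eq_Re)
      then have "norm (char \<nu> (u / a n) ^ m n - exp (z n) ^ m n) \<le> real (m n) * norm (char \<nu> (u / a n) - exp (z n))"
        using cmod_char_le_1 by (intro norm_power_diff) auto
      also have "norm (char \<nu> (u / a n) - exp (z n)) = norm (exp (z n) - (\<Sum>k\<le>1. z n ^ k / fact k))"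
        by (simp add: z_def norm_minus_commute)
      also have "\<dots> \<le> exp \<bar>Re (z n)\<bar> * norm (z n) ^ Suc 1 / fact 1" by (rule Taylor_exp)
      also have "\<dots> \<le> exp 2 * (norm (z n))\<^sup>2"
      proof -
        have "\<bar>Re (z n)\<bar> \<le> 2" using abs_Re_le_cmod[of "z n"] z2[of n] by linarith
        then show ?thesis by (simp add: power2_eq_square mult_right_mono)
      qed
      finally have "norm (char \<nu> (u / a n) ^ m n - exp (z n) ^ m n) \<le> real (m n) * (exp 2 * (norm (z n))\<^sup>2)"
        by (simp add: mult_left_mono)
      then show ?case using elim by (simp add: norm_mult nE mult_ac)
    qed
    have "(\<lambda>n. exp 2 * (real (m n) / real n * (real n * (norm (z n))\<^sup>2))) \<longlonglongrightarrow> exp 2 * (t * 0)"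
      by (intro tendsto_intros m q)
    then show "(\<lambda>n. exp 2 * (real (m n) / real n * (real n * (norm (z n))\<^sup>2))) \<longlonglongrightarrow> 0" by simp
  qed
  have "(\<lambda>n. exp (of_real (real (m n) / real n) * w n)) \<longlonglongrightarrow> exp (of_real t * exponent u)"
    by (intro tendsto_intros m wl)
  then have "(\<lambda>n. exp (z n) ^ m n * E n) \<longlonglongrightarrow> exp (of_real t * exponent u)"
  proof (rule Lim_transform_eventually)
    show "eventually (\<lambda>n. exp (of_real (real (m n) / real n) * w n) = exp (z n) ^ m n * E n) sequentially"
      using eventually_ge_at_top[of 1]
    proof eventually_elim
      case (elim n)
      have "of_nat (m n) * z n + - (\<i> * complex_of_real (u * centre / a n * real (m n))) = of_real (real (m n) / real n) * w n"
        using elim by (simp add: zw algebra_simps)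
      then show ?case unfolding E_def exp_of_nat_mult[symmetric] exp_add[symmetric] by simp
    qed
  qed
  from tendsto_add[OF d0 this]
  have "(\<lambda>n. (char \<nu> (u / a n) ^ m n - exp (z n) ^ m n) * E n + exp (z n) ^ m n * E n) \<longlonglongrightarrow> exp (of_real t * exponent u)"
    by simp
  then show ?thesis by (simp add: E_def algebra_simps)
qed

text \<open>The shell where \<open>\<bar>y\<bar> / a n\<close> lies between 1 and 2 has mass of order \<open>1/n\<close>, and there \<open>1 - cos\<close> is
bounded below by \<open>1 - cos 1\<close>.\<close>

lemma Re_exponent_neg: "Re (exponent 1) < 0"
proof -
  define w where "w = (\<lambda>n. of_nat n * (\<integral>y. kern (1 / a n * y) \<partial>\<nu>))"
  have wl: "(\<lambda>n. Re (w n)) \<longlonglongrightarrow> Re (exponent 1)" unfolding w_def by (intro tendsto_intros kern_integral_tendsto)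
  define c where "c = 1 - cos (1::real)"
  have c: "c > 0"
    unfolding c_def using cos_monotone_0_pi[of 0 1] pi_gt3 by simp
  have "(\<lambda>n. - c * (real n * G (1 * a n) - real n * G (2 * a n))) \<longlonglongrightarrow> - c * (1 powr (- \<alpha>) - 2 powr (- \<alpha>))"
    by (intro tendsto_intros nG_tendsto) auto
  moreover have "eventually (\<lambda>n. Re (w n) \<le> - c * (real n * G (1 * a n) - real n * G (2 * a n))) sequentially"
    using eventually_ge_at_top[of 1]
  proof eventually_elim
    case (elim n)
    have an: "a n > 0" by (rule a_pos[OF elim])
    define J where "J = (\<lambda>y. indicator {y. \<bar>y\<bar> > 1 * a n} y - indicator {y. \<bar>y\<bar> > 2 * a n} y :: real)"
    have iJ: "integrable \<nu> J" unfolding J_def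
      by (intro Bochner_Integration.integrable_diff integrable_real_indicator) (auto simp: less_top[symmetric])
    have Rk: "Re (kern v) = cos v - 1" for v by (simp add: kern_def Re_exp)
    have ik: "integrable \<nu> (\<lambda>y. kern (1 / a n * y))" by (rule integrable_kern)
    have "Re (\<integral>y. kern (1 / a n * y) \<partial>\<nu>) = (\<integral>y. Re (kern (1 / a n * y)) \<partial>\<nu>)"
      using ik by (simp only: integral_Re)
    also have "\<dots> \<le> (\<integral>y. - c * J y \<partial>\<nu>)"
    proof (rule integral_mono)
      show "integrable \<nu> (\<lambda>y. Re (kern (1 / a n * y)))" using ik by (rule integrable_Re)
      show "integrable \<nu> (\<lambda>y. - c * J y)" using iJ by (rule integrable_mult_right)
      fix y :: real
      show "Re (kern (1 / a n * y)) \<le> - c * J y"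
      proof (cases "a n < \<bar>y\<bar> \<and> \<bar>y\<bar> \<le> 2 * a n")
        case True
        then have "J y = 1" by (simp add: J_def)
        have b: "1 \<le> \<bar>1 / a n * y\<bar>" "\<bar>1 / a n * y\<bar> \<le> 2" using True an by (auto simp: abs_mult field_simps)
        have "cos (1 / a n * y) = cos \<bar>1 / a n * y\<bar>" by (rule cos_abs_real[symmetric])
        also have "\<dots> \<le> cos 1" using b pi_gt3 by (intro cos_monotone_0_pi_le) auto
        finally show ?thesis using \<open>J y = 1\<close> by (simp add: Rk c_def)
      next
        case False
        then have "J y = 0" using an by (auto simp: J_def indicator_def)
        then show ?thesis by (simp add: Rk)
      qed
    qed
    also have "\<dots> = - c * (\<integral>y. J y \<partial>\<nu>)" by (rule integral_mult_right_zero)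
    also have "(\<integral>y. J y \<partial>\<nu>) = G (1 * a n) - G (2 * a n)"
      unfolding J_def G_def
      by (subst Bochner_Integration.integral_diff) (auto intro!: integrable_real_indicator simp: less_top[symmetric])
    finally have "real n * Re (\<integral>y. kern (1 / a n * y) \<partial>\<nu>) \<le> real n * (- c * (G (1 * a n) - G (2 * a n)))"
      by (rule mult_left_mono) simp
    then show ?case by (simp add: w_def algebra_simps)
  qed
  ultimately have "Re (exponent 1) \<le> - c * (1 powr (- \<alpha>) - 2 powr (- \<alpha>))"
    by (rule tendsto_le[OF sequentially_bot _ wl])
  moreover have "2 powr (- \<alpha>) < 2 powr (0::real)" using alpha by (intro powr_less_mono) auto
  then have "- c * (1 powr (- \<alpha>) - 2 powr (- \<alpha>)) < 0" using c by simp
  ultimately show ?thesis by linarith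
qed

text \<open>The norming sequence is an asymptotic inverse of \<open>1 / G\<close>. If \<open>a (m n)\<close> were on the wrong side of
\<open>x * a n\<close>, monotonicity of \<open>G\<close> would contradict the limits \<open>1\<close> and \<open>t * x powr (- \<alpha>)\<close> of
\<open>m n * G (a (m n))\<close> and \<open>m n * G (x * a n)\<close>.\<close>

lemma a_ratio_tendsto:
  assumes m: "(\<lambda>n. real (m n) / real n) \<longlonglongrightarrow> t" and t: "t > 0" and minf: "filterlim m at_top sequentially"
  shows "(\<lambda>n. a (m n) / a n) \<longlonglongrightarrow> t powr (1 / \<alpha>)"
proof -
  define L where "L = t powr (1 / \<alpha>)"
  have L: "L > 0" "L powr (- \<alpha>) = 1 / t"
    using t alpha by (auto simp: L_def powr_powr powr_minus field_simps)
  have lim1: "(\<lambda>n. real (m n) * G (a (m n))) \<longlonglongrightarrow> 1"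
    using filterlim_compose[OF a_norm[folded G_def] minf] by simp
  have lim2: "(\<lambda>n. real (m n) * G (x * a n)) \<longlonglongrightarrow> t * x powr (- \<alpha>)" if "x > 0" for x
  proof -
    have "(\<lambda>n. real (m n) / real n * (real n * G (x * a n))) \<longlonglongrightarrow> t * x powr (- \<alpha>)"
      by (intro tendsto_intros m nG_tendsto that)
    then show ?thesis
    proof (rule Lim_transform_eventually)
      show "eventually (\<lambda>n. real (m n) / real n * (real n * G (x * a n)) = real (m n) * G (x * a n)) sequentially"
        using eventually_ge_at_top[of 1] by eventually_elim simp
    qed
  qed
  have pos: "eventually (\<lambda>n. a (m n) > 0 \<and> a n > 0) sequentially"
  proof -
    have "eventually (\<lambda>n. m n \<ge> 1) sequentially" using minf unfolding filterlim_at_top by blast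
    then show ?thesis using eventually_ge_at_top[of 1] by eventually_elim (use a_pos in auto)
  qed
  have pw: "x powr (- \<alpha>) < y powr (- \<alpha>)" if "0 < y" "y < x" for x y
    using that alpha by (simp add: powr_less_mono2_neg)
  have "(\<lambda>n. a (m n) / a n) \<longlonglongrightarrow> L"
  proof (rule order_tendstoI)
    fix x assume x: "x < L"
    define y where "y = max x (L / 2)"
    have y: "0 < y" "y < L" "x \<le> y" using x L by (auto simp: y_def)
    have gt: "t * y powr (- \<alpha>) > 1" using pw[OF y(1,2)] L t by (simp add: field_simps)
    then obtain b where b: "1 < b" "b < t * y powr (- \<alpha>)" using dense by blast
    show "eventually (\<lambda>n. x < a (m n) / a n) sequentially"
      using order_tendstoD(2)[OF lim1 b(1)] order_tendstoD(1)[OF lim2[OF y(1)] b(2)] pos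
    proof eventually_elim
      case (elim n)
      have "y * a n < a (m n)"
      proof (rule ccontr)
        assume "\<not> ?thesis"
        then have "G (y * a n) \<le> G (a (m n))" by (intro G_antimono) simp
        then have "real (m n) * G (y * a n) \<le> real (m n) * G (a (m n))" by (intro mult_left_mono) auto
        with elim show False by linarith
      qed
      then have "y < a (m n) / a n" using elim by (simp add: field_simps)
      then show ?case using y by linarith
    qed
  next
    fix x assume x: "L < x"
    then have xpos: "x > 0" using L by simp
    have lt: "t * x powr (- \<alpha>) < 1" using pw[OF L(1) x] L t by (simp add: field_simps)
    then obtain b where b: "b < 1" "t * x powr (- \<alpha>) < b" using dense by blast
    show "eventually (\<lambda>n. a (m n) / a n < x) sequentially"
      using order_tendstoD(1)[OF lim1 b(1)] order_tendstoD(2)[OF lim2[OF xpos] b(2)] pos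
    proof eventually_elim
      case (elim n)
      have "a (m n) < x * a n"
      proof (rule ccontr)
        assume "\<not> ?thesis"
        then have "G (a (m n)) \<le> G (x * a n)" by (intro G_antimono) simp
        then have "real (m n) * G (a (m n)) \<le> real (m n) * G (x * a n)" by (intro mult_left_mono) auto
        with elim show False by linarith
      qed
      then show ?case using elim by (simp add: field_simps)
    qed
  qed
  then show ?thesis by (simp add: L_def)
qed

end

section \<open>The limit law of block sums\<close>

locale iid_heavy_tail = heavy_tail \<nu> \<alpha> a p r + S: prob_space M
  for \<nu> :: "real measure" and \<alpha> :: real and a :: "nat \<Rightarrow> real" and p r :: real and M :: "'a measure" +
  fixes \<xi> :: "nat \<Rightarrow> 'a \<Rightarrow> real"
  assumes indep: "S.indep_vars (\<lambda>_. borel) \<xi> UNIV"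
    and law: "distr M borel (\<xi> i) = \<nu>"
begin

definition block :: "nat \<Rightarrow> nat set \<Rightarrow> 'a \<Rightarrow> real" where
  "block n I \<omega> = (\<Sum>i\<in>I. (\<xi> i \<omega> - centre) / a n)"

lemma xi_measurable[measurable]: "\<xi> i \<in> borel_measurable M"
  using indep by (simp add: S.indep_vars_def)

lemma block_measurable[measurable]: "block n I \<in> borel_measurable M"
  unfolding block_def[abs_def] by measurable

lemma indep_terms: "S.indep_vars (\<lambda>_. borel) (\<lambda>i \<omega>. (\<xi> i \<omega> - centre) / a n) I"
proof -
  have "S.indep_vars (\<lambda>_. borel) \<xi> I" by (rule S.indep_vars_subset[OF indep]) simp
  then show ?thesis by (rule S.indep_vars_compose2[where Y="\<lambda>i y. (y - centre) / a n"]) measurable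
qed

lemma distr_block_real: "real_distribution (distr M borel (block n I))"
  by (rule S.real_distribution_distr) simp

lemma char_block:
  assumes "finite I"
  shows "char (distr M borel (block n I)) u = char \<nu> (u / a n) ^ card I * exp (- (\<i> * of_real (u * centre / a n * real (card I))))"
proof -
  have one: "char (distr M borel (\<lambda>\<omega>. (\<xi> i \<omega> - centre) / a n)) u = char \<nu> (u / a n) * exp (- (\<i> * of_real (u * centre / a n)))" for i
  proof -
    have "char (distr M borel (\<lambda>\<omega>. (\<xi> i \<omega> - centre) / a n)) u = (\<integral>\<omega>. iexp (u * ((\<xi> i \<omega> - centre) / a n)) \<partial>M)"
      unfolding char_def by (subst integral_distr) auto
    also have "\<dots> = (\<integral>y. iexp (u * ((y - centre) / a n)) \<partial>\<nu>)"
      unfolding law[of i, symmetric] by (subst integral_distr) auto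
    also have "\<dots> = (\<integral>y. iexp (u / a n * y) * exp (- (\<i> * of_real (u * centre / a n))) \<partial>\<nu>)"
      by (intro Bochner_Integration.integral_cong refl) (simp add: exp_add[symmetric] algebra_simps diff_divide_distrib)
    also have "\<dots> = char \<nu> (u / a n) * exp (- (\<i> * of_real (u * centre / a n)))"
      unfolding char_def by (rule integral_mult_left_zero)
    finally show ?thesis .
  qed
  have "char (distr M borel (block n I)) u = (\<Prod>i\<in>I. char (distr M borel (\<lambda>\<omega>. (\<xi> i \<omega> - centre) / a n)) u)"
    unfolding block_def[abs_def] by (rule S.char_distr_sum[OF indep_terms])
  also have "\<dots> = (char \<nu> (u / a n) * exp (- (\<i> * of_real (u * centre / a n)))) ^ card I"
    unfolding one by simp
  also have "\<dots> = char \<nu> (u / a n) ^ card I * exp (- (\<i> * of_real (u * centre / a n * real (card I))))"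
    by (simp add: power_mult_distrib exp_of_nat_mult[symmetric] algebra_simps)
  finally show ?thesis .
qed

lemma char_block_tendsto:
  assumes "\<And>n. finite (I n)" "(\<lambda>n. real (card (I n)) / real n) \<longlonglongrightarrow> t"
  shows "(\<lambda>n. char (distr M borel (block n (I n))) u) \<longlonglongrightarrow> exp (of_real t * exponent u)"
  using char_power_tendsto[OF assms(2)] by (simp only: char_block[OF assms(1)])

lemma block_eq: "block n I \<omega> = (\<Sum>i\<in>I. \<xi> i \<omega> - centre) / a n"
  by (simp add: block_def sum_divide_distrib)

lemma block_tail_raw:
  obtains C x0 where "x0 > 0" "C > 0"
    "\<And>I n K. finite I \<Longrightarrow> n \<ge> 1 \<Longrightarrow> K * a n \<ge> x0 \<Longrightarrow>
      S.prob {\<omega>\<in>space M. \<bar>block n I \<omega>\<bar> > K} \<le> C * (real (card I) * G (K * a n) + (real (card I) * G (K * a n))\<^sup>2)"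
proof -
  obtain C x0 where C: "x0 > 0" "C > 0"
    "\<And>(M :: 'a measure) (\<xi> :: nat \<Rightarrow> 'a \<Rightarrow> real) I x. prob_space M \<Longrightarrow> prob_space.indep_vars M (\<lambda>_. borel) \<xi> I \<Longrightarrow>
      (\<And>i. i \<in> I \<Longrightarrow> distr M borel (\<xi> i) = \<nu>) \<Longrightarrow> finite I \<Longrightarrow> x \<ge> x0 \<Longrightarrow>
      measure M {\<omega>\<in>space M. \<bar>\<Sum>i\<in>I. \<xi> i \<omega> - centre\<bar> > x} \<le> C * (real (card I) * G x + (real (card I) * G x)\<^sup>2)"
    by (rule sum_tail_bound) blast
  show ?thesis
  proof (rule that[OF C(1,2)])
    fix I :: "nat set" and n :: nat and K assume *: "finite I" "n \<ge> 1" "K * a n \<ge> x0"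
    have an: "a n > 0" by (rule a_pos[OF *(2)])
    have "{\<omega>\<in>space M. \<bar>block n I \<omega>\<bar> > K} = {\<omega>\<in>space M. \<bar>\<Sum>i\<in>I. \<xi> i \<omega> - centre\<bar> > K * a n}"
      using an by (auto simp: block_eq field_simps)
    moreover have "S.indep_vars (\<lambda>_. borel) \<xi> I" by (rule S.indep_vars_subset[OF indep]) simp
    ultimately show "S.prob {\<omega>\<in>space M. \<bar>block n I \<omega>\<bar> > K} \<le> C * (real (card I) * G (K * a n) + (real (card I) * G (K * a n))\<^sup>2)"
      using C(3)[OF S.prob_space_axioms _ law *(1,3)] by simp
  qed
qed

text \<open>A bound proportional to the share of the block in the time interval. The quadratic term of
\<open>sum_tail_bound\<close> is absorbed because \<open>card I \<le> n\<close>, and \<open>n * G (e * a n)\<close> is bounded.\<close>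

lemma block_tail_bound:
  assumes e: "e > 0"
  obtains C where "C > 0" "eventually (\<lambda>n. \<forall>I. finite I \<longrightarrow> card I \<le> n \<longrightarrow>
      S.prob {\<omega>\<in>space M. \<bar>block n I \<omega>\<bar> > e} \<le> C * (real (card I) / real n)) sequentially"
proof -
  obtain C x0 where C: "x0 > 0" "C > 0"
    "\<And>I n K. finite I \<Longrightarrow> n \<ge> 1 \<Longrightarrow> K * a n \<ge> x0 \<Longrightarrow>
      S.prob {\<omega>\<in>space M. \<bar>block n I \<omega>\<bar> > K} \<le> C * (real (card I) * G (K * a n) + (real (card I) * G (K * a n))\<^sup>2)"
    by (rule block_tail_raw) (rule that, assumption, assumption, simp only:)
  define g where "g = e powr (- \<alpha>) + 1"
  have g: "g > 0" unfolding g_def by (rule add_nonneg_pos) auto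
  have "eventually (\<lambda>n. real n * G (e * a n) < g) sequentially"
    by (rule order_tendstoD(2)[OF nG_tendsto[OF e]]) (simp add: g_def)
  moreover have "eventually (\<lambda>n. x0 \<le> e * a n) sequentially"
    using scaled_at_top[OF e] unfolding filterlim_at_top by blast
  ultimately have "eventually (\<lambda>n. \<forall>I. finite I \<longrightarrow> card I \<le> n \<longrightarrow>
      S.prob {\<omega>\<in>space M. \<bar>block n I \<omega>\<bar> > e} \<le> C * (g + g\<^sup>2) * (real (card I) / real n)) sequentially"
    using eventually_ge_at_top[of 1]
  proof eventually_elim
    case (elim n)
    show ?case
    proof (intro allI impI)
      fix I :: "nat set" assume I: "finite I" "card I \<le> n"
      define f where "f = real (card I) / real n"
      have f: "0 \<le> f" "f \<le> 1" using I elim by (auto simp: f_def)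
      have q: "real (card I) * G (e * a n) \<le> f * g" "0 \<le> real (card I) * G (e * a n)"
      proof -
        have "real (card I) * G (e * a n) = f * (real n * G (e * a n))" using elim by (simp add: f_def)
        also have "\<dots> \<le> f * g" using elim f by (intro mult_left_mono) auto
        finally show "real (card I) * G (e * a n) \<le> f * g" .
      qed simp
      have "(real (card I) * G (e * a n))\<^sup>2 \<le> (f * g)\<^sup>2" using q by (intro power_mono) auto
      also have "\<dots> = f * (f * g\<^sup>2)" by (simp add: power2_eq_square)
      also have "\<dots> \<le> f * (1 * g\<^sup>2)" using f by (intro mult_left_mono mult_right_mono) auto
      finally have q2: "(real (card I) * G (e * a n))\<^sup>2 \<le> f * g\<^sup>2" by simp
      have "S.prob {\<omega>\<in>space M. \<bar>block n I \<omega>\<bar> > e} \<le> C * (real (card I) * G (e * a n) + (real (card I) * G (e * a n))\<^sup>2)"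
        by (rule C(3)[OF I(1) elim(3,2)])
      also have "\<dots> \<le> C * (f * g + f * g\<^sup>2)" using q q2 C by (intro mult_left_mono add_mono) auto
      also have "\<dots> = C * (g + g\<^sup>2) * f" by (simp add: algebra_simps)
      finally show "S.prob {\<omega>\<in>space M. \<bar>block n I \<omega>\<bar> > e} \<le> C * (g + g\<^sup>2) * (real (card I) / real n)"
        by (simp add: f_def)
    qed
  qed
  moreover have "C * (g + g\<^sup>2) > 0" using C g by (simp add: add_pos_pos)
  ultimately show ?thesis using that by blast
qed

lemma distr_block_measure: "measure (distr M borel (block n I)) {x. \<bar>x\<bar> > K} = S.prob {\<omega>\<in>space M. \<bar>block n I \<omega>\<bar> > K}"
proof -
  have "measure (distr M borel (block n I)) {x. \<bar>x\<bar> > K} = S.prob (block n I -` {x. \<bar>x\<bar> > K} \<inter> space M)"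
    by (rule measure_distr) auto
  also have "block n I -` {x. \<bar>x\<bar> > K} \<inter> space M = {\<omega>\<in>space M. \<bar>block n I \<omega>\<bar> > K}" by auto
  finally show ?thesis .
qed

text \<open>The tail bound serves all large \<open>n\<close>, and the finitely many other laws have small tails
individually.\<close>

lemma tight_blocks: "tight (\<lambda>n. distr M borel (block n {..<n}))"
  unfolding tight_def
proof (intro conjI allI impI distr_block_real)
  fix e :: real assume e: "e > 0"
  define L where "L = (\<lambda>n. distr M borel (block n {..<n}))"
  have "\<exists>K. eventually (\<lambda>n. measure (L n) {x. \<bar>x\<bar> > K} < e) sequentially"
  proof -
    obtain C x0 where C: "x0 > 0" "C > 0"
      "\<And>I n K. finite I \<Longrightarrow> n \<ge> 1 \<Longrightarrow> K * a n \<ge> x0 \<Longrightarrow>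
        S.prob {\<omega>\<in>space M. \<bar>block n I \<omega>\<bar> > K} \<le> C * (real (card I) * G (K * a n) + (real (card I) * G (K * a n))\<^sup>2)"
      by (rule block_tail_raw) (rule that, assumption, assumption, simp only:)
    define d where "d = min 1 (e / (4 * C))"
    have d: "d > 0" "d \<le> 1" "4 * C * d \<le> e" using e C by (auto simp: d_def min_def field_simps)
    obtain K where K: "K > 0" "K powr (- \<alpha>) < d" using ex_powr_neg_less[OF alpha(1) d(1)] by blast
    have "eventually (\<lambda>n. x0 \<le> K * a n) sequentially"
      using scaled_at_top[OF K(1)] unfolding filterlim_at_top by blast
    with order_tendstoD(2)[OF nG_tendsto[OF K(1)] K(2)]
    have "eventually (\<lambda>n. measure (L n) {x. \<bar>x\<bar> > K} < e) sequentially"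
      using eventually_ge_at_top[of 1]
    proof eventually_elim
      case (elim n)
      define q where "q = real n * G (K * a n)"
      have q: "0 \<le> q" "q < d" using elim by (auto simp: q_def)
      have "q\<^sup>2 \<le> 1 * q" unfolding power2_eq_square using q d by (intro mult_right_mono) auto
      have "measure (L n) {x. \<bar>x\<bar> > K} \<le> C * (q + q\<^sup>2)"
        using C(3)[of "{..<n}" n K] elim by (simp add: L_def distr_block_measure q_def)
      also have "\<dots> \<le> C * (2 * q)" using \<open>q\<^sup>2 \<le> 1 * q\<close> C by (intro mult_left_mono) auto
      also have "\<dots> \<le> C * (2 * d)" using q C by (intro mult_left_mono) auto
      also have "\<dots> < 4 * C * d" using C d by simp
      finally show ?case using d by linarith
    qed
    then show ?thesis by blast
  qed
  then obtain K N where KN: "\<And>n. n \<ge> N \<Longrightarrow> measure (L n) {x. \<bar>x\<bar> > K} < e"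
    by (auto simp: eventually_sequentially)
  have "\<forall>n. \<exists>k. \<forall>k'\<ge>k. measure (L n) {x. \<bar>x\<bar> > k'} < e"
    using real_distribution.tail_small[OF distr_block_real e] by (simp add: L_def)
  then obtain k where k: "\<And>n k'. k' \<ge> k n \<Longrightarrow> measure (L n) {x. \<bar>x\<bar> > k'} < e" by metis
  define B where "B = \<bar>K\<bar> + (\<Sum>n<N. \<bar>k n\<bar>) + 1"
  have le: "measure (L n) {x. \<bar>x\<bar> > B} < e" for n
  proof (cases "n < N")
    case True
    have "k n \<le> \<bar>k n\<bar>" by simp
    also have "\<dots> \<le> (\<Sum>n<N. \<bar>k n\<bar>)" using True by (intro member_le_sum) auto
    finally show ?thesis by (intro k) (simp add: B_def)
  next
    case False
    interpret L: real_distribution "L n" unfolding L_def by (rule distr_block_real)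
    have "K \<le> B" unfolding B_def using sum_nonneg[of "{..<N}" "\<lambda>n. \<bar>k n\<bar>"] by linarith
    then have "measure (L n) {x. \<bar>x\<bar> > B} \<le> measure (L n) {x. \<bar>x\<bar> > K}"
      by (intro L.finite_measure_mono) auto
    also have "\<dots> < e" using KN False by simp
    finally show ?thesis .
  qed
  have "1 - e < measure (L n) {- (B + 1)<..B + 1}" for n
  proof -
    interpret L: real_distribution "L n" unfolding L_def by (rule distr_block_real)
    have "1 - measure (L n) {x. \<bar>x\<bar> > B} = measure (L n) (UNIV - {x. \<bar>x\<bar> > B})"
      using L.prob_compl[of "{x. \<bar>x\<bar> > B}"] by simp
    also have "\<dots> \<le> measure (L n) {- (B + 1)<..B + 1}"
      by (intro L.finite_measure_mono) auto
    finally show ?thesis using le[of n] by linarith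
  qed
  moreover have "B > 0" unfolding B_def using sum_nonneg[of "{..<N}" "\<lambda>n. \<bar>k n\<bar>"] by linarith
  ultimately show "\<exists>a b. a < b \<and> (\<forall>n. 1 - e < measure (distr M borel (block n {..<n})) {a<..b})"
    by (intro exI[of _ "- (B + 1)"] exI[of _ "B + 1"]) (auto simp: L_def)
qed

text \<open>Tightness yields a convergent subsequence, and the characteristic functions of the whole sequence
already converge.\<close>

lemma stable_law_exists:
  "\<exists>\<mu>. real_distribution \<mu> \<and> (\<forall>u. char \<mu> u = exp (exponent u))"
proof -
  obtain s \<mu> where s: "strict_mono (s :: nat \<Rightarrow> nat)" and \<mu>: "real_distribution \<mu>"
    and w: "weak_conv_m ((\<lambda>n. distr M borel (block n {..<n})) \<circ> id \<circ> s) \<mu>"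
    using tight_imp_convergent_subsubsequence[OF tight_blocks, of id] by (auto simp: strict_mono_def)
  have "char \<mu> u = exp (exponent u)" for u
  proof -
    have "(\<lambda>n. char (((\<lambda>n. distr M borel (block n {..<n})) \<circ> id \<circ> s) n) u) \<longlonglongrightarrow> char \<mu> u"
      by (rule levy_continuity1[OF _ \<mu> w]) (simp add: distr_block_real)
    moreover have "(\<lambda>n. char (distr M borel (block n {..<n})) u) \<longlonglongrightarrow> exp (of_real 1 * exponent u)"
    proof (rule char_block_tendsto)
      show "(\<lambda>n. real (card {..<n}) / real n) \<longlonglongrightarrow> 1"
        by (rule tendsto_eventually) (auto intro!: eventually_sequentiallyI[of 1])
    qed simp
    then have "(\<lambda>n. char (distr M borel (block (s n) {..<s n})) u) \<longlonglongrightarrow> exp (of_real 1 * exponent u)"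
      by (rule LIMSEQ_subseq_LIMSEQ[OF _ s, unfolded comp_def])
    ultimately show ?thesis using LIMSEQ_unique by fastforce
  qed
  with \<mu> show ?thesis by blast
qed

definition stable_law :: "real measure" where
  "stable_law = (SOME \<mu>. real_distribution \<mu> \<and> (\<forall>u. char \<mu> u = exp (exponent u)))"

lemma stable_law: "real_distribution stable_law" "char stable_law u = exp (exponent u)"
  using someI_ex[OF stable_law_exists] unfolding stable_law_def by auto

lemma floor_ratio_tendsto:
  assumes "t \<ge> 0"
  shows "(\<lambda>n. real (nat \<lfloor>real n * t\<rfloor>) / real n) \<longlonglongrightarrow> t"
proof -
  have "(\<lambda>n. of_int \<lfloor>real n * t\<rfloor> / real n) \<longlonglongrightarrow> t" by real_asymp
  moreover have "real (nat \<lfloor>real n * t\<rfloor>) = of_int \<lfloor>real n * t\<rfloor>" for n using assms by simp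
  ultimately show ?thesis by simp
qed

text \<open>The characteristic function of the sum of the first \<open>m n = \<lfloor>n * t\<rfloor>\<close> terms, divided by \<open>a n\<close>, has
two descriptions of its limit. It is \<open>exp (t * exponent u)\<close> because the block makes up the fraction
\<open>t\<close> of all terms. Dividing by \<open>a (m n)\<close> instead gives the limit law itself, and \<open>a (m n) / a n\<close>
tends to \<open>t powr (1 / \<alpha>)\<close>.\<close>

lemma exponent_scaling:
  assumes "t \<ge> 0"
  shows "exp (of_real t * exponent u) = char stable_law (t powr (1 / \<alpha>) * u)"
proof (cases "t = 0")
  case True
  interpret L: real_distribution stable_law by (rule stable_law)
  show ?thesis using True alpha by (simp add: L.char_zero)
next
  case False
  then have t: "t > 0" using assms by simp
  define m where "m = (\<lambda>n. nat \<lfloor>real n * t\<rfloor>)"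
  define L where "L = (\<lambda>n. distr M borel (block n {..<n}))"
  have m: "(\<lambda>n. real (m n) / real n) \<longlonglongrightarrow> t" unfolding m_def by (rule floor_ratio_tendsto[OF assms])
  have minf: "filterlim m at_top sequentially"
  proof -
    have "filterlim (\<lambda>n. \<lfloor>real n * t\<rfloor>) at_top sequentially"
      by (intro filterlim_compose[OF filterlim_floor_sequentially] filterlim_at_top_mult_tendsto_pos[OF tendsto_const t] filterlim_real_sequentially)
    then show ?thesis unfolding m_def by (rule filterlim_compose[OF filterlim_nat_sequentially])
  qed
  have Lchar: "(\<lambda>n. char (L n) v) \<longlonglongrightarrow> char stable_law v" for v
  proof -
    have "(\<lambda>n. char (L n) v) \<longlonglongrightarrow> exp (of_real 1 * exponent v)"
      unfolding L_def
    proof (rule char_block_tendsto)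
      show "(\<lambda>n. real (card {..<n}) / real n) \<longlonglongrightarrow> 1"
        by (rule tendsto_eventually) (auto intro!: eventually_sequentiallyI[of 1])
    qed simp
    then show ?thesis by (simp add: stable_law)
  qed
  have w: "weak_conv_m (\<lambda>n. L (m n)) stable_law"
  proof (rule levy_continuity)
    show "(\<lambda>n. char (L (m n)) v) \<longlonglongrightarrow> char stable_law v" for v
      using filterlim_compose[OF Lchar minf] .
  qed (auto simp: L_def distr_block_real stable_law)
  have "(\<lambda>n. a (m n) / a n * u) \<longlonglongrightarrow> t powr (1 / \<alpha>) * u"
    by (intro tendsto_intros a_ratio_tendsto[OF m t minf])
  from char_tendsto_joint[OF _ stable_law(1) w this]
  have 1: "(\<lambda>n. char (L (m n)) (a (m n) / a n * u)) \<longlonglongrightarrow> char stable_law (t powr (1 / \<alpha>) * u)"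
    by (simp add: L_def distr_block_real)
  have 2: "(\<lambda>n. char (distr M borel (block n {..<m n})) u) \<longlonglongrightarrow> exp (of_real t * exponent u)"
    using m by (intro char_block_tendsto) auto
  have "eventually (\<lambda>n. m n \<ge> 1) sequentially" using minf unfolding filterlim_at_top by blast
  then have "eventually (\<lambda>n. char (L (m n)) (a (m n) / a n * u) = char (distr M borel (block n {..<m n})) u) sequentially"
  proof eventually_elim
    case (elim n)
    have am: "a (m n) > 0" by (rule a_pos[OF elim])
    have "a (m n) / a n * u * block (m n) {..<m n} \<omega> = u * block n {..<m n} \<omega>" for \<omega>
      using am by (simp add: block_eq)
    then have "iexp (a (m n) / a n * u * block (m n) {..<m n} \<omega>) = iexp (u * block n {..<m n} \<omega>)" for \<omega> by (simp only:)
    then show ?case unfolding L_def char_def by (subst (1 2) integral_distr) auto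
  qed
  from Lim_transform_eventually[OF 1 this] 2 show ?thesis by (rule LIMSEQ_unique[symmetric])
qed

lemma nondegenerate_stable_law: "\<not> degenerate_distribution stable_law"
proof
  assume "degenerate_distribution stable_law"
  then obtain c where c: "stable_law = return borel c" by (auto simp: degenerate_distribution_def)
  have "char stable_law 1 = iexp c" unfolding c char_def by (subst integral_return) auto
  then have "norm (char stable_law 1) = 1" by simp
  moreover have "norm (char stable_law 1) < 1" using Re_exponent_neg by (simp add: stable_law norm_exp_eq_Re)
  ultimately show False by simp
qed

text \<open>By \<open>exponent_scaling\<close> the law with characteristic function \<open>exp (t * exponent u)\<close> is a rescaling of
the law at time 1.\<close>

definition levy_law :: "real \<Rightarrow> real measure" where
  "levy_law t = distr stable_law borel (\<lambda>x. t powr (1 / \<alpha>) * x)"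

lemma levy_law: "real_distribution (levy_law t)" 
  "t \<ge> 0 \<Longrightarrow> char (levy_law t) u = exp (of_real t * exponent u)"
proof -
  interpret L: real_distribution stable_law by (rule stable_law)
  show "real_distribution (levy_law t)" unfolding levy_law_def by (rule L.real_distribution_distr) simp
  assume "t \<ge> 0"
  have "char (levy_law t) u = char stable_law (t powr (1 / \<alpha>) * u)"
    unfolding levy_law_def char_def by (subst integral_distr) (auto simp: mult_ac)
  then show "char (levy_law t) u = exp (of_real t * exponent u)" using exponent_scaling[OF \<open>t \<ge> 0\<close>] by simp
qed

lemma levy_law_1: "levy_law 1 = stable_law"
proof -
  interpret L: real_distribution stable_law by (rule stable_law)
  have "levy_law 1 = distr stable_law borel (\<lambda>x. x)" by (simp add: levy_law_def)
  also have "\<dots> = stable_law" by (rule distr_id2) simp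
  finally show ?thesis .
qed

text \<open>With \<open>b = (b powr \<alpha>) powr (1 / \<alpha>)\<close>, the characteristic function of \<open>b * x\<close> is that of the law at time
\<open>b powr \<alpha>\<close>, and times add under convolution. The shift is 0.\<close>

lemma stable_distribution_stable_law: "stable_distribution \<alpha> stable_law"
  unfolding stable_distribution_def
proof (intro conjI stable_law(1) allI impI)
  interpret L: real_distribution stable_law by (rule stable_law)
  interpret LL: pair_prob_space stable_law stable_law ..
  fix b c :: real assume bc: "b > 0" "c > 0"
  define s where "s = (b powr \<alpha> + c powr \<alpha>) powr (1 / \<alpha>)"
  have m1: "(\<lambda>(x, y). b * x + c * y) \<in> borel_measurable (stable_law \<Otimes>\<^sub>M stable_law)" by measurable
  have "distr (stable_law \<Otimes>\<^sub>M stable_law) borel (\<lambda>(x, y). b * x + c * y) = distr stable_law borel (\<lambda>x. s * x + 0)"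
  proof (rule Levy_uniqueness)
    show "real_distribution (distr (stable_law \<Otimes>\<^sub>M stable_law) borel (\<lambda>(x, y). b * x + c * y))"
      by (rule LL.real_distribution_distr[OF m1])
    show "real_distribution (distr stable_law borel (\<lambda>x. s * x + 0))" by (rule L.real_distribution_distr) simp
    show "char (distr (stable_law \<Otimes>\<^sub>M stable_law) borel (\<lambda>(x, y). b * x + c * y)) = char (distr stable_law borel (\<lambda>x. s * x + 0))"
    proof
      fix u
      have pw: "(x powr \<alpha>) powr (1 / \<alpha>) = x" if "x > 0" for x using that alpha by (simp add: powr_powr)
      have "char (distr (stable_law \<Otimes>\<^sub>M stable_law) borel (\<lambda>(x, y). b * x + c * y)) u
          = (\<integral>z. iexp (u * (case z of (x, y) \<Rightarrow> b * x + c * y)) \<partial>(stable_law \<Otimes>\<^sub>M stable_law))"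
        unfolding char_def by (rule integral_distr[OF m1]) simp
      also have "\<dots> = (\<integral>z. (case z of (x, y) \<Rightarrow> iexp ((b * u) * x) * iexp ((c * u) * y)) \<partial>(stable_law \<Otimes>\<^sub>M stable_law))"
        by (intro Bochner_Integration.integral_cong refl) (auto simp: exp_add[symmetric] algebra_simps)
      also have "\<dots> = (\<integral>x. (\<integral>y. iexp ((b * u) * x) * iexp ((c * u) * y) \<partial>stable_law) \<partial>stable_law)"
      proof (rule LL.integral_fst[symmetric])
        show "integrable (stable_law \<Otimes>\<^sub>M stable_law) (\<lambda>(x, y). iexp ((b * u) * x) * iexp ((c * u) * y))"
          by (rule LL.integrable_const_bound[of _ 1]) (auto simp: norm_mult split_beta)
      qed
      also have "\<dots> = char stable_law (b * u) * char stable_law (c * u)"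
        unfolding char_def by simp
      also have "\<dots> = exp (of_real (b powr \<alpha>) * exponent u) * exp (of_real (c powr \<alpha>) * exponent u)"
        using exponent_scaling[of "b powr \<alpha>" u] exponent_scaling[of "c powr \<alpha>" u] bc by (simp add: pw)
      also have "\<dots> = exp (of_real (b powr \<alpha> + c powr \<alpha>) * exponent u)" by (simp add: exp_add[symmetric] algebra_simps)
      also have "\<dots> = char stable_law (s * u)" unfolding s_def by (rule exponent_scaling) (simp add: bc)
      also have "\<dots> = char (distr stable_law borel (\<lambda>x. s * x + 0)) u"
        unfolding char_def by (subst integral_distr) (auto simp: mult_ac)
      finally show "char (distr (stable_law \<Otimes>\<^sub>M stable_law) borel (\<lambda>(x, y). b * x + c * y)) u = char (distr stable_law borel (\<lambda>x. s * x + 0)) u" .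
    qed
  qed
  then show "\<exists>d. distr (stable_law \<Otimes>\<^sub>M stable_law) borel (\<lambda>(x, y). b * x + c * y) =
      distr stable_law borel (\<lambda>x. (b powr \<alpha> + c powr \<alpha>) powr (1 / \<alpha>) * x + d)"
    unfolding s_def by blast
qed

lemma block_weak_conv:
  assumes "\<And>n. finite (I n)" "(\<lambda>n. real (card (I n)) / real n) \<longlonglongrightarrow> t" "t \<ge> 0"
  shows "weak_conv_m (\<lambda>n. distr M borel (block n (I n))) (levy_law t)"
proof (rule levy_continuity)
  show "(\<lambda>n. char (distr M borel (block n (I n))) u) \<longlonglongrightarrow> char (levy_law t) u" for u
    using char_block_tendsto[OF assms(1,2)] levy_law(2)[OF assms(3)] by simp
qed (auto simp: distr_block_real levy_law)

text \<open>The bound of \<open>block_tail_bound\<close> passes to the limit along a continuous function between the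
indicator functions of \<open>\<bar>x\<bar> > e\<close> and \<open>\<bar>x\<bar> > e / 2\<close>.\<close>

lemma levy_law_tail:
  assumes e: "e > 0"
  obtains C where "C > 0" "\<And>t. 0 \<le> t \<Longrightarrow> t \<le> 1 \<Longrightarrow> measure (levy_law t) {x. \<bar>x\<bar> > e} \<le> C * t"
proof -
  have e2: "e / 2 > 0" using e by simp
  obtain C where C: "C > 0" "eventually (\<lambda>n. \<forall>I. finite I \<longrightarrow> card I \<le> n \<longrightarrow>
      S.prob {\<omega>\<in>space M. \<bar>block n I \<omega>\<bar> > e / 2} \<le> C * (real (card I) / real n)) sequentially"
    using block_tail_bound[OF e2] by blast
  show ?thesis
  proof (rule that[OF C(1)])
    fix t :: real assume t: "0 \<le> t" "t \<le> 1"
    interpret T: real_distribution "levy_law t" by (rule levy_law)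
    define I where "I = (\<lambda>n. {..<nat \<lfloor>real n * t\<rfloor>})"
    define f where "f = (\<lambda>x::real. min 1 (max 0 (2 * \<bar>x\<bar> / e - 1)))"
    have fc: "continuous_on UNIV f" unfolding f_def using e by (intro continuous_intros) auto
    have fm[measurable]: "f \<in> borel_measurable borel" using fc by (rule borel_measurable_continuous_onI)
    have f01: "0 \<le> f x" "f x \<le> 1" for x by (auto simp: f_def)
    have f1: "indicator {x. \<bar>x\<bar> > e} x \<le> f x" for x using e by (auto simp: f_def indicator_def field_simps)
    have f2: "f x \<le> indicator {x. \<bar>x\<bar> > e / 2} x" for x using e by (auto simp: f_def indicator_def field_simps)
    have r: "(\<lambda>n. real (card (I n)) / real n) \<longlonglongrightarrow> t" unfolding I_def using floor_ratio_tendsto[OF t(1)] by simp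
    have w: "weak_conv_m (\<lambda>n. distr M borel (block n (I n))) (levy_law t)"
      by (rule block_weak_conv[OF _ r t(1)]) (simp add: I_def)
    have lim: "(\<lambda>n. integral\<^sup>L (distr M borel (block n (I n))) f) \<longlonglongrightarrow> integral\<^sup>L (levy_law t) f"
    proof (rule weak_conv_imp_integral_bdd_continuous_conv[OF distr_block_real levy_law(1) w, of f 1])
      show "isCont f x" for x using fc by (simp add: continuous_on_eq_continuous_at)
      show "norm (f x) \<le> 1" for x using f01[of x] by simp
    qed
    have ub: "eventually (\<lambda>n. integral\<^sup>L (distr M borel (block n (I n))) f \<le> C * (real (card (I n)) / real n)) sequentially"
      using C(2)
    proof eventually_elim
      case (elim n)
      interpret Ln: real_distribution "distr M borel (block n (I n))" by (rule distr_block_real)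
      have "real n * t \<le> real n" using t by (simp add: mult_left_le)
      then have cI: "finite (I n)" "card (I n) \<le> n" using t by (auto simp: I_def floor_le_iff nat_le_iff)
      have "integral\<^sup>L (distr M borel (block n (I n))) f \<le> integral\<^sup>L (distr M borel (block n (I n))) (indicator {x. \<bar>x\<bar> > e / 2})"
      proof (rule integral_mono[OF _ _ f2])
        show "integrable (distr M borel (block n (I n))) f"
          by (rule Ln.integrable_const_bound[of _ 1]) (use f01 in auto)
        show "integrable (distr M borel (block n (I n))) (indicator {x. \<bar>x\<bar> > e / 2} :: real \<Rightarrow> real)"
          by (intro integrable_real_indicator) (auto simp: less_top[symmetric])
      qed
      also have "\<dots> = measure (distr M borel (block n (I n))) {x. \<bar>x\<bar> > e / 2}" by simp
      also have "\<dots> \<le> C * (real (card (I n)) / real n)"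
        using elim cI by (simp only: distr_block_measure)
      finally show ?case .
    qed
    have "(\<lambda>n. C * (real (card (I n)) / real n)) \<longlonglongrightarrow> C * t" by (intro tendsto_intros r)
    then have le: "integral\<^sup>L (levy_law t) f \<le> C * t"
      by (rule tendsto_le[OF sequentially_bot _ lim ub])
    have "measure (levy_law t) {x. \<bar>x\<bar> > e} = integral\<^sup>L (levy_law t) (indicator {x. \<bar>x\<bar> > e})" by simp
    also have "\<dots> \<le> integral\<^sup>L (levy_law t) f"
    proof (rule integral_mono[OF _ _ f1])
      show "integrable (levy_law t) f" by (rule T.integrable_const_bound[of _ 1]) (use f01 in auto)
      show "integrable (levy_law t) (indicator {x. \<bar>x\<bar> > e} :: real \<Rightarrow> real)"
        by (intro integrable_real_indicator) (auto simp: less_top[symmetric])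
    qed
    finally show "measure (levy_law t) {x. \<bar>x\<bar> > e} \<le> C * t" using le by linarith
  qed
qed

end

section \<open>Limits of independent random variables\<close>

lemma (in prob_space) indep_vars_disjoint_sums:
  fixes \<xi> :: "'i \<Rightarrow> 'a \<Rightarrow> real"
  assumes "indep_vars (\<lambda>_. borel) \<xi> I" "\<And>j. j \<in> L \<Longrightarrow> K j \<subseteq> I" "disjoint_family_on K L"
  shows "indep_vars (\<lambda>_. borel) (\<lambda>j \<omega>. \<Sum>i\<in>K j. \<xi> i \<omega>) L"
proof -
  have "indep_vars (\<lambda>j. PiM (K j) (\<lambda>_. borel)) (\<lambda>j \<omega>. restrict (\<lambda>i. \<xi> i \<omega>) (K j)) L"
    by (rule indep_vars_restrict[OF assms])
  then have "indep_vars (\<lambda>_. borel) (\<lambda>j \<omega>. \<Sum>i\<in>K j. restrict (\<lambda>i. \<xi> i \<omega>) (K j) i) L"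
    by (rule indep_vars_compose2[where Y="\<lambda>j x. \<Sum>i\<in>K j. x i"])
       (intro borel_measurable_sum measurable_component_singleton)
  then show ?thesis by simp
qed

text \<open>Continuous functions that decrease, as \<open>m\<close> grows, to the indicator function of the half-line \<open>{..0}\<close>.\<close>

definition soft_step :: "nat \<Rightarrow> real \<Rightarrow> real" where
  "soft_step m y = max 0 (min 1 (1 - real m * y))"

lemma soft_step_bounds: "0 \<le> soft_step m y" "soft_step m y \<le> 1"
  by (auto simp: soft_step_def)

lemma soft_step_continuous: "continuous_on UNIV (soft_step m)"
  unfolding soft_step_def[abs_def] by (intro continuous_intros)

lemma soft_step_measurable[measurable]: "soft_step m \<in> borel_measurable borel"
  using soft_step_continuous by (rule borel_measurable_continuous_onI)

lemma soft_step_tendsto: "(\<lambda>m. soft_step m y) \<longlonglongrightarrow> indicator {..0} y"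
proof (cases "y \<le> 0")
  case True
  then have "soft_step m y = 1" for m by (simp add: soft_step_def mult_nonneg_nonpos)
  then show ?thesis using True by simp
next
  case False
  obtain N :: nat where N: "1 / y < real N" using reals_Archimedean2 by blast
  have "soft_step m y = 0" if "m \<ge> N" for m
  proof -
    have "1 < real N * y" using N False by (simp add: field_simps)
    also have "\<dots> \<le> real m * y" using that False by (intro mult_right_mono) auto
    finally show ?thesis by (simp add: soft_step_def)
  qed
  then have "eventually (\<lambda>m. soft_step m y = 0) sequentially" by (auto simp: eventually_sequentially)
  then show ?thesis using False by (simp add: tendsto_eventually)
qed

text \<open>The product formula passes to the limit for expectations of continuous functions, and from these to
half-lines, which generate the Borel sets.\<close>

lemma (in prob_space) indep_vars_limit:
  fixes Y :: "'i \<Rightarrow> 'a \<Rightarrow> real"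
  assumes ind: "\<And>l. indep_vars (\<lambda>_. borel) (Z l) I"
    and Y: "\<And>i. i \<in> I \<Longrightarrow> Y i \<in> borel_measurable M"
    and lim: "\<And>i. i \<in> I \<Longrightarrow> AE \<omega> in M. (\<lambda>l. Z l i \<omega>) \<longlonglongrightarrow> Y i \<omega>"
  shows "indep_vars (\<lambda>_. borel) Y I"
proof -
  have Zm: "Z l i \<in> borel_measurable M" if "i \<in> I" for l i
    using ind[of l] that by (auto simp: indep_vars_def)
  have soft: "expectation (\<lambda>\<omega>. \<Prod>j\<in>J. soft_step m (Y j \<omega> - x j)) = (\<Prod>j\<in>J. expectation (\<lambda>\<omega>. soft_step m (Y j \<omega> - x j)))"
    if J: "J \<subseteq> I" "finite J" for J m x
  proof -
    have prod_bd: "norm (\<Prod>j\<in>J. soft_step m (f j)) \<le> 1" for f :: "'i \<Rightarrow> real"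
      unfolding abs_prod real_norm_def by (intro prod_le_1) (auto simp: soft_step_bounds)
    have AEj: "AE \<omega> in M. \<forall>j\<in>J. (\<lambda>l. Z l j \<omega>) \<longlonglongrightarrow> Y j \<omega>"
      using J lim by (subst AE_ball_countable) (auto intro: countable_finite)
    have cont: "(\<lambda>l. soft_step m (Z l j \<omega> - x j)) \<longlonglongrightarrow> soft_step m (Y j \<omega> - x j)"
      if "(\<lambda>l. Z l j \<omega>) \<longlonglongrightarrow> Y j \<omega>" for j \<omega>
      using that soft_step_continuous[of m]
      by (intro isCont_tendsto_compose[of _ "soft_step m"] tendsto_intros) (auto simp: continuous_on_eq_continuous_at)
    have l1: "(\<lambda>l. expectation (\<lambda>\<omega>. \<Prod>j\<in>J. soft_step m (Z l j \<omega> - x j))) \<longlonglongrightarrow> expectation (\<lambda>\<omega>. \<Prod>j\<in>J. soft_step m (Y j \<omega> - x j))"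
    proof (rule integral_dominated_convergence[where w="\<lambda>_. 1"])
      show "(\<lambda>\<omega>. \<Prod>j\<in>J. soft_step m (Y j \<omega> - x j)) \<in> borel_measurable M"
        using Y J by (intro borel_measurable_prod measurable_compose[OF _ soft_step_measurable] borel_measurable_diff) auto
      show "(\<lambda>\<omega>. \<Prod>j\<in>J. soft_step m (Z l j \<omega> - x j)) \<in> borel_measurable M" for l
        using Zm J by (intro borel_measurable_prod measurable_compose[OF _ soft_step_measurable] borel_measurable_diff) auto
      show "AE \<omega> in M. (\<lambda>l. \<Prod>j\<in>J. soft_step m (Z l j \<omega> - x j)) \<longlonglongrightarrow> (\<Prod>j\<in>J. soft_step m (Y j \<omega> - x j))"
        using AEj by eventually_elim (intro tendsto_prod cont, auto)
      show "AE \<omega> in M. norm (\<Prod>j\<in>J. soft_step m (Z l j \<omega> - x j)) \<le> 1" for l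
        by (intro AE_I2 prod_bd)
    qed simp
    have l2: "(\<lambda>l. expectation (\<lambda>\<omega>. soft_step m (Z l j \<omega> - x j))) \<longlonglongrightarrow> expectation (\<lambda>\<omega>. soft_step m (Y j \<omega> - x j))"
      if "j \<in> J" for j
    proof (rule integral_dominated_convergence[where w="\<lambda>_. 1"])
      have jI: "j \<in> I" using that J by auto
      show "(\<lambda>\<omega>. soft_step m (Y j \<omega> - x j)) \<in> borel_measurable M"
        using Y[OF jI] by (intro measurable_compose[OF _ soft_step_measurable] borel_measurable_diff) auto
      show "(\<lambda>\<omega>. soft_step m (Z l j \<omega> - x j)) \<in> borel_measurable M" for l
        using Zm[OF jI] by (intro measurable_compose[OF _ soft_step_measurable] borel_measurable_diff) auto
      show "AE \<omega> in M. (\<lambda>l. soft_step m (Z l j \<omega> - x j)) \<longlonglongrightarrow> soft_step m (Y j \<omega> - x j)"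
        using lim[OF jI] by eventually_elim (rule cont)
      show "AE \<omega> in M. norm (soft_step m (Z l j \<omega> - x j)) \<le> 1" for l
        by (intro AE_I2) (simp add: soft_step_bounds)
    qed simp
    have eq: "expectation (\<lambda>\<omega>. \<Prod>j\<in>J. soft_step m (Z l j \<omega> - x j)) = (\<Prod>j\<in>J. expectation (\<lambda>\<omega>. soft_step m (Z l j \<omega> - x j)))" for l
    proof (rule indep_vars_lebesgue_integral[OF J(2)])
      have "indep_vars (\<lambda>_. borel) (Z l) J" by (rule indep_vars_subset[OF ind J(1)])
      then show "indep_vars (\<lambda>_. borel) (\<lambda>j \<omega>. soft_step m (Z l j \<omega> - x j)) J"
        by (rule indep_vars_compose2[where Y="\<lambda>j z. soft_step m (z - x j)"]) measurable
      show "integrable M (\<lambda>\<omega>. soft_step m (Z l j \<omega> - x j))" if "j \<in> J" for j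
        using Zm[of j l] that J
        by (intro integrable_const_bound[of _ 1] measurable_compose[OF _ soft_step_measurable] borel_measurable_diff)
           (auto simp: soft_step_bounds)
    qed
    from l1 have "(\<lambda>l. \<Prod>j\<in>J. expectation (\<lambda>\<omega>. soft_step m (Z l j \<omega> - x j))) \<longlonglongrightarrow> expectation (\<lambda>\<omega>. \<Prod>j\<in>J. soft_step m (Y j \<omega> - x j))"
      unfolding eq .
    moreover have "(\<lambda>l. \<Prod>j\<in>J. expectation (\<lambda>\<omega>. soft_step m (Z l j \<omega> - x j))) \<longlonglongrightarrow> (\<Prod>j\<in>J. expectation (\<lambda>\<omega>. soft_step m (Y j \<omega> - x j)))"
      by (intro tendsto_prod l2)
    ultimately show ?thesis by (rule LIMSEQ_unique)
  qed
  have cdf: "prob {\<omega>\<in>space M. \<forall>j\<in>J. Y j \<omega> \<le> x j} = (\<Prod>j\<in>J. prob {\<omega>\<in>space M. Y j \<omega> \<le> x j})"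
    if J: "J \<subseteq> I" "finite J" for J x
  proof -
    have Em: "{\<omega>\<in>space M. Y j \<omega> \<le> x j} \<in> events" if "j \<in> J" for j
      using Y that J by (auto intro!: borel_measurable_le)
    have ind0: "indicator {..0} (Y j \<omega> - x j) = (indicator {\<omega>\<in>space M. Y j \<omega> \<le> x j} \<omega> :: real)" if "\<omega> \<in> space M" for j \<omega>
      using that by (auto simp: indicator_def)
    have Ej: "{\<omega>\<in>space M. \<forall>j\<in>J. Y j \<omega> \<le> x j} \<in> events"
      using Em J by (intro sets.sets_Collect_finite_All) auto
    have prodind: "(\<Prod>j\<in>J. indicator {..0} (Y j \<omega> - x j)) = (indicator {\<omega>\<in>space M. \<forall>j\<in>J. Y j \<omega> \<le> x j} \<omega> :: real)" if "\<omega> \<in> space M" for \<omega>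
      using that J(2) by (auto simp: indicator_def prod_zero_iff split: if_splits)
    have prod_bd: "norm (\<Prod>j\<in>J. soft_step m (f j)) \<le> 1" for m and f :: "'i \<Rightarrow> real"
      unfolding abs_prod real_norm_def by (intro prod_le_1) (auto simp: soft_step_bounds)
    have "(\<lambda>m. expectation (\<lambda>\<omega>. \<Prod>j\<in>J. soft_step m (Y j \<omega> - x j))) \<longlonglongrightarrow> expectation (indicator {\<omega>\<in>space M. \<forall>j\<in>J. Y j \<omega> \<le> x j})"
    proof (rule integral_dominated_convergence[where w="\<lambda>_. 1"])
      show "(\<lambda>\<omega>. \<Prod>j\<in>J. soft_step m (Y j \<omega> - x j)) \<in> borel_measurable M" for m
        using Y J by (intro borel_measurable_prod measurable_compose[OF _ soft_step_measurable] borel_measurable_diff) auto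
      show "AE \<omega> in M. (\<lambda>m. \<Prod>j\<in>J. soft_step m (Y j \<omega> - x j)) \<longlonglongrightarrow> indicator {\<omega>\<in>space M. \<forall>j\<in>J. Y j \<omega> \<le> x j} \<omega>"
      proof (rule AE_I2)
        fix \<omega> assume "\<omega> \<in> space M"
        then show "(\<lambda>m. \<Prod>j\<in>J. soft_step m (Y j \<omega> - x j)) \<longlonglongrightarrow> indicator {\<omega>\<in>space M. \<forall>j\<in>J. Y j \<omega> \<le> x j} \<omega>"
          by (subst prodind[symmetric], assumption) (intro tendsto_prod soft_step_tendsto)
      qed
      show "AE \<omega> in M. norm (\<Prod>j\<in>J. soft_step m (Y j \<omega> - x j)) \<le> 1" for m
        by (intro AE_I2 prod_bd)
    qed (use Ej in auto)
    then have l1: "(\<lambda>m. expectation (\<lambda>\<omega>. \<Prod>j\<in>J. soft_step m (Y j \<omega> - x j))) \<longlonglongrightarrow> prob {\<omega>\<in>space M. \<forall>j\<in>J. Y j \<omega> \<le> x j}"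
      using Ej by simp
    have "(\<lambda>m. expectation (\<lambda>\<omega>. soft_step m (Y j \<omega> - x j))) \<longlonglongrightarrow> expectation (indicator {\<omega>\<in>space M. Y j \<omega> \<le> x j})" if "j \<in> J" for j
    proof (rule integral_dominated_convergence[where w="\<lambda>_. 1"])
      have jI: "j \<in> I" using that J by auto
      show "(\<lambda>\<omega>. soft_step m (Y j \<omega> - x j)) \<in> borel_measurable M" for m
        using Y[OF jI] by (intro measurable_compose[OF _ soft_step_measurable] borel_measurable_diff) auto
      show "AE \<omega> in M. (\<lambda>m. soft_step m (Y j \<omega> - x j)) \<longlonglongrightarrow> indicator {\<omega>\<in>space M. Y j \<omega> \<le> x j} \<omega>"
      proof (rule AE_I2)
        fix \<omega> assume "\<omega> \<in> space M"
        then show "(\<lambda>m. soft_step m (Y j \<omega> - x j)) \<longlonglongrightarrow> indicator {\<omega>\<in>space M. Y j \<omega> \<le> x j} \<omega>"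
          by (subst ind0[symmetric], assumption) (rule soft_step_tendsto)
      qed
      show "AE \<omega> in M. norm (soft_step m (Y j \<omega> - x j)) \<le> 1" for m
        by (intro AE_I2) (simp add: soft_step_bounds)
    qed (use Em that in auto)
    then have "(\<lambda>m. expectation (\<lambda>\<omega>. soft_step m (Y j \<omega> - x j))) \<longlonglongrightarrow> prob {\<omega>\<in>space M. Y j \<omega> \<le> x j}" if "j \<in> J" for j
      using Em that by simp
    then have "(\<lambda>m. \<Prod>j\<in>J. expectation (\<lambda>\<omega>. soft_step m (Y j \<omega> - x j))) \<longlonglongrightarrow> (\<Prod>j\<in>J. prob {\<omega>\<in>space M. Y j \<omega> \<le> x j})"
      by (intro tendsto_prod)
    with l1 show ?thesis unfolding soft[OF J] by (rule LIMSEQ_unique)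
  qed
  define E where "E = (\<lambda>i. {Y i -` A \<inter> space M |A. A \<in> range (\<lambda>x::real. {..x})})"
  have "indep_sets E I"
  proof (rule indep_setsI)
    show "E i \<subseteq> events" if "i \<in> I" for i using Y[OF that] by (auto simp: E_def)
    fix A J assume J: "J \<noteq> {}" "J \<subseteq> I" "finite J" "\<forall>j\<in>J. A j \<in> E j"
    have "\<forall>j\<in>J. \<exists>x. A j = {\<omega>\<in>space M. Y j \<omega> \<le> x}" using J(4) by (fastforce simp: E_def)
    then obtain x where x: "\<And>j. j \<in> J \<Longrightarrow> A j = {\<omega>\<in>space M. Y j \<omega> \<le> x j}" by metis
    have "(\<Inter>j\<in>J. A j) = {\<omega>\<in>space M. \<forall>j\<in>J. Y j \<omega> \<le> x j}" using x J(1) by auto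
    then show "prob (\<Inter>j\<in>J. A j) = (\<Prod>j\<in>J. prob (A j))" using cdf[OF J(2,3), of x] x by simp
  qed
  then have "indep_sets (\<lambda>i. sigma_sets (space M) (E i)) I"
  proof (rule indep_sets_sigma)
    fix i assume "i \<in> I"
    show "Int_stable (E i)"
    proof (rule Int_stableI)
      fix a b assume "a \<in> E i" "b \<in> E i"
      then obtain x y where "a = Y i -` {..x} \<inter> space M" "b = Y i -` {..y} \<inter> space M" by (auto simp: E_def)
      then have "a \<inter> b = Y i -` {..min x y} \<inter> space M" by auto
      then show "a \<inter> b \<in> E i" by (auto simp: E_def)
    qed
  qed
  moreover have "sigma_sets (space M) (E i) = sigma_sets (space M) {Y i -` A \<inter> space M |A. A \<in> sets borel}" for i
  proof -
    have "{Y i -` A \<inter> space M |A. A \<in> sets borel} = {Y i -` A \<inter> space M |A. A \<in> sigma_sets UNIV (range (\<lambda>x::real. {..x}))}"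
      by (subst borel_eq_atMost) simp
    also have "\<dots> = sigma_sets (space M) (E i)"
      unfolding E_def by (rule sigma_sets_vimage_commute) simp
    finally have "{Y i -` A \<inter> space M |A. A \<in> sets borel} = sigma_sets (space M) (E i)" .
    moreover have "sigma_sets (space M) (sigma_sets (space M) (E i)) = sigma_sets (space M) (E i)"
      by (rule sigma_sets_sigma_sets_eq) (auto simp: E_def)
    ultimately show ?thesis by simp
  qed
  ultimately show ?thesis unfolding indep_vars_def using Y by simp
qed

section \<open>Levy processes from convolution semigroups\<close>

text \<open>The tail condition is what \<open>two_big_blocks_bound\<close> requires: two large increments within an interval of
length \<open>h\<close> have probability of order \<open>h\<^sup>2\<close>, so that the total over the \<open>1/h\<close> intervals of a partition
of the unit interval vanishes with \<open>h\<close>.\<close>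

locale convolution_semigroup =
  fixes \<mu> :: "real \<Rightarrow> real measure" and \<Psi> :: "real \<Rightarrow> complex"
  assumes real_distr: "real_distribution (\<mu> t)"
    and char_law: "t \<ge> 0 \<Longrightarrow> char (\<mu> t) u = exp (of_real t * \<Psi> u)"
    and tail: "e > 0 \<Longrightarrow> \<exists>C>0. \<forall>t\<in>{0..1}. measure (\<mu> t) {x. \<bar>x\<bar> > e} \<le> C * t"
begin

lemma law_unique:
  assumes "real_distribution \<nu>" "t \<ge> 0" "\<And>u. char \<nu> u = exp (of_real t * \<Psi> u)"
  shows "\<nu> = \<mu> t"
  by (rule Levy_uniqueness[OF assms(1) real_distr]) (use assms char_law in auto)

text \<open>The law of an increment over an interval of the dyadic grid of level \<open>k\<close>, and the joint law of all
increments over this grid.\<close>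

definition step :: "nat \<Rightarrow> real measure" where "step k = \<mu> (1 / 2 ^ k)"

definition noise :: "nat \<Rightarrow> (nat \<Rightarrow> real) measure" where "noise k = PiM UNIV (\<lambda>_. step k)"

lemma step_real: "real_distribution (step k)"
  unfolding step_def by (rule real_distr)

lemma product_step: "product_prob_space (\<lambda>_::nat. step k)"
  by (intro product_prob_spaceI real_distribution.axioms(1) step_real)

lemma prob_space_noise: "prob_space (noise k)"
  unfolding noise_def by (intro prob_space_PiM real_distribution.axioms(1) step_real)

lemma sets_step [measurable_cong]: "sets (step k) = sets borel"
  using real_distribution.events_eq_borel[OF step_real] .

lemma sets_noise [measurable_cong]: "sets (noise k) = sets (PiM UNIV (\<lambda>_. borel))"
  unfolding noise_def by (intro sets_PiM_cong refl sets_step)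

lemma space_noise [simp]: "space (noise k) = UNIV"
  using sets_eq_imp_space_eq[OF sets_noise[of k]] by (simp add: space_PiM)

lemma distr_coord: "distr (noise k) borel (\<lambda>y. y i) = step k"
proof -
  have "distr (noise k) borel (\<lambda>y. y i) = distr (noise k) (step k) (\<lambda>y. y i)"
    by (rule distr_cong) (auto simp: sets_step)
  also have "\<dots> = step k"
    unfolding noise_def by (rule distr_PiM_component) (auto intro: real_distribution.axioms(1) step_real)
  finally show ?thesis .
qed

lemma indep_coords: "prob_space.indep_vars (noise k) (\<lambda>_. borel) (\<lambda>i y. y i) UNIV"
proof -
  interpret prob_space "noise k" by (rule prob_space_noise)
  have "distr (noise k) (PiM UNIV (\<lambda>_. borel)) (\<lambda>y. \<lambda>i\<in>UNIV. y i) = noise k"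
    unfolding restrict_UNIV by (rule distr_id2) (simp add: sets_noise)
  also have "noise k = PiM UNIV (\<lambda>i. distr (noise k) borel (\<lambda>y. y i))"
    unfolding distr_coord by (rule noise_def)
  finally show ?thesis
    by (subst indep_vars_iff_distr_eq_PiM) auto
qed

lemma char_sum_law:
  assumes "prob_space N" "prob_space.indep_vars N (\<lambda>_. borel) X A" "finite A" "\<And>i. i \<in> A \<Longrightarrow> distr N borel (X i) = step k"
  shows "distr N borel (\<lambda>\<omega>. \<Sum>i\<in>A. X i \<omega>) = \<mu> (real (card A) / 2 ^ k)"
proof -
  interpret prob_space N by fact
  have Xm: "X i \<in> borel_measurable N" if "i \<in> A" for i using assms(2) that by (auto simp: indep_vars_def)
  show ?thesis
  proof (rule law_unique)
    show "real_distribution (distr N borel (\<lambda>\<omega>. \<Sum>i\<in>A. X i \<omega>))"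
      using Xm by (intro real_distribution_distr borel_measurable_sum)
    fix u
    have "char (distr N borel (\<lambda>\<omega>. \<Sum>i\<in>A. X i \<omega>)) u = (\<Prod>i\<in>A. char (distr N borel (X i)) u)"
      by (rule char_distr_sum[OF assms(2)])
    also have "\<dots> = (\<Prod>i\<in>A. exp (of_real (1 / 2 ^ k) * \<Psi> u))"
      using assms(4) by (intro prod.cong refl) (simp add: step_def char_law)
    also have "\<dots> = exp (of_real (real (card A) / 2 ^ k) * \<Psi> u)"
      by (simp add: exp_of_nat_mult[symmetric])
    finally show "char (distr N borel (\<lambda>\<omega>. \<Sum>i\<in>A. X i \<omega>)) u = exp (of_real (real (card A) / 2 ^ k) * \<Psi> u)" .
  qed simp
qed

text \<open>Adding neighbouring increments of a grid gives the increments of the next coarser grid; this is the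
consistency behind Kolmogorov's theorem.\<close>

lemma noise_coarsen:
  "distr (noise (Suc k)) (PiM UNIV (\<lambda>_. borel)) (\<lambda>y i. y (2 * i) + y (Suc (2 * i))) = noise k"
proof -
  interpret prob_space "noise (Suc k)" by (rule prob_space_noise)
  define K where "K = (\<lambda>i::nat. {2 * i, Suc (2 * i)})"
  have sumK: "(\<Sum>j\<in>K i. y j) = y (2 * i) + y (Suc (2 * i))" for i and y :: "nat \<Rightarrow> real" by (simp add: K_def)
  have disj: "disjoint_family_on K UNIV" unfolding disjoint_family_on_def K_def by auto
  have ind: "indep_vars (\<lambda>_. borel) (\<lambda>i y. \<Sum>j\<in>K i. y j) UNIV"
    by (rule indep_vars_disjoint_sums[OF indep_coords _ disj]) simp
  have law: "distr (noise (Suc k)) borel (\<lambda>y. \<Sum>j\<in>K i. y j) = step k" for i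
  proof -
    have "distr (noise (Suc k)) borel (\<lambda>y. \<Sum>j\<in>K i. y j) = \<mu> (real (card (K i)) / 2 ^ Suc k)"
      by (intro char_sum_law prob_space_noise indep_vars_subset[OF indep_coords] distr_coord) (auto simp: K_def)
    also have "card (K i) = 2" by (simp add: K_def)
    finally show ?thesis by (simp add: step_def)
  qed
  have "distr (noise (Suc k)) (PiM UNIV (\<lambda>_. borel)) (\<lambda>y. \<lambda>i\<in>UNIV. \<Sum>j\<in>K i. y j) = PiM UNIV (\<lambda>i. distr (noise (Suc k)) borel (\<lambda>y. \<Sum>j\<in>K i. y j))"
    by (subst indep_vars_iff_distr_eq_PiM[symmetric]) (auto intro!: ind borel_measurable_sum)
  then show ?thesis unfolding law unfolding restrict_UNIV sumK by (simp only: noise_def)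
qed

definition level :: "nat \<Rightarrow> real set" where "level k = {real j / 2 ^ k | j. True}"

definition dyadics :: "real set" where "dyadics = (\<Union>k. level k)"

definition walk :: "nat \<Rightarrow> (nat \<Rightarrow> real) \<Rightarrow> real \<Rightarrow> real" where
  "walk k y q = (\<Sum>i<nat \<lfloor>2 ^ k * q\<rfloor>. y i)"

lemma level_Suc: "level k \<subseteq> level (Suc k)"
proof
  fix x assume "x \<in> level k"
  then obtain j where "x = real j / 2 ^ k" by (auto simp: level_def)
  then have "x = real (2 * j) / 2 ^ Suc k" by simp
  then show "x \<in> level (Suc k)" unfolding level_def by blast
qed

lemma level_mono: "k \<le> l \<Longrightarrow> level k \<subseteq> level l"
  by (rule lift_Suc_mono_le[of level]) (use level_Suc in auto)

lemma finite_in_level: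
  assumes "finite J" "J \<subseteq> dyadics"
  shows "\<exists>k. J \<subseteq> level k"
  using assms
proof (induction J)
  case (insert x J)
  then obtain k l where kl: "J \<subseteq> level k" "x \<in> level l" by (auto simp: dyadics_def)
  then have "insert x J \<subseteq> level (max k l)" using level_mono[of k "max k l"] level_mono[of l "max k l"] by auto
  then show ?case by blast
qed auto

lemma walk_level: "walk k y (real j / 2 ^ k) = (\<Sum>i<j. y i)"
  by (simp add: walk_def)

lemma walk_coarsen:
  assumes "q \<in> level k"
  shows "walk k (\<lambda>i. y (2 * i) + y (Suc (2 * i))) q = walk (Suc k) y q"
proof -
  obtain j where j: "q = real j / 2 ^ k" using assms by (auto simp: level_def)
  then have j2: "q = real (2 * j) / 2 ^ Suc k" by simp
  have "(\<Sum>i<j. y (2 * i) + y (Suc (2 * i))) = (\<Sum>i<2 * j. y i)" by (induction j) auto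
  then show ?thesis using walk_level[of k _ j] walk_level[of "Suc k" _ "2 * j"] j j2 by metis
qed

lemma walk_measurable: "(\<lambda>y. walk k y q) \<in> borel_measurable (PiM UNIV (\<lambda>_. borel))"
  unfolding walk_def by (intro borel_measurable_sum measurable_component_singleton) simp

lemma walk_restrict_measurable: "(\<lambda>y. \<lambda>q\<in>J. walk k y q) \<in> PiM UNIV (\<lambda>_. borel) \<rightarrow>\<^sub>M PiM J (\<lambda>_. borel)"
  by (intro measurable_restrict walk_measurable)

definition grid_law :: "nat \<Rightarrow> real set \<Rightarrow> (real \<Rightarrow> real) measure" where
  "grid_law k J = distr (noise k) (PiM J (\<lambda>_. borel)) (\<lambda>y. \<lambda>q\<in>J. walk k y q)"

lemma grid_law_Suc:
  assumes "J \<subseteq> level k"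
  shows "grid_law (Suc k) J = grid_law k J"
proof -
  define c where "c = (\<lambda>(y::nat \<Rightarrow> real) i. y (2 * i) + y (Suc (2 * i)))"
  have cm: "c \<in> noise (Suc k) \<rightarrow>\<^sub>M PiM UNIV (\<lambda>_. borel)"
    unfolding c_def by (intro measurable_PiM_single') (auto intro!: borel_measurable_add)
  have "grid_law k J = distr (distr (noise (Suc k)) (PiM UNIV (\<lambda>_. borel)) c) (PiM J (\<lambda>_. borel)) (\<lambda>y. \<lambda>q\<in>J. walk k y q)"
    unfolding grid_law_def c_def noise_coarsen ..
  also have "\<dots> = distr (noise (Suc k)) (PiM J (\<lambda>_. borel)) ((\<lambda>y. \<lambda>q\<in>J. walk k y q) \<circ> c)"
    by (rule distr_distr[OF walk_restrict_measurable cm])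
  also have "(\<lambda>y. \<lambda>q\<in>J. walk k y q) \<circ> c = (\<lambda>y. \<lambda>q\<in>J. walk (Suc k) y q)"
    unfolding comp_def c_def by (intro ext restrict_ext walk_coarsen) (use assms in auto)
  finally show ?thesis unfolding grid_law_def by (rule sym)
qed

lemma grid_law_mono:
  assumes "J \<subseteq> level k" "k \<le> l"
  shows "grid_law l J = grid_law k J"
  using assms(2)
proof (induction l rule: dec_induct)
  case (step l)
  then have "J \<subseteq> level l" using assms level_mono[of k l] by auto
  then show ?case using grid_law_Suc step by simp
qed simp

lemma noise_measurable: "f \<in> PiM UNIV (\<lambda>_. borel) \<rightarrow>\<^sub>M L \<Longrightarrow> f \<in> noise k \<rightarrow>\<^sub>M L"
  by (simp cong: measurable_cong_sets add: sets_noise)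

text \<open>By \<open>fdd_eq\<close> every grid that contains \<open>J\<close> produces the same law.\<close>

definition fdd :: "real set \<Rightarrow> (real \<Rightarrow> real) measure" where
  "fdd J = grid_law (LEAST k. J \<subseteq> level k) J"

lemma fdd_eq:
  assumes "finite J" "J \<subseteq> level k"
  shows "fdd J = grid_law k J"
proof -
  have "J \<subseteq> level (LEAST k. J \<subseteq> level k)" by (rule LeastI[of _ k]) (rule assms)
  moreover have "(LEAST k. J \<subseteq> level k) \<le> k" by (rule Least_le) (rule assms)
  ultimately show ?thesis unfolding fdd_def by (rule grid_law_mono[symmetric])
qed

lemma projective: "projective_family dyadics fdd (\<lambda>_. borel)"
proof (unfold projective_family_def, intro conjI allI impI)
  fix J H :: "real set" assume JH: "J \<subseteq> H" "finite H" "H \<subseteq> dyadics"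
  obtain k where k: "H \<subseteq> level k" using finite_in_level JH by blast
  have rm: "(\<lambda>f. restrict f J) \<in> PiM H (\<lambda>_. borel) \<rightarrow>\<^sub>M PiM J (\<lambda>_. borel::real measure)"
    using JH by (intro measurable_restrict_subset)
  have "distr (fdd H) (PiM J (\<lambda>_. borel)) (\<lambda>f. restrict f J) = distr (noise k) (PiM J (\<lambda>_. borel)) ((\<lambda>f. restrict f J) \<circ> (\<lambda>y. \<lambda>q\<in>H. walk k y q))"
    unfolding fdd_eq[OF JH(2) k] grid_law_def by (rule distr_distr[OF rm noise_measurable[OF walk_restrict_measurable]])
  also have "(\<lambda>f. restrict f J) \<circ> (\<lambda>y. \<lambda>q\<in>H. walk k y q) = (\<lambda>y. \<lambda>q\<in>J. walk k y q)"
    unfolding comp_def using JH by (intro ext) (auto simp: restrict_def)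
  also have "distr (noise k) (PiM J (\<lambda>_. borel)) (\<lambda>y. \<lambda>q\<in>J. walk k y q) = fdd J"
    using fdd_eq[of J k] JH k finite_subset[OF JH(1,2)] unfolding grid_law_def by simp
  finally show "fdd J = distr (fdd H) (PiM J (\<lambda>_. borel)) (\<lambda>f. restrict f J)" by (rule sym)
next
  fix J :: "real set" assume "finite J" "J \<subseteq> dyadics"
  show "prob_space (fdd J)"
    unfolding fdd_def grid_law_def
    by (intro prob_space.prob_space_distr prob_space_noise noise_measurable walk_restrict_measurable)
qed

sublocale PP: polish_projective dyadics fdd
  by (intro polish_projective.intro projective)

definition path_space :: "(real \<Rightarrow> real) measure" where "path_space = PP.lim"

lemma sets_path_space [measurable_cong]: "sets path_space = sets (PiM dyadics (\<lambda>_. borel))"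
  unfolding path_space_def by (rule PP.sets_lim)

lemma space_path_space: "space path_space = space (PiM dyadics (\<lambda>_. borel))"
  by (rule sets_eq_imp_space_eq[OF sets_path_space])

lemma distr_path_restrict:
  assumes J: "finite J" "J \<subseteq> dyadics"
  shows "distr path_space (PiM J (\<lambda>_. borel)) (\<lambda>x. restrict x J) = fdd J"
proof (rule measure_eqI)
  show "sets (distr path_space (PiM J (\<lambda>_. borel)) (\<lambda>x. restrict x J)) = sets (fdd J)"
    using PP.sets_P[OF J] by simp
  fix A assume "A \<in> sets (distr path_space (PiM J (\<lambda>_. borel)) (\<lambda>x. restrict x J))"
  then have A: "A \<in> sets (PiM J (\<lambda>_. borel))" by simp
  have rm: "(\<lambda>x. restrict x J) \<in> path_space \<rightarrow>\<^sub>M PiM J (\<lambda>_. borel)"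
    using measurable_restrict_subset[OF J(2)] by (simp cong: measurable_cong_sets add: sets_path_space)
  have "emeasure (distr path_space (PiM J (\<lambda>_. borel)) (\<lambda>x. restrict x J)) A = emeasure path_space ((\<lambda>x. restrict x J) -` A \<inter> space path_space)"
    by (rule emeasure_distr[OF rm A])
  also have "(\<lambda>x. restrict x J) -` A \<inter> space path_space = prod_emb dyadics (\<lambda>_. borel) J A"
    unfolding prod_emb_def space_path_space space_PiM by simp
  also have "emeasure path_space \<dots> = emeasure (fdd J) A"
    unfolding path_space_def by (rule PP.emeasure_lim_emb[OF J(2,1) A])
  finally show "emeasure (distr path_space (PiM J (\<lambda>_. borel)) (\<lambda>x. restrict x J)) A = emeasure (fdd J) A" .
qed

lemma prob_space_path: "prob_space path_space"
proof (rule prob_spaceI)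
  have "emeasure (distr path_space (PiM {} (\<lambda>_. borel)) (\<lambda>x. restrict x {})) (space (PiM {} (\<lambda>_. borel))) = 
    emeasure path_space ((\<lambda>x. restrict x {}) -` space (PiM {} (\<lambda>_. borel)) \<inter> space path_space)"
    by (rule emeasure_distr) auto
  also have "(\<lambda>x. restrict x {}) -` space (PiM {} (\<lambda>_. borel)) \<inter> space path_space = space path_space"
    by (auto simp: space_PiM)
  also have "distr path_space (PiM {} (\<lambda>_. borel)) (\<lambda>x. restrict x {}) = fdd {}"
    by (rule distr_path_restrict) auto
  also have "emeasure (fdd {}) (space (PiM {} (\<lambda>_. borel))) = 1"
  proof -
    have "prob_space (fdd {})" by (rule PP.prob_space_P) auto
    then show ?thesis using prob_space.emeasure_space_1[of "fdd {}"] PP.space_P[of "{}"] by simp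
  qed
  finally show "emeasure path_space (space path_space) = 1" by simp
qed

text \<open>The increments of a path over the grid of level \<open>k\<close>; they are independent with law \<open>step k\<close> by
\<open>distr_incr\<close>.\<close>

definition incr :: "nat \<Rightarrow> nat \<Rightarrow> (real \<Rightarrow> real) \<Rightarrow> real" where
  "incr k i x = x (real (Suc i) / 2 ^ k) - x (real i / 2 ^ k)"

lemma level_memI [simp]: "real j / 2 ^ k \<in> level k"
  by (auto simp: level_def)

lemma level_dyadics: "level k \<subseteq> dyadics"
  by (auto simp: dyadics_def)

lemma grid_dyadics: "real j / 2 ^ k \<in> dyadics"
  using level_dyadics level_memI by (rule subsetD)

lemma path_coord_measurable: "q \<in> dyadics \<Longrightarrow> (\<lambda>x. x q) \<in> borel_measurable path_space"
  using measurable_component_singleton[of q dyadics "\<lambda>_. borel"] by (simp cong: measurable_cong_sets add: sets_path_space)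

lemma incr_measurable: "incr k i \<in> borel_measurable path_space"
  unfolding incr_def[abs_def]
  by (intro borel_measurable_diff path_coord_measurable grid_dyadics)

lemma distr_incr:
  "distr path_space (PiM {..<m} (\<lambda>_. borel)) (\<lambda>x. \<lambda>i\<in>{..<m}. incr k i x) = PiM {..<m} (\<lambda>_. step k)"
proof -
  define J where "J = (\<lambda>i. real i / 2 ^ k) ` {..m}"
  have J: "finite J" "J \<subseteq> level k" "J \<subseteq> dyadics" using level_dyadics[of k] by (auto simp: J_def)
  define D where "D = (\<lambda>x. \<lambda>i\<in>{..<m}. incr k i x)"
  have inJ: "real i / 2 ^ k \<in> J" if "i \<le> m" for i using that by (auto simp: J_def)
  have Dm: "D \<in> PiM J (\<lambda>_. borel) \<rightarrow>\<^sub>M PiM {..<m} (\<lambda>_. borel)"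
    unfolding D_def incr_def
    by (intro measurable_restrict borel_measurable_diff measurable_component_singleton inJ) auto
  have rm: "(\<lambda>x. restrict x J) \<in> path_space \<rightarrow>\<^sub>M PiM J (\<lambda>_. borel)"
    using measurable_restrict_subset[OF J(3)] by (simp cong: measurable_cong_sets add: sets_path_space)
  have "D = D \<circ> (\<lambda>x. restrict x J)"
  proof
    fix x
    show "D x = (D \<circ> (\<lambda>x. restrict x J)) x"
      unfolding D_def comp_def incr_def using inJ
      by (intro restrict_ext) (simp del: of_nat_Suc)
  qed
  then have "distr path_space (PiM {..<m} (\<lambda>_. borel)) D = distr path_space (PiM {..<m} (\<lambda>_. borel)) (D \<circ> (\<lambda>x. restrict x J))" by simp
  also have "\<dots> = distr (distr path_space (PiM J (\<lambda>_. borel)) (\<lambda>x. restrict x J)) (PiM {..<m} (\<lambda>_. borel)) D"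
    by (rule distr_distr[OF Dm rm, symmetric])
  also have "distr path_space (PiM J (\<lambda>_. borel)) (\<lambda>x. restrict x J) = grid_law k J"
    using distr_path_restrict[OF J(1,3)] fdd_eq[OF J(1,2)] by simp
  also have "distr (grid_law k J) (PiM {..<m} (\<lambda>_. borel)) D = distr (noise k) (PiM {..<m} (\<lambda>_. borel)) (D \<circ> (\<lambda>y. \<lambda>q\<in>J. walk k y q))"
    unfolding grid_law_def by (rule distr_distr[OF Dm noise_measurable[OF walk_restrict_measurable]])
  also have "D \<circ> (\<lambda>y. \<lambda>q\<in>J. walk k y q) = (\<lambda>y. restrict y {..<m})"
  proof
    fix y
    show "(D \<circ> (\<lambda>y. \<lambda>q\<in>J. walk k y q)) y = restrict y {..<m}"
      unfolding D_def comp_def incr_def using inJ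
      by (intro restrict_ext) (simp add: walk_level del: of_nat_Suc)
  qed
  also have "distr (noise k) (PiM {..<m} (\<lambda>_. borel)) (\<lambda>y. restrict y {..<m}) = distr (noise k) (PiM {..<m} (\<lambda>_. step k)) (\<lambda>y. restrict y {..<m})"
    by (intro distr_cong refl sets_PiM_cong) (simp add: sets_step)
  also have "\<dots> = PiM {..<m} (\<lambda>_. step k)"
    unfolding noise_def by (rule product_prob_space.distr_PiM_restrict_finite[OF product_step]) auto
  finally show ?thesis unfolding D_def .
qed

lemma incr_law: "distr path_space borel (incr k i) = step k"
proof -
  have m: "(\<lambda>x. \<lambda>i\<in>{..<Suc i}. incr k i x) \<in> path_space \<rightarrow>\<^sub>M PiM {..<Suc i} (\<lambda>_. borel)"
    by (intro measurable_restrict incr_measurable)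
  have c: "(\<lambda>y. y i) \<in> PiM {..<Suc i} (\<lambda>_. borel) \<rightarrow>\<^sub>M (borel :: real measure)" by (intro measurable_component_singleton) simp
  have "distr path_space borel (incr k i) = distr path_space borel ((\<lambda>y. y i) \<circ> (\<lambda>x. \<lambda>i\<in>{..<Suc i}. incr k i x))"
    by (simp add: comp_def)
  also have "\<dots> = distr (distr path_space (PiM {..<Suc i} (\<lambda>_. borel)) (\<lambda>x. \<lambda>i\<in>{..<Suc i}. incr k i x)) borel (\<lambda>y. y i)"
    by (rule distr_distr[OF c m, symmetric])
  also have "\<dots> = distr (PiM {..<Suc i} (\<lambda>_. step k)) (step k) (\<lambda>y. y i)"
    unfolding distr_incr by (rule distr_cong) (auto simp: sets_step)
  also have "\<dots> = step k" by (rule distr_PiM_component) (auto intro: real_distribution.axioms(1) step_real)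
  finally show ?thesis .
qed

lemma incr_indep: "prob_space.indep_vars path_space (\<lambda>_. borel) (incr k) {..<m}"
proof (cases "m = 0")
  case True
  interpret prob_space path_space by (rule prob_space_path)
  show ?thesis using True by (simp add: indep_vars_def indep_sets_def)
next
  case False
  interpret prob_space path_space by (rule prob_space_path)
  show ?thesis
    by (subst indep_vars_iff_distr_eq_PiM) (use False in \<open>auto intro: incr_measurable simp: distr_incr incr_law lessThan_empty_iff\<close>)
qed

lemma path_diff_eq_sum:
  assumes "i \<le> j"
  shows "x (real j / 2 ^ k) - x (real i / 2 ^ k) = (\<Sum>m\<in>{i..<j}. incr k m x)"
  unfolding incr_def by (rule sum_Suc_diff'[OF assms, of "\<lambda>i. x (real i / 2 ^ k)", symmetric])

lemma block_law:
  assumes "finite A"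
  shows "distr path_space borel (\<lambda>x. \<Sum>m\<in>A. incr k m x) = \<mu> (real (card A) / 2 ^ k)"
proof -
  interpret prob_space path_space by (rule prob_space_path)
  obtain n where "A \<subseteq> {..<n}" using finite_nat_iff_bounded assms by blast
  then have "indep_vars (\<lambda>_. borel) (incr k) A" by (rule indep_vars_subset[OF incr_indep])
  from char_sum_law[OF prob_space_path this assms incr_law] show ?thesis .
qed

end

text \<open>If \<open>f\<close> had oscillations larger than \<open>2 * e\<close> arbitrarily close to \<open>t\<close> on the right, a first one and a
second one closer to \<open>t\<close> would supply three points with two successive moves larger than \<open>e\<close>.\<close>

lemma right_limit_exists:
  fixes f :: "real \<Rightarrow> real" and D :: "real set"
  assumes s: "\<And>l::nat. s l \<in> D" "\<And>l. t < s l" "s \<longlonglongrightarrow> t"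
    and H: "\<And>e. e > 0 \<Longrightarrow> \<exists>\<delta>>0. \<forall>q1\<in>D. \<forall>q2\<in>D. \<forall>q3\<in>D. t < q1 \<longrightarrow> q1 \<le> q2 \<longrightarrow> q2 \<le> q3 \<longrightarrow> q3 < t + \<delta> \<longrightarrow>
      \<bar>f q2 - f q1\<bar> \<le> e \<or> \<bar>f q3 - f q2\<bar> \<le> e"
  shows "\<exists>L. (\<lambda>l. f (s l)) \<longlonglongrightarrow> L \<and> (\<forall>e>0. \<exists>\<eta>>0. \<forall>q\<in>D. t < q \<longrightarrow> q < t + \<eta> \<longrightarrow> \<bar>f q - L\<bar> \<le> e)"
proof -
  have osc: "\<exists>\<eta>>0. \<forall>q\<in>D. \<forall>q'\<in>D. t < q \<longrightarrow> q < t + \<eta> \<longrightarrow> t < q' \<longrightarrow> q' < t + \<eta> \<longrightarrow> \<bar>f q - f q'\<bar> \<le> 2 * e"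
    if e: "e > 0" for e
  proof (rule ccontr)
    assume neg: "\<not> ?thesis"
    have ex: "\<exists>q\<in>D. \<exists>q'\<in>D. t < q \<and> q \<le> q' \<and> q' < t + \<eta> \<and> \<bar>f q' - f q\<bar> > 2 * e" if \<eta>: "\<eta> > 0" for \<eta>
    proof -
      obtain q q' where q: "q \<in> D" "q' \<in> D" "t < q" "q < t + \<eta>" "t < q'" "q' < t + \<eta>" "\<bar>f q - f q'\<bar> > 2 * e"
        using neg \<eta> by (meson not_le)
      show ?thesis
      proof (cases "q \<le> q'")
        case True
        then show ?thesis using q by (intro bexI[of _ q] bexI[of _ q']) auto
      next
        case False
        then show ?thesis using q by (intro bexI[of _ q'] bexI[of _ q]) auto
      qed
    qed
    obtain \<delta> where \<delta>: "\<delta> > 0" "\<forall>q1\<in>D. \<forall>q2\<in>D. \<forall>q3\<in>D. t < q1 \<longrightarrow> q1 \<le> q2 \<longrightarrow> q2 \<le> q3 \<longrightarrow> q3 < t + \<delta> \<longrightarrow>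
      \<bar>f q2 - f q1\<bar> \<le> e \<or> \<bar>f q3 - f q2\<bar> \<le> e" using H[OF e] by blast
    obtain q2 q3 where q: "q2 \<in> D" "q3 \<in> D" "t < q2" "q2 \<le> q3" "q3 < t + \<delta>" "\<bar>f q3 - f q2\<bar> > 2 * e"
      using ex[OF \<delta>(1)] by blast
    have "q2 - t > 0" using q by simp
    from ex[OF this] obtain r r' where r: "r \<in> D" "r' \<in> D" "t < r" "r \<le> r'" "r' < q2" "\<bar>f r' - f r\<bar> > 2 * e"
      by auto
    have "\<bar>f q2 - f r\<bar> > e \<or> \<bar>f q2 - f r'\<bar> > e" using r(6) by linarith
    then obtain u where u: "u \<in> D" "t < u" "u \<le> q2" "\<bar>f q2 - f u\<bar> > e" using r by force
    have "\<bar>f q2 - f u\<bar> \<le> e \<or> \<bar>f q3 - f q2\<bar> \<le> e" using \<delta>(2) u q by blast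
    then show False using u q e by auto
  qed
  have ev: "eventually (\<lambda>l. s l < t + \<eta>) sequentially" if "\<eta> > 0" for \<eta>
    using order_tendstoD(2)[OF s(3), of "t + \<eta>"] that by simp
  have "Cauchy (\<lambda>l. f (s l))"
  proof (rule CauchyI)
    fix e :: real assume e: "e > 0"
    then have "e / 3 > 0" by simp
    from osc[OF this] obtain \<eta> where \<eta>: "\<eta> > 0" "\<forall>q\<in>D. \<forall>q'\<in>D. t < q \<longrightarrow> q < t + \<eta> \<longrightarrow> t < q' \<longrightarrow> q' < t + \<eta> \<longrightarrow> \<bar>f q - f q'\<bar> \<le> 2 * (e / 3)"
      by blast
    obtain N where N: "\<And>l. l \<ge> N \<Longrightarrow> s l < t + \<eta>" using ev[OF \<eta>(1)] by (auto simp: eventually_sequentially)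
    have "norm (f (s m) - f (s n)) < e" if mn: "m \<ge> N" "n \<ge> N" for m n
    proof -
      have "\<bar>f (s m) - f (s n)\<bar> \<le> 2 * (e / 3)" using \<eta>(2) s(1,2) N mn by blast
      then show ?thesis using e by simp
    qed
    then show "\<exists>N. \<forall>m\<ge>N. \<forall>n\<ge>N. norm (f (s m) - f (s n)) < e" by blast
  qed
  then obtain L where L: "(\<lambda>l. f (s l)) \<longlonglongrightarrow> L" by (auto simp: Cauchy_convergent_iff convergent_def)
  show ?thesis
  proof (rule exI[of _ L], intro conjI L allI impI)
    fix e :: real assume e: "e > 0"
    then have "e / 2 > 0" by simp
    from osc[OF this] obtain \<eta> where \<eta>: "\<eta> > 0" "\<forall>q\<in>D. \<forall>q'\<in>D. t < q \<longrightarrow> q < t + \<eta> \<longrightarrow> t < q' \<longrightarrow> q' < t + \<eta> \<longrightarrow> \<bar>f q - f q'\<bar> \<le> 2 * (e / 2)"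
      by blast
    have "\<bar>f q - L\<bar> \<le> e" if q: "q \<in> D" "t < q" "q < t + \<eta>" for q
    proof (rule tendsto_upperbound)
      show "(\<lambda>l. \<bar>f q - f (s l)\<bar>) \<longlonglongrightarrow> \<bar>f q - L\<bar>" by (intro tendsto_intros L)
      show "eventually (\<lambda>l. \<bar>f q - f (s l)\<bar> \<le> e) sequentially"
        using ev[OF \<eta>(1)] by eventually_elim (use \<eta>(2) s(1,2) q in fastforce)
    qed simp
    then show "\<exists>\<eta>>0. \<forall>q\<in>D. t < q \<longrightarrow> q < t + \<eta> \<longrightarrow> \<bar>f q - L\<bar> \<le> e" using \<eta>(1) by blast
  qed
qed

lemma left_limit_exists:
  fixes f :: "real \<Rightarrow> real" and D :: "real set"
  assumes s: "\<And>l::nat. s l \<in> D" "\<And>l. s l < t" "s \<longlonglongrightarrow> t"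
    and H: "\<And>e. e > 0 \<Longrightarrow> \<exists>\<delta>>0. \<forall>q1\<in>D. \<forall>q2\<in>D. \<forall>q3\<in>D. t - \<delta> < q1 \<longrightarrow> q1 \<le> q2 \<longrightarrow> q2 \<le> q3 \<longrightarrow> q3 < t \<longrightarrow>
      \<bar>f q2 - f q1\<bar> \<le> e \<or> \<bar>f q3 - f q2\<bar> \<le> e"
  shows "\<exists>L. \<forall>e>0. \<exists>\<eta>>0. \<forall>q\<in>D. t - \<eta> < q \<longrightarrow> q < t \<longrightarrow> \<bar>f q - L\<bar> \<le> e"
proof -
  define D' where "D' = uminus ` D"
  define f' where "f' = (\<lambda>x. f (- x))"
  have D': "x \<in> D' \<longleftrightarrow> - x \<in> D" for x by (force simp: D'_def)
  have H': "\<exists>\<delta>>0. \<forall>q1\<in>D'. \<forall>q2\<in>D'. \<forall>q3\<in>D'. - t < q1 \<longrightarrow> q1 \<le> q2 \<longrightarrow> q2 \<le> q3 \<longrightarrow> q3 < - t + \<delta> \<longrightarrow>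
      \<bar>f' q2 - f' q1\<bar> \<le> e \<or> \<bar>f' q3 - f' q2\<bar> \<le> e" if "e > 0" for e
  proof -
    obtain \<delta> where \<delta>: "\<delta> > 0" and h: "\<And>q1 q2 q3. q1 \<in> D \<Longrightarrow> q2 \<in> D \<Longrightarrow> q3 \<in> D \<Longrightarrow> t - \<delta> < q1 \<Longrightarrow> q1 \<le> q2 \<Longrightarrow> q2 \<le> q3 \<Longrightarrow> q3 < t \<Longrightarrow>
      \<bar>f q2 - f q1\<bar> \<le> e \<or> \<bar>f q3 - f q2\<bar> \<le> e" using H[OF \<open>e > 0\<close>] by blast
    show ?thesis
    proof (intro exI[of _ \<delta>] conjI \<delta> ballI impI)
      fix q1 q2 q3 assume *: "q1 \<in> D'" "q2 \<in> D'" "q3 \<in> D'" "- t < q1" "q1 \<le> q2" "q2 \<le> q3" "q3 < - t + \<delta>"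
      have "\<bar>f (- q2) - f (- q3)\<bar> \<le> e \<or> \<bar>f (- q1) - f (- q2)\<bar> \<le> e"
        by (rule h) (use * in \<open>auto simp: D'\<close>)
      then show "\<bar>f' q2 - f' q1\<bar> \<le> e \<or> \<bar>f' q3 - f' q2\<bar> \<le> e" by (auto simp: f'_def abs_minus_commute)
    qed
  qed
  have s': "- s l \<in> D'" "- t < - s l" for l using s by (auto simp: D')
  have s'': "(\<lambda>l. - s l) \<longlonglongrightarrow> - t" using s by (intro tendsto_intros)
  obtain L where L: "\<And>e. e > 0 \<Longrightarrow> \<exists>\<eta>>0. \<forall>q\<in>D'. - t < q \<longrightarrow> q < - t + \<eta> \<longrightarrow> \<bar>f' q - L\<bar> \<le> e"
    using right_limit_exists[where f=f' and s="\<lambda>l. - s l", OF s' s'' H'] by blast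
  show ?thesis
  proof (rule exI[of _ L], intro allI impI)
    fix e :: real assume "e > 0"
    then obtain \<eta> where \<eta>: "\<eta> > 0" and h: "\<And>q. q \<in> D' \<Longrightarrow> - t < q \<Longrightarrow> q < - t + \<eta> \<Longrightarrow> \<bar>f' q - L\<bar> \<le> e" using L by blast
    show "\<exists>\<eta>>0. \<forall>q\<in>D. t - \<eta> < q \<longrightarrow> q < t \<longrightarrow> \<bar>f q - L\<bar> \<le> e"
    proof (intro exI[of _ \<eta>] conjI \<eta> ballI impI)
      fix q assume "q \<in> D" "t - \<eta> < q" "q < t"
      then show "\<bar>f q - L\<bar> \<le> e" using h[of "- q"] by (auto simp: D' f'_def)
    qed
  qed
qed

context convolution_semigroup
begin

text \<open>The index of a grid point of level \<open>l\<close> strictly to the right of \<open>t\<close>, so that limits along these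
points are right limits.\<close>

definition up :: "nat \<Rightarrow> real \<Rightarrow> nat" where "up l t = nat \<lfloor>2 ^ l * t\<rfloor> + 1"

lemma up_bounds:
  assumes "t \<ge> 0"
  shows "t < real (up l t) / 2 ^ l" "real (up l t) / 2 ^ l \<le> t + 1 / 2 ^ l"
proof -
  have "real (nat \<lfloor>2 ^ l * t\<rfloor>) = of_int \<lfloor>2 ^ l * t\<rfloor>" using assms by simp
  then have u: "real (up l t) = of_int \<lfloor>2 ^ l * t\<rfloor> + 1" by (simp add: up_def)
  have "2 ^ l * t < real (up l t)" unfolding u by linarith
  then show "t < real (up l t) / 2 ^ l" by (simp add: field_simps)
  have "real (up l t) \<le> 2 ^ l * t + 1" unfolding u by linarith
  then show "real (up l t) / 2 ^ l \<le> t + 1 / 2 ^ l" by (simp add: field_simps)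
qed

lemma up_mono: "s \<le> t \<Longrightarrow> up l s \<le> up l t"
  by (auto simp: up_def intro!: nat_mono floor_mono)

lemma up_tendsto:
  assumes "t \<ge> 0"
  shows "(\<lambda>l. real (up l t) / 2 ^ l) \<longlonglongrightarrow> t"
proof (rule tendsto_sandwich)
  show "eventually (\<lambda>l. t \<le> real (up l t) / 2 ^ l) sequentially"
    "eventually (\<lambda>l. real (up l t) / 2 ^ l \<le> t + 1 / 2 ^ l) sequentially"
    using up_bounds[OF assms] by (auto intro!: always_eventually less_imp_le)
  show "(\<lambda>l. t + 1 / 2 ^ l) \<longlonglongrightarrow> t"
    using tendsto_add[OF tendsto_const LIMSEQ_divide_realpow_zero[of 2 1]] by simp
qed simp

text \<open>The window consists of two adjacent cells of level \<open>k\<close>, so that any three points within distance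
\<open>2 ^ (- k)\<close> lie in a common window. The grids of all finer levels are inspected.\<close>

definition window_bad :: "real \<Rightarrow> nat \<Rightarrow> nat \<Rightarrow> (real \<Rightarrow> real) set" where
  "window_bad e k j = {x\<in>space path_space. \<exists>n. two_big_blocks e (j * 2 ^ n) ((j + 2) * 2 ^ n) (\<lambda>i. incr (k + n) i x)}"

lemma two_big_blocks_measurable:
  "{x\<in>space path_space. two_big_blocks e a b (\<lambda>i. incr k i x)} \<in> sets path_space"
  unfolding two_big_blocks_def
  by (intro predE pred_intros_finite pred_intros_logic borel_measurable_pred_less
      borel_measurable_abs borel_measurable_sum incr_measurable measurable_const) auto

lemma window_bad_measurable: "window_bad e k j \<in> sets path_space"
proof -
  have "window_bad e k j = (\<Union>n. {x\<in>space path_space. two_big_blocks e (j * 2 ^ n) ((j + 2) * 2 ^ n) (\<lambda>i. incr (k + n) i x)})"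
    by (auto simp: window_bad_def)
  also have "\<dots> \<in> sets path_space" by (intro sets.countable_UN image_subsetI two_big_blocks_measurable)
  finally show ?thesis .
qed

lemma incr_refine: "(\<Sum>m\<in>{i..<j}. incr l m x) = (\<Sum>m\<in>{2 * i..<2 * j}. incr (Suc l) m x)"
proof (cases "i \<le> j")
  case True
  have "real (2 * i) / 2 ^ Suc l = real i / 2 ^ l" for i by simp
  then show ?thesis
    using path_diff_eq_sum[OF True, of x l] path_diff_eq_sum[of "2 * i" "2 * j" x "Suc l"] True by simp
qed simp

lemma two_big_blocks_refine:
  assumes "two_big_blocks e a b (\<lambda>i. incr l i x)"
  shows "two_big_blocks e (2 * a) (2 * b) (\<lambda>i. incr (Suc l) i x)"
proof -
  obtain i j m n where *: "i \<in> {a..b}" "j \<in> {i..b}" "m \<in> {j..b}" "n \<in> {m..b}"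
      "\<bar>\<Sum>m\<in>{i..<j}. incr l m x\<bar> > e" "\<bar>\<Sum>m\<in>{m..<n}. incr l m x\<bar> > e"
    using assms unfolding two_big_blocks_def by blast
  have big: "\<bar>\<Sum>m\<in>{2 * i..<2 * j}. incr (Suc l) m x\<bar> > e" "\<bar>\<Sum>m\<in>{2 * m..<2 * n}. incr (Suc l) m x\<bar> > e"
    using *(5,6) by (simp_all only: incr_refine[symmetric])
  show ?thesis unfolding two_big_blocks_def
    by (rule bexI[of _ "2 * i"], rule bexI[of _ "2 * j"], rule bexI[of _ "2 * m"], rule bexI[of _ "2 * n"])
       (use * big in auto)
qed

text \<open>The bound \<open>two_big_blocks_bound\<close> is the same for all finer grids, and by \<open>two_big_blocks_refine\<close> the
events increase with the level.\<close>

lemma window_bad_prob: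
  assumes e: "e > 0"
  obtains C where "C > 0" "\<And>k j. k \<ge> 1 \<Longrightarrow> measure path_space (window_bad (4 * e) k j) \<le> 4 * (C * (2 / 2 ^ k))\<^sup>2"
proof -
  interpret prob_space path_space by (rule prob_space_path)
  obtain C where C: "C > 0" "\<And>t. 0 \<le> t \<Longrightarrow> t \<le> 1 \<Longrightarrow> measure (\<mu> t) {x. \<bar>x\<bar> > e} \<le> C * t"
    using tail[OF e] by auto
  show ?thesis
  proof (rule that[OF C(1)])
    fix k j :: nat assume k: "k \<ge> 1"
    define B where "B = (\<lambda>n. {x\<in>space path_space. two_big_blocks (4 * e) (j * 2 ^ n) ((j + 2) * 2 ^ n) (\<lambda>i. incr (k + n) i x)})"
    have "incseq B"
    proof (rule incseq_SucI, rule subsetI)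
      fix n x assume "x \<in> B n"
      then have x: "x \<in> space path_space" "two_big_blocks (4 * e) (j * 2 ^ n) ((j + 2) * 2 ^ n) (\<lambda>i. incr (k + n) i x)" by (auto simp: B_def)
      show "x \<in> B (Suc n)" using two_big_blocks_refine[OF x(2)] x(1) by (simp add: B_def mult_ac)
    qed
    then have "(\<lambda>n. prob (B n)) \<longlonglongrightarrow> prob (\<Union>n. B n)"
      by (intro finite_Lim_measure_incseq) (auto simp: B_def two_big_blocks_measurable)
    moreover have "prob (B n) \<le> 4 * (C * (2 / 2 ^ k))\<^sup>2" for n
      unfolding B_def
    proof (rule two_big_blocks_bound)
      show "indep_vars (\<lambda>_. borel) (incr (k + n)) {j * 2 ^ n..<(j + 2) * 2 ^ n}"
        by (rule indep_vars_subset[OF incr_indep[of "k + n" "(j + 2) * 2 ^ n"]]) auto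
      fix i i' assume ii: "j * 2 ^ n \<le> i" "i \<le> i'" "i' \<le> (j + 2) * 2 ^ n"
      define m where "m = i' - i"
      have "m \<le> 2 * 2 ^ n" using ii by (simp add: m_def algebra_simps)
      then have "real m \<le> real (2 * 2 ^ n)" by (rule of_nat_mono)
      then have m: "real m / 2 ^ (k + n) \<le> 2 / 2 ^ k" by (simp add: field_simps power_add)
      have "(2::real) ^ 1 \<le> 2 ^ k" using k by (intro power_increasing) auto
      then have "2 / 2 ^ k \<le> (1::real)" by simp
      with m have m1: "real m / 2 ^ (k + n) \<le> 1" by linarith
      have sm: "(\<lambda>x. \<Sum>l\<in>{i..<i'}. incr (k + n) l x) \<in> borel_measurable path_space"
        by (intro borel_measurable_sum incr_measurable)
      have "{x\<in>space path_space. \<bar>\<Sum>l\<in>{i..<i'}. incr (k + n) l x\<bar> > e} = (\<lambda>x. \<Sum>l\<in>{i..<i'}. incr (k + n) l x) -` {x. \<bar>x\<bar> > e} \<inter> space path_space"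
        by auto
      then have "prob {x\<in>space path_space. \<bar>\<Sum>l\<in>{i..<i'}. incr (k + n) l x\<bar> > e} = measure (distr path_space borel (\<lambda>x. \<Sum>l\<in>{i..<i'}. incr (k + n) l x)) {x. \<bar>x\<bar> > e}"
        using measure_distr[OF sm, of "{x. \<bar>x\<bar> > e}"] by simp
      also have "\<dots> = measure (\<mu> (real m / 2 ^ (k + n))) {x. \<bar>x\<bar> > e}" by (simp add: block_law m_def)
      also have "\<dots> \<le> C * (real m / 2 ^ (k + n))" using m1 by (intro C) auto
      also have "\<dots> \<le> C * (2 / 2 ^ k)" using m C(1) by (intro mult_left_mono) auto
      finally show "prob {x\<in>space path_space. \<bar>\<Sum>l\<in>{i..<i'}. incr (k + n) l x\<bar> > e} \<le> C * (2 / 2 ^ k)" .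
    qed
    ultimately have "prob (\<Union>n. B n) \<le> 4 * (C * (2 / 2 ^ k))\<^sup>2" by (intro LIMSEQ_le_const2) auto
    moreover have "window_bad (4 * e) k j = (\<Union>n. B n)" by (auto simp: window_bad_def B_def)
    ultimately show "prob (window_bad (4 * e) k j) \<le> 4 * (C * (2 / 2 ^ k))\<^sup>2" by simp
  qed
qed

definition irregular :: "real \<Rightarrow> nat \<Rightarrow> (real \<Rightarrow> real) set" where
  "irregular e m = (\<Inter>k\<in>{1..}. \<Union>j<m * 2 ^ k. window_bad e k j)"

lemma irregular_measurable: "irregular e m \<in> sets path_space"
  unfolding irregular_def
  by (intro sets.countable_INT' image_subsetI sets.finite_UN window_bad_measurable) auto

text \<open>There are \<open>m * 2 ^ k\<close> windows before time \<open>m\<close>, each bad with probability of order \<open>4 ^ (- k)\<close>.\<close>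

lemma irregular_null:
  assumes "e > 0"
  shows "measure path_space (irregular e m) = 0"
proof -
  interpret prob_space path_space by (rule prob_space_path)
  have "e / 4 > 0" using assms by simp
  from window_bad_prob[OF this] obtain C where C: "C > 0" "\<And>k j. k \<ge> 1 \<Longrightarrow> prob (window_bad e k j) \<le> 4 * (C * (2 / 2 ^ k))\<^sup>2"
    by auto
  have le: "prob (irregular e m) \<le> 16 * C\<^sup>2 * real m / 2 ^ k" if k: "k \<ge> 1" for k
  proof -
    have "prob (irregular e m) \<le> prob (\<Union>j<m * 2 ^ k. window_bad e k j)"
      using k by (intro finite_measure_mono sets.finite_UN window_bad_measurable) (auto simp: irregular_def)
    also have "\<dots> \<le> (\<Sum>j<m * 2 ^ k. prob (window_bad e k j))"
      by (intro measure_UNION_le window_bad_measurable) auto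
    also have "\<dots> \<le> (\<Sum>j<m * 2 ^ k. 4 * (C * (2 / 2 ^ k))\<^sup>2)" by (intro sum_mono C k)
    also have "\<dots> = real m * 2 ^ k * (4 * (C * (2 / 2 ^ k))\<^sup>2)" by simp
    also have "\<dots> = 16 * C\<^sup>2 * real m / 2 ^ k" by (simp add: power2_eq_square field_simps)
    finally show ?thesis .
  qed
  have "(\<lambda>k. 16 * C\<^sup>2 * real m / 2 ^ k) \<longlonglongrightarrow> 0" by (rule LIMSEQ_divide_realpow_zero) simp
  then have "prob (irregular e m) \<le> 0"
    by (rule LIMSEQ_le_const) (use le in blast)
  then show ?thesis using measure_nonneg[of path_space "irregular e m"] by linarith
qed

definition regular :: "(real \<Rightarrow> real) set" where
  "regular = space path_space - (\<Union>r m. irregular (1 / real (Suc r)) m)"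

lemma regular_measurable: "regular \<in> sets path_space"
  unfolding regular_def by (intro sets.Diff sets.top sets.countable_UN image_subsetI irregular_measurable)

lemma AE_regular: "AE x in path_space. x \<in> regular"
proof -
  interpret prob_space path_space by (rule prob_space_path)
  have "irregular (1 / real (Suc r)) m \<in> null_sets path_space" for r m
    using irregular_null[of "1 / real (Suc r)" m] irregular_measurable
    by (intro null_setsI) (auto simp: emeasure_eq_measure)
  then have "(\<Union>r m. irregular (1 / real (Suc r)) m) \<in> null_sets path_space"
    by (intro null_sets_UN' countableI_type)
  from AE_not_in[OF this] show ?thesis
    using AE_space by eventually_elim (auto simp: regular_def)
qed

text \<open>The counterpart for dyadic times of \<open>cadlag_three_points\<close>.\<close>

lemma regular_three_points:
  assumes x: "x \<in> regular" and e: "e > 0"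
  obtains \<delta> where "\<delta> > 0" "\<And>q1 q2 q3. q1 \<in> dyadics \<Longrightarrow> q2 \<in> dyadics \<Longrightarrow> q3 \<in> dyadics \<Longrightarrow>
    q1 \<le> q2 \<Longrightarrow> q2 \<le> q3 \<Longrightarrow> q3 - q1 < \<delta> \<Longrightarrow> q1 \<le> T \<Longrightarrow> \<bar>x q2 - x q1\<bar> \<le> e \<or> \<bar>x q3 - x q2\<bar> \<le> e"
proof -
  obtain r where r: "1 / real (Suc r) < e" using nat_approx_posE[OF e] by blast
  obtain m :: nat where m: "T < real m" using reals_Archimedean2 by blast
  have "x \<notin> irregular (1 / real (Suc r)) m" using x by (auto simp: regular_def)
  then obtain k where k: "k \<ge> 1" "\<And>j. j < m * 2 ^ k \<Longrightarrow> x \<notin> window_bad (1 / real (Suc r)) k j"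
    by (auto simp: irregular_def)
  show ?thesis
  proof (rule that[of "1 / 2 ^ k"])
    fix q1 q2 q3 assume q: "q1 \<in> dyadics" "q2 \<in> dyadics" "q3 \<in> dyadics" "q1 \<le> q2" "q2 \<le> q3" "q3 - q1 < 1 / 2 ^ k" "q1 \<le> T"
    obtain l where l: "{q1, q2, q3} \<subseteq> level l" using finite_in_level[of "{q1, q2, q3}"] q by auto
    then have "{q1, q2, q3} \<subseteq> level (k + l)" using level_mono[of l "k + l"] by auto
    then obtain a1 a2 a3 where a: "q1 = real a1 / 2 ^ (k + l)" "q2 = real a2 / 2 ^ (k + l)" "q3 = real a3 / 2 ^ (k + l)"
      by (auto simp: level_def)
    define j where "j = a1 div 2 ^ l"
    have a12: "a1 \<le> a2" "a2 \<le> a3" using q a by (auto simp: field_simps)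
    have j1: "j * 2 ^ l \<le> a1" by (simp add: j_def)
    have j2: "a1 < (j + 1) * 2 ^ l" unfolding j_def using dividend_less_times_div[of "2 ^ l" a1] by (simp add: algebra_simps)
    have "real a3 - real a1 < 2 ^ l"
    proof -
      have "(real a3 - real a1) / 2 ^ (k + l) < 1 / 2 ^ k" using q(6) unfolding a by (simp add: diff_divide_distrib)
      then have "real a3 - real a1 < 1 / 2 ^ k * 2 ^ (k + l)" by (simp only: pos_divide_less_eq zero_less_power zero_less_numeral)
      then show ?thesis by (simp add: power_add)
    qed
    then have "real a3 < real (a1 + 2 ^ l)" by simp
    then have "a3 < a1 + 2 ^ l" by (simp only: of_nat_less_iff)
    then have a3: "a3 \<le> (j + 2) * 2 ^ l" using j2 by (simp add: algebra_simps)
    have "real a1 < real m * 2 ^ (k + l)" using q(7) m unfolding a by (simp add: field_simps) (smt (verit) mult_strict_right_mono zero_less_power)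
    then have "real a1 < real (m * 2 ^ (k + l))" by simp
    then have "a1 < m * 2 ^ k * 2 ^ l" by (simp only: of_nat_less_iff power_add mult.assoc)
    then have "j < m * 2 ^ k" unfolding j_def by (rule less_mult_imp_div_less)
    then have "\<not> two_big_blocks (1 / real (Suc r)) (j * 2 ^ l) ((j + 2) * 2 ^ l) (\<lambda>i. incr (k + l) i x)"
      using k(2)[of j] x by (auto simp: window_bad_def regular_def)
    then have "\<bar>\<Sum>m\<in>{a1..<a2}. incr (k + l) m x\<bar> \<le> 1 / real (Suc r) \<or> \<bar>\<Sum>m\<in>{a2..<a3}. incr (k + l) m x\<bar> \<le> 1 / real (Suc r)"
      unfolding two_big_blocks_def using a12 j1 a3 by (auto simp: not_less) (meson atLeastAtMost_iff order_refl order_trans not_le)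
    then show "\<bar>x q2 - x q1\<bar> \<le> e \<or> \<bar>x q3 - x q2\<bar> \<le> e"
      unfolding a path_diff_eq_sum[OF a12(1)] path_diff_eq_sum[OF a12(2)] using r by linarith
  qed simp
qed

text \<open>The value 0 outside \<open>regular\<close> makes every path right continuous with left limits.\<close>

definition limit_path :: "real \<Rightarrow> (real \<Rightarrow> real) \<Rightarrow> real" where
  "limit_path t x = (if x \<in> regular then lim (\<lambda>l. x (real (up l t) / 2 ^ l)) else 0)"

lemma right_limit_path:
  assumes x: "x \<in> regular" and t: "t \<ge> 0"
  shows "(\<lambda>l. x (real (up l t) / 2 ^ l)) \<longlonglongrightarrow> limit_path t x"
    and "e > 0 \<Longrightarrow> \<exists>\<eta>>0. \<forall>q\<in>dyadics. t < q \<longrightarrow> q < t + \<eta> \<longrightarrow> \<bar>x q - limit_path t x\<bar> \<le> e"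
proof -
  have H: "\<exists>\<delta>>0. \<forall>q1\<in>dyadics. \<forall>q2\<in>dyadics. \<forall>q3\<in>dyadics. t < q1 \<longrightarrow> q1 \<le> q2 \<longrightarrow> q2 \<le> q3 \<longrightarrow> q3 < t + \<delta> \<longrightarrow>
      \<bar>x q2 - x q1\<bar> \<le> e \<or> \<bar>x q3 - x q2\<bar> \<le> e" if e: "e > 0" for e
  proof -
    obtain \<delta> where \<delta>: "\<delta> > 0" and h: "\<And>q1 q2 q3. q1 \<in> dyadics \<Longrightarrow> q2 \<in> dyadics \<Longrightarrow> q3 \<in> dyadics \<Longrightarrow>
      q1 \<le> q2 \<Longrightarrow> q2 \<le> q3 \<Longrightarrow> q3 - q1 < \<delta> \<Longrightarrow> q1 \<le> t + 1 \<Longrightarrow> \<bar>x q2 - x q1\<bar> \<le> e \<or> \<bar>x q3 - x q2\<bar> \<le> e"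
      using regular_three_points[OF x e, of "t + 1"] by blast
    show ?thesis
    proof (intro exI[of _ "min \<delta> 1"] conjI ballI impI)
      fix q1 q2 q3 assume *: "q1 \<in> dyadics" "q2 \<in> dyadics" "q3 \<in> dyadics" "t < q1" "q1 \<le> q2" "q2 \<le> q3" "q3 < t + min \<delta> 1"
      show "\<bar>x q2 - x q1\<bar> \<le> e \<or> \<bar>x q3 - x q2\<bar> \<le> e" by (rule h) (use * in auto)
    qed (use \<delta> in simp)
  qed
  obtain L where L: "(\<lambda>l. x (real (up l t) / 2 ^ l)) \<longlonglongrightarrow> L"
    "\<And>e. e > 0 \<Longrightarrow> \<exists>\<eta>>0. \<forall>q\<in>dyadics. t < q \<longrightarrow> q < t + \<eta> \<longrightarrow> \<bar>x q - L\<bar> \<le> e"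
    using right_limit_exists[where f=x and s="\<lambda>l. real (up l t) / 2 ^ l" and D=dyadics, OF grid_dyadics up_bounds(1)[OF t] up_tendsto[OF t] H] by blast
  have "limit_path t x = L" using L(1) x by (simp add: limit_path_def limI)
  then show "(\<lambda>l. x (real (up l t) / 2 ^ l)) \<longlonglongrightarrow> limit_path t x"
    and "e > 0 \<Longrightarrow> \<exists>\<eta>>0. \<forall>q\<in>dyadics. t < q \<longrightarrow> q < t + \<eta> \<longrightarrow> \<bar>x q - limit_path t x\<bar> \<le> e" using L by auto
qed

lemma limit_path_close:
  assumes x: "x \<in> regular" and s: "0 \<le> s" "u < s \<or> u = s" "s < v" and h: "\<And>q. q \<in> dyadics \<Longrightarrow> u < q \<Longrightarrow> q < v \<Longrightarrow> \<bar>x q - L\<bar> \<le> e"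
  shows "\<bar>limit_path s x - L\<bar> \<le> e"
proof (rule tendsto_upperbound)
  show "(\<lambda>l. \<bar>x (real (up l s) / 2 ^ l) - L\<bar>) \<longlonglongrightarrow> \<bar>limit_path s x - L\<bar>"
    by (intro tendsto_intros right_limit_path x s)
  have "eventually (\<lambda>l. real (up l s) / 2 ^ l < v) sequentially"
    by (rule order_tendstoD(2)[OF up_tendsto[OF s(1)] s(3)])
  then show "eventually (\<lambda>l. \<bar>x (real (up l s) / 2 ^ l) - L\<bar> \<le> e) sequentially"
  proof eventually_elim
    case (elim l)
    show ?case by (rule h[OF grid_dyadics _ elim]) (use up_bounds(1)[OF s(1), of l] s in linarith)
  qed
qed simp

lemma limit_path_cadlag:
  assumes x: "x \<in> regular"
  shows "cadlag_on {0..} (\<lambda>t. limit_path t x)"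
  unfolding cadlag_on_def
proof (intro ballI conjI)
  fix t :: real assume "t \<in> {0..}"
  then have t: "t \<ge> 0" by simp
  show "((\<lambda>t. limit_path t x) \<longlongrightarrow> limit_path t x) (at t within {0..} \<inter> {t<..})"
  proof (rule tendstoI)
    fix e :: real assume e: "e > 0"
    then have "e / 2 > 0" by simp
    from right_limit_path(2)[OF x t this] obtain \<eta> where \<eta>: "\<eta> > 0" "\<And>q. q \<in> dyadics \<Longrightarrow> t < q \<Longrightarrow> q < t + \<eta> \<Longrightarrow> \<bar>x q - limit_path t x\<bar> \<le> e / 2" by blast
    show "eventually (\<lambda>s. dist (limit_path s x) (limit_path t x) < e) (at t within {0..} \<inter> {t<..})"
      unfolding eventually_at
    proof (intro exI[of _ \<eta>] conjI \<eta>(1) ballI impI)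
      fix s assume s: "s \<in> {0..} \<inter> {t<..}" "s \<noteq> t \<and> dist s t < \<eta>"
      have "\<bar>limit_path s x - limit_path t x\<bar> \<le> e / 2"
        by (rule limit_path_close[OF x, of s t "t + \<eta>"]) (use s \<eta>(2) in \<open>auto simp: dist_real_def\<close>)
      then show "dist (limit_path s x) (limit_path t x) < e" using e by (simp add: dist_real_def)
    qed
  qed
  show "\<exists>L. ((\<lambda>t. limit_path t x) \<longlongrightarrow> L) (at t within {0..} \<inter> {..<t})"
  proof (cases "t = 0")
    case True
    then have "{0..} \<inter> {..<t} = {}" by auto
    then show ?thesis by simp
  next
    case False
    with t have t: "t > 0" by simp
    define s where "s = (\<lambda>l. real (nat (\<lceil>2 ^ l * t\<rceil> - 1)) / 2 ^ l)"
    have sb: "s l < t" "t - 1 / 2 ^ l \<le> s l" for l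
    proof -
      have "0 < \<lceil>2 ^ l * t\<rceil>" using t by simp
      then have r: "real (nat (\<lceil>2 ^ l * t\<rceil> - 1)) = of_int \<lceil>2 ^ l * t\<rceil> - 1" by simp
      have "real (nat (\<lceil>2 ^ l * t\<rceil> - 1)) < 2 ^ l * t" unfolding r by linarith
      then show "s l < t" by (simp add: s_def field_simps)
      have "2 ^ l * t - 1 \<le> real (nat (\<lceil>2 ^ l * t\<rceil> - 1))" unfolding r by linarith
      then have "(2 ^ l * t - 1) / 2 ^ l \<le> s l" unfolding s_def by (rule divide_right_mono) simp
      then show "t - 1 / 2 ^ l \<le> s l" by (simp add: diff_divide_distrib)
    qed
    have st: "s \<longlonglongrightarrow> t"
    proof (rule tendsto_sandwich)
      show "(\<lambda>l. t - 1 / 2 ^ l) \<longlonglongrightarrow> t"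
        using tendsto_diff[OF tendsto_const LIMSEQ_divide_realpow_zero[of 2 1]] by simp
      show "eventually (\<lambda>l. t - 1 / 2 ^ l \<le> s l) sequentially" "eventually (\<lambda>l. s l \<le> t) sequentially"
        using sb by (auto intro!: always_eventually less_imp_le)
    qed simp
    have H: "\<exists>\<delta>>0. \<forall>q1\<in>dyadics. \<forall>q2\<in>dyadics. \<forall>q3\<in>dyadics. t - \<delta> < q1 \<longrightarrow> q1 \<le> q2 \<longrightarrow> q2 \<le> q3 \<longrightarrow> q3 < t \<longrightarrow>
        \<bar>x q2 - x q1\<bar> \<le> e \<or> \<bar>x q3 - x q2\<bar> \<le> e" if e: "e > 0" for e
    proof -
      obtain \<delta> where \<delta>: "\<delta> > 0" and h: "\<And>q1 q2 q3. q1 \<in> dyadics \<Longrightarrow> q2 \<in> dyadics \<Longrightarrow> q3 \<in> dyadics \<Longrightarrow>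
        q1 \<le> q2 \<Longrightarrow> q2 \<le> q3 \<Longrightarrow> q3 - q1 < \<delta> \<Longrightarrow> q1 \<le> t \<Longrightarrow> \<bar>x q2 - x q1\<bar> \<le> e \<or> \<bar>x q3 - x q2\<bar> \<le> e"
        using regular_three_points[OF x e, of t] by blast
      show ?thesis
      proof (intro exI[of _ \<delta>] conjI \<delta> ballI impI)
        fix q1 q2 q3 assume *: "q1 \<in> dyadics" "q2 \<in> dyadics" "q3 \<in> dyadics" "t - \<delta> < q1" "q1 \<le> q2" "q2 \<le> q3" "q3 < t"
        show "\<bar>x q2 - x q1\<bar> \<le> e \<or> \<bar>x q3 - x q2\<bar> \<le> e" by (rule h) (use * in auto)
      qed
    qed
    have sD: "s l \<in> dyadics" for l unfolding s_def by (rule grid_dyadics)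
    obtain L where L: "\<And>e. e > 0 \<Longrightarrow> \<exists>\<eta>>0. \<forall>q\<in>dyadics. t - \<eta> < q \<longrightarrow> q < t \<longrightarrow> \<bar>x q - L\<bar> \<le> e"
      using left_limit_exists[where f=x and s=s and D=dyadics, OF sD sb(1) st H] by blast
    have "((\<lambda>t. limit_path t x) \<longlongrightarrow> L) (at t within {0..} \<inter> {..<t})"
    proof (rule tendstoI)
      fix e :: real assume e: "e > 0"
      then have "e / 2 > 0" by simp
      from L[OF this] obtain \<eta> where \<eta>: "\<eta> > 0" "\<And>q. q \<in> dyadics \<Longrightarrow> t - \<eta> < q \<Longrightarrow> q < t \<Longrightarrow> \<bar>x q - L\<bar> \<le> e / 2" by blast
      show "eventually (\<lambda>s. dist (limit_path s x) L < e) (at t within {0..} \<inter> {..<t})"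
        unfolding eventually_at
      proof (intro exI[of _ \<eta>] conjI \<eta>(1) ballI impI)
        fix s assume s: "s \<in> {0..} \<inter> {..<t}" "s \<noteq> t \<and> dist s t < \<eta>"
        have "\<bar>limit_path s x - L\<bar> \<le> e / 2"
          by (rule limit_path_close[OF x, of s "t - \<eta>" t]) (use s \<eta>(2) in \<open>auto simp: dist_real_def\<close>)
        then show "dist (limit_path s x) L < e" using e by (simp add: dist_real_def)
      qed
    qed
    then show ?thesis by blast
  qed
qed

text \<open>The increments determine the path up to its value at 0; subtracting the latter makes every path start
at 0.\<close>

definition levy :: "real \<Rightarrow> (real \<Rightarrow> real) \<Rightarrow> real" where
  "levy t x = limit_path t x - limit_path 0 x"

lemma limit_path_measurable: "limit_path t \<in> borel_measurable path_space"
proof -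
  have "(\<lambda>x. lim (\<lambda>l. x (real (up l t) / 2 ^ l))) \<in> borel_measurable path_space"
    by (intro borel_measurable_lim_metric path_coord_measurable grid_dyadics)
  then show ?thesis unfolding limit_path_def[abs_def]
    using regular_measurable by (intro measurable_If_set) auto
qed

lemma levy_measurable: "levy t \<in> borel_measurable path_space"
  unfolding levy_def[abs_def] by (intro borel_measurable_diff limit_path_measurable)

lemma AE_incr_limit:
  assumes "0 \<le> s" "s \<le> t"
  shows "AE x in path_space. (\<lambda>l. \<Sum>m\<in>{up l s..<up l t}. incr l m x) \<longlonglongrightarrow> levy t x - levy s x"
  using AE_regular
proof eventually_elim
  case (elim x)
  have "(\<lambda>l. x (real (up l t) / 2 ^ l) - x (real (up l s) / 2 ^ l)) \<longlonglongrightarrow> limit_path t x - limit_path s x"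
    using assms by (intro tendsto_diff right_limit_path elim) auto
  then show ?case by (simp add: path_diff_eq_sum[OF up_mono[OF assms(2)]] levy_def)
qed

text \<open>An increment is the almost sure limit of dyadic increments, whose laws are known by \<open>block_law\<close>.\<close>

lemma levy_increment_law:
  assumes "0 \<le> s" "s \<le> t"
  shows "distr path_space borel (\<lambda>x. levy t x - levy s x) = \<mu> (t - s)"
proof (rule law_unique)
  interpret prob_space path_space by (rule prob_space_path)
  have dm: "(\<lambda>x. levy t x - levy s x) \<in> borel_measurable path_space" by (intro borel_measurable_diff levy_measurable)
  show "real_distribution (distr path_space borel (\<lambda>x. levy t x - levy s x))" by (rule real_distribution_distr[OF dm])
  show "0 \<le> t - s" using assms by simp
  fix u
  define I where "I = (\<lambda>l x. \<Sum>m\<in>{up l s..<up l t}. incr l m x)"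
  have Im: "I l \<in> borel_measurable path_space" for l unfolding I_def by (intro borel_measurable_sum incr_measurable)
  have "(\<lambda>l. \<integral>x. iexp (u * I l x) \<partial>path_space) \<longlonglongrightarrow> (\<integral>x. iexp (u * (levy t x - levy s x)) \<partial>path_space)"
  proof (rule integral_dominated_convergence[where w="\<lambda>_. 1"])
    show "AE x in path_space. (\<lambda>l. iexp (u * I l x)) \<longlonglongrightarrow> iexp (u * (levy t x - levy s x))"
      using AE_incr_limit[OF assms] by eventually_elim (intro tendsto_intros, simp add: I_def)
    show "(\<lambda>x. iexp (u * (levy t x - levy s x))) \<in> borel_measurable path_space" using dm by measurable
    show "(\<lambda>x. iexp (u * I l x)) \<in> borel_measurable path_space" for l using Im[of l] by measurable
  qed auto
  then have "(\<lambda>l. char (distr path_space borel (I l)) u) \<longlonglongrightarrow> char (distr path_space borel (\<lambda>x. levy t x - levy s x)) u"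
    unfolding char_def using Im dm by (simp add: integral_distr)
  moreover have "char (distr path_space borel (I l)) u = exp (of_real (real (up l t) / 2 ^ l - real (up l s) / 2 ^ l) * \<Psi> u)" for l
  proof -
    have "distr path_space borel (I l) = \<mu> (real (card {up l s..<up l t}) / 2 ^ l)"
      unfolding I_def by (rule block_law) simp
    also have "real (card {up l s..<up l t}) / 2 ^ l = real (up l t) / 2 ^ l - real (up l s) / 2 ^ l"
      using up_mono[OF assms(2), of l] by (simp add: of_nat_diff diff_divide_distrib)
    finally have "distr path_space borel (I l) = \<mu> (real (up l t) / 2 ^ l - real (up l s) / 2 ^ l)" .
    moreover have "0 \<le> real (up l t) / 2 ^ l - real (up l s) / 2 ^ l"
      using up_mono[OF assms(2), of l] by (simp add: divide_right_mono)
    ultimately show ?thesis by (simp only: char_law)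
  qed
  moreover have "(\<lambda>l. exp (complex_of_real (real (up l t) / 2 ^ l - real (up l s) / 2 ^ l) * \<Psi> u)) \<longlonglongrightarrow> exp (of_real (t - s) * \<Psi> u)"
    using assms by (intro tendsto_intros up_tendsto) auto
  ultimately show "char (distr path_space borel (\<lambda>x. levy t x - levy s x)) u = exp (of_real (t - s) * \<Psi> u)"
    using LIMSEQ_unique by (simp only:) blast
qed

lemma levy_0 [simp]: "levy 0 x = 0"
  by (simp add: levy_def)

lemma levy_law_eq: "t \<ge> 0 \<Longrightarrow> distr path_space borel (levy t) = \<mu> t"
  using levy_increment_law[of 0 t] by simp

lemma levy_indep:
  assumes t0: "0 \<le> t 0" and mono: "\<And>i. i < k \<Longrightarrow> t i \<le> t (Suc i)"
  shows "prob_space.indep_vars path_space (\<lambda>_. borel) (\<lambda>i x. levy (t (Suc i)) x - levy (t i) x) {..<k::nat}"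
proof -
  interpret prob_space path_space by (rule prob_space_path)
  have mono': "t i \<le> t j" if "i \<le> j" "j \<le> k" for i j
    using that
  proof (induction j rule: dec_induct)
    case (step j)
    then show ?case using mono[of j] by auto
  qed simp
  have tpos: "t i \<ge> 0" if "i \<le> k" for i using mono'[of 0 i] t0 that by simp
  show ?thesis
  proof (rule indep_vars_limit[where Z="\<lambda>l i x. \<Sum>m\<in>{up l (t i)..<up l (t (Suc i))}. incr l m x"])
    show "indep_vars (\<lambda>_. borel) (\<lambda>i x. \<Sum>m\<in>{up l (t i)..<up l (t (Suc i))}. incr l m x) {..<k}" for l
    proof (rule indep_vars_disjoint_sums[OF incr_indep[of l "up l (t k)"]])
      show "{up l (t i)..<up l (t (Suc i))} \<subseteq> {..<up l (t k)}" if "i \<in> {..<k}" for i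
        using up_mono[OF mono'[of "Suc i" k], of l] that by auto
      have dis: "{up l (t i)..<up l (t (Suc i))} \<inter> {up l (t j)..<up l (t (Suc j))} = {}" if "i < j" "j < k" for i j
        using up_mono[OF mono'[of "Suc i" j], of l] that by auto
      show "disjoint_family_on (\<lambda>i. {up l (t i)..<up l (t (Suc i))}) {..<k}"
        unfolding disjoint_family_on_def
      proof (intro ballI impI)
        fix i j assume "i \<in> {..<k}" "j \<in> {..<k}" "i \<noteq> j"
        then show "{up l (t i)..<up l (t (Suc i))} \<inter> {up l (t j)..<up l (t (Suc j))} = {}"
          using dis[of i j] dis[of j i] by (cases "i < j") auto
      qed
    qed
    fix i assume i: "i \<in> {..<k}"
    show "(\<lambda>x. levy (t (Suc i)) x - levy (t i) x) \<in> borel_measurable path_space"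
      by (intro borel_measurable_diff levy_measurable)
    show "AE x in path_space. (\<lambda>l. \<Sum>m\<in>{up l (t i)..<up l (t (Suc i))}. incr l m x) \<longlonglongrightarrow> levy (t (Suc i)) x - levy (t i) x"
      by (rule AE_incr_limit) (use i tpos mono in auto)
  qed
qed

theorem levy_process_levy: "levy_process path_space levy"
  unfolding levy_process_def
proof (intro conjI allI ballI impI)
  show "prob_space path_space" by (rule prob_space_path)
  show "levy t \<in> borel_measurable path_space" for t by (rule levy_measurable)
  show "levy 0 x = 0" for x by simp
  show "cadlag_on {0..} (\<lambda>t. levy t x)" for x
  proof (cases "x \<in> regular")
    case True
    have c: "cadlag_on {0..} (\<lambda>t. limit_path t x)" by (rule limit_path_cadlag[OF True])
    show ?thesis unfolding cadlag_on_def levy_def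
    proof (intro ballI conjI)
      fix t :: real assume t: "t \<in> {0..}"
      show "((\<lambda>t. limit_path t x - limit_path 0 x) \<longlongrightarrow> limit_path t x - limit_path 0 x) (at t within {0..} \<inter> {t<..})"
        using c t unfolding cadlag_on_def by (intro tendsto_intros) auto
      obtain L where "((\<lambda>t. limit_path t x) \<longlongrightarrow> L) (at t within {0..} \<inter> {..<t})"
        using c t unfolding cadlag_on_def by blast
      then have "((\<lambda>t. limit_path t x - limit_path 0 x) \<longlongrightarrow> L - limit_path 0 x) (at t within {0..} \<inter> {..<t})"
        by (intro tendsto_intros)
      then show "\<exists>L. ((\<lambda>t. limit_path t x - limit_path 0 x) \<longlongrightarrow> L) (at t within {0..} \<inter> {..<t})" by blast
    qed
  next
    case False
    then show ?thesis unfolding cadlag_on_def levy_def limit_path_def by auto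
  qed
  show "distr path_space borel (\<lambda>x. levy (s + h) x - levy s x) = distr path_space borel (levy h)"
    if "0 \<le> s" "0 \<le> h" for s h
    using levy_increment_law[of s "s + h"] levy_law_eq[of h] that by simp
  show "prob_space.indep_vars path_space (\<lambda>_. borel) (\<lambda>i x. levy (t (Suc i)) x - levy (t i) x) {..<k}"
    if "0 \<le> t 0" "\<forall>i<k. t i \<le> t (Suc i)" for k :: nat and t
    using that by (intro levy_indep) auto
qed

end

section \<open>Joint convergence of independent coordinates\<close>

lemma measurable_vector:
  assumes "\<And>i. i \<in> I \<Longrightarrow> X i \<in> borel_measurable M"
  shows "(\<lambda>\<omega>. \<lambda>i\<in>I. X i \<omega>) \<in> M \<rightarrow>\<^sub>M PiM I (\<lambda>_. borel)"
  by (intro measurable_restrict assms)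

lemma indep_joint_law_eq:
  fixes X :: "nat \<Rightarrow> 'a \<Rightarrow> real" and Y :: "nat \<Rightarrow> 'b \<Rightarrow> real"
  assumes M: "prob_space M" "prob_space.indep_vars M (\<lambda>_. borel) X {..<k}"
    and N: "prob_space N" "prob_space.indep_vars N (\<lambda>_. borel) Y {..<k}"
    and eq: "\<And>i. i < k \<Longrightarrow> distr M borel (X i) = distr N borel (Y i)" and k: "k > 0"
  shows "distr M (PiM {..<k} (\<lambda>_. borel)) (\<lambda>\<omega>. \<lambda>i\<in>{..<k}. X i \<omega>) = distr N (PiM {..<k} (\<lambda>_. borel)) (\<lambda>\<omega>. \<lambda>i\<in>{..<k}. Y i \<omega>)"
proof -
  interpret M: prob_space M by fact
  interpret N: prob_space N by fact
  have Xm: "X i \<in> borel_measurable M" if "i \<in> {..<k}" for i using M(2) that by (auto simp: M.indep_vars_def)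
  have Ym: "Y i \<in> borel_measurable N" if "i \<in> {..<k}" for i using N(2) that by (auto simp: N.indep_vars_def)
  have ne: "{..<k} \<noteq> {}" using k by auto
  have "M.indep_vars (\<lambda>_. borel) X {..<k} \<longleftrightarrow>
      distr M (PiM {..<k} (\<lambda>_. borel)) (\<lambda>\<omega>. \<lambda>i\<in>{..<k}. X i \<omega>) = PiM {..<k} (\<lambda>i. distr M borel (X i))"
    by (rule M.indep_vars_iff_distr_eq_PiM'[OF ne Xm])
  then have "distr M (PiM {..<k} (\<lambda>_. borel)) (\<lambda>\<omega>. \<lambda>i\<in>{..<k}. X i \<omega>) = PiM {..<k} (\<lambda>i. distr M borel (X i))"
    using M(2) by (rule iffD1)
  also have "\<dots> = PiM {..<k} (\<lambda>i. distr N borel (Y i))" by (intro PiM_cong refl eq) auto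
  also have "\<dots> = distr N (PiM {..<k} (\<lambda>_. borel)) (\<lambda>\<omega>. \<lambda>i\<in>{..<k}. Y i \<omega>)"
  proof -
    have "N.indep_vars (\<lambda>_. borel) Y {..<k} \<longleftrightarrow>
        distr N (PiM {..<k} (\<lambda>_. borel)) (\<lambda>\<omega>. \<lambda>i\<in>{..<k}. Y i \<omega>) = PiM {..<k} (\<lambda>i. distr N borel (Y i))"
      by (rule N.indep_vars_iff_distr_eq_PiM'[OF ne Ym])
    from iffD1[OF this N(2)] show ?thesis by (rule sym)
  qed
  finally show ?thesis .
qed

lemma indep_coordinates:
  fixes S :: "nat \<Rightarrow> 'c \<Rightarrow> real"
  assumes \<Omega>: "\<And>i. prob_space (\<Omega> i)" and S: "\<And>i. i < k \<Longrightarrow> S i \<in> borel_measurable (\<Omega> i)" and k: "k > 0"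
  defines "P \<equiv> PiM {..<k} \<Omega>"
  shows "prob_space.indep_vars P (\<lambda>_. borel) (\<lambda>i x. S i (x i)) {..<k}"
    and "i < k \<Longrightarrow> distr P borel (\<lambda>x. S i (x i)) = distr (\<Omega> i) borel (S i)"
proof -
  interpret P: prob_space P unfolding P_def by (intro prob_space_PiM \<Omega>)
  have ne: "{..<k} \<noteq> {}" using k by auto
  have comp: "distr P (\<Omega> i) (\<lambda>x. x i) = \<Omega> i" if "i \<in> {..<k}" for i
    unfolding P_def by (rule distr_PiM_component) (use \<Omega> that in auto)
  have cm: "(\<lambda>x. x i) \<in> P \<rightarrow>\<^sub>M \<Omega> i" if "i \<in> {..<k}" for i
    unfolding P_def using that by (intro measurable_component_singleton)
  have "distr P (PiM {..<k} \<Omega>) (\<lambda>x. \<lambda>i\<in>{..<k}. x i) = distr P P (\<lambda>x. x)"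
    by (rule distr_cong) (auto simp: P_def space_PiM PiE_restrict restrict_def extensional_def PiE_def fun_eq_iff)
  also have "\<dots> = P" by simp
  also have "P = PiM {..<k} (\<lambda>i. distr P (\<Omega> i) (\<lambda>x. x i))"
    unfolding P_def by (intro PiM_cong refl) (use comp in \<open>auto simp: P_def\<close>)
  finally have vec: "distr P (PiM {..<k} \<Omega>) (\<lambda>x. \<lambda>i\<in>{..<k}. x i) = PiM {..<k} (\<lambda>i. distr P (\<Omega> i) (\<lambda>x. x i))" .
  have "P.indep_vars \<Omega> (\<lambda>i x. x i) {..<k} \<longleftrightarrow>
      distr P (PiM {..<k} \<Omega>) (\<lambda>x. \<lambda>i\<in>{..<k}. x i) = PiM {..<k} (\<lambda>i. distr P (\<Omega> i) (\<lambda>x. x i))"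
    by (rule P.indep_vars_iff_distr_eq_PiM'[OF ne cm])
  from iffD2[OF this vec] have "P.indep_vars \<Omega> (\<lambda>i x. x i) {..<k}" .
  then show "P.indep_vars (\<lambda>_. borel) (\<lambda>i x. S i (x i)) {..<k}"
    by (rule P.indep_vars_compose2) (use S in auto)
  show "distr P borel (\<lambda>x. S i (x i)) = distr (\<Omega> i) borel (S i)" if "i < k"
  proof -
    have i: "i \<in> {..<k}" using that by simp
    have "distr P borel (\<lambda>x. S i (x i)) = distr (distr P (\<Omega> i) (\<lambda>x. x i)) borel (S i)"
      using distr_distr[OF S[OF that] cm[OF i]] by (simp add: comp_def)
    then show ?thesis unfolding comp[OF i] .
  qed
qed

text \<open>Skorohod's theorem is applied to each coordinate separately. On the product of the resulting
probability spaces the coordinates are independent and all of them converge pointwise, and by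
independence the joint laws are the original ones.\<close>

lemma independent_weak_convergence:
  fixes X :: "nat \<Rightarrow> nat \<Rightarrow> 'a \<Rightarrow> real" and Y :: "nat \<Rightarrow> 'b \<Rightarrow> real" and F :: "(nat \<Rightarrow> real) \<Rightarrow> real"
  assumes M: "prob_space M" "\<And>n. prob_space.indep_vars M (\<lambda>_. borel) (X n) {..<k}"
    and N: "prob_space N" "prob_space.indep_vars N (\<lambda>_. borel) Y {..<k}" and k: "k > 0"
    and w: "\<And>i. i < k \<Longrightarrow> weak_conv_m (\<lambda>n. distr M borel (X n i)) (distr N borel (Y i))"
    and Fm: "F \<in> borel_measurable (PiM {..<k} (\<lambda>_. borel))" and B: "\<And>y. \<bar>F y\<bar> \<le> B"
    and cont: "\<And>y z. (\<And>i. i < k \<Longrightarrow> (\<lambda>n. y n i) \<longlonglongrightarrow> z i) \<Longrightarrow> (\<lambda>n. F (y n)) \<longlonglongrightarrow> F z"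
  shows "(\<lambda>n. \<integral>\<omega>. F (\<lambda>i\<in>{..<k}. X n i \<omega>) \<partial>M) \<longlonglongrightarrow> (\<integral>\<omega>. F (\<lambda>i\<in>{..<k}. Y i \<omega>) \<partial>N)"
proof -
  interpret M: prob_space M by fact
  interpret N: prob_space N by fact
  have Xm: "X n i \<in> borel_measurable M" if "i < k" for n i using M(2)[of n] that by (auto simp: M.indep_vars_def)
  have Ym: "Y i \<in> borel_measurable N" if "i < k" for i using N(2) that by (auto simp: N.indep_vars_def)
  define R where "R = (\<lambda>i (\<Omega> :: real measure) (S :: nat \<Rightarrow> real \<Rightarrow> real) (T :: real \<Rightarrow> real). prob_space \<Omega> \<and>
      (i < k \<longrightarrow> (\<forall>n. S n \<in> borel_measurable \<Omega>) \<and> (\<forall>n. distr \<Omega> borel (S n) = distr M borel (X n i)) \<and>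
        T \<in> borel_measurable \<Omega> \<and> distr \<Omega> borel T = distr N borel (Y i) \<and> (\<forall>x\<in>space \<Omega>. (\<lambda>n. S n x) \<longlonglongrightarrow> T x)))"
  have "\<exists>\<Omega> S T. R i \<Omega> S T" for i
  proof (cases "i < k")
    case True
    show ?thesis
      using Skorohod[OF M.real_distribution_distr[OF Xm[OF True]] N.real_distribution_distr[OF Ym[OF True]] w[OF True]] True
      by (simp add: R_def measurable_lborel2)
  next
    case False
    \<comment> \<open>Only coordinates below \<open>k\<close> matter; the others receive a dummy probability space.\<close>
    have "R i (return borel 0) S T" for S T using False by (simp add: R_def prob_space_return)
    then show ?thesis by blast
  qed
  then have "\<forall>i. \<exists>w. R i (fst w) (fst (snd w)) (snd (snd w))" by simp
  then obtain w where R: "\<And>i. R i (fst (w i)) (fst (snd (w i))) (snd (snd (w i)))" by (rule choice[elim_format]) blast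
  define \<Omega> S T where "\<Omega> = (\<lambda>i. fst (w i))" and "S = (\<lambda>i. fst (snd (w i)))" and "T = (\<lambda>i. snd (snd (w i)))"
  have R: "R i (\<Omega> i) (S i) (T i)" for i using R[of i] by (simp add: \<Omega>_def S_def T_def)
  have \<Omega>: "\<And>i. prob_space (\<Omega> i)" and S: "\<And>i n. i < k \<Longrightarrow> S i n \<in> borel_measurable (\<Omega> i)"
    and Sd: "\<And>i n. i < k \<Longrightarrow> distr (\<Omega> i) borel (S i n) = distr M borel (X n i)"
    and T: "\<And>i. i < k \<Longrightarrow> T i \<in> borel_measurable (\<Omega> i)" and Td: "\<And>i. i < k \<Longrightarrow> distr (\<Omega> i) borel (T i) = distr N borel (Y i)"
    and lim: "\<And>i x. i < k \<Longrightarrow> x \<in> space (\<Omega> i) \<Longrightarrow> (\<lambda>n. S i n x) \<longlonglongrightarrow> T i x"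
    using R unfolding R_def by simp_all
  define P where "P = PiM {..<k} \<Omega>"
  interpret P: prob_space P unfolding P_def by (intro prob_space_PiM \<Omega>)
  have cm: "(\<lambda>x. x i) \<in> P \<rightarrow>\<^sub>M \<Omega> i" if "i \<in> {..<k}" for i
    unfolding P_def using that by (intro measurable_component_singleton)
  have Sv: "(\<lambda>x. \<lambda>i\<in>{..<k}. S i n (x i)) \<in> P \<rightarrow>\<^sub>M PiM {..<k} (\<lambda>_. borel)" for n
    by (intro measurable_vector measurable_compose[OF cm S]) auto
  have Tv: "(\<lambda>x. \<lambda>i\<in>{..<k}. T i (x i)) \<in> P \<rightarrow>\<^sub>M PiM {..<k} (\<lambda>_. borel)"
    by (intro measurable_vector measurable_compose[OF cm T]) auto
  have eX: "(\<integral>\<omega>. F (\<lambda>i\<in>{..<k}. X n i \<omega>) \<partial>M) = (\<integral>x. F (\<lambda>i\<in>{..<k}. S i n (x i)) \<partial>P)" for n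
  proof -
    have Xv: "(\<lambda>\<omega>. \<lambda>i\<in>{..<k}. X n i \<omega>) \<in> M \<rightarrow>\<^sub>M PiM {..<k} (\<lambda>_. borel)"
      by (intro measurable_vector Xm) auto
    have "distr M (PiM {..<k} (\<lambda>_. borel)) (\<lambda>\<omega>. \<lambda>i\<in>{..<k}. X n i \<omega>) = distr P (PiM {..<k} (\<lambda>_. borel)) (\<lambda>x. \<lambda>i\<in>{..<k}. S i n (x i))"
      using indep_coordinates[where \<Omega>=\<Omega> and S="\<lambda>i. S i n", OF \<Omega> S k] Sd
      by (intro indep_joint_law_eq M P.prob_space_axioms k) (simp_all add: P_def)
    then show ?thesis by (simp only: integral_distr[OF Xv Fm, symmetric] integral_distr[OF Sv Fm, symmetric])
  qed
  have eY: "(\<integral>\<omega>. F (\<lambda>i\<in>{..<k}. Y i \<omega>) \<partial>N) = (\<integral>x. F (\<lambda>i\<in>{..<k}. T i (x i)) \<partial>P)"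
  proof -
    have Yv: "(\<lambda>\<omega>. \<lambda>i\<in>{..<k}. Y i \<omega>) \<in> N \<rightarrow>\<^sub>M PiM {..<k} (\<lambda>_. borel)"
      by (intro measurable_vector Ym) auto
    have "distr N (PiM {..<k} (\<lambda>_. borel)) (\<lambda>\<omega>. \<lambda>i\<in>{..<k}. Y i \<omega>) = distr P (PiM {..<k} (\<lambda>_. borel)) (\<lambda>x. \<lambda>i\<in>{..<k}. T i (x i))"
      using indep_coordinates[where \<Omega>=\<Omega> and S=T, OF \<Omega> T k] Td
      by (intro indep_joint_law_eq N P.prob_space_axioms k) (simp_all add: P_def)
    then show ?thesis by (simp only: integral_distr[OF Yv Fm, symmetric] integral_distr[OF Tv Fm, symmetric])
  qed
  show ?thesis unfolding eX eY
  proof (rule integral_dominated_convergence[where w="\<lambda>_. B"])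
    show "(\<lambda>x. F (\<lambda>i\<in>{..<k}. T i (x i))) \<in> borel_measurable P" by (rule measurable_compose[OF Tv Fm])
    show "(\<lambda>x. F (\<lambda>i\<in>{..<k}. S i n (x i))) \<in> borel_measurable P" for n by (rule measurable_compose[OF Sv Fm])
    show "AE x in P. (\<lambda>n. F (\<lambda>i\<in>{..<k}. S i n (x i))) \<longlonglongrightarrow> F (\<lambda>i\<in>{..<k}. T i (x i))"
    proof (rule AE_I2)
      fix x assume x: "x \<in> space P"
      show "(\<lambda>n. F (\<lambda>i\<in>{..<k}. S i n (x i))) \<longlonglongrightarrow> F (\<lambda>i\<in>{..<k}. T i (x i))"
      proof (rule cont)
        fix i assume i: "i < k"
        then have "x i \<in> space (\<Omega> i)" using x by (auto simp: P_def space_PiM)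
        then show "(\<lambda>n. (\<lambda>i\<in>{..<k}. S i n (x i)) i) \<longlonglongrightarrow> (\<lambda>i\<in>{..<k}. T i (x i)) i" using i lim[OF i] by simp
      qed
    qed
    show "AE x in P. norm (F (\<lambda>i\<in>{..<k}. S i n (x i))) \<le> B" for n using B by simp
  qed simp
qed

section \<open>The geometry of a moving average\<close>


lemma abel_summation:
  fixes \<phi> g :: "nat \<Rightarrow> real"
  shows "(\<Sum>s<q. (\<Sum>i\<le>s. \<phi> i) * (g s - g (Suc s))) + (\<Sum>i\<le>q. \<phi> i) * g q = (\<Sum>s\<le>q. \<phi> s * g s)"
  by (induction q) (auto simp: algebra_simps)

text \<open>At time \<open>m\<close> the term \<open>x (m + q - 1 - s)\<close> has contributed only the share \<open>\<beta> s\<close> of its total effect.\<close>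

definition smoothed_walk :: "nat \<Rightarrow> (nat \<Rightarrow> real) \<Rightarrow> (nat \<Rightarrow> real) \<Rightarrow> nat \<Rightarrow> real" where
  "smoothed_walk q \<beta> x m = (\<Sum>i<m. x i) + (\<Sum>s<q. \<beta> s * x (m + q - 1 - s))"

lemma moving_average_sum:
  fixes \<phi> x :: "nat \<Rightarrow> real"
  assumes \<Phi>: "\<Phi> = (\<Sum>i\<le>q. \<phi> i)" "\<Phi> \<noteq> 0" and \<beta>: "\<And>s. \<beta> s = (\<Sum>i\<le>s. \<phi> i) / \<Phi>"
  shows "(\<Sum>j<m. \<Sum>s\<le>q. \<phi> s * x (j + q - s)) = \<Phi> * (smoothed_walk q \<beta> x m - smoothed_walk q \<beta> x 0)"
proof (induction m)
  case (Suc m)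
  have "\<Phi> * (smoothed_walk q \<beta> x (Suc m) - smoothed_walk q \<beta> x m)
      = \<Phi> * x m + (\<Sum>s<q. \<Phi> * \<beta> s * (x (m + q - s) - x (m + q - Suc s)))"
    by (simp add: smoothed_walk_def algebra_simps sum_distrib_left sum_subtractf)
  also have "(\<Sum>s<q. \<Phi> * \<beta> s * (x (m + q - s) - x (m + q - Suc s))) = (\<Sum>s<q. (\<Sum>i\<le>s. \<phi> i) * (x (m + q - s) - x (m + q - Suc s)))"
    using \<Phi>(2) by (simp add: \<beta>)
  also have "\<Phi> * x m + \<dots> = (\<Sum>s\<le>q. \<phi> s * x (m + q - s))"
    using abel_summation[of \<phi> "\<lambda>s. x (m + q - s)" q] \<Phi>(1) by simp
  finally show ?case using Suc by (simp add: algebra_simps)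
qed simp

lemma sum_block_reverse:
  fixes q m :: nat
  shows "(\<Sum>s<q. x (m + q - 1 - s)) = (\<Sum>i\<in>{m..<m + q}. x i :: real)"
proof -
  have "(\<Sum>s<q. x (m + q - 1 - s)) = (\<Sum>s<q. (\<lambda>i. x (m + i)) (q - Suc s))"
    by (intro sum.cong refl) (auto intro!: arg_cong[of _ _ x])
  also have "\<dots> = (\<Sum>i<q. x (m + i))" by (rule sum.nat_diff_reindex)
  also have "\<dots> = (\<Sum>i\<in>{m..<m + q}. x i)"
    using sum.shift_bounds_nat_ivl[of x 0 m q] by (simp add: add.commute atLeast0LessThan)
  finally show ?thesis .
qed

lemma single_big_in_window:
  assumes "\<not> two_big_blocks e A B x" "i \<in> {A..<B}" "j \<in> {A..<B}" "i \<noteq> j" "\<bar>x i\<bar> > e"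
  shows "\<bar>x j\<bar> \<le> (e::real)"
proof (rule ccontr)
  assume "\<not> ?thesis"
  then have j: "\<bar>x j\<bar> > e" by simp
  have *: "two_big_blocks e A B x" if "i < j" "\<bar>x i\<bar> > e" "\<bar>x j\<bar> > e" "A \<le> i" "j < B" for i j
    unfolding two_big_blocks_def
    by (rule bexI[of _ i], rule bexI[of _ "Suc i"], rule bexI[of _ j], rule bexI[of _ "Suc j"])
       (use that in auto)
  show False using *[of i j] *[of j i] j assms by (cases "i < j") auto
qed

text \<open>At most one of the \<open>q\<close> partially counted terms is large, and \<open>\<theta>\<close> is taken to be its share. All the
other terms may be counted with the wrong share at a cost of \<open>e\<close> each.\<close>

lemma smoothed_walk_between:
  fixes x \<beta> :: "nat \<Rightarrow> real"
  assumes \<beta>: "\<And>s. s < q \<Longrightarrow> 0 \<le> \<beta> s \<and> \<beta> s \<le> 1" and e: "e \<ge> 0"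
    and nb: "\<not> two_big_blocks e A (B + q) x" and m: "A \<le> m" "m \<le> B"
  shows "\<exists>\<theta>\<in>{0..1}. \<bar>smoothed_walk q \<beta> x m - ((1 - \<theta>) * (\<Sum>i<m. x i) + \<theta> * (\<Sum>i<m + q. x i))\<bar> \<le> real q * e"
proof -
  define y where "y = (\<lambda>s. x (m + q - 1 - s))"
  have R: "(\<Sum>i<m + q. x i) = (\<Sum>i<m. x i) + (\<Sum>s<q. y s)"
  proof -
    have "(\<Sum>i<m + q. x i) = (\<Sum>i<m. x i) + (\<Sum>i\<in>{m..<m + q}. x i)"
      using sum.atLeastLessThan_concat[of 0 m "m + q" x] by (simp add: atLeast0LessThan)
    then show ?thesis using sum_block_reverse[of x m q] by (simp add: y_def)
  qed
  have diff: "smoothed_walk q \<beta> x m - ((1 - \<theta>) * (\<Sum>i<m. x i) + \<theta> * (\<Sum>i<m + q. x i)) = (\<Sum>s<q. (\<beta> s - \<theta>) * y s)" for \<theta>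
    unfolding R smoothed_walk_def y_def by (simp add: algebra_simps sum_subtractf sum_distrib_left)
  have bound: "\<bar>\<Sum>s<q. (\<beta> s - \<theta>) * y s\<bar> \<le> real q * e"
    if \<theta>: "\<theta> \<in> {0..1}" "\<And>s. s < q \<Longrightarrow> \<beta> s = \<theta> \<or> \<bar>y s\<bar> \<le> e" for \<theta>
  proof -
    have "\<bar>\<Sum>s<q. (\<beta> s - \<theta>) * y s\<bar> \<le> (\<Sum>s<q. \<bar>(\<beta> s - \<theta>) * y s\<bar>)" by (rule sum_abs)
    also have "\<dots> \<le> (\<Sum>s<q. e)"
    proof (rule sum_mono)
      fix s assume s: "s \<in> {..<q}"
      have "\<bar>\<beta> s - \<theta>\<bar> \<le> 1" using \<beta>[of s] \<theta>(1) s by auto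
      then have "\<bar>\<beta> s - \<theta>\<bar> * \<bar>y s\<bar> \<le> 1 * e" if "\<bar>y s\<bar> \<le> e" using that by (intro mult_mono) auto
      then show "\<bar>(\<beta> s - \<theta>) * y s\<bar> \<le> e" using \<theta>(2)[of s] s e by (auto simp: abs_mult)
    qed
    finally show ?thesis by simp
  qed
  show ?thesis
  proof (cases "\<exists>s<q. \<bar>y s\<bar> > e")
    case False
    then show ?thesis unfolding diff by (intro bexI[of _ 0] bound) auto
  next
    case True
    then obtain s0 where s0: "s0 < q" "\<bar>y s0\<bar> > e" by blast
    have "\<bar>y s\<bar> \<le> e" if "s < q" "s \<noteq> s0" for s
      unfolding y_def
      by (rule single_big_in_window[OF nb, of "m + q - 1 - s0"]) (use s0 that m in \<open>auto simp: y_def\<close>)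
    then show ?thesis unfolding diff using \<beta>[OF s0(1)] by (intro bexI[of _ "\<beta> s0"] bound) auto
  qed
qed

lemma partial_sum_diff: "A \<le> (v::nat) \<Longrightarrow> (\<Sum>i<v. x i) - (\<Sum>i<A. x i) = (\<Sum>i\<in>{A..<v}. x i :: real)"
  using sum.atLeastLessThan_concat[of 0 A v x] by (simp add: atLeast0LessThan)

lemma small_terms_sum:
  fixes x :: "nat \<Rightarrow> real"
  assumes "\<And>i. i \<in> {A..<A + q} \<Longrightarrow> \<bar>x i\<bar> \<le> e"
  shows "\<bar>(\<Sum>i<A + q. x i) - (\<Sum>i<A. x i)\<bar> \<le> real q * e"
proof -
  have "\<bar>\<Sum>i\<in>{A..<A + q}. x i\<bar> \<le> (\<Sum>i\<in>{A..<A + q}. \<bar>x i\<bar>)" by (rule sum_abs)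
  also have "\<dots> \<le> (\<Sum>i\<in>{A..<A + q}. e)" by (intro sum_mono assms)
  finally show ?thesis by (simp add: partial_sum_diff)
qed

lemma smoothed_walk_node:
  fixes x \<beta> :: "nat \<Rightarrow> real"
  assumes \<beta>: "\<And>s. s < q \<Longrightarrow> 0 \<le> \<beta> s \<and> \<beta> s \<le> 1"
    and small: "\<And>i. i \<in> {A..<A + q} \<Longrightarrow> \<bar>x i\<bar> \<le> e"
  shows "\<bar>smoothed_walk q \<beta> x A - (\<Sum>i<A + q. x i)\<bar> \<le> real q * e"
proof -
  have "(\<Sum>i<A + q. x i) = (\<Sum>i<A. x i) + (\<Sum>s<q. x (A + q - 1 - s))"
    using partial_sum_diff[of A "A + q" x] sum_block_reverse[of x A q] by simp
  then have "smoothed_walk q \<beta> x A - (\<Sum>i<A + q. x i) = (\<Sum>s<q. (\<beta> s - 1) * x (A + q - 1 - s))"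
    by (simp add: smoothed_walk_def algebra_simps sum_subtractf)
  also have "\<bar>\<dots>\<bar> \<le> (\<Sum>s<q. \<bar>(\<beta> s - 1) * x (A + q - 1 - s)\<bar>)" by (rule sum_abs)
  also have "\<dots> \<le> (\<Sum>s<q. e)"
  proof (rule sum_mono)
    fix s assume s: "s \<in> {..<q}"
    have 1: "\<bar>\<beta> s - 1\<bar> \<le> 1" using \<beta>[of s] s by auto
    have 2: "\<bar>x (A + q - 1 - s)\<bar> \<le> e" by (rule small) (use s in auto)
    have "\<bar>\<beta> s - 1\<bar> * \<bar>x (A + q - 1 - s)\<bar> \<le> 1 * e" using 1 2 by (intro mult_mono) auto
    then show "\<bar>(\<beta> s - 1) * x (A + q - 1 - s)\<bar> \<le> e" by (simp add: abs_mult)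
  qed
  finally show ?thesis by simp
qed

text \<open>In the absence of two large blocks, a partial sum at a time \<open>w\<close> within the cell is close to the
partial sum at one of the ends, for otherwise the blocks from \<open>A\<close> to \<open>w\<close> and from \<open>w\<close> to \<open>B + q\<close> would
both be large. By \<open>smoothed_walk_between\<close> the smoothed walk lies between two such partial sums.\<close>

lemma smoothed_walk_cell:
  fixes x \<beta> :: "nat \<Rightarrow> real"
  assumes \<beta>: "\<And>s. s < q \<Longrightarrow> 0 \<le> \<beta> s \<and> \<beta> s \<le> 1" and e: "e \<ge> 0"
    and nb: "\<not> two_big_blocks e A (B + q) x" and m: "A \<le> m" "m \<le> B"
    and small: "\<And>i. i \<in> {A..<A + q} \<Longrightarrow> \<bar>x i\<bar> \<le> e"
  defines "u \<equiv> (\<Sum>i<A + q. x i)" and "v \<equiv> (\<Sum>i<B + q. x i)"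
  shows "min u v - (2 * real q + 1) * e \<le> smoothed_walk q \<beta> x m \<and> smoothed_walk q \<beta> x m \<le> max u v + (2 * real q + 1) * e"
proof -
  define R where "R = (\<lambda>j. \<Sum>i<j. x i)"
  define d where "d = (real q + 1) * e"
  have qe: "real q * e \<ge> 0" using e by simp
  have A: "\<bar>R A - u\<bar> \<le> real q * e" using small_terms_sum[of A q x e, OF small] by (simp add: R_def u_def abs_minus_commute)
  have near: "min u v - d \<le> R w \<and> R w \<le> max u v + d" if w: "A \<le> w" "w \<le> B + q" for w
  proof -
    have "\<not> (\<bar>\<Sum>i\<in>{A..<w}. x i\<bar> > e \<and> \<bar>\<Sum>i\<in>{w..<B + q}. x i\<bar> > e)"
      using nb w unfolding two_big_blocks_def by (meson atLeastAtMost_iff order_refl order_trans)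
    then have "\<bar>R w - R A\<bar> \<le> e \<or> \<bar>v - R w\<bar> \<le> e"
      using w partial_sum_diff[of A w x] partial_sum_diff[of w "B + q" x] by (auto simp: R_def v_def)
    moreover have "d = real q * e + e" by (simp add: d_def algebra_simps)
    ultimately show ?thesis using A qe e by linarith
  qed
  obtain \<theta> where \<theta>: "\<theta> \<in> {0..1}" "\<bar>smoothed_walk q \<beta> x m - ((1 - \<theta>) * R m + \<theta> * R (m + q))\<bar> \<le> real q * e"
    using smoothed_walk_between[where \<beta>=\<beta>, OF \<beta> e nb m] by (auto simp: R_def)
  \<comment> \<open>The segment from \<open>min u v - d\<close> to \<open>max u v + d\<close>, given by its midpoint and half its length.\<close>
  define z where "z = (max u v + min u v) / 2"
  define h where "h = (max u v - min u v) / 2 + d"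
  have "\<bar>\<theta> * R (m + q) + (1 - \<theta>) * R m - z\<bar> \<le> h"
    using near[of m] near[of "m + q"] m \<theta>(1)
    by (intro segment_abs_le) (auto simp: z_def h_def abs_le_iff field_simps)
  then have "min u v - d \<le> \<theta> * R (m + q) + (1 - \<theta>) * R m \<and> \<theta> * R (m + q) + (1 - \<theta>) * R m \<le> max u v + d"
    by (auto simp: z_def h_def abs_le_iff field_simps)
  moreover have "(2 * real q + 1) * e = d + real q * e" by (simp add: d_def algebra_simps)
  ultimately show ?thesis using \<theta>(2) by linarith
qed

lemma step_path_at_grid:
  assumes "k > 0" "j \<le> k"
  shows "step_path n v (real j / real k) = v (n * j div k)"
proof -
  have "real n * (real j / real k) = real (n * j) / real k" by simp
  then have "\<lfloor>real n * (real j / real k)\<rfloor> = int (n * j div k)" by (simp only: floor_divide_of_nat_eq)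
  then show ?thesis using assms by (simp add: step_path_def)
qed

lemma cell_index:
  assumes "k > 0" "t \<in> {0..1}" "real j \<le> real k * t" "real k * t \<le> real j + 1"
  shows "n * j div k \<le> nat \<lfloor>real n * t\<rfloor>" "nat \<lfloor>real n * t\<rfloor> \<le> n * Suc j div k"
proof -
  have fl: "\<lfloor>real (n * j) / real k\<rfloor> = int (n * j div k)" for j by (rule floor_divide_of_nat_eq)
  have "real j / real k \<le> t" using assms by (simp add: field_simps)
  then have "real n * (real j / real k) \<le> real n * t" by (intro mult_left_mono) auto
  then have "real (n * j) / real k \<le> real n * t" by simp
  then have "\<lfloor>real (n * j) / real k\<rfloor> \<le> \<lfloor>real n * t\<rfloor>" by (rule floor_mono)
  then show "n * j div k \<le> nat \<lfloor>real n * t\<rfloor>" unfolding fl by linarith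
  have "t \<le> real (Suc j) / real k" using assms by (simp add: field_simps)
  then have "real n * t \<le> real n * (real (Suc j) / real k)" by (intro mult_left_mono) auto
  then have "real n * t \<le> real (n * Suc j) / real k" by (simp only: of_nat_mult times_divide_eq_right)
  then have "\<lfloor>real n * t\<rfloor> \<le> \<lfloor>real (n * Suc j) / real k\<rfloor>" by (rule floor_mono)
  then show "nat \<lfloor>real n * t\<rfloor> \<le> n * Suc j div k" unfolding fl by linarith
qed

lemma scaled_between:
  fixes \<Phi> y c u v d :: real
  assumes "min u v - d \<le> y" "y \<le> max u v + d" "\<bar>c - c'\<bar> \<le> d'"
  shows "min (\<Phi> * (u - c')) (\<Phi> * (v - c')) - \<bar>\<Phi>\<bar> * (d + d') \<le> \<Phi> * (y - c) \<and>
    \<Phi> * (y - c) \<le> max (\<Phi> * (u - c')) (\<Phi> * (v - c')) + \<bar>\<Phi>\<bar> * (d + d')"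
proof -
  have lo: "min u v - c' - (d + d') \<le> y - c" and hi: "y - c \<le> max u v - c' + (d + d')" using assms by linarith+
  show ?thesis
  proof (cases "\<Phi> \<ge> 0")
    case True
    have m: "min (\<Phi> * (u - c')) (\<Phi> * (v - c')) = \<Phi> * (min u v - c')" "max (\<Phi> * (u - c')) (\<Phi> * (v - c')) = \<Phi> * (max u v - c')"
      using True mult_left_mono[of u v \<Phi>] mult_left_mono[of v u \<Phi>] by (auto simp: min_def max_def algebra_simps)
    show ?thesis unfolding m using mult_left_mono[OF lo True] mult_left_mono[OF hi True] True by (simp add: algebra_simps)
  next
    case False
    then have F: "\<Phi> \<le> 0" by simp
    have m: "min (\<Phi> * (u - c')) (\<Phi> * (v - c')) = \<Phi> * (max u v - c')" "max (\<Phi> * (u - c')) (\<Phi> * (v - c')) = \<Phi> * (min u v - c')"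
      using F mult_left_mono_neg[of u v \<Phi>] mult_left_mono_neg[of v u \<Phi>] by (auto simp: min_def max_def algebra_simps)
    show ?thesis unfolding m using mult_left_mono_neg[OF lo F] mult_left_mono_neg[OF hi F] F by (simp add: algebra_simps)
  qed
qed

text \<open>The grid values of the comparison path are \<open>\<Phi>\<close> times the partial sums up to \<open>n * j div k + q\<close>, started
at \<open>q\<close>. At the grid times the
smoothed walk agrees with them because the partially counted terms are small, and between grid times
\<open>smoothed_walk_cell\<close> keeps it between them.\<close>

lemma moving_average_path_close:
  fixes x \<beta> :: "nat \<Rightarrow> real" and n k q :: nat
  defines "A \<equiv> (\<lambda>j. n * j div k)"
  assumes k: "k > 0" and e: "e \<ge> 0" and \<beta>: "\<And>s. s < q \<Longrightarrow> 0 \<le> \<beta> s \<and> \<beta> s \<le> 1"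
    and nb: "\<And>j. j < k \<Longrightarrow> \<not> two_big_blocks e (A j) (A (Suc j) + q) x"
    and small: "\<And>i j. j \<le> k \<Longrightarrow> i \<in> {A j..<A j + q} \<Longrightarrow> \<bar>x i\<bar> \<le> e"
  shows "dist_M2 (step_path n (\<lambda>m. \<Phi> * (smoothed_walk q \<beta> x m - smoothed_walk q \<beta> x 0)))
      (step_path k (\<lambda>j. \<Phi> * (\<Sum>i<j. \<Sum>l\<in>{A i + q..<A (Suc i) + q}. x l))) \<le> 1 / real k + \<bar>\<Phi>\<bar> * ((4 * real q + 1) * e)"
proof -
  define R where "R = (\<lambda>j. \<Sum>i<j. x i)"
  define T where "T = smoothed_walk q \<beta> x"
  have A0: "A 0 = 0" by (simp add: A_def)
  have Amono: "A i \<le> A j" if "i \<le> j" for i j using that by (auto simp: A_def intro!: div_le_mono mult_le_mono)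
  have sums: "(\<Sum>i<j. \<Sum>l\<in>{A i + q..<A (Suc i) + q}. x l) = R (A j + q) - R q" for j
  proof (induction j)
    case (Suc j)
    have "(\<Sum>l\<in>{A j + q..<A (Suc j) + q}. x l) = R (A (Suc j) + q) - R (A j + q)"
      unfolding R_def using Amono[of j "Suc j"] by (subst partial_sum_diff) auto
    then show ?case using Suc by simp
  qed (simp add: A0)
  have node: "\<bar>T (A j) - R (A j + q)\<bar> \<le> real q * e" if "j \<le> k" for j
    unfolding T_def R_def by (rule smoothed_walk_node[OF \<beta> small[OF that]])
  have T0: "\<bar>T 0 - R q\<bar> \<le> real q * e" using node[of 0] by (simp add: A0)
  have qe: "real q * e \<ge> 0" using e by simp
  have split: "(4 * real q + 1) * e = (2 * real q + 1) * e + real q * e + real q * e" by (simp add: algebra_simps)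
  have "dist_M2 (step_path n (\<lambda>m. \<Phi> * (T m - T 0))) (step_path k (\<lambda>j. \<Phi> * (R (A j + q) - R q))) \<le> 1 / real k + \<bar>\<Phi>\<bar> * ((4 * real q + 1) * e)"
  proof (rule dist_M2_step_path_grid[OF step_path_in_D01 k])
    fix j t assume j: "j < k" and t: "real j \<le> real k * t" "real k * t \<le> real j + 1"
    have t01: "t \<in> {0..1}"
    proof -
      have "0 \<le> real k * t" using t(1) by linarith
      moreover have "real k * t \<le> real k * 1" using t(2) j by linarith
      ultimately show ?thesis using k by (simp add: zero_le_mult_iff)
    qed
    define m where "m = nat \<lfloor>real n * t\<rfloor>"
    have m: "A j \<le> m" "m \<le> A (Suc j)" using cell_index[OF k t01 t, of n] by (auto simp: A_def m_def)
    have "min (R (A j + q)) (R (A (Suc j) + q)) - (2 * real q + 1) * e \<le> T m \<and> T m \<le> max (R (A j + q)) (R (A (Suc j) + q)) + (2 * real q + 1) * e"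
      unfolding T_def R_def
      by (rule smoothed_walk_cell[OF \<beta> e nb[OF j] m]) (use small[of j] j in auto)
    then have "min (\<Phi> * (R (A j + q) - R q)) (\<Phi> * (R (A (Suc j) + q) - R q)) - \<bar>\<Phi>\<bar> * ((2 * real q + 1) * e + real q * e) \<le> \<Phi> * (T m - T 0) \<and>
      \<Phi> * (T m - T 0) \<le> max (\<Phi> * (R (A j + q) - R q)) (\<Phi> * (R (A (Suc j) + q) - R q)) + \<bar>\<Phi>\<bar> * ((2 * real q + 1) * e + real q * e)"
      using T0 by (intro scaled_between) auto
    moreover have "\<bar>\<Phi>\<bar> * ((2 * real q + 1) * e + real q * e) \<le> \<bar>\<Phi>\<bar> * ((4 * real q + 1) * e)"
      unfolding split using qe by (intro mult_left_mono; linarith)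
    moreover have "step_path n (\<lambda>m. \<Phi> * (T m - T 0)) t = \<Phi> * (T m - T 0)"
      using t01 by (simp add: step_path_def m_def)
    ultimately show "min (\<Phi> * (R (A j + q) - R q)) (\<Phi> * (R (A (Suc j) + q) - R q)) - \<bar>\<Phi>\<bar> * ((4 * real q + 1) * e) \<le> step_path n (\<lambda>m. \<Phi> * (T m - T 0)) t \<and>
      step_path n (\<lambda>m. \<Phi> * (T m - T 0)) t \<le> max (\<Phi> * (R (A j + q) - R q)) (\<Phi> * (R (A (Suc j) + q) - R q)) + \<bar>\<Phi>\<bar> * ((4 * real q + 1) * e)"
      by linarith
  next
    fix j assume j: "j \<le> k"
    have "step_path n (\<lambda>m. \<Phi> * (T m - T 0)) (real j / real k) = \<Phi> * (T (A j) - T 0)"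
      using step_path_at_grid[OF k j] by (simp add: A_def)
    then have "\<bar>step_path n (\<lambda>m. \<Phi> * (T m - T 0)) (real j / real k) - \<Phi> * (R (A j + q) - R q)\<bar> = \<bar>\<Phi>\<bar> * \<bar>(T (A j) - R (A j + q)) - (T 0 - R q)\<bar>"
      by (simp add: abs_mult[symmetric] algebra_simps)
    also have "\<dots> \<le> \<bar>\<Phi>\<bar> * (real q * e + real q * e)" using node[OF j] T0 by (intro mult_left_mono; linarith)
    also have "\<dots> \<le> \<bar>\<Phi>\<bar> * ((4 * real q + 1) * e)"
      unfolding split using qe e by (intro mult_left_mono; simp add: algebra_simps)
    finally show "\<bar>step_path n (\<lambda>m. \<Phi> * (T m - T 0)) (real j / real k) - \<Phi> * (R (A j + q) - R q)\<bar> \<le> \<bar>\<Phi>\<bar> * ((4 * real q + 1) * e)" .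
  qed
  then show ?thesis unfolding sums T_def .
qed

lemma restrict_cadlag_in_D01:
  assumes "cadlag_on {0..} y"
  shows "(\<lambda>t\<in>{0..1}. c * y t) \<in> D01"
proof -
  have "cadlag_on {0..1} (\<lambda>t\<in>{0..1}. c * y t)"
    unfolding cadlag_on_def
  proof (intro ballI conjI)
    fix t :: real assume t: "t \<in> {0..1}"
    have tr: "((\<lambda>t\<in>{0..1}. c * y t) \<longlongrightarrow> l) (at t within {0..1} \<inter> U)" if "(y \<longlongrightarrow> l') (at t within {0..} \<inter> U)" "l = c * l'" for l l' U
    proof -
      have "(y \<longlongrightarrow> l') (at t within {0..1} \<inter> U)" by (rule tendsto_within_subset[OF that(1)]) auto
      then have "((\<lambda>t. c * y t) \<longlongrightarrow> l) (at t within {0..1} \<inter> U)" unfolding that(2) by (intro tendsto_intros)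
      moreover have "eventually (\<lambda>s. c * y s = (\<lambda>t\<in>{0..1}. c * y t) s) (at t within {0..1} \<inter> U)"
        by (auto simp: eventually_at_filter)
      ultimately show ?thesis by (rule Lim_transform_eventually)
    qed
    have y: "(y \<longlongrightarrow> y t) (at t within {0..} \<inter> {t<..})" "\<exists>l. (y \<longlongrightarrow> l) (at t within {0..} \<inter> {..<t})"
      using assms t unfolding cadlag_on_def by auto
    show "((\<lambda>t\<in>{0..1}. c * y t) \<longlongrightarrow> (\<lambda>t\<in>{0..1}. c * y t) t) (at t within {0..1} \<inter> {t<..})"
      by (rule tr[OF y(1)]) (use t in simp)
    show "\<exists>l. ((\<lambda>t\<in>{0..1}. c * y t) \<longlongrightarrow> l) (at t within {0..1} \<inter> {..<t})"
      using y(2) tr by blast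
  qed
  then show ?thesis by (auto simp: D01_def)
qed

section \<open>Convergence of the moving average paths\<close>

context iid_heavy_tail
begin

lemma convolution_semigroup_levy_law: "convolution_semigroup levy_law exponent"
proof (rule convolution_semigroup.intro)
  fix e :: real assume "e > 0"
  from levy_law_tail[OF this] show "\<exists>C>0. \<forall>t\<in>{0..1}. measure (levy_law t) {x. \<bar>x\<bar> > e} \<le> C * t"
    by (metis atLeastAtMost_iff)
qed (use levy_law in auto)

sublocale CS: convolution_semigroup levy_law exponent
  by (rule convolution_semigroup_levy_law)

lemma stable_levy: "stable_levy_process \<alpha> CS.path_space CS.levy"
proof -
  have "distr CS.path_space borel (CS.levy 1) = stable_law"
    using CS.levy_law_eq[of 1] levy_law_1 by simp
  then show ?thesis
    unfolding stable_levy_process_def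
    using CS.levy_process_levy stable_distribution_stable_law nondegenerate_stable_law by simp
qed

definition noise_term :: "nat \<Rightarrow> nat \<Rightarrow> 'a \<Rightarrow> real" where
  "noise_term n i \<omega> = (\<xi> i \<omega> - centre) / a n"

lemma block_noise: "block n I \<omega> = (\<Sum>i\<in>I. noise_term n i \<omega>)"
  by (simp add: block_def noise_term_def)

lemma noise_term_measurable[measurable]: "noise_term n i \<in> borel_measurable M"
  unfolding noise_term_def[abs_def] by measurable

lemma noise_term_indep: "S.indep_vars (\<lambda>_. borel) (noise_term n) I"
  using indep_terms[of n I] by (simp add: noise_term_def[abs_def])

text \<open>The exceptional set for \<open>moving_average_path_close\<close>.\<close>

definition bad_event :: "nat \<Rightarrow> nat \<Rightarrow> real \<Rightarrow> nat \<Rightarrow> 'a set" where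
  "bad_event q k e n =
     (\<Union>j<k. {\<omega>\<in>space M. two_big_blocks e (n * j div k) (n * Suc j div k + q) (\<lambda>i. noise_term n i \<omega>)}) \<union>
     (\<Union>j\<le>k. \<Union>i\<in>{n * j div k..<n * j div k + q}. {\<omega>\<in>space M. \<bar>noise_term n i \<omega>\<bar> > e})"

lemma two_big_noise_measurable: "{\<omega>\<in>space M. two_big_blocks e b c (\<lambda>i. noise_term n i \<omega>)} \<in> sets M"
  unfolding two_big_blocks_def
  by (intro predE pred_intros_finite pred_intros_logic borel_measurable_pred_less
      borel_measurable_abs borel_measurable_sum noise_term_measurable measurable_const) auto

lemma big_noise_measurable: "{\<omega>\<in>space M. \<bar>noise_term n i \<omega>\<bar> > e} \<in> sets M"
  by measurable

lemma bad_event_measurable: "bad_event q k e n \<in> sets M"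
  unfolding bad_event_def
  by (intro sets.Un sets.finite_UN two_big_noise_measurable big_noise_measurable) auto

text \<open>For large \<open>n\<close> a window consists of at most \<open>2 * n / k\<close> terms. Hence each of the \<open>k\<close> windows contains
two large blocks with probability of order \<open>1 / k\<^sup>2\<close>, while each of the \<open>(k + 1) * q\<close> terms next to a
grid point is large with probability of order \<open>1 / n\<close>.\<close>

lemma bad_event_bound:
  assumes e: "e > 0" and \<eta>: "\<eta> > 0"
  shows "\<exists>k0. \<forall>k\<ge>k0. eventually (\<lambda>n. S.prob (bad_event q k e n) \<le> \<eta>) sequentially"
proof -
  have e4: "e / 4 > 0" using e by simp
  obtain C where C: "C > 0" "eventually (\<lambda>n. \<forall>I. finite I \<longrightarrow> card I \<le> n \<longrightarrow>
      S.prob {\<omega>\<in>space M. \<bar>block n I \<omega>\<bar> > e / 4} \<le> C * (real (card I) / real n)) sequentially"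
    using block_tail_bound[OF e4] by blast
  obtain k1 :: nat where k1: "32 * C\<^sup>2 / \<eta> < real k1" using reals_Archimedean2 by blast
  show ?thesis
  proof (rule exI[of _ "max 2 k1"], intro allI impI)
    fix k :: nat assume k: "k \<ge> max 2 k1"
    have k0: "k > 0" "real k \<ge> 2" using k by auto
    have "32 * C\<^sup>2 / \<eta> \<le> real k" using k1 k by (meson le_less_trans less_imp_le max.boundedE of_nat_mono order_trans)
    then have kC: "16 * C\<^sup>2 / real k \<le> \<eta> / 2" using \<eta> k0 by (simp add: field_simps)
    \<comment> \<open>For \<open>n\<close> beyond \<open>n1\<close> the extension of a window by \<open>q\<close> and by rounding at most doubles its length.\<close>
    obtain n1 :: nat where n1: "real k * (real q + 1) < real n1" using reals_Archimedean2 by blast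
    \<comment> \<open>For \<open>n\<close> beyond \<open>n2\<close> the contribution of the single terms is at most \<open>\<eta> / 2\<close>.\<close>
    obtain n2 :: nat where n2: "2 * real (k + 1) * real q * C / \<eta> < real n2" using reals_Archimedean2 by blast
    show "eventually (\<lambda>n. S.prob (bad_event q k e n) \<le> \<eta>) sequentially"
      using C(2) eventually_ge_at_top[of "max 1 (max n1 n2)"]
    proof eventually_elim
      case (elim n)
      have n: "real n \<ge> 1" "real n \<ge> real n1" "real n \<ge> real n2" using elim(2) by auto
      then have nk: "real k * (real q + 1) \<le> real n" using n1 by linarith
      have blk: "S.prob {\<omega>\<in>space M. \<bar>\<Sum>l\<in>I. noise_term n l \<omega>\<bar> > e / 4} \<le> C * (real (card I) / real n)"
        if "finite I" "card I \<le> n" for I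
        using elim(1) that by (simp only: block_noise)
      have two: "S.prob {\<omega>\<in>space M. two_big_blocks e (n * j div k) (n * Suc j div k + q) (\<lambda>i. noise_term n i \<omega>)} \<le> 4 * (C * (2 / real k))\<^sup>2" for j
      proof -
        have "S.prob {\<omega>\<in>space M. two_big_blocks (4 * (e / 4)) (n * j div k) (n * Suc j div k + q) (\<lambda>i. noise_term n i \<omega>)} \<le> 4 * (C * (2 / real k))\<^sup>2"
        proof (rule S.two_big_blocks_bound[OF noise_term_indep])
          fix i i' assume i: "n * j div k \<le> i" "i \<le> i'" "i' \<le> n * Suc j div k + q"
          have d1: "real (n * Suc j div k) \<le> real (n * Suc j) / real k"
            using floor_divide_of_nat_eq[of "n * Suc j" k, where 'a=real] by linarith
          have "real (n * j) / real k - real (n * j div k) \<le> 1"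
            using floor_divide_of_nat_eq[of "n * j" k, where 'a=real] by linarith
          moreover have "real (n * Suc j) / real k = real (n * j) / real k + real n / real k" by (simp add: add_divide_distrib algebra_simps)
          moreover have "real i' - real i \<le> real (n * Suc j div k) + real q - real (n * j div k)"
            using i by linarith
          ultimately have "real i' - real i \<le> real n / real k + 1 + real q" using d1 by linarith
          moreover have "real q + 1 \<le> real n / real k" using nk k0 by (simp add: field_simps)
          ultimately have len: "real (i' - i) \<le> 2 * (real n / real k)" using i by (simp add: of_nat_diff)
          also have "2 * (real n / real k) \<le> real n" using k0 n by (simp add: field_simps)
          finally have "card {i..<i'} \<le> n" by simp
          then have "S.prob {\<omega>\<in>space M. \<bar>\<Sum>l\<in>{i..<i'}. noise_term n l \<omega>\<bar> > e / 4} \<le> C * (real (card {i..<i'}) / real n)"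
            by (intro blk) auto
          also have "\<dots> \<le> C * (2 / real k)"
            using len n k0 C by (intro mult_left_mono) (auto simp: field_simps)
          finally show "S.prob {\<omega>\<in>space M. \<bar>\<Sum>l\<in>{i..<i'}. noise_term n l \<omega>\<bar> > e / 4} \<le> C * (2 / real k)" .
        qed
        then show ?thesis by simp
      qed
      have one: "S.prob {\<omega>\<in>space M. \<bar>noise_term n i \<omega>\<bar> > e} \<le> C / real n" for i
      proof -
        have "S.prob {\<omega>\<in>space M. \<bar>noise_term n i \<omega>\<bar> > e} \<le> S.prob {\<omega>\<in>space M. \<bar>\<Sum>l\<in>{i}. noise_term n l \<omega>\<bar> > e / 4}"
          using e by (intro S.finite_measure_mono) (auto intro!: measurable)
        also have "\<dots> \<le> C * (real (card {i}) / real n)" using n by (intro blk) auto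
        finally show ?thesis by simp
      qed
      have "S.prob (bad_event q k e n) \<le> S.prob (\<Union>j<k. {\<omega>\<in>space M. two_big_blocks e (n * j div k) (n * Suc j div k + q) (\<lambda>i. noise_term n i \<omega>)})
          + S.prob (\<Union>j\<le>k. \<Union>i\<in>{n * j div k..<n * j div k + q}. {\<omega>\<in>space M. \<bar>noise_term n i \<omega>\<bar> > e})"
        unfolding bad_event_def
        by (intro measure_Un_le sets.finite_UN two_big_noise_measurable big_noise_measurable) auto
      also have "\<dots> \<le> (\<Sum>j<k. 4 * (C * (2 / real k))\<^sup>2) + (\<Sum>j\<le>k. \<Sum>i\<in>{n * j div k..<n * j div k + q}. C / real n)"
      proof (intro add_mono)
        have "S.prob (\<Union>j<k. {\<omega>\<in>space M. two_big_blocks e (n * j div k) (n * Suc j div k + q) (\<lambda>i. noise_term n i \<omega>)})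
          \<le> (\<Sum>j<k. S.prob {\<omega>\<in>space M. two_big_blocks e (n * j div k) (n * Suc j div k + q) (\<lambda>i. noise_term n i \<omega>)})"
          by (intro measure_UNION_le two_big_noise_measurable) auto
        also have "\<dots> \<le> (\<Sum>j<k. 4 * (C * (2 / real k))\<^sup>2)" by (intro sum_mono two)
        finally show "S.prob (\<Union>j<k. {\<omega>\<in>space M. two_big_blocks e (n * j div k) (n * Suc j div k + q) (\<lambda>i. noise_term n i \<omega>)}) \<le> (\<Sum>j<k. 4 * (C * (2 / real k))\<^sup>2)" .
        have "S.prob (\<Union>j\<le>k. \<Union>i\<in>{n * j div k..<n * j div k + q}. {\<omega>\<in>space M. \<bar>noise_term n i \<omega>\<bar> > e})
          \<le> (\<Sum>j\<le>k. S.prob (\<Union>i\<in>{n * j div k..<n * j div k + q}. {\<omega>\<in>space M. \<bar>noise_term n i \<omega>\<bar> > e}))"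
          by (intro measure_UNION_le sets.finite_UN big_noise_measurable) auto
        also have "\<dots> \<le> (\<Sum>j\<le>k. \<Sum>i\<in>{n * j div k..<n * j div k + q}. S.prob {\<omega>\<in>space M. \<bar>noise_term n i \<omega>\<bar> > e})"
          by (intro sum_mono measure_UNION_le big_noise_measurable) auto
        also have "\<dots> \<le> (\<Sum>j\<le>k. \<Sum>i\<in>{n * j div k..<n * j div k + q}. C / real n)" by (intro sum_mono one)
        finally show "S.prob (\<Union>j\<le>k. \<Union>i\<in>{n * j div k..<n * j div k + q}. {\<omega>\<in>space M. \<bar>noise_term n i \<omega>\<bar> > e})
          \<le> (\<Sum>j\<le>k. \<Sum>i\<in>{n * j div k..<n * j div k + q}. C / real n)" .
      qed
      also have "(\<Sum>j<k. 4 * (C * (2 / real k))\<^sup>2) = 16 * C\<^sup>2 / real k"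
        using k0 by (simp add: power2_eq_square field_simps)
      also have "(\<Sum>j\<le>k. \<Sum>i\<in>{n * j div k..<n * j div k + q}. C / real n) = real (k + 1) * real q * C / real n"
        by (simp add: field_simps)
      also have "real (k + 1) * real q * C / real n \<le> \<eta> / 2"
      proof -
        have "2 * real (k + 1) * real q * C / \<eta> \<le> real n" using n2 n by linarith
        then have "2 * real (k + 1) * real q * C \<le> real n * \<eta>" using \<eta> by (simp add: field_simps)
        then show ?thesis using n by (simp add: field_simps)
      qed
      finally show ?case using kC by linarith
    qed
  qed
qed

text \<open>The blocks between consecutive grid points are disjoint, and each of them makes up asymptotically the
fraction \<open>1 / k\<close> of all terms.\<close>

lemma increments_weak_convergence:
  fixes q k :: nat and F :: "(nat \<Rightarrow> real) \<Rightarrow> real"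
  assumes k: "k > 0"
    and Fm: "F \<in> borel_measurable (PiM {..<k} (\<lambda>_. borel))" and B: "\<And>y. \<bar>F y\<bar> \<le> B"
    and cont: "\<And>y z. (\<And>i. i < k \<Longrightarrow> (\<lambda>n. y n i) \<longlonglongrightarrow> z i) \<Longrightarrow> (\<lambda>n. F (y n)) \<longlonglongrightarrow> F z"
  shows "(\<lambda>n. \<integral>\<omega>. F (\<lambda>i\<in>{..<k}. block n {n * i div k + q..<n * Suc i div k + q} \<omega>) \<partial>M) \<longlonglongrightarrow>
     (\<integral>x. F (\<lambda>i\<in>{..<k}. CS.levy (real (Suc i) / real k) x - CS.levy (real i / real k) x) \<partial>CS.path_space)"
proof (rule independent_weak_convergence[where N=CS.path_space and M=M and F=F and B=B and k=k and X="\<lambda>n i. block n {n * i div k + q..<n * Suc i div k + q}"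
    and Y="\<lambda>i x. CS.levy (real (Suc i) / real k) x - CS.levy (real i / real k) x"])
  show "prob_space M" "prob_space CS.path_space" "k > 0" by (fact S.prob_space_axioms CS.prob_space_path k)+
  show "F \<in> borel_measurable (PiM {..<k} (\<lambda>_. borel))" by (fact Fm)
  show "\<bar>F y\<bar> \<le> B" for y by (fact B)
  show "(\<lambda>n. F (y n)) \<longlonglongrightarrow> F z" if "\<And>i. i < k \<Longrightarrow> (\<lambda>n. y n i) \<longlonglongrightarrow> z i" for y z by (rule cont) (fact that)
  have Amono: "n * i div k \<le> n * j div k" if "i \<le> j" for n i j :: nat using that by (auto intro!: div_le_mono mult_le_mono)
  show "S.indep_vars (\<lambda>_. borel) (\<lambda>i. block n {n * i div k + q..<n * Suc i div k + q}) {..<k}" for n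
  proof -
    have dis: "{n * i div k + q..<n * Suc i div k + q} \<inter> {n * j div k + q..<n * Suc j div k + q} = {}" if "i < j" for i j
      using Amono[of "Suc i" j n] that by auto
    have "disjoint_family_on (\<lambda>i. {n * i div k + q..<n * Suc i div k + q}) {..<k}"
      unfolding disjoint_family_on_def
    proof (intro ballI impI)
      fix i j :: nat assume "i \<noteq> j"
      then show "{n * i div k + q..<n * Suc i div k + q} \<inter> {n * j div k + q..<n * Suc j div k + q} = {}"
        using dis[of i j] dis[of j i] by (cases "i < j") auto
    qed
    then have "S.indep_vars (\<lambda>_. borel) (\<lambda>i \<omega>. \<Sum>l\<in>{n * i div k + q..<n * Suc i div k + q}. noise_term n l \<omega>) {..<k}"
      by (intro S.indep_vars_disjoint_sums[OF noise_term_indep[of n UNIV]]) auto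
    then show ?thesis by (simp only: block_noise[abs_def, symmetric] block_noise[symmetric])
  qed
  show "prob_space.indep_vars CS.path_space (\<lambda>_. borel) (\<lambda>i x. CS.levy (real (Suc i) / real k) x - CS.levy (real i / real k) x) {..<k}"
    using CS.levy_indep[of "\<lambda>i. real i / real k" k] by (simp add: divide_right_mono)
  fix i assume i: "i < k"
  have "distr CS.path_space borel (\<lambda>x. CS.levy (real (Suc i) / real k) x - CS.levy (real i / real k) x) = levy_law (real (Suc i) / real k - real i / real k)"
    by (rule CS.levy_increment_law) (auto simp: divide_right_mono)
  also have "real (Suc i) / real k - real i / real k = 1 / real k" by (simp add: diff_divide_distrib[symmetric])
  finally have law: "distr CS.path_space borel (\<lambda>x. CS.levy (real (Suc i) / real k) x - CS.levy (real i / real k) x) = levy_law (1 / real k)" .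
  have r: "(\<lambda>n. real (n * j div k) / real n) \<longlonglongrightarrow> real j / real k" for j
  proof -
    have "nat \<lfloor>real n * (real j / real k)\<rfloor> = n * j div k" for n
    proof -
      have "real n * (real j / real k) = real (n * j) / real k" by simp
      then show ?thesis by (simp only: floor_divide_of_nat_eq nat_int)
    qed
    then show ?thesis using floor_ratio_tendsto[of "real j / real k"] by simp
  qed
  have "(\<lambda>n. real (n * Suc i div k) / real n - real (n * i div k) / real n) \<longlonglongrightarrow> real (Suc i) / real k - real i / real k"
    by (intro tendsto_diff r)
  moreover have "real (Suc i) / real k - real i / real k = 1 / real k" by (simp add: diff_divide_distrib[symmetric])
  moreover have "real (card {n * i div k + q..<n * Suc i div k + q}) / real n = real (n * Suc i div k) / real n - real (n * i div k) / real n" for n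
    using Amono[of i "Suc i" n] by (simp add: of_nat_diff diff_divide_distrib)
  ultimately have "(\<lambda>n. real (card {n * i div k + q..<n * Suc i div k + q}) / real n) \<longlonglongrightarrow> 1 / real k" by simp
  then show "weak_conv_m (\<lambda>n. distr M borel (block n {n * i div k + q..<n * Suc i div k + q}))
     (distr CS.path_space borel (\<lambda>x. CS.levy (real (Suc i) / real k) x - CS.levy (real i / real k) x))"
    unfolding law by (intro block_weak_conv) auto
qed

text \<open>By \<open>moving_average_sum\<close> this is the normalised partial sum process of the moving average.\<close>

definition smoothed_path :: "nat \<Rightarrow> (nat \<Rightarrow> real) \<Rightarrow> real \<Rightarrow> nat \<Rightarrow> 'a \<Rightarrow> real \<Rightarrow> real" where
  "smoothed_path q \<beta> \<Phi> n \<omega> =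
     step_path n (\<lambda>m. \<Phi> * (smoothed_walk q \<beta> (\<lambda>i. noise_term n i \<omega>) m - smoothed_walk q \<beta> (\<lambda>i. noise_term n i \<omega>) 0))"

definition scaled_levy :: "real \<Rightarrow> (real \<Rightarrow> real) \<Rightarrow> real \<Rightarrow> real" where
  "scaled_levy \<Phi> x = (\<lambda>t\<in>{0..1}. \<Phi> * CS.levy t x)"

lemma smoothed_path_measurable: "smoothed_path q \<beta> \<Phi> n \<in> M \<rightarrow>\<^sub>M borel_of M2_topology"
  unfolding smoothed_path_def[abs_def] smoothed_walk_def
  by (rule measurable_step_path_comp) measurable

lemma scaled_levy_in_D01:
  assumes "x \<in> space CS.path_space"
  shows "scaled_levy \<Phi> x \<in> D01"
  unfolding scaled_levy_def
  by (rule restrict_cadlag_in_D01) (use CS.levy_process_levy assms in \<open>simp add: levy_process_def\<close>)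

lemma sampled_scaled_levy_measurable:
  "(\<lambda>x. step_path k (\<lambda>j. scaled_levy \<Phi> x (real j / real k))) \<in> CS.path_space \<rightarrow>\<^sub>M borel_of M2_topology"
proof (rule measurable_step_path_comp)
  fix j assume "j \<le> k"
  then have "real j / real k \<in> {0..1}" by (auto simp: divide_le_eq_1)
  then have "(\<lambda>x. scaled_levy \<Phi> x (real j / real k)) = (\<lambda>x. \<Phi> * CS.levy (real j / real k) x)"
    by (simp add: scaled_levy_def)
  then show "(\<lambda>x. scaled_levy \<Phi> x (real j / real k)) \<in> borel_measurable CS.path_space"
    using CS.levy_measurable[of "real j / real k"] by simp
qed

lemma scaled_levy_measurable: "scaled_levy \<Phi> \<in> CS.path_space \<rightarrow>\<^sub>M borel_of M2_topology"
  by (rule measurable_M2_limit[OF sampled_scaled_levy_measurable scaled_levy_in_D01 dist_M2_sampled_tendsto_0[OF scaled_levy_in_D01]])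

text \<open>Telescoping, since the process starts at 0.\<close>

lemma sampled_scaled_levy:
  assumes "k > 0"
  shows "step_path k (\<lambda>j. scaled_levy \<Phi> x (real j / real k)) =
     step_path k (\<lambda>j. \<Phi> * (\<Sum>i<j. CS.levy (real (Suc i) / real k) x - CS.levy (real i / real k) x))"
proof (rule step_path_cong)
  fix j assume j: "j \<le> k"
  have "(\<Sum>i<j. CS.levy (real (Suc i) / real k) x - CS.levy (real i / real k) x) = CS.levy (real j / real k) x"
    by (subst sum_lessThan_telescope) simp
  then show "scaled_levy \<Phi> x (real j / real k) = \<Phi> * (\<Sum>i<j. CS.levy (real (Suc i) / real k) x - CS.levy (real i / real k) x)"
    using j assms by (simp only:) (simp add: scaled_levy_def)
qed

lemma sampled_scaled_levy_integral:
  assumes f: "M2_lipschitz L f" and B: "\<And>x. x \<in> D01 \<Longrightarrow> \<bar>f x\<bar> \<le> B"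
  shows "(\<lambda>k. \<integral>x. f (step_path k (\<lambda>j. scaled_levy \<Phi> x (real j / real k))) \<partial>CS.path_space) \<longlonglongrightarrow>
     (\<integral>x. f (scaled_levy \<Phi> x) \<partial>CS.path_space)"
proof -
  interpret P: prob_space CS.path_space by (rule CS.prob_space_path)
  have fm: "f \<in> borel_measurable (borel_of M2_topology)"
    by (rule continuous_map_measurable_borel_of[OF M2_lipschitz_continuous[OF f]])
  show ?thesis
  proof (rule integral_dominated_convergence[where w="\<lambda>_. B"])
    show "(\<lambda>x. f (scaled_levy \<Phi> x)) \<in> borel_measurable CS.path_space"
      by (rule measurable_compose[OF scaled_levy_measurable fm])
    show "(\<lambda>x. f (step_path k (\<lambda>j. scaled_levy \<Phi> x (real j / real k)))) \<in> borel_measurable CS.path_space" for k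
      by (rule measurable_compose[OF sampled_scaled_levy_measurable fm])
    show "AE x in CS.path_space. (\<lambda>k. f (step_path k (\<lambda>j. scaled_levy \<Phi> x (real j / real k)))) \<longlonglongrightarrow> f (scaled_levy \<Phi> x)"
    proof (rule AE_I2)
      fix x assume x: "x \<in> space CS.path_space"
      define y where "y = (\<lambda>k. step_path k (\<lambda>j. scaled_levy \<Phi> x (real j / real k)))"
      have lim: "(\<lambda>k. L * dist_M2 (scaled_levy \<Phi> x) (y k)) \<longlonglongrightarrow> 0"
        using tendsto_mult_left[OF dist_M2_sampled_tendsto_0[OF scaled_levy_in_D01[OF x]], of L \<Phi>] by (simp add: y_def)
      have "norm (f (y k) - f (scaled_levy \<Phi> x)) \<le> L * dist_M2 (scaled_levy \<Phi> x) (y k)" for k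
        using f scaled_levy_in_D01[OF x, of \<Phi>] step_path_in_D01[of k] unfolding M2_lipschitz_def y_def
        by (simp add: dist_M2_commute[of "scaled_levy \<Phi> x"])
      then have "eventually (\<lambda>k. norm (f (y k) - f (scaled_levy \<Phi> x)) \<le> L * dist_M2 (scaled_levy \<Phi> x) (y k)) sequentially" by simp
      then have "(\<lambda>k. f (y k) - f (scaled_levy \<Phi> x)) \<longlonglongrightarrow> 0"
        using lim by (rule Lim_null_comparison)
      then show "(\<lambda>k. f (step_path k (\<lambda>j. scaled_levy \<Phi> x (real j / real k)))) \<longlonglongrightarrow> f (scaled_levy \<Phi> x)"
        by (simp only: LIM_zero_iff y_def)
    qed
    show "AE x in CS.path_space. norm (f (step_path k (\<lambda>j. scaled_levy \<Phi> x (real j / real k)))) \<le> B" for k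
      using B[OF step_path_in_D01] by simp
  qed simp
qed

text \<open>The comparison path of \<open>moving_average_path_close\<close>.\<close>

definition grid_path :: "nat \<Rightarrow> real \<Rightarrow> nat \<Rightarrow> nat \<Rightarrow> 'a \<Rightarrow> real \<Rightarrow> real" where
  "grid_path q \<Phi> k n \<omega> = step_path k (\<lambda>j. \<Phi> * (\<Sum>i<j. block n {n * i div k + q..<n * Suc i div k + q} \<omega>))"

lemma grid_path_measurable: "grid_path q \<Phi> k n \<in> M \<rightarrow>\<^sub>M borel_of M2_topology"
  unfolding grid_path_def[abs_def] block_noise
  by (rule measurable_step_path_comp) measurable

text \<open>For fixed \<open>k\<close> the path depends continuously on its \<open>k\<close> increments.\<close>

lemma grid_path_integral:
  assumes k: "k > 0" and f: "M2_lipschitz L f" and B: "\<And>x. x \<in> D01 \<Longrightarrow> \<bar>f x\<bar> \<le> B"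
  shows "(\<lambda>n. \<integral>\<omega>. f (grid_path q \<Phi> k n \<omega>) \<partial>M) \<longlonglongrightarrow>
     (\<integral>x. f (step_path k (\<lambda>j. scaled_levy \<Phi> x (real j / real k))) \<partial>CS.path_space)"
proof -
  define F where "F = (\<lambda>y. f (step_path k (\<lambda>j. \<Phi> * (\<Sum>i<j. y i))))"
  have F_restrict: "F (\<lambda>i\<in>{..<k}. y i) = F y" for y
  proof -
    have "step_path k (\<lambda>j. \<Phi> * (\<Sum>i<j. (\<lambda>i\<in>{..<k}. y i) i)) = step_path k (\<lambda>j. \<Phi> * (\<Sum>i<j. y i))"
      by (rule step_path_cong) (auto intro!: sum.cong)
    then show ?thesis by (simp only: F_def)
  qed
  have "(\<lambda>n. \<integral>\<omega>. F (\<lambda>i\<in>{..<k}. block n {n * i div k + q..<n * Suc i div k + q} \<omega>) \<partial>M) \<longlonglongrightarrow>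
     (\<integral>x. F (\<lambda>i\<in>{..<k}. CS.levy (real (Suc i) / real k) x - CS.levy (real i / real k) x) \<partial>CS.path_space)"
  proof (rule increments_weak_convergence[OF k])
    have "(\<lambda>y. step_path k (\<lambda>j. \<Phi> * (\<Sum>i<j. y i))) \<in> PiM {..<k} (\<lambda>_. borel) \<rightarrow>\<^sub>M borel_of M2_topology"
      by (rule measurable_step_path_comp, intro borel_measurable_times borel_measurable_const borel_measurable_sum measurable_component_singleton) auto
    then show "F \<in> borel_measurable (PiM {..<k} (\<lambda>_. borel))"
      unfolding F_def by (rule measurable_compose[OF _ continuous_map_measurable_borel_of[OF M2_lipschitz_continuous[OF f]]])
    show "\<bar>F y\<bar> \<le> B" for y unfolding F_def by (rule B[OF step_path_in_D01])
    fix y :: "nat \<Rightarrow> nat \<Rightarrow> real" and z assume y: "\<And>i. i < k \<Longrightarrow> (\<lambda>n. y n i) \<longlonglongrightarrow> z i"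
    have "(\<lambda>n. L * (\<bar>\<Phi>\<bar> * (\<Sum>i<k. \<bar>y n i - z i\<bar>))) \<longlonglongrightarrow> L * (\<bar>\<Phi>\<bar> * (\<Sum>i<k. \<bar>z i - z i\<bar>))"
      using y by (intro tendsto_intros) auto
    then have lim: "(\<lambda>n. L * (\<bar>\<Phi>\<bar> * (\<Sum>i<k. \<bar>y n i - z i\<bar>))) \<longlonglongrightarrow> 0" by simp
    have bnd: "norm (F (y n) - F z) \<le> L * (\<bar>\<Phi>\<bar> * (\<Sum>i<k. \<bar>y n i - z i\<bar>))" for n
    proof -
      have "dist_M2 (step_path k (\<lambda>j. \<Phi> * (\<Sum>i<j. y n i))) (step_path k (\<lambda>j. \<Phi> * (\<Sum>i<j. z i))) \<le> \<bar>\<Phi>\<bar> * (\<Sum>i<k. \<bar>y n i - z i\<bar>)"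
      proof (rule dist_M2_step_path_le)
        fix j assume j: "j \<le> k"
        have "\<bar>\<Phi> * (\<Sum>i<j. y n i) - \<Phi> * (\<Sum>i<j. z i)\<bar> = \<bar>\<Phi>\<bar> * \<bar>\<Sum>i<j. y n i - z i\<bar>"
          by (simp add: sum_subtractf abs_mult[symmetric] right_diff_distrib)
        also have "\<dots> \<le> \<bar>\<Phi>\<bar> * (\<Sum>i<k. \<bar>y n i - z i\<bar>)"
        proof (rule mult_left_mono)
          have "\<bar>\<Sum>i<j. y n i - z i\<bar> \<le> (\<Sum>i<j. \<bar>y n i - z i\<bar>)" by (rule sum_abs)
          also have "\<dots> \<le> (\<Sum>i<k. \<bar>y n i - z i\<bar>)" using j by (intro sum_mono2) auto
          finally show "\<bar>\<Sum>i<j. y n i - z i\<bar> \<le> (\<Sum>i<k. \<bar>y n i - z i\<bar>)" .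
        qed simp
        finally show "\<bar>\<Phi> * (\<Sum>i<j. y n i) - \<Phi> * (\<Sum>i<j. z i)\<bar> \<le> \<bar>\<Phi>\<bar> * (\<Sum>i<k. \<bar>y n i - z i\<bar>)" .
      qed
      then have "L * dist_M2 (step_path k (\<lambda>j. \<Phi> * (\<Sum>i<j. y n i))) (step_path k (\<lambda>j. \<Phi> * (\<Sum>i<j. z i))) \<le> L * (\<bar>\<Phi>\<bar> * (\<Sum>i<k. \<bar>y n i - z i\<bar>))"
        using f by (intro mult_left_mono) (auto simp: M2_lipschitz_def)
      moreover have "\<bar>F (y n) - F z\<bar> \<le> L * dist_M2 (step_path k (\<lambda>j. \<Phi> * (\<Sum>i<j. y n i))) (step_path k (\<lambda>j. \<Phi> * (\<Sum>i<j. z i)))"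
        using f step_path_in_D01 unfolding M2_lipschitz_def F_def by blast
      ultimately show ?thesis by simp
    qed
    have "(\<lambda>n. F (y n) - F z) \<longlonglongrightarrow> 0"
      by (rule Lim_null_comparison[OF always_eventually lim]) (use bnd in blast)
    then show "(\<lambda>n. F (y n)) \<longlonglongrightarrow> F z" by (simp only: LIM_zero_iff)
  qed
  then show ?thesis unfolding F_restrict by (simp only: F_def grid_path_def sampled_scaled_levy[OF k])
qed

lemma smoothed_path_near_grid_path:
  assumes k: "k > 0" and e: "e \<ge> 0" and \<beta>: "\<And>s. s < q \<Longrightarrow> 0 \<le> \<beta> s \<and> \<beta> s \<le> 1"
    and \<omega>: "\<omega> \<in> space M" "\<omega> \<notin> bad_event q k e n"
  shows "dist_M2 (smoothed_path q \<beta> \<Phi> n \<omega>) (grid_path q \<Phi> k n \<omega>) \<le> 1 / real k + \<bar>\<Phi>\<bar> * ((4 * real q + 1) * e)"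
  unfolding smoothed_path_def grid_path_def block_noise
proof (rule moving_average_path_close[OF k e])
  show "0 \<le> \<beta> s \<and> \<beta> s \<le> 1" if "s < q" for s using that by (rule \<beta>)
  show "\<not> two_big_blocks e (n * j div k) (n * Suc j div k + q) (\<lambda>i. noise_term n i \<omega>)" if "j < k" for j
    using \<omega> that unfolding bad_event_def by blast
  show "\<bar>noise_term n i \<omega>\<bar> \<le> e" if "j \<le> k" "i \<in> {n * j div k..<n * j div k + q}" for i j
  proof (rule ccontr)
    assume "\<not> \<bar>noise_term n i \<omega>\<bar> \<le> e"
    then have "\<omega> \<in> {\<omega>\<in>space M. \<bar>noise_term n i \<omega>\<bar> > e}" using \<omega> by simp
    then show False using \<omega>(2) that unfolding bad_event_def by blast
  qed
qed

text \<open>Outside the exceptional event the Lipschitz bound applies, and on it the bound \<open>2 * B\<close>.\<close>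

lemma smoothed_path_integral_near:
  assumes k: "k > 0" and e: "e \<ge> 0" and \<beta>: "\<And>s. s < q \<Longrightarrow> 0 \<le> \<beta> s \<and> \<beta> s \<le> 1"
    and f: "M2_lipschitz L f" and B: "\<And>x. x \<in> D01 \<Longrightarrow> \<bar>f x\<bar> \<le> B"
  shows "\<bar>(\<integral>\<omega>. f (smoothed_path q \<beta> \<Phi> n \<omega>) \<partial>M) - (\<integral>\<omega>. f (grid_path q \<Phi> k n \<omega>) \<partial>M)\<bar> \<le>
     L * (1 / real k + \<bar>\<Phi>\<bar> * ((4 * real q + 1) * e)) + 2 * B * S.prob (bad_event q k e n)"
proof -
  let ?r = "1 / real k + \<bar>\<Phi>\<bar> * ((4 * real q + 1) * e)"
  have L: "L \<ge> 0" using f by (simp add: M2_lipschitz_def)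
  have B0: "B \<ge> 0" using B[OF step_path_in_D01] by (meson abs_ge_zero order_trans)
  have r0: "?r \<ge> 0" using e by simp
  note fc = M2_lipschitz_continuous[OF f]
  have iV: "integrable M (\<lambda>\<omega>. f (smoothed_path q \<beta> \<Phi> n \<omega>))"
    by (rule integrable_bounded_M2(2)[where f=f and B=B, OF S.prob_space_axioms smoothed_path_measurable fc]) (erule B)
  have iW: "integrable M (\<lambda>\<omega>. f (grid_path q \<Phi> k n \<omega>))"
    by (rule integrable_bounded_M2(2)[where f=f and B=B, OF S.prob_space_axioms grid_path_measurable fc]) (erule B)
  have inD: "smoothed_path q \<beta> \<Phi> n \<omega> \<in> D01" "grid_path q \<Phi> k n \<omega> \<in> D01" for \<omega>
    by (simp_all add: smoothed_path_def grid_path_def step_path_in_D01)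
  have pt: "\<bar>f (smoothed_path q \<beta> \<Phi> n \<omega>) - f (grid_path q \<Phi> k n \<omega>)\<bar> \<le> L * ?r + 2 * B * indicator (bad_event q k e n) \<omega>"
    if \<omega>: "\<omega> \<in> space M" for \<omega>
  proof (cases "\<omega> \<in> bad_event q k e n")
    case True
    have "\<bar>f (smoothed_path q \<beta> \<Phi> n \<omega>) - f (grid_path q \<Phi> k n \<omega>)\<bar> \<le> 2 * B"
      using B[OF inD(1), of \<omega>] B[OF inD(2), of \<omega>] by linarith
    moreover have "L * ?r \<ge> 0" using L r0 by (rule mult_nonneg_nonneg)
    ultimately show ?thesis using True by simp
  next
    case False
    have "\<bar>f (smoothed_path q \<beta> \<Phi> n \<omega>) - f (grid_path q \<Phi> k n \<omega>)\<bar> \<le> L * dist_M2 (smoothed_path q \<beta> \<Phi> n \<omega>) (grid_path q \<Phi> k n \<omega>)"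
      using f inD by (simp add: M2_lipschitz_def)
    also have "\<dots> \<le> L * ?r" by (rule mult_left_mono[OF smoothed_path_near_grid_path[OF k e _ \<omega> False] L]) (erule \<beta>)
    finally show ?thesis using False by simp
  qed
  have ii: "integrable M (\<lambda>\<omega>. L * ?r + 2 * B * indicator (bad_event q k e n) \<omega>)"
    using bad_event_measurable by (intro Bochner_Integration.integrable_add integrable_mult_right) (auto simp: S.emeasure_eq_measure)
  have "\<bar>(\<integral>\<omega>. f (smoothed_path q \<beta> \<Phi> n \<omega>) \<partial>M) - (\<integral>\<omega>. f (grid_path q \<Phi> k n \<omega>) \<partial>M)\<bar>
      = \<bar>\<integral>\<omega>. f (smoothed_path q \<beta> \<Phi> n \<omega>) - f (grid_path q \<Phi> k n \<omega>) \<partial>M\<bar>"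
    using iV iW by simp
  also have "\<dots> \<le> (\<integral>\<omega>. \<bar>f (smoothed_path q \<beta> \<Phi> n \<omega>) - f (grid_path q \<Phi> k n \<omega>)\<bar> \<partial>M)"
    by (rule integral_abs_bound)
  also have "\<dots> \<le> (\<integral>\<omega>. L * ?r + 2 * B * indicator (bad_event q k e n) \<omega> \<partial>M)"
    by (rule integral_mono[OF _ ii pt]) (use iV iW in auto)
  also have "\<dots> = L * ?r + 2 * B * S.prob (bad_event q k e n)"
    using bad_event_measurable by (simp add: S.emeasure_eq_measure S.prob_space)
  finally show ?thesis .
qed

text \<open>The error is distributed as follows: the exceptional event and the distance of the paths determine
\<open>\<eta>\<close>, \<open>e\<close> and a lower bound for the number \<open>k\<close> of cells, \<open>k\<close> is then fixed such that the sampled limit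
path is also close to the limit path, and for this \<open>k\<close> the grid paths converge as \<open>n\<close> grows.\<close>

theorem moving_average_invariance:
  assumes \<beta>: "\<And>s. s < q \<Longrightarrow> 0 \<le> \<beta> s \<and> \<beta> s \<le> 1"
  shows "conv_in_distribution M2_topology M (smoothed_path q \<beta> \<Phi>) CS.path_space (scaled_levy \<Phi>)"
proof (rule conv_in_distribution_M2I[OF S.prob_space_axioms CS.prob_space_path smoothed_path_measurable scaled_levy_measurable])
  fix f L B assume f: "M2_lipschitz L f" and B: "\<And>x. x \<in> D01 \<Longrightarrow> \<bar>f x\<bar> \<le> (B :: real)"
  have L: "L \<ge> 0" using f by (simp add: M2_lipschitz_def)
  have B0: "B \<ge> 0" using B[OF step_path_in_D01] by (meson abs_ge_zero order_trans)
  let ?I = "\<lambda>n. \<integral>\<omega>. f (smoothed_path q \<beta> \<Phi> n \<omega>) \<partial>M"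
  let ?J = "\<integral>x. f (scaled_levy \<Phi> x) \<partial>CS.path_space"
  let ?Jk = "\<lambda>k. \<integral>x. f (step_path k (\<lambda>j. scaled_levy \<Phi> x (real j / real k))) \<partial>CS.path_space"
  show "?I \<longlonglongrightarrow> ?J"
  proof (rule tendstoI)
    fix \<epsilon> :: real assume \<epsilon>: "\<epsilon> > 0"
    \<comment> \<open>The part of the distance bound that is proportional to \<open>e\<close>; the increments by 1 below avoid a vanishing denominator.\<close>
    define D where "D = L * \<bar>\<Phi>\<bar> * (4 * real q + 1)"
    define e where "e = \<epsilon> / 8 / (D + 1)"
    have D: "D \<ge> 0" using L by (simp add: D_def)
    have e: "e > 0" using D \<epsilon> by (simp add: e_def)
    have "D * e \<le> (D + 1) * e" using e by (intro mult_right_mono) auto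
    also have "(D + 1) * e = \<epsilon> / 8" using D by (auto simp: e_def divide_simps)
    finally have De: "D * e \<le> \<epsilon> / 8" .
    define \<eta> where "\<eta> = \<epsilon> / 8 / (2 * B + 1)"
    have \<eta>: "\<eta> > 0" using B0 \<epsilon> by (simp add: \<eta>_def)
    have "2 * B * \<eta> \<le> (2 * B + 1) * \<eta>" using \<eta> by (intro mult_right_mono) auto
    also have "(2 * B + 1) * \<eta> = \<epsilon> / 8" using B0 by (auto simp: \<eta>_def divide_simps)
    finally have B\<eta>: "2 * B * \<eta> \<le> \<epsilon> / 8" .
    obtain k0 where k0: "\<And>k. k \<ge> k0 \<Longrightarrow> eventually (\<lambda>n. S.prob (bad_event q k e n) \<le> \<eta>) sequentially"
      using bad_event_bound[OF e \<eta>, of q] by blast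
    have "(\<lambda>k. L / real k) \<longlonglongrightarrow> 0" by (rule lim_const_over_n)
    then have ev1: "eventually (\<lambda>k. L / real k < \<epsilon> / 8) sequentially"
      by (rule order_tendstoD) (use \<epsilon> in simp)
    have ev2: "eventually (\<lambda>k. dist (?Jk k) ?J < \<epsilon> / 4) sequentially"
      by (rule tendstoD[OF sampled_scaled_levy_integral[OF f]]) (erule B, use \<epsilon> in simp)
    have "eventually (\<lambda>k. L / real k < \<epsilon> / 8 \<and> dist (?Jk k) ?J < \<epsilon> / 4 \<and> k \<ge> k0 \<and> k > 0) sequentially"
      by (intro eventually_conj ev1 ev2 eventually_ge_at_top eventually_gt_at_top)
    then obtain k where k: "L / real k < \<epsilon> / 8" "dist (?Jk k) ?J < \<epsilon> / 4" "k \<ge> k0" "k > 0"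
      using eventually_happens by fastforce
    have ev3: "eventually (\<lambda>n. dist (\<integral>\<omega>. f (grid_path q \<Phi> k n \<omega>) \<partial>M) (?Jk k) < \<epsilon> / 4) sequentially"
      by (rule tendstoD[OF grid_path_integral[OF k(4) f]]) (erule B, use \<epsilon> in simp)
    show "eventually (\<lambda>n. dist (?I n) ?J < \<epsilon>) sequentially"
      using ev3 k0[OF k(3)]
    proof eventually_elim
      case (elim n)
      have "\<bar>?I n - (\<integral>\<omega>. f (grid_path q \<Phi> k n \<omega>) \<partial>M)\<bar> \<le> L * (1 / real k + \<bar>\<Phi>\<bar> * ((4 * real q + 1) * e)) + 2 * B * S.prob (bad_event q k e n)"
        by (rule smoothed_path_integral_near[OF k(4) less_imp_le[OF e] _ f]) (erule \<beta>, erule B)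
      also have "L * (1 / real k + \<bar>\<Phi>\<bar> * ((4 * real q + 1) * e)) = L / real k + D * e"
        by (simp add: D_def algebra_simps)
      also have "2 * B * S.prob (bad_event q k e n) \<le> 2 * B * \<eta>" using elim(2) B0 by (intro mult_left_mono) auto
      finally have "\<bar>?I n - (\<integral>\<omega>. f (grid_path q \<Phi> k n \<omega>) \<partial>M)\<bar> \<le> 3 * \<epsilon> / 8" using k(1) De B\<eta> by linarith
      then show ?case using elim(1) k(2) \<epsilon> unfolding dist_real_def by linarith
    qed
  qed
qed

end

section \<open>The invariance principle for linear processes\<close>

lemma (in prob_space) indep_sets_reindex:
  assumes f: "inj_on f I" and F: "indep_sets F (f ` I)"
  shows "indep_sets (\<lambda>i. F (f i)) I"
proof (rule indep_setsI)
  show "F (f i) \<subseteq> events" if "i \<in> I" for i using F that by (auto simp: indep_sets_def)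
  fix A J assume J: "J \<noteq> {}" "J \<subseteq> I" "finite J" and A: "\<forall>j\<in>J. A j \<in> F (f j)"
  have inj: "inj_on f J" using f J by (blast intro: inj_on_subset)
  have g: "the_inv_into J f (f j) = j" if "j \<in> J" for j using inj that by (rule the_inv_into_f_f)
  have "prob (\<Inter>j\<in>f ` J. A (the_inv_into J f j)) = (\<Prod>j\<in>f ` J. prob (A (the_inv_into J f j)))"
    using J A g by (intro indep_setsD[OF F]) auto
  then show "prob (\<Inter>j\<in>J. A j) = (\<Prod>j\<in>J. prob (A j))"
    using g inj by (simp add: prod.reindex)
qed

lemma (in prob_space) indep_vars_reindex:
  assumes "inj_on f I" "indep_vars N X (f ` I)"
  shows "indep_vars (\<lambda>i. N (f i)) (\<lambda>i. X (f i)) I"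
  using assms indep_sets_reindex[of f I] unfolding indep_vars_def2 by auto

text \<open>The slowly varying factor cancels in the quotient \<open>G (c * x) / G x\<close>.\<close>

lemma (in prob_space) heavy_tail_distr:
  assumes rv: "regularly_varying \<alpha> Z" and \<alpha>: "0 < \<alpha>" "\<alpha> < 2"
    and sym: "\<alpha> = 1 \<Longrightarrow> distr M borel Z = distr M borel (\<lambda>\<omega>. - Z \<omega>)"
    and a: "\<And>n. n \<ge> 1 \<Longrightarrow> a n > 0" "(\<lambda>n. real n * prob {\<omega> \<in> space M. \<bar>Z \<omega>\<bar> > a n}) \<longlonglongrightarrow> 1"
  shows "\<exists>p r. heavy_tail (distr M borel Z) \<alpha> a p r"
proof -
  let ?\<nu> = "distr M borel Z"
  have Z[measurable]: "Z \<in> borel_measurable M" using rv by (simp add: regularly_varying_def)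
  obtain L p r where L: "slowly_varying L" "\<And>x. x > 0 \<Longrightarrow> prob {\<omega> \<in> space M. \<bar>Z \<omega>\<bar> > x} = x powr (- \<alpha>) * L x"
    and p: "((\<lambda>x. prob {\<omega> \<in> space M. Z \<omega> > x} / prob {\<omega> \<in> space M. \<bar>Z \<omega>\<bar> > x}) \<longlongrightarrow> p) at_top"
    and r: "((\<lambda>x. prob {\<omega> \<in> space M. Z \<omega> < - x} / prob {\<omega> \<in> space M. \<bar>Z \<omega>\<bar> > x}) \<longlongrightarrow> r) at_top"
    using rv unfolding regularly_varying_def by blast
  have law: "measure ?\<nu> {y. \<bar>y\<bar> > x} = prob {\<omega> \<in> space M. \<bar>Z \<omega>\<bar> > x}"
    "measure ?\<nu> {y. y > x} = prob {\<omega> \<in> space M. Z \<omega> > x}"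
    "measure ?\<nu> {y. y < x} = prob {\<omega> \<in> space M. Z \<omega> < x}" for x
    by (subst measure_distr; auto intro!: arg_cong[where f=prob])+
  interpret D: prob_space ?\<nu> by (rule prob_space_distr) measurable
  have Lpos: "L x > 0" if "x > 0" for x using L(1) that by (simp add: slowly_varying_def)
  have "heavy_tail ?\<nu> \<alpha> a p r"
  proof (rule heavy_tail.intro)
    show "real_distribution ?\<nu>" by unfold_locales auto
    show "heavy_tail_axioms ?\<nu> \<alpha> a p r"
    proof (rule heavy_tail_axioms.intro)
      show "measure ?\<nu> {y. \<bar>y\<bar> > x} > 0" if "x > 0" for x
        using Lpos[OF that] L(2)[OF that] that by (simp add: law)
      show "((\<lambda>x. measure ?\<nu> {y. \<bar>y\<bar> > c * x} / measure ?\<nu> {y. \<bar>y\<bar> > x}) \<longlongrightarrow> c powr (- \<alpha>)) at_top" if c: "c > 0" for c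
      proof -
        have "((\<lambda>x. c powr (- \<alpha>) * (L (c * x) / L x)) \<longlongrightarrow> c powr (- \<alpha>) * 1) at_top"
          using L(1) c by (intro tendsto_mult tendsto_const) (simp add: slowly_varying_def)
        moreover have "eventually (\<lambda>x. c powr (- \<alpha>) * (L (c * x) / L x) = measure ?\<nu> {y. \<bar>y\<bar> > c * x} / measure ?\<nu> {y. \<bar>y\<bar> > x}) at_top"
          using eventually_gt_at_top[of 0]
        proof eventually_elim
          case (elim x)
          then show ?case using c by (simp add: law L(2) powr_mult)
        qed
        ultimately show ?thesis by (simp only: mult_1_right) (rule Lim_transform_eventually)
      qed
      show "distr ?\<nu> borel uminus = ?\<nu>" if "\<alpha> = 1"
        using sym[OF that] by (subst distr_distr) (auto simp: comp_def)
    qed (use \<alpha> p r a in \<open>simp_all add: law\<close>)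
  qed
  then show ?thesis by blast
qed

theorem theorem2p1:
  fixes M :: "'a measure" and Z X :: "int \<Rightarrow> 'a \<Rightarrow> real"
    and \<alpha> \<Phi> :: real and a b :: "nat \<Rightarrow> real" and q :: nat and \<phi> :: "nat \<Rightarrow> real"
    and V\<^sub>n :: "nat \<Rightarrow> 'a \<Rightarrow> real \<Rightarrow> real"
  assumes "prob_space M"
    and "0 < \<alpha>" "\<alpha> < 2"
    and "prob_space.indep_vars M (\<lambda>_. borel) Z UNIV"
    and "\<And>i. distr M borel (Z i) = distr M borel (Z 1)"
    and "prob_space.regularly_varying M \<alpha> (Z 1)"
    and "\<alpha> = 1 \<Longrightarrow> distr M borel (Z 1) = distr M borel (\<lambda>\<omega>. - Z 1 \<omega>)"
    and "\<And>n. n \<ge> 1 \<Longrightarrow> a n > 0"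
    and "(\<lambda>n. real n * measure M {\<omega> \<in> space M. \<bar>Z 1 \<omega>\<bar> > a n}) \<longlonglongrightarrow> 1"
    and "\<Phi> = (\<Sum>i=0..q. \<phi> i)" "\<Phi> \<noteq> 0"
    and "\<And>s. s \<le> q \<Longrightarrow>
           0 \<le> (\<Sum>i=0..s. \<phi> i) / (\<Sum>i=0..q. \<phi> i) \<and> (\<Sum>i=0..s. \<phi> i) / (\<Sum>i=0..q. \<phi> i) \<le> 1"
    and "\<And>t \<omega>. X t \<omega> = (\<Sum>i=0..q. \<phi> i * Z (t - int i) \<omega>)"
    and "\<And>n. b n = (if \<alpha> \<le> 1 then 0 else \<Phi> * integral\<^sup>L M (Z 1))"
    and "\<And>n \<omega>. V\<^sub>n n \<omega> =
           (\<lambda>t\<in>{0..1}. (1 / a n) * ((\<Sum>i=1..\<lfloor>real n * t\<rfloor>. X i \<omega>) - real_of_int \<lfloor>real n * t\<rfloor> * b n))"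
  shows "\<exists>(N :: (real \<Rightarrow> real) measure) V.
           stable_levy_process \<alpha> N V \<and>
           conv_in_distribution M2_topology M V\<^sub>n N (\<lambda>\<omega>. \<lambda>t\<in>{0..1}. \<Phi> * V t \<omega>)"
proof -
  interpret M: prob_space M by fact
  let ?\<nu> = "distr M borel (Z 1)"
  obtain p r where H: "heavy_tail ?\<nu> \<alpha> a p r"
    using M.heavy_tail_distr[OF assms(6,2,3) assms(7) assms(8) assms(9)] by blast
  \<comment> \<open>The innovations that enter \<open>X 1, X 2, ...\<close>, numbered from 0: the oldest one in \<open>X 1\<close> is \<open>Z (1 - q)\<close>.\<close>
  define \<xi> where "\<xi> = (\<lambda>k::nat. Z (int k + 1 - int q))"
  interpret iid_heavy_tail ?\<nu> \<alpha> a p r M \<xi>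
  proof (rule iid_heavy_tail.intro[OF H assms(1)], rule iid_heavy_tail_axioms.intro)
    have "M.indep_vars (\<lambda>_. borel) (\<lambda>k. Z (int k + 1 - int q)) (UNIV :: nat set)"
      by (rule M.indep_vars_reindex[where f="\<lambda>k. int k + 1 - int q" and X=Z])
         (auto intro: injI M.indep_vars_subset[OF assms(4)])
    then show "M.indep_vars (\<lambda>_. borel) \<xi> UNIV" by (simp add: \<xi>_def)
    show "distr M borel (\<xi> i) = ?\<nu>" for i unfolding \<xi>_def by (rule assms(5))
  qed
  define \<beta> where "\<beta> = (\<lambda>s. (\<Sum>i\<le>s. \<phi> i) / \<Phi>)"
  have \<Phi>: "\<Phi> = (\<Sum>i\<le>q. \<phi> i)" using assms(10) by (simp add: atLeast0AtMost)
  have \<beta>: "0 \<le> \<beta> s \<and> \<beta> s \<le> 1" if "s < q" for s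
    using assms(12)[of s] that by (simp add: \<beta>_def \<Phi> atLeast0AtMost)
  have Z1: "Z 1 \<in> borel_measurable M" using assms(6) by (simp add: M.regularly_varying_def)
  have b: "b n = \<Phi> * centre" for n
    using assms(14)[of n] integral_distr[OF Z1, of "\<lambda>x. x"] by (simp add: centre_def)
  have walk: "(1 / a n) * ((\<Sum>i=1..int m. X i \<omega>) - real m * b n) =
      \<Phi> * (smoothed_walk q \<beta> (\<lambda>i. noise_term n i \<omega>) m - smoothed_walk q \<beta> (\<lambda>i. noise_term n i \<omega>) 0)" for n m \<omega>
  proof -
    have X: "X (int j + 1) \<omega> - b n = (\<Sum>s\<le>q. \<phi> s * (\<xi> (j + q - s) \<omega> - centre))" for j
    proof -
      have "X (int j + 1) \<omega> = (\<Sum>s\<le>q. \<phi> s * \<xi> (j + q - s) \<omega>)"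
        unfolding assms(13) atLeast0AtMost
      proof (rule sum.cong)
        fix s assume "s \<in> {..q}"
        then have "int (j + q - s) + 1 - int q = int j + 1 - int s" by (simp add: of_nat_diff)
        then show "\<phi> s * Z (int j + 1 - int s) \<omega> = \<phi> s * \<xi> (j + q - s) \<omega>" by (simp only: \<xi>_def)
      qed simp
      then show ?thesis by (simp add: b \<Phi> right_diff_distrib sum_subtractf sum_distrib_right)
    qed
    have "(\<Sum>i=1..int m. X i \<omega>) = (\<Sum>j<m. X (int j + 1) \<omega>)"
      by (rule sum.reindex_bij_witness[of _ "\<lambda>j. int j + 1" "\<lambda>i. nat (i - 1)"]) auto
    then have "(\<Sum>i=1..int m. X i \<omega>) - real m * b n = (\<Sum>j<m. X (int j + 1) \<omega> - b n)"
      by (simp add: sum_subtractf)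
    then have "(1 / a n) * ((\<Sum>i=1..int m. X i \<omega>) - real m * b n) = (\<Sum>j<m. \<Sum>s\<le>q. \<phi> s * noise_term n (j + q - s) \<omega>)"
      by (simp add: X noise_term_def sum_divide_distrib)
    also have "\<dots> = \<Phi> * (smoothed_walk q \<beta> (\<lambda>i. noise_term n i \<omega>) m - smoothed_walk q \<beta> (\<lambda>i. noise_term n i \<omega>) 0)"
      by (rule moving_average_sum[OF \<Phi> assms(11)]) (simp add: \<beta>_def)
    finally show ?thesis .
  qed
  have "V\<^sub>n n \<omega> = smoothed_path q \<beta> \<Phi> n \<omega>" for n \<omega>
  proof
    fix t
    show "V\<^sub>n n \<omega> t = smoothed_path q \<beta> \<Phi> n \<omega> t"
    proof (cases "t \<in> {0..1}")
      case True
      define m where "m = nat \<lfloor>real n * t\<rfloor>"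
      have fl: "\<lfloor>real n * t\<rfloor> = int m" using True by (simp add: m_def)
      then show ?thesis using True walk[of n \<omega> m]
        by (simp add: assms(15) smoothed_path_def step_path_def fl)
    next
      case False
      then show ?thesis unfolding assms(15) smoothed_path_def step_path_def by (simp only: restrict_def if_False)
    qed
  qed
  then have V: "V\<^sub>n = smoothed_path q \<beta> \<Phi>" by blast
  have "conv_in_distribution M2_topology M V\<^sub>n CS.path_space (\<lambda>\<omega>. \<lambda>t\<in>{0..1}. \<Phi> * CS.levy t \<omega>)"
    using moving_average_invariance[of q \<beta> \<Phi>] \<beta> unfolding V scaled_levy_def[abs_def] by blast
  with stable_levy show ?thesis by blast
qed

end
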